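(* Let $k$ be a field and let $G$ be a finite group acting on a $k$-algebra $S$ by automorphisms. Let $C_\bullet$ be a $G$-graded projective resolution of $kG$ as a $kG$-bimodule, and let $D_\bullet$ be a projective resolution of $S$ as an $S$-bimodule that carries a compatible action of $G$ (both in the sense described in the context). Let $C\otimes^G D$ be the resulting twisted product resolution of $S\rtimes G$. Let $\overline{B}_G$, $\overline{B}_S$, $\overline{B}_{S\rtimes G}$ be the reduced bar resolutions of $kG$, $S$, $S\rtimes G$, respectively. Suppose there are given chain maps of $kG$-bimodules $\iota_G: C\to \overline{B}_G$ and $\pi_G:\overline{B}_G\to C$, and chain maps of $S$-bimodules $\iota_S: D\to\overline{B}_S$ and $\pi_S:\overline{B}_S\to D$, such that $\iota_S$ and $\pi_S$ are also $kG$-module homomorphisms, and such that $\pi_G\iota_G$ and $\pi_S\iota_S$ are the identity maps in each degree. Then there exist chain maps of $(S\rtimes G)$-bimodules $$\iota:(C\otimes^G D)_\bullet\to(\overline{B}_{S\rtimes G})_\bullet\quad\text{and}\quad \pi:(\overline{B}_{S\rtimes G})_\bullet\to (C\otimes^G D)_\bullet$$ for which $\pi_n\iota_n:(C\otimes^G D)_n\to (C\otimes^G D)_n$ is the identity map for all $n$. Moreover, if $S$ is a graded algebra and $G$ consists of elements of degree $0$ (so that $S\rtimes G$ is a graded algebra), then these chain maps $\iota,\pi$ can be taken to be graded maps provided $\iota_S$ and $\pi_S$ are graded maps.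
   Context: Throughout, $k$ is a field of arbitrary characteristic and $\otimes=\otimes_k$. Skew group algebra: $S\rtimes G$ is the free $S$-module with basis $G$ and multiplication $(sg)\cdot(s'g')=s({}^gs')\,gg'$ for $s,s'\in S$, $g,g'\in G$, where ${}^gs'$ is the action of $g$ on $s'$. Conditions on $C_\bullet$: $C_\bullet$ is a projective resolution of $kG$ as a $kG$-bimodule which is $G$-graded, $C_i=\bigoplus_{g\in G}(C_i)_g$, with $g_1\big((C_i)_{g_2}\big)g_3=(C_i)_{g_1g_2g_3}$ for all $g_1,g_2,g_3\in G$ and all $i$; the differentials and the augmentation to $kG$ preserve the $G$-grading. Conditions on $D_\bullet$: $D_\bullet$ is a projective resolution of $S$ as an $S$-bimodule; each $D_i$ is a left $kG$-module with $g\cdot(s\cdot d)={}^gs\cdot(g\cdot d)$ and $g\cdot(d\cdot s)=(g\cdot d)\cdot{}^gs$ for $g\in G$, $s\in S$, $d\in D_i$, and the differentials and the augmentation to $S$ are $kG$-module homomorphisms. We write ${}^gd$ for $g\cdot d$. Twisted product resolution: $C\otimes^G D$ is the total complex of the double complex $C_\bullet\otimes D_\bullet$, so $(C\otimes^G D)_n=\bigoplus_{i+j=n}C_i\otimes D_j$, with differential $d(c\otimes d')=d(c)\otimes d'+(-1)^i c\otimes d(d')$ for $c\in C_i$, $d'\in D_j$. Its $(S\rtimes G)$-bimodule structure is as follows: $kG$ acts on the left through the left action on $C$, $S$ acts on the right through the right action on $D$, and for $c\in C_g$, $d\in D$, $s\in S$, $h\in G$, $$s\cdot(c\otimes d)\cdot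 h=ch\otimes\big({}^{(gh)^{-1}}s\cdot{}^{h^{-1}}d\big).$$ The complex $C\otimes^G D$ augmented by $S\rtimes G$ is an exact sequence of $(S\rtimes G)$-bimodules. Reduced bar resolutions: for a $k$-algebra $A$, $(\overline{B}_A)_n=A\otimes\overline{A}^{\otimes n}\otimes A$ with $\overline{A}=A/(k\cdot 1_A)$ as a vector space, with the usual bar differential $d(a_0\otimes\cdots\otimes a_{n+1})=\sum_{i=0}^n(-1)^ia_0\otimes\cdots\otimes a_ia_{i+1}\otimes\cdots\otimes a_{n+1}$. Write $\overline{B}_G=\overline{B}_{kG}$. The group $G$ acts on $\overline{B}_S$ diagonally. *)

theory Defs
  imports "HOL-Algebra.Module" "HOL-Algebra.AbelCoset" "HOL-Algebra.Group_Action"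
begin

text \<open>
  Vector spaces over the field \<open>k\<close> are \<^locale>\<open>module\<close>s over \<open>k\<close>.  The library's
  \<^locale>\<open>algebra\<close> is commutative, so associative unital algebras are introduced here.
\<close>

locale k_algebra = module k A + ring A for k and A (structure) +
  assumes smult_mult_left:
      "\<lbrakk>r \<in> carrier k; x \<in> carrier A; y \<in> carrier A\<rbrakk> \<Longrightarrow> (r \<odot> x) \<otimes> y = r \<odot> (x \<otimes> y)"
    and smult_mult_right:
      "\<lbrakk>r \<in> carrier k; x \<in> carrier A; y \<in> carrier A\<rbrakk> \<Longrightarrow> x \<otimes> (r \<odot> y) = r \<odot> (x \<otimes> y)"

text \<open>The fields \<open>mult\<close> and \<open>one\<close> inherited from rings are not used for (bi)modules.\<close>

record ('k, 'a, 'm) bimodule = "('k, 'm) module" +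
  lact :: "'a \<Rightarrow> 'm \<Rightarrow> 'm" (infixr "\<triangleright>\<index>" 70)
  ract :: "'m \<Rightarrow> 'a \<Rightarrow> 'm" (infixl "\<triangleleft>\<index>" 71)

text \<open>Bimodules over a \<open>k\<close>-algebra; \<open>k\<close> acts in the same way from both sides.\<close>

locale k_bimodule = A: k_algebra k A + M: module k M
  for k :: "'k ring" and A :: "('k, 'a) module" and M :: "('k, 'a, 'm) bimodule" (structure) +
  assumes lact_closed: "\<lbrakk>a \<in> carrier A; x \<in> carrier M\<rbrakk> \<Longrightarrow> a \<triangleright> x \<in> carrier M"
    and ract_closed: "\<lbrakk>a \<in> carrier A; x \<in> carrier M\<rbrakk> \<Longrightarrow> x \<triangleleft> a \<in> carrier M"
    and lact_add: "\<lbrakk>a \<in> carrier A; x \<in> carrier M; y \<in> carrier M\<rbrakk>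
      \<Longrightarrow> a \<triangleright> (x \<oplus> y) = (a \<triangleright> x) \<oplus> (a \<triangleright> y)"
    and add_lact: "\<lbrakk>a \<in> carrier A; b \<in> carrier A; x \<in> carrier M\<rbrakk>
      \<Longrightarrow> (a \<oplus>\<^bsub>A\<^esub> b) \<triangleright> x = (a \<triangleright> x) \<oplus> (b \<triangleright> x)"
    and ract_add: "\<lbrakk>a \<in> carrier A; b \<in> carrier A; x \<in> carrier M\<rbrakk>
      \<Longrightarrow> x \<triangleleft> (a \<oplus>\<^bsub>A\<^esub> b) = (x \<triangleleft> a) \<oplus> (x \<triangleleft> b)"
    and add_ract: "\<lbrakk>a \<in> carrier A; x \<in> carrier M; y \<in> carrier M\<rbrakk>
      \<Longrightarrow> (x \<oplus> y) \<triangleleft> a = (x \<triangleleft> a) \<oplus> (y \<triangleleft> a)"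
    and mult_lact: "\<lbrakk>a \<in> carrier A; b \<in> carrier A; x \<in> carrier M\<rbrakk>
      \<Longrightarrow> (a \<otimes>\<^bsub>A\<^esub> b) \<triangleright> x = a \<triangleright> (b \<triangleright> x)"
    and ract_mult: "\<lbrakk>a \<in> carrier A; b \<in> carrier A; x \<in> carrier M\<rbrakk>
      \<Longrightarrow> x \<triangleleft> (a \<otimes>\<^bsub>A\<^esub> b) = (x \<triangleleft> a) \<triangleleft> b"
    and one_lact: "x \<in> carrier M \<Longrightarrow> \<one>\<^bsub>A\<^esub> \<triangleright> x = x"
    and ract_one: "x \<in> carrier M \<Longrightarrow> x \<triangleleft> \<one>\<^bsub>A\<^esub> = x"
    and lact_ract: "\<lbrakk>a \<in> carrier A; b \<in> carrier A; x \<in> carrier M\<rbrakk>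
      \<Longrightarrow> (a \<triangleright> x) \<triangleleft> b = a \<triangleright> (x \<triangleleft> b)"
    and scalar_lact: "\<lbrakk>r \<in> carrier k; x \<in> carrier M\<rbrakk> \<Longrightarrow> (r \<odot>\<^bsub>A\<^esub> \<one>\<^bsub>A\<^esub>) \<triangleright> x = r \<odot> x"
    and scalar_ract: "\<lbrakk>r \<in> carrier k; x \<in> carrier M\<rbrakk> \<Longrightarrow> x \<triangleleft> (r \<odot>\<^bsub>A\<^esub> \<one>\<^bsub>A\<^esub>) = r \<odot> x"

definition bimodule_hom ::
  "('k, 'a) module \<Rightarrow> ('k, 'a, 'm) bimodule \<Rightarrow> ('k, 'a, 'n) bimodule \<Rightarrow> ('m \<Rightarrow> 'n) set" where
  "bimodule_hom A M N = {f \<in> carrier M \<rightarrow> carrier N.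
     (\<forall>x\<in>carrier M. \<forall>y\<in>carrier M. f (x \<oplus>\<^bsub>M\<^esub> y) = f x \<oplus>\<^bsub>N\<^esub> f y) \<and>
     (\<forall>a\<in>carrier A. \<forall>x\<in>carrier M. f (a \<triangleright>\<^bsub>M\<^esub> x) = a \<triangleright>\<^bsub>N\<^esub> f x) \<and>
     (\<forall>a\<in>carrier A. \<forall>x\<in>carrier M. f (x \<triangleleft>\<^bsub>M\<^esub> a) = f x \<triangleleft>\<^bsub>N\<^esub> a)}"

definition with_actions ::
  "('k, 'm) module \<Rightarrow> ('a \<Rightarrow> 'm \<Rightarrow> 'm) \<Rightarrow> ('m \<Rightarrow> 'a \<Rightarrow> 'm) \<Rightarrow> ('k, 'a, 'm) bimodule" where
  "with_actions M l r = module.extend M (bimodule.fields l r)"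

definition regular_bimodule :: "('k, 'a) module \<Rightarrow> ('k, 'a, 'a) bimodule" where
  "regular_bimodule A = with_actions A (mult A) (mult A)"


section \<open>Vector spaces given by generators and relations\<close>

definition free_module :: "'k ring \<Rightarrow> 'x set \<Rightarrow> ('k, 'x \<Rightarrow> 'k) module" where
  "free_module k X =
    \<lparr>carrier = {f. range f \<subseteq> carrier k \<and> finite {x. f x \<noteq> \<zero>\<^bsub>k\<^esub>} \<and> (\<forall>x. x \<notin> X \<longrightarrow> f x = \<zero>\<^bsub>k\<^esub>)},
     mult = undefined, one = undefined,
     zero = (\<lambda>x. \<zero>\<^bsub>k\<^esub>), add = (\<lambda>f g x. f x \<oplus>\<^bsub>k\<^esub> g x), smult = (\<lambda>r f x. r \<otimes>\<^bsub>k\<^esub> f x)\<rparr>"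

definition free_gen :: "'k ring \<Rightarrow> 'x \<Rightarrow> 'x \<Rightarrow> 'k" where
  "free_gen k x = (\<lambda>y. if y = x then \<one>\<^bsub>k\<^esub> else \<zero>\<^bsub>k\<^esub>)"

definition span_of :: "'k ring \<Rightarrow> ('k, 'm, 'z) module_scheme \<Rightarrow> 'm set \<Rightarrow> 'm set" where
  "span_of k M X = \<Inter>{H. submodule H k M \<and> X \<subseteq> H}"

definition quotient_module :: "('k, 'm) module \<Rightarrow> 'm set \<Rightarrow> ('k, 'm set) module" where
  "quotient_module M H =
    \<lparr>carrier = a_rcosets\<^bsub>M\<^esub> H, mult = undefined, one = undefined, zero = H,
     add = set_add M, smult = (\<lambda>r U. \<Union>x\<in>U. H +>\<^bsub>M\<^esub> (r \<odot>\<^bsub>M\<^esub> x))\<rparr>"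

text \<open>
  \<open>presented k X R\<close> is the vector space with generating set \<open>X\<close> and relators \<open>R\<close>;
  \<open>presented_gen k X R x\<close> is the class of the generator \<open>x\<close>, and \<open>linear_ext k N \<phi>\<close> is the
  linear map from it to \<open>N\<close> sending the class of each generator \<open>x\<close> to \<open>\<phi> x\<close>.  As for
  homomorphisms out of factor groups in the library, \<^const>\<open>the_elem\<close> picks the common value
  on a coset; this is meaningful whenever \<open>\<phi>\<close> respects the relators.
\<close>

definition presented :: "'k ring \<Rightarrow> 'x set \<Rightarrow> ('x \<Rightarrow> 'k) set \<Rightarrow> ('k, ('x \<Rightarrow> 'k) set) module" where
  "presented k X R = quotient_module (free_module k X) (span_of k (free_module k X) R)"

definition presented_gen :: "'k ring \<Rightarrow> 'x set \<Rightarrow> ('x \<Rightarrow> 'k) set \<Rightarrow> 'x \<Rightarrow> ('x \<Rightarrow> 'k) set" where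
  "presented_gen k X R x =
     span_of k (free_module k X) R +>\<^bsub>free_module k X\<^esub> free_gen k x"

definition linear_ext ::
  "'k ring \<Rightarrow> ('k, 'n, 'z) module_scheme \<Rightarrow> ('x \<Rightarrow> 'n) \<Rightarrow> ('x \<Rightarrow> 'k) set \<Rightarrow> 'n" where
  "linear_ext k N \<phi> u =
     the_elem ((\<lambda>f. \<Oplus>\<^bsub>N\<^esub>x\<in>{x. f x \<noteq> \<zero>\<^bsub>k\<^esub>}. f x \<odot>\<^bsub>N\<^esub> \<phi> x) ` u)"


section \<open>Tensor products over the ground field\<close>

definition tensor_rels ::
  "'k ring \<Rightarrow> ('k, 'm, 'y) module_scheme \<Rightarrow> ('k, 'n, 'z) module_scheme \<Rightarrow> ('m \<times> 'n \<Rightarrow> 'k) set" where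
  "tensor_rels k M N =
    (let F = free_module k (carrier M \<times> carrier N); e = (\<lambda>x y. free_gen k (x, y)) in
     {e (x \<oplus>\<^bsub>M\<^esub> x') y \<ominus>\<^bsub>F\<^esub> (e x y \<oplus>\<^bsub>F\<^esub> e x' y) | x x' y.
        x \<in> carrier M \<and> x' \<in> carrier M \<and> y \<in> carrier N} \<union>
     {e x (y \<oplus>\<^bsub>N\<^esub> y') \<ominus>\<^bsub>F\<^esub> (e x y \<oplus>\<^bsub>F\<^esub> e x y') | x y y'.
        x \<in> carrier M \<and> y \<in> carrier N \<and> y' \<in> carrier N} \<union>
     {e (r \<odot>\<^bsub>M\<^esub> x) y \<ominus>\<^bsub>F\<^esub> (r \<odot>\<^bsub>F\<^esub> e x y) | r x y.
        r \<in> carrier k \<and> x \<in> carrier M \<and> y \<in> carrier N} \<union>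
     {e x (r \<odot>\<^bsub>N\<^esub> y) \<ominus>\<^bsub>F\<^esub> (r \<odot>\<^bsub>F\<^esub> e x y) | r x y.
        r \<in> carrier k \<and> x \<in> carrier M \<and> y \<in> carrier N})"

definition tensor_module ::
  "'k ring \<Rightarrow> ('k, 'm, 'y) module_scheme \<Rightarrow> ('k, 'n, 'z) module_scheme
    \<Rightarrow> ('k, ('m \<times> 'n \<Rightarrow> 'k) set) module" where
  "tensor_module k M N = presented k (carrier M \<times> carrier N) (tensor_rels k M N)"

definition tensor ::
  "'k ring \<Rightarrow> ('k, 'm, 'y) module_scheme \<Rightarrow> ('k, 'n, 'z) module_scheme
    \<Rightarrow> 'm \<Rightarrow> 'n \<Rightarrow> ('m \<times> 'n \<Rightarrow> 'k) set" where
  "tensor k M N x y = presented_gen k (carrier M \<times> carrier N) (tensor_rels k M N) (x, y)"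

text \<open>The map \<open>f \<otimes> g\<close> with values in \<open>M' \<otimes> N'\<close>.\<close>

definition tensor_map ::
  "'k ring \<Rightarrow> ('k, 'm', 'y) module_scheme \<Rightarrow> ('k, 'n', 'z) module_scheme
    \<Rightarrow> ('m \<Rightarrow> 'm') \<Rightarrow> ('n \<Rightarrow> 'n') \<Rightarrow> ('m \<times> 'n \<Rightarrow> 'k) set \<Rightarrow> ('m' \<times> 'n' \<Rightarrow> 'k) set" where
  "tensor_map k M' N' f g =
     linear_ext k (tensor_module k M' N') (\<lambda>(x, y). tensor k M' N' (f x) (g y))"


section \<open>Projective bimodules and resolutions\<close>

text \<open>The free bimodule of rank one, \<open>A \<otimes> A\<close> with the outer actions.\<close>

definition outer_bimodule :: "'k ring \<Rightarrow> ('k, 'a) module \<Rightarrow> ('k, 'a, ('a \<times> 'a \<Rightarrow> 'k) set) bimodule" where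
  "outer_bimodule k A = with_actions (tensor_module k A A)
     (\<lambda>a. tensor_map k A A (\<lambda>x. a \<otimes>\<^bsub>A\<^esub> x) (\<lambda>y. y))
     (\<lambda>u a. tensor_map k A A (\<lambda>x. x) (\<lambda>y. y \<otimes>\<^bsub>A\<^esub> a) u)"

definition free_bimodule ::
  "'k ring \<Rightarrow> ('k, 'a) module \<Rightarrow> 'x set \<Rightarrow> ('k, 'a, 'x \<Rightarrow> ('a \<times> 'a \<Rightarrow> 'k) set) bimodule" where
  "free_bimodule k A X =
    (let E = outer_bimodule k A in
     \<lparr>carrier = {f. range f \<subseteq> carrier E \<and> finite {x. f x \<noteq> \<zero>\<^bsub>E\<^esub>} \<and> (\<forall>x. x \<notin> X \<longrightarrow> f x = \<zero>\<^bsub>E\<^esub>)},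
      mult = undefined, one = undefined,
      zero = (\<lambda>x. \<zero>\<^bsub>E\<^esub>), add = (\<lambda>f g x. f x \<oplus>\<^bsub>E\<^esub> g x), smult = (\<lambda>r f x. r \<odot>\<^bsub>E\<^esub> f x),
      lact = (\<lambda>a f x. a \<triangleright>\<^bsub>E\<^esub> f x), ract = (\<lambda>f a x. f x \<triangleleft>\<^bsub>E\<^esub> a)\<rparr>)"

text \<open>
  A bimodule is projective if it is a direct summand of a free one.  Bases inside the carrier
  type of \<open>P\<close> suffice, since the carrier of \<open>P\<close> is a generating set of \<open>P\<close>.
\<close>

definition projective_bimodule :: "'k ring \<Rightarrow> ('k, 'a) module \<Rightarrow> ('k, 'a, 'm) bimodule \<Rightarrow> bool" where
  "projective_bimodule k A P \<longleftrightarrow> k_bimodule k A P \<and>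
    (\<exists>(X :: 'm set) i p. i \<in> bimodule_hom A P (free_bimodule k A X) \<and>
       p \<in> bimodule_hom A (free_bimodule k A X) P \<and> (\<forall>x\<in>carrier P. p (i x) = x))"

text \<open>
  Complexes in non-negative degrees; \<open>Diff X n\<close> is the differential from degree \<open>n\<close> to degree
  \<open>n - 1\<close> and is only meaningful for \<open>n > 0\<close>.
\<close>

record ('k, 'a, 'm) bimodule_complex =
  Obj :: "nat \<Rightarrow> ('k, 'a, 'm) bimodule"
  Diff :: "nat \<Rightarrow> 'm \<Rightarrow> 'm"

definition projective_resolution ::
  "'k ring \<Rightarrow> ('k, 'a) module \<Rightarrow> ('k, 'a, 'm) bimodule_complex \<Rightarrow> ('m \<Rightarrow> 'a) \<Rightarrow> bool" where
  "projective_resolution k A X \<epsilon> \<longleftrightarrow>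
     (\<forall>n. projective_bimodule k A (Obj X n)) \<and>
     (\<forall>n. Diff X (Suc n) \<in> bimodule_hom A (Obj X (Suc n)) (Obj X n)) \<and>
     \<epsilon> \<in> bimodule_hom A (Obj X 0) (regular_bimodule A) \<and>
     \<epsilon> ` carrier (Obj X 0) = carrier A \<and>
     {x \<in> carrier (Obj X 0). \<epsilon> x = \<zero>\<^bsub>A\<^esub>} = Diff X 1 ` carrier (Obj X 1) \<and>
     (\<forall>n. {x \<in> carrier (Obj X (Suc n)). Diff X (Suc n) x = \<zero>\<^bsub>Obj X n\<^esub>} =
            Diff X (Suc (Suc n)) ` carrier (Obj X (Suc (Suc n))))"

definition chain_map ::
  "('k, 'a) module \<Rightarrow> ('k, 'a, 'm) bimodule_complex \<Rightarrow> ('k, 'a, 'n) bimodule_complex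
    \<Rightarrow> (nat \<Rightarrow> 'm \<Rightarrow> 'n) \<Rightarrow> bool" where
  "chain_map A X Y f \<longleftrightarrow>
     (\<forall>n. f n \<in> bimodule_hom A (Obj X n) (Obj Y n)) \<and>
     (\<forall>n. \<forall>x\<in>carrier (Obj X (Suc n)). Diff Y (Suc n) (f (Suc n) x) = f n (Diff X (Suc n) x))"


section \<open>Reduced bar resolution\<close>

text \<open>
  \<open>A \<otimes> (A/k)\<^sup>\<otimes>\<^sup>n \<otimes> A\<close> is presented by the lists \<open>[a\<^sub>0, \<dots>, a\<^sub>n\<^sub>+\<^sub>1]\<close> over \<open>A\<close>, subject to
  additivity and homogeneity in each entry and to the vanishing of lists having an element of
  \<open>k \<cdot> 1\<close> as an entry other than the first or the last.
\<close>

definition bar_lists :: "('k, 'a) module \<Rightarrow> nat \<Rightarrow> 'a list set" where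
  "bar_lists A n = {xs. set xs \<subseteq> carrier A \<and> length xs = n + 2}"

definition bar_rels :: "'k ring \<Rightarrow> ('k, 'a) module \<Rightarrow> nat \<Rightarrow> ('a list \<Rightarrow> 'k) set" where
  "bar_rels k A n =
    (let F = free_module k (bar_lists A n); e = free_gen k in
     {e (us @ [a \<oplus>\<^bsub>A\<^esub> b] @ vs) \<ominus>\<^bsub>F\<^esub> (e (us @ [a] @ vs) \<oplus>\<^bsub>F\<^esub> e (us @ [b] @ vs)) | us a b vs.
        us @ [a] @ vs \<in> bar_lists A n \<and> b \<in> carrier A} \<union>
     {e (us @ [r \<odot>\<^bsub>A\<^esub> a] @ vs) \<ominus>\<^bsub>F\<^esub> (r \<odot>\<^bsub>F\<^esub> e (us @ [a] @ vs)) | us r a vs.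
        us @ [a] @ vs \<in> bar_lists A n \<and> r \<in> carrier k} \<union>
     {e (us @ [r \<odot>\<^bsub>A\<^esub> \<one>\<^bsub>A\<^esub>] @ vs) | us r vs.
        us @ [\<one>\<^bsub>A\<^esub>] @ vs \<in> bar_lists A n \<and> r \<in> carrier k \<and> us \<noteq> [] \<and> vs \<noteq> []})"

definition bar_module :: "'k ring \<Rightarrow> ('k, 'a) module \<Rightarrow> nat \<Rightarrow> ('k, ('a list \<Rightarrow> 'k) set) module" where
  "bar_module k A n = presented k (bar_lists A n) (bar_rels k A n)"

definition bar_tensor :: "'k ring \<Rightarrow> ('k, 'a) module \<Rightarrow> nat \<Rightarrow> 'a list \<Rightarrow> ('a list \<Rightarrow> 'k) set" where
  "bar_tensor k A n xs = presented_gen k (bar_lists A n) (bar_rels k A n) xs"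

definition bar_bimodule ::
  "'k ring \<Rightarrow> ('k, 'a) module \<Rightarrow> nat \<Rightarrow> ('k, 'a, ('a list \<Rightarrow> 'k) set) bimodule" where
  "bar_bimodule k A n = with_actions (bar_module k A n)
     (\<lambda>a. linear_ext k (bar_module k A n)
            (\<lambda>xs. bar_tensor k A n ((a \<otimes>\<^bsub>A\<^esub> hd xs) # tl xs)))
     (\<lambda>u a. linear_ext k (bar_module k A n)
            (\<lambda>xs. bar_tensor k A n (butlast xs @ [last xs \<otimes>\<^bsub>A\<^esub> a])) u)"

definition signed :: "('k, 'm, 'z) module_scheme \<Rightarrow> nat \<Rightarrow> 'm \<Rightarrow> 'm" where
  "signed M i x = (if even i then x else \<ominus>\<^bsub>M\<^esub> x)"

definition bar_diff ::
  "'k ring \<Rightarrow> ('k, 'a) module \<Rightarrow> nat \<Rightarrow> ('a list \<Rightarrow> 'k) set \<Rightarrow> ('a list \<Rightarrow> 'k) set" where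
  "bar_diff k A n =
    (let N = bar_module k A (n - 1) in
     linear_ext k N (\<lambda>xs. \<Oplus>\<^bsub>N\<^esub>i\<in>{..n}. signed N i (bar_tensor k A (n - 1)
       (take i xs @ [xs ! i \<otimes>\<^bsub>A\<^esub> xs ! (i + 1)] @ drop (i + 2) xs))))"

definition reduced_bar ::
  "'k ring \<Rightarrow> ('k, 'a) module \<Rightarrow> ('k, 'a, ('a list \<Rightarrow> 'k) set) bimodule_complex" where
  "reduced_bar k A = \<lparr>Obj = bar_bimodule k A, Diff = bar_diff k A\<rparr>"

definition bar_action ::
  "'k ring \<Rightarrow> ('k, 'a) module \<Rightarrow> ('g \<Rightarrow> 'a \<Rightarrow> 'a) \<Rightarrow> nat \<Rightarrow> 'g
    \<Rightarrow> ('a list \<Rightarrow> 'k) set \<Rightarrow> ('a list \<Rightarrow> 'k) set" where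
  "bar_action k A act n g =
     linear_ext k (bar_module k A n) (\<lambda>xs. bar_tensor k A n (map (act g) xs))"


section \<open>Group actions and skew group algebras\<close>

definition acts_by_automorphisms ::
  "'k ring \<Rightarrow> 'g monoid \<Rightarrow> ('k, 's) module \<Rightarrow> ('g \<Rightarrow> 's \<Rightarrow> 's) \<Rightarrow> bool" where
  "acts_by_automorphisms k G S act \<longleftrightarrow> group_action G (carrier S) act \<and>
     (\<forall>g\<in>carrier G. act g \<in> ring_hom S S \<and>
        (\<forall>r\<in>carrier k. \<forall>s\<in>carrier S. act g (r \<odot>\<^bsub>S\<^esub> s) = r \<odot>\<^bsub>S\<^esub> act g s))"

text \<open>
  For finite \<open>G\<close>, the element \<open>\<Sum>\<^sub>g s\<^sub>g g\<close> of the skew group algebra is the function \<open>g \<mapsto> s\<^sub>g\<close>;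
  the product is the bilinear extension of \<open>(s g) \<cdot> (s' g') = s (act g s') g g'\<close>.
\<close>

definition skew_group_algebra ::
  "'g monoid \<Rightarrow> ('k, 's) module \<Rightarrow> ('g \<Rightarrow> 's \<Rightarrow> 's) \<Rightarrow> ('k, 'g \<Rightarrow> 's) module" where
  "skew_group_algebra G S act =
    \<lparr>carrier = carrier G \<rightarrow>\<^sub>E carrier S,
     mult = (\<lambda>a b. \<lambda>x\<in>carrier G. \<Oplus>\<^bsub>S\<^esub>g\<in>carrier G. a g \<otimes>\<^bsub>S\<^esub> act g (b (inv\<^bsub>G\<^esub> g \<otimes>\<^bsub>G\<^esub> x))),
     one = (\<lambda>x\<in>carrier G. if x = \<one>\<^bsub>G\<^esub> then \<one>\<^bsub>S\<^esub> else \<zero>\<^bsub>S\<^esub>),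
     zero = (\<lambda>x\<in>carrier G. \<zero>\<^bsub>S\<^esub>),
     add = (\<lambda>a b. \<lambda>x\<in>carrier G. a x \<oplus>\<^bsub>S\<^esub> b x),
     smult = (\<lambda>r a. \<lambda>x\<in>carrier G. r \<odot>\<^bsub>S\<^esub> a x)\<rparr>"

text \<open>The group algebra is the skew group algebra of \<open>G\<close> acting trivially on \<open>k\<close>.\<close>

definition group_algebra :: "'k ring \<Rightarrow> 'g monoid \<Rightarrow> ('k, 'g \<Rightarrow> 'k) module" where
  "group_algebra k G = skew_group_algebra G (ring.extend k (module.fields (mult k))) (\<lambda>g r. r)"

definition group_elem :: "'k ring \<Rightarrow> 'g monoid \<Rightarrow> 'g \<Rightarrow> 'g \<Rightarrow> 'k" where
  "group_elem k G g = (\<lambda>x\<in>carrier G. if x = g then \<one>\<^bsub>k\<^esub> else \<zero>\<^bsub>k\<^esub>)"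


section \<open>Conditions on the two resolutions\<close>

definition internal_direct_sum ::
  "'k ring \<Rightarrow> ('k, 'm, 'z) module_scheme \<Rightarrow> 'i set \<Rightarrow> ('i \<Rightarrow> 'm set) \<Rightarrow> bool" where
  "internal_direct_sum k M I N \<longleftrightarrow> (\<forall>i\<in>I. submodule (N i) k M) \<and>
     (\<forall>x\<in>carrier M. \<exists>!u. u \<in> Pi\<^sub>E I N \<and> finite {i\<in>I. u i \<noteq> \<zero>\<^bsub>M\<^esub>} \<and>
        x = (\<Oplus>\<^bsub>M\<^esub>i\<in>{i\<in>I. u i \<noteq> \<zero>\<^bsub>M\<^esub>}. u i))"

definition component ::
  "('k, 'm, 'z) module_scheme \<Rightarrow> 'i set \<Rightarrow> ('i \<Rightarrow> 'm set) \<Rightarrow> 'i \<Rightarrow> 'm \<Rightarrow> 'm" where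
  "component M I N i x = (THE u. u \<in> Pi\<^sub>E I N \<and> finite {i\<in>I. u i \<noteq> \<zero>\<^bsub>M\<^esub>} \<and>
     x = (\<Oplus>\<^bsub>M\<^esub>i\<in>{i\<in>I. u i \<noteq> \<zero>\<^bsub>M\<^esub>}. u i)) i"

text \<open>Below, \<open>gr i g\<close> is the homogeneous component \<open>(C\<^sub>i)\<^sub>g\<close>.\<close>

definition group_graded_resolution ::
  "'k ring \<Rightarrow> 'g monoid \<Rightarrow> ('k, 'g \<Rightarrow> 'k, 'c) bimodule_complex \<Rightarrow> ('c \<Rightarrow> 'g \<Rightarrow> 'k)
    \<Rightarrow> (nat \<Rightarrow> 'g \<Rightarrow> 'c set) \<Rightarrow> bool" where
  "group_graded_resolution k G C \<epsilon> gr \<longleftrightarrow>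
     projective_resolution k (group_algebra k G) C \<epsilon> \<and>
     (\<forall>i. internal_direct_sum k (Obj C i) (carrier G) (gr i)) \<and>
     (\<forall>i. \<forall>g1\<in>carrier G. \<forall>g2\<in>carrier G. \<forall>g3\<in>carrier G.
        (\<lambda>c. (group_elem k G g1 \<triangleright>\<^bsub>Obj C i\<^esub> c) \<triangleleft>\<^bsub>Obj C i\<^esub> group_elem k G g3) ` gr i g2
          = gr i (g1 \<otimes>\<^bsub>G\<^esub> g2 \<otimes>\<^bsub>G\<^esub> g3)) \<and>
     (\<forall>i. \<forall>g\<in>carrier G. Diff C (Suc i) ` gr (Suc i) g \<subseteq> gr i g) \<and>
     (\<forall>g\<in>carrier G. \<epsilon> ` gr 0 g \<subseteq> {r \<odot>\<^bsub>group_algebra k G\<^esub> group_elem k G g | r. r \<in> carrier k})"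

text \<open>
  Below, \<open>actD j\<close> is the action of \<open>G\<close> on \<open>D\<^sub>j\<close>.  A left \<open>kG\<close>-module structure on a vector space
  is given by a \<open>k\<close>-linear action of \<open>G\<close>.
\<close>

definition equivariant_resolution ::
  "'k ring \<Rightarrow> 'g monoid \<Rightarrow> ('k, 's) module \<Rightarrow> ('g \<Rightarrow> 's \<Rightarrow> 's)
    \<Rightarrow> ('k, 's, 'd) bimodule_complex \<Rightarrow> ('d \<Rightarrow> 's) \<Rightarrow> (nat \<Rightarrow> 'g \<Rightarrow> 'd \<Rightarrow> 'd) \<Rightarrow> bool" where
  "equivariant_resolution k G S act D \<epsilon> actD \<longleftrightarrow>
     projective_resolution k S D \<epsilon> \<and>
     (\<forall>j. group_action G (carrier (Obj D j)) (actD j)) \<and>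
     (\<forall>j. \<forall>g\<in>carrier G. \<forall>x\<in>carrier (Obj D j). \<forall>y\<in>carrier (Obj D j).
        actD j g (x \<oplus>\<^bsub>Obj D j\<^esub> y) = actD j g x \<oplus>\<^bsub>Obj D j\<^esub> actD j g y) \<and>
     (\<forall>j. \<forall>g\<in>carrier G. \<forall>r\<in>carrier k. \<forall>x\<in>carrier (Obj D j).
        actD j g (r \<odot>\<^bsub>Obj D j\<^esub> x) = r \<odot>\<^bsub>Obj D j\<^esub> actD j g x) \<and>
     (\<forall>j. \<forall>g\<in>carrier G. \<forall>s\<in>carrier S. \<forall>x\<in>carrier (Obj D j).
        actD j g (s \<triangleright>\<^bsub>Obj D j\<^esub> x) = act g s \<triangleright>\<^bsub>Obj D j\<^esub> actD j g x \<and>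
        actD j g (x \<triangleleft>\<^bsub>Obj D j\<^esub> s) = actD j g x \<triangleleft>\<^bsub>Obj D j\<^esub> act g s) \<and>
     (\<forall>j. \<forall>g\<in>carrier G. \<forall>x\<in>carrier (Obj D (Suc j)).
        Diff D (Suc j) (actD (Suc j) g x) = actD j g (Diff D (Suc j) x)) \<and>
     (\<forall>g\<in>carrier G. \<forall>x\<in>carrier (Obj D 0). \<epsilon> (actD 0 g x) = act g (\<epsilon> x))"


section \<open>Twisted product resolution\<close>

text \<open>
  \<open>M \<otimes> N\<close> for a \<open>G\<close>-graded \<open>kG\<close>-bimodule \<open>M\<close> (homogeneous components \<open>gr g\<close>) and an
  \<open>S\<close>-bimodule \<open>N\<close> with compatible \<open>G\<close>-action \<open>actN\<close>.  For \<open>c\<close> of degree \<open>g\<close> and \<open>a = \<Sum>\<^sub>h a\<^sub>h h\<close>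
  the actions read
  \<open>a \<cdot> (c \<otimes> d) = \<Sum>\<^sub>h hc \<otimes> (act ((hg)\<^sup>-\<^sup>1) a\<^sub>h \<cdot> d)\<close>, as \<open>hc\<close> has degree \<open>hg\<close>, and
  \<open>(c \<otimes> d) \<cdot> a = \<Sum>\<^sub>h ch \<otimes> actN (h\<^sup>-\<^sup>1) (d \<cdot> a\<^sub>h)\<close>.
\<close>

definition twisted_tensor ::
  "'k ring \<Rightarrow> 'g monoid \<Rightarrow> ('k, 's) module \<Rightarrow> ('g \<Rightarrow> 's \<Rightarrow> 's)
    \<Rightarrow> ('k, 'g \<Rightarrow> 'k, 'c) bimodule \<Rightarrow> ('g \<Rightarrow> 'c set)
    \<Rightarrow> ('k, 's, 'd) bimodule \<Rightarrow> ('g \<Rightarrow> 'd \<Rightarrow> 'd)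
    \<Rightarrow> ('k, 'g \<Rightarrow> 's, ('c \<times> 'd \<Rightarrow> 'k) set) bimodule" where
  "twisted_tensor k G S act M gr N actN =
    (let T = tensor_module k M N in
     with_actions T
       (\<lambda>a. linear_ext k T (\<lambda>(c, d). \<Oplus>\<^bsub>T\<^esub>h\<in>carrier G. \<Oplus>\<^bsub>T\<^esub>g\<in>carrier G.
          tensor k M N (group_elem k G h \<triangleright>\<^bsub>M\<^esub> component M (carrier G) gr g c)
                       (act (inv\<^bsub>G\<^esub> (h \<otimes>\<^bsub>G\<^esub> g)) (a h) \<triangleright>\<^bsub>N\<^esub> d)))
       (\<lambda>u a. linear_ext k T (\<lambda>(c, d). \<Oplus>\<^bsub>T\<^esub>h\<in>carrier G.
          tensor k M N (c \<triangleleft>\<^bsub>M\<^esub> group_elem k G h) (actN (inv\<^bsub>G\<^esub> h) (d \<triangleleft>\<^bsub>N\<^esub> a h))) u))"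

definition direct_sum_bimodule ::
  "'i set \<Rightarrow> ('i \<Rightarrow> ('k, 'a, 'm) bimodule) \<Rightarrow> ('k, 'a, 'i \<Rightarrow> 'm) bimodule" where
  "direct_sum_bimodule I M =
    \<lparr>carrier = {u \<in> \<Pi>\<^sub>E i\<in>I. carrier (M i). finite {i\<in>I. u i \<noteq> \<zero>\<^bsub>M i\<^esub>}},
     mult = undefined, one = undefined,
     zero = (\<lambda>i\<in>I. \<zero>\<^bsub>M i\<^esub>),
     add = (\<lambda>u v. \<lambda>i\<in>I. u i \<oplus>\<^bsub>M i\<^esub> v i),
     smult = (\<lambda>r u. \<lambda>i\<in>I. r \<odot>\<^bsub>M i\<^esub> u i),
     lact = (\<lambda>a u. \<lambda>i\<in>I. a \<triangleright>\<^bsub>M i\<^esub> u i),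
     ract = (\<lambda>u a. \<lambda>i\<in>I. u i \<triangleleft>\<^bsub>M i\<^esub> a)\<rparr>"

text \<open>
  An element of degree \<open>n\<close> is a family \<open>u\<close> with \<open>u i \<in> C\<^sub>i \<otimes> D\<^sub>n\<^sub>-\<^sub>i\<close>.  The component of \<open>d u\<close> in
  \<open>C\<^sub>i \<otimes> D\<^sub>n\<^sub>-\<^sub>1\<^sub>-\<^sub>i\<close> collects \<open>d \<otimes> 1\<close> from \<open>C\<^sub>i\<^sub>+\<^sub>1 \<otimes> D\<^sub>n\<^sub>-\<^sub>1\<^sub>-\<^sub>i\<close> and \<open>(-1)\<^sup>i (1 \<otimes> d)\<close> from
  \<open>C\<^sub>i \<otimes> D\<^sub>n\<^sub>-\<^sub>i\<close>.
\<close>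

definition twisted_product ::
  "'k ring \<Rightarrow> 'g monoid \<Rightarrow> ('k, 's) module \<Rightarrow> ('g \<Rightarrow> 's \<Rightarrow> 's)
    \<Rightarrow> ('k, 'g \<Rightarrow> 'k, 'c) bimodule_complex \<Rightarrow> (nat \<Rightarrow> 'g \<Rightarrow> 'c set)
    \<Rightarrow> ('k, 's, 'd) bimodule_complex \<Rightarrow> (nat \<Rightarrow> 'g \<Rightarrow> 'd \<Rightarrow> 'd)
    \<Rightarrow> ('k, 'g \<Rightarrow> 's, nat \<Rightarrow> ('c \<times> 'd \<Rightarrow> 'k) set) bimodule_complex" where
  "twisted_product k G S act C gr D actD =
    \<lparr>Obj = (\<lambda>n. direct_sum_bimodule {..n}
        (\<lambda>i. twisted_tensor k G S act (Obj C i) (gr i) (Obj D (n - i)) (actD (n - i)))),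
     Diff = (\<lambda>n u. \<lambda>i\<in>{..n - 1}.
        (let C' = Obj C i; D' = Obj D (n - 1 - i); T = tensor_module k C' D' in
         tensor_map k C' D' (Diff C (i + 1)) (\<lambda>d. d) (u (i + 1)) \<oplus>\<^bsub>T\<^esub>
         signed T i (tensor_map k C' D' (\<lambda>c. c) (Diff D (n - i)) (u i))))\<rparr>"


section \<open>Internal gradings\<close>

definition graded_algebra :: "'k ring \<Rightarrow> ('k, 'a) module \<Rightarrow> (int \<Rightarrow> 'a set) \<Rightarrow> bool" where
  "graded_algebra k A gr \<longleftrightarrow> internal_direct_sum k A UNIV gr \<and> \<one>\<^bsub>A\<^esub> \<in> gr 0 \<and>
     (\<forall>m n. \<forall>x\<in>gr m. \<forall>y\<in>gr n. x \<otimes>\<^bsub>A\<^esub> y \<in> gr (m + n))"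

definition graded_bimodule ::
  "'k ring \<Rightarrow> (int \<Rightarrow> 'a set) \<Rightarrow> ('k, 'a, 'm) bimodule \<Rightarrow> (int \<Rightarrow> 'm set) \<Rightarrow> bool" where
  "graded_bimodule k grA M gr \<longleftrightarrow> internal_direct_sum k M UNIV gr \<and>
     (\<forall>m n. \<forall>a\<in>grA m. \<forall>x\<in>gr n. a \<triangleright>\<^bsub>M\<^esub> x \<in> gr (m + n) \<and> x \<triangleleft>\<^bsub>M\<^esub> a \<in> gr (n + m))"

definition graded_map ::
  "(nat \<Rightarrow> int \<Rightarrow> 'm set) \<Rightarrow> (nat \<Rightarrow> int \<Rightarrow> 'n set) \<Rightarrow> (nat \<Rightarrow> 'm \<Rightarrow> 'n) \<Rightarrow> bool" where
  "graded_map gr gr' f \<longleftrightarrow> (\<forall>n m. f n ` gr n m \<subseteq> gr' n m)"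

text \<open>The grading of the skew group algebra with \<open>G\<close> in degree 0.\<close>

definition skew_grading :: "'g monoid \<Rightarrow> (int \<Rightarrow> 's set) \<Rightarrow> int \<Rightarrow> ('g \<Rightarrow> 's) set" where
  "skew_grading G gr m = carrier G \<rightarrow>\<^sub>E gr m"

definition bar_grading ::
  "'k ring \<Rightarrow> ('k, 'a) module \<Rightarrow> (int \<Rightarrow> 'a set) \<Rightarrow> nat \<Rightarrow> int \<Rightarrow> ('a list \<Rightarrow> 'k) set set" where
  "bar_grading k A gr n m = span_of k (bar_module k A n)
     {bar_tensor k A n xs | xs ms. xs \<in> bar_lists A n \<and>
        list_all2 (\<lambda>x j. x \<in> gr j) xs ms \<and> sum_list ms = m}"

text \<open>\<open>C\<close> is placed in degree 0, so the degree of \<open>c \<otimes> d\<close> is that of \<open>d\<close>.\<close>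

definition twisted_product_grading ::
  "'k ring \<Rightarrow> ('k, 'g \<Rightarrow> 'k, 'c) bimodule_complex \<Rightarrow> ('k, 's, 'd) bimodule_complex
    \<Rightarrow> (nat \<Rightarrow> int \<Rightarrow> 'd set) \<Rightarrow> nat \<Rightarrow> int \<Rightarrow> (nat \<Rightarrow> ('c \<times> 'd \<Rightarrow> 'k) set) set" where
  "twisted_product_grading k C D grD n m = (\<Pi>\<^sub>E i\<in>{..n}.
     span_of k (tensor_module k (Obj C i) (Obj D (n - i)))
       {tensor k (Obj C i) (Obj D (n - i)) c d | c d. c \<in> carrier (Obj C i) \<and> d \<in> grD (n - i) m})"

end

theory Submission
  imports Defs
begin

text \<open>
  Write \<open>A = S \<rtimes> G\<close>.  If \<open>C\<close> and \<open>D\<close> are the reduced bar resolutions themselves, the two maps are a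
  twisted version of the Eilenberg-Zilber equivalence: a shuffle map, sending \<open>u \<otimes> v\<close> for bars \<open>u\<close> over
  \<open>kG\<close> and \<open>v\<close> over \<open>S\<close> to a bar over \<open>A\<close>, and Alexander-Whitney maps, one for each total degree
  \<open>\<gamma> \<in> G\<close>, in the opposite direction.  Both are defined by recursion on the length of the bars, using the
  contraction \<open>y \<mapsto> 1 \<otimes> y\<close> and its conjugates by elements of \<open>G\<close>; the normalization of the bar
  resolutions makes the composition Alexander-Whitney after shuffle strictly equal to the identity.
  In the general case \<open>\<iota>\<close> sends \<open>c \<otimes> d\<close>, with \<open>c\<close> of degree \<open>g\<close>, to the shuffle of \<open>\<iota>\<^sub>G c\<close> and
  \<open>\<iota>\<^sub>S (g \<cdot> d)\<close> multiplied by \<open>g\<close> from the right, and \<open>\<pi>\<close> applies \<open>\<pi>\<^sub>G \<otimes> \<pi>\<^sub>S\<close> after the Alexander-Whitney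
  map for \<open>\<gamma>\<close>, twisted by \<open>\<gamma>\<close>.  As \<open>\<iota>\<^sub>G\<close> and \<open>\<pi>\<^sub>G\<close> need not respect the grading by \<open>G\<close>, the shuffle and
  Alexander-Whitney maps have to be insensitive to the right action of \<open>G\<close> on bars over \<open>kG\<close>, and
  \<open>\<pi>\<^sub>G\<close> has to be followed by the map that sends \<open>c\<close> of degree \<open>h\<close> to \<open>c h\<^sup>-\<^sup>1\<close>.
\<close>

section \<open>Linear maps and vector spaces with generators and relations\<close>

text \<open>The comparison theorem for resolutions would make \<open>\<pi> \<iota>\<close> only
  homotopic to the identity; strict equality calls for formulas. The shuffle map follows the pattern
  f(x) = h(f(d x)) for maps into a complex with contraction h, here h(y) = 1 \<otimes> y. But h does
  not commute with conjugation by G, while the shuffle map must turn the diagonal action of G on its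
  arguments into conjugation. Conjugating h by the first group entry g repairs this, and d h_g + h_g
  d = 1 and h_g h_g = 0 remain true. The second identity comes from normalization. It deletes from
  f(d x) the terms already in the image of h_g, which leaves two summands, and it later removes the
  summand that would spoil the composition. The index \<open>\<gamma>\<close> is the product of all
  group entries of a bar: the differential preserves it, and the left and right actions of G shift
  it. Since bars are classes of lists, a map out of them is prescribed on (first entry, tail) and
  must vanish if the tail starts with 1. So each recursion has to prove its own well-definedness
  along the way.\<close>

definition lin ::
  "'k ring \<Rightarrow> ('k, 'm, 'y) module_scheme \<Rightarrow> ('k, 'n, 'z) module_scheme \<Rightarrow> ('m \<Rightarrow> 'n) set" where
  "lin k M N = {f \<in> carrier M \<rightarrow> carrier N.
     (\<forall>x\<in>carrier M. \<forall>y\<in>carrier M. f (x \<oplus>\<^bsub>M\<^esub> y) = f x \<oplus>\<^bsub>N\<^esub> f y) \<and>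
     (\<forall>r\<in>carrier k. \<forall>x\<in>carrier M. f (r \<odot>\<^bsub>M\<^esub> x) = r \<odot>\<^bsub>N\<^esub> f x)}"

lemma linI:
  assumes "\<And>x. x \<in> carrier M \<Longrightarrow> f x \<in> carrier N"
    and "\<And>x y. x \<in> carrier M \<Longrightarrow> y \<in> carrier M \<Longrightarrow> f (x \<oplus>\<^bsub>M\<^esub> y) = f x \<oplus>\<^bsub>N\<^esub> f y"
    and "\<And>r x. r \<in> carrier k \<Longrightarrow> x \<in> carrier M \<Longrightarrow> f (r \<odot>\<^bsub>M\<^esub> x) = r \<odot>\<^bsub>N\<^esub> f x"
  shows "f \<in> lin k M N"
  using assms by (auto simp: lin_def)

lemma lin_closed: "f \<in> lin k M N \<Longrightarrow> x \<in> carrier M \<Longrightarrow> f x \<in> carrier N"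
  by (auto simp: lin_def)

lemma lin_add:
  "f \<in> lin k M N \<Longrightarrow> x \<in> carrier M \<Longrightarrow> y \<in> carrier M \<Longrightarrow> f (x \<oplus>\<^bsub>M\<^esub> y) = f x \<oplus>\<^bsub>N\<^esub> f y"
  by (auto simp: lin_def)

lemma lin_smult:
  "f \<in> lin k M N \<Longrightarrow> r \<in> carrier k \<Longrightarrow> x \<in> carrier M \<Longrightarrow> f (r \<odot>\<^bsub>M\<^esub> x) = r \<odot>\<^bsub>N\<^esub> f x"
  by (auto simp: lin_def)

lemma module_zero_closed: "module k M \<Longrightarrow> \<zero>\<^bsub>M\<^esub> \<in> carrier M"
proof -
  assume "module k M"
  then interpret module k M .
  show ?thesis by simp
qed

lemma module_add_closed:
  "module k M \<Longrightarrow> x \<in> carrier M \<Longrightarrow> y \<in> carrier M \<Longrightarrow> x \<oplus>\<^bsub>M\<^esub> y \<in> carrier M"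
proof -
  assume "module k M" and *: "x \<in> carrier M" "y \<in> carrier M"
  then interpret module k M by simp
  show ?thesis using * by simp
qed

lemma module_abelian: "module k M \<Longrightarrow> abelian_group M"
  by (simp add: module_def)

lemma module_cring: "module k M \<Longrightarrow> cring k"
  by (simp add: module_def)

lemma module_finsum_closed:
  "module k M \<Longrightarrow> (\<And>i. i \<in> I \<Longrightarrow> f i \<in> carrier M) \<Longrightarrow> (\<Oplus>\<^bsub>M\<^esub>i\<in>I. f i) \<in> carrier M"
  by (rule abelian_monoid.finsum_closed) (auto dest: module_abelian abelian_group.axioms(1))

lemma finsum_congI:
  assumes "module k M" "\<And>i. i \<in> I \<Longrightarrow> f i = g i" "\<And>i. i \<in> I \<Longrightarrow> g i \<in> carrier M"
  shows "(\<Oplus>\<^bsub>M\<^esub>i\<in>I. f i) = (\<Oplus>\<^bsub>M\<^esub>i\<in>I. g i)"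
  by (rule abelian_monoid.finsum_cong') (use assms in \<open>auto dest: module_abelian abelian_group.axioms(1)\<close>)

lemma finsum_addI:
  assumes "module k M" "\<And>i. i \<in> I \<Longrightarrow> f i \<in> carrier M" "\<And>i. i \<in> I \<Longrightarrow> g i \<in> carrier M"
  shows "(\<Oplus>\<^bsub>M\<^esub>i\<in>I. f i \<oplus>\<^bsub>M\<^esub> g i) = (\<Oplus>\<^bsub>M\<^esub>i\<in>I. f i) \<oplus>\<^bsub>M\<^esub> (\<Oplus>\<^bsub>M\<^esub>i\<in>I. g i)"
  by (rule abelian_monoid.finsum_addf) (use assms in \<open>auto dest: module_abelian abelian_group.axioms(1)\<close>)

lemma finsum_smultI:
  assumes "module k M" "finite I" "\<And>i. i \<in> I \<Longrightarrow> f i \<in> carrier M" "r \<in> carrier k"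
  shows "(\<Oplus>\<^bsub>M\<^esub>i\<in>I. r \<odot>\<^bsub>M\<^esub> f i) = r \<odot>\<^bsub>M\<^esub> (\<Oplus>\<^bsub>M\<^esub>i\<in>I. f i)"
  by (rule module.finsum_smult_ldistr[symmetric]) (use assms in auto)

lemma finsum_reindexI:
  assumes "module k M" "bij_betw h I J" "\<And>j. j \<in> J \<Longrightarrow> f j \<in> carrier M"
  shows "(\<Oplus>\<^bsub>M\<^esub>j\<in>J. f j) = (\<Oplus>\<^bsub>M\<^esub>i\<in>I. f (h i))"
proof -
  interpret module k M by fact
  have "finsum M f (h ` I) = finsum M (\<lambda>i. f (h i)) I"
    by (rule finsum_reindex) (use assms in \<open>auto simp: bij_betw_def\<close>)
  then show ?thesis using assms(2) by (simp add: bij_betw_def)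
qed

lemma finsum_single:
  assumes "module k M" "finite I" "i \<in> I" "f i \<in> carrier M"
    and "\<And>j. j \<in> I \<Longrightarrow> j \<noteq> i \<Longrightarrow> f j = \<zero>\<^bsub>M\<^esub>"
  shows "(\<Oplus>\<^bsub>M\<^esub>j\<in>I. f j) = f i"
proof -
  interpret module k M by fact
  have "(\<Oplus>\<^bsub>M\<^esub>j\<in>I. f j) = (\<Oplus>\<^bsub>M\<^esub>j\<in>I. if i = j then f i else \<zero>\<^bsub>M\<^esub>)"
    by (rule M.finsum_cong') (use assms in auto)
  also have "\<dots> = f i"
    using M.finsum_singleton[of i I "\<lambda>_. f i"] assms by auto
  finally show ?thesis .
qed

lemma finsum_zeroI:
  assumes "module k M" "\<And>i. i \<in> I \<Longrightarrow> f i = \<zero>\<^bsub>M\<^esub>"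
  shows "(\<Oplus>\<^bsub>M\<^esub>i\<in>I. f i) = \<zero>\<^bsub>M\<^esub>"
proof -
  interpret module k M by fact
  show ?thesis using assms(2) by (rule M.add.finprod_one_eqI)
qed

lemma lin_zero:
  assumes "module k M" "module k N" "f \<in> lin k M N"
  shows "f \<zero>\<^bsub>M\<^esub> = \<zero>\<^bsub>N\<^esub>"
proof -
  interpret M: module k M by fact
  interpret N: module k N by fact
  have "f (\<zero>\<^bsub>k\<^esub> \<odot>\<^bsub>M\<^esub> \<zero>\<^bsub>M\<^esub>) = \<zero>\<^bsub>k\<^esub> \<odot>\<^bsub>N\<^esub> f \<zero>\<^bsub>M\<^esub>"
    using assms(3) by (intro lin_smult) auto
  then show ?thesis using lin_closed[OF assms(3)] by simp
qed

lemma lin_neg: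
  assumes "module k M" "module k N" "f \<in> lin k M N" "x \<in> carrier M"
  shows "f (\<ominus>\<^bsub>M\<^esub> x) = \<ominus>\<^bsub>N\<^esub> f x"
proof -
  interpret M: module k M by fact
  interpret N: module k N by fact
  have "f (\<ominus>\<^bsub>M\<^esub> x) \<oplus>\<^bsub>N\<^esub> f x = \<zero>\<^bsub>N\<^esub>"
    using lin_add[OF assms(3), of "\<ominus>\<^bsub>M\<^esub> x" x] assms lin_zero[OF assms(1-3)] by (simp add: M.M.l_neg)
  then show ?thesis
    using lin_closed[OF assms(3)] assms(4) by (metis M.M.a_inv_closed N.M.minus_equality)
qed

lemma lin_minus:
  assumes "module k M" "module k N" "f \<in> lin k M N" "x \<in> carrier M" "y \<in> carrier M"
  shows "f (x \<ominus>\<^bsub>M\<^esub> y) = f x \<ominus>\<^bsub>N\<^esub> f y"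
proof -
  interpret M: module k M by fact
  show ?thesis
    using assms by (simp add: a_minus_def lin_add[OF assms(3)] lin_neg[OF assms(1-3)])
qed

text \<open>For infinite \<open>I\<close> both sums are zero by convention, which is why the
  induction has a third case.\<close>

lemma lin_finsum:
  assumes "module k M" "module k N" "f \<in> lin k M N" "\<And>i. i \<in> I \<Longrightarrow> h i \<in> carrier M"
  shows "f (\<Oplus>\<^bsub>M\<^esub>i\<in>I. h i) = (\<Oplus>\<^bsub>N\<^esub>i\<in>I. f (h i))"
proof -
  interpret M: module k M by fact
  interpret N: module k N by fact
  show ?thesis using assms(4)
  proof (induction I rule: infinite_finite_induct)
    case (insert x F)
    then show ?case
      using lin_closed[OF assms(3)]
      by (simp add: Pi_iff lin_add[OF assms(3)] M.M.finsum_closed)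
  qed (simp_all add: lin_zero[OF assms(1-3)])
qed

lemma signed_closed: "module k M \<Longrightarrow> x \<in> carrier M \<Longrightarrow> signed M i x \<in> carrier M"
  by (auto simp: signed_def dest: module_abelian abelian_group.a_inv_closed)

lemma lin_signed:
  assumes "module k M" "module k N" "f \<in> lin k M N" "x \<in> carrier M"
  shows "f (signed M i x) = signed N i (f x)"
  using lin_neg[OF assms] by (simp add: signed_def)

lemma lin_ident: "(\<lambda>x. x) \<in> lin k M M"
  by (simp add: lin_def)

lemma lin_comp:
  assumes "f \<in> lin k M N" "g \<in> lin k N P"
  shows "(\<lambda>x. g (f x)) \<in> lin k M P"
  by (rule linI) (simp_all add: assms lin_closed[OF assms(1)] lin_closed[OF assms(2)] lin_add[OF assms(1)]
     lin_add[OF assms(2)] lin_smult[OF assms(1)] lin_smult[OF assms(2)])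

text \<open>Linearity concerns values on the carrier only. Many maps below have a closed form just
  there, and their linearity is transported from that form; the module axioms for \<open>M\<close>
  keep sums and multiples inside the carrier.\<close>

lemma lin_cong:
  assumes "f \<in> lin k M N" "module k M" "\<And>x. x \<in> carrier M \<Longrightarrow> g x = f x"
  shows "g \<in> lin k M N"
proof -
  interpret M: module k M by fact
  show ?thesis using assms(1,3) by (auto simp: lin_def)
qed

lemma lin_zerof: "module k N \<Longrightarrow> (\<lambda>x. \<zero>\<^bsub>N\<^esub>) \<in> lin k M N"
proof -
  assume "module k N"
  then interpret N: module k N .
  show ?thesis by (rule linI) auto
qed

lemma lin_addf:
  assumes "module k N" "f \<in> lin k M N" "g \<in> lin k M N"
  shows "(\<lambda>x. f x \<oplus>\<^bsub>N\<^esub> g x) \<in> lin k M N"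
proof -
  interpret N: module k N by fact
  show ?thesis
    by (rule linI) (simp_all add: lin_closed[OF assms(2)] lin_closed[OF assms(3)] lin_add[OF assms(2)]
     lin_add[OF assms(3)] lin_smult[OF assms(2)] lin_smult[OF assms(3)] N.smult_r_distr N.M.a_ac)
qed

lemma lin_negf:
  assumes "module k N" "f \<in> lin k M N"
  shows "(\<lambda>x. \<ominus>\<^bsub>N\<^esub> f x) \<in> lin k M N"
proof -
  interpret N: module k N by fact
  show ?thesis
    by (rule linI) (simp_all add: lin_closed[OF assms(2)] lin_add[OF assms(2)]
        lin_smult[OF assms(2)] N.smult_r_minus N.M.minus_add)
qed

lemma lin_minusf:
  assumes "module k N" "f \<in> lin k M N" "g \<in> lin k M N"
  shows "(\<lambda>x. f x \<ominus>\<^bsub>N\<^esub> g x) \<in> lin k M N"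
  unfolding a_minus_def by (intro lin_addf lin_negf assms)

lemma lin_signedf:
  assumes "module k N" "f \<in> lin k M N"
  shows "(\<lambda>x. signed N i (f x)) \<in> lin k M N"
  using assms lin_negf[OF assms] by (cases "even i") (simp_all add: signed_def)

lemma lin_smultf:
  assumes "module k N" "f \<in> lin k M N" "r \<in> carrier k"
  shows "(\<lambda>x. r \<odot>\<^bsub>N\<^esub> f x) \<in> lin k M N"
proof -
  interpret N: module k N by fact
  show ?thesis
    by (rule linI) (simp_all add: lin_closed[OF assms(2)] lin_add[OF assms(2)] assms(3)
        lin_smult[OF assms(2)] N.smult_r_distr N.smult_assoc1[symmetric] N.R.m_comm)
qed

lemma lin_finsumf:
  assumes "module k N" "\<And>i. i \<in> I \<Longrightarrow> f i \<in> lin k M N"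
  shows "(\<lambda>x. \<Oplus>\<^bsub>N\<^esub>i\<in>I. f i x) \<in> lin k M N"
proof (cases "finite I")
  case True
  note c = lin_closed[OF assms(2)] and a = lin_add[OF assms(2)] and m = lin_smult[OF assms(2)]
  interpret N: module k N by fact
  show ?thesis
  proof (rule linI)
    fix x assume x: "x \<in> carrier M"
    show "(\<Oplus>\<^bsub>N\<^esub>i\<in>I. f i x) \<in> carrier N"
      by (rule module_finsum_closed[OF assms(1)]) (rule c[OF _ x])
    { fix y assume y: "y \<in> carrier M"
      have "(\<Oplus>\<^bsub>N\<^esub>i\<in>I. f i (x \<oplus>\<^bsub>M\<^esub> y)) = (\<Oplus>\<^bsub>N\<^esub>i\<in>I. f i x \<oplus>\<^bsub>N\<^esub> f i y)"
        by (rule finsum_congI[OF assms(1)]) (simp_all add: a c x y)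
      also have "\<dots> = (\<Oplus>\<^bsub>N\<^esub>i\<in>I. f i x) \<oplus>\<^bsub>N\<^esub> (\<Oplus>\<^bsub>N\<^esub>i\<in>I. f i y)"
        by (rule finsum_addI[OF assms(1)]) (simp_all add: c x y)
      finally show "(\<Oplus>\<^bsub>N\<^esub>i\<in>I. f i (x \<oplus>\<^bsub>M\<^esub> y)) = (\<Oplus>\<^bsub>N\<^esub>i\<in>I. f i x) \<oplus>\<^bsub>N\<^esub> (\<Oplus>\<^bsub>N\<^esub>i\<in>I. f i y)" . }
    { fix r assume r: "r \<in> carrier k"
      have "(\<Oplus>\<^bsub>N\<^esub>i\<in>I. f i (r \<odot>\<^bsub>M\<^esub> x)) = (\<Oplus>\<^bsub>N\<^esub>i\<in>I. r \<odot>\<^bsub>N\<^esub> f i x)"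
        by (rule finsum_congI[OF assms(1)]) (simp_all add: m c r x)
      also have "\<dots> = r \<odot>\<^bsub>N\<^esub> (\<Oplus>\<^bsub>N\<^esub>i\<in>I. f i x)"
        by (rule finsum_smultI[OF assms(1) True]) (simp_all add: c x r)
      finally show "(\<Oplus>\<^bsub>N\<^esub>i\<in>I. f i (r \<odot>\<^bsub>M\<^esub> x)) = r \<odot>\<^bsub>N\<^esub> (\<Oplus>\<^bsub>N\<^esub>i\<in>I. f i x)" . }
  qed
next
  case False
  interpret N: module k N by fact
  show ?thesis using False by (simp add: lin_zerof[OF assms(1)])
qed

lemma submodule_kernel:
  assumes "module k M" "module k N" "f \<in> lin k M N" "submodule K k N"
  shows "submodule {x \<in> carrier M. f x \<in> K} k M"
proof -
  interpret M: module k M by fact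
  interpret N: module k N by fact
  note K = N.submoduleE[OF assms(4)]
  have "\<zero>\<^bsub>N\<^esub> \<in> K" using assms(4) subgroup.one_closed[OF submodule.axioms(1)] by fastforce
  then show ?thesis
    using K by (intro M.submoduleI)
      (auto simp: lin_zero[OF assms(1-3)] lin_neg[OF assms(1-3)] lin_add[OF assms(3)] lin_smult[OF assms(3)])
qed

lemma submodule_zero_set: "module k M \<Longrightarrow> submodule {\<zero>\<^bsub>M\<^esub>} k M"
proof -
  assume "module k M"
  then interpret M: module k M .
  show ?thesis by (rule M.submoduleI) auto
qed

lemma submodule_zero: "submodule H k M \<Longrightarrow> \<zero>\<^bsub>M\<^esub> \<in> H"
  using subgroup.one_closed[OF submodule.axioms(1)] by fastforce

lemma submodule_add: "submodule H k M \<Longrightarrow> x \<in> H \<Longrightarrow> y \<in> H \<Longrightarrow> x \<oplus>\<^bsub>M\<^esub> y \<in> H"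
  using subgroup.m_closed[OF submodule.axioms(1)] by fastforce

lemma submodule_subset: "submodule H k M \<Longrightarrow> H \<subseteq> carrier M"
  using subgroup.subset[OF submodule.axioms(1)] by fastforce

lemma submodule_smult: "submodule H k M \<Longrightarrow> r \<in> carrier k \<Longrightarrow> x \<in> H \<Longrightarrow> r \<odot>\<^bsub>M\<^esub> x \<in> H"
  by (rule submodule.smult_closed)

lemma submodule_finsum:
  assumes "module k M" "submodule H k M" "\<And>i. i \<in> I \<Longrightarrow> f i \<in> H"
  shows "(\<Oplus>\<^bsub>M\<^esub>i\<in>I. f i) \<in> H"
proof -
  interpret M: module k M by fact
  show ?thesis using assms(3)
  proof (induction I rule: infinite_finite_induct)
    case (insert i F)
    then show ?case using submodule_subset[OF assms(2)]
      by (subst M.M.finsum_insert) (auto intro!: submodule_add[OF assms(2)])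
  qed (simp_all add: submodule_zero[OF assms(2)])
qed

lemma submodule_neg:
  "module k M \<Longrightarrow> submodule H k M \<Longrightarrow> x \<in> H \<Longrightarrow> \<ominus>\<^bsub>M\<^esub> x \<in> H"
  by (simp add: module.submoduleE)

lemma submodule_signed:
  "module k M \<Longrightarrow> submodule H k M \<Longrightarrow> x \<in> H \<Longrightarrow> signed M i x \<in> H"
  by (simp add: signed_def submodule_neg)

lemma span_of_submodule:
  assumes "module k M" "X \<subseteq> carrier M"
  shows "submodule (span_of k M X) k M"
proof -
  interpret M: module k M by fact
  \<comment> \<open>The carrier belongs to the intersected family; an empty family would make the
    intersection the whole type.\<close>
  have c: "submodule (carrier M) k M \<and> X \<subseteq> carrier M" using assms(2) M.carrier_is_submodule by simp
  show ?thesis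
    unfolding span_of_def
    by (rule M.submoduleI)
      (use c in \<open>auto intro: submodule_zero submodule_add submodule_smult submodule_neg[OF assms(1)]\<close>)
qed

lemma span_of_gen: "x \<in> X \<Longrightarrow> x \<in> span_of k M X"
  by (auto simp: span_of_def)

lemma span_of_min: "submodule H k M \<Longrightarrow> X \<subseteq> H \<Longrightarrow> span_of k M X \<subseteq> H"
  by (auto simp: span_of_def)

text \<open>The preimage of \<open>K\<close> is one of the submodules whose intersection is the
  span. With \<open>K\<close> zero this kills the consequences of relators, with \<open>K\<close> a
  homogeneous piece it shows that a map preserves degrees.\<close>

lemma lin_span:
  assumes "module k M" "module k N" "f \<in> lin k M N" "submodule K k N" "X \<subseteq> carrier M"
    and "\<And>x. x \<in> X \<Longrightarrow> f x \<in> K" "y \<in> span_of k M X"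
  shows "f y \<in> K"
  using span_of_min[OF submodule_kernel[OF assms(1-4)], of X] assms(5-7) by auto

section \<open>Free modules\<close>

lemma free_module_simps [simp]:
  "\<zero>\<^bsub>free_module k X\<^esub> = (\<lambda>x. \<zero>\<^bsub>k\<^esub>)"
  "f \<oplus>\<^bsub>free_module k X\<^esub> g = (\<lambda>x. f x \<oplus>\<^bsub>k\<^esub> g x)"
  "r \<odot>\<^bsub>free_module k X\<^esub> f = (\<lambda>x. r \<otimes>\<^bsub>k\<^esub> f x)"
  by (simp_all add: free_module_def)

lemma free_module_carrier:
  "f \<in> carrier (free_module k X) \<longleftrightarrow>
     (\<forall>x. f x \<in> carrier k) \<and> finite {x. f x \<noteq> \<zero>\<^bsub>k\<^esub>} \<and> (\<forall>x. x \<notin> X \<longrightarrow> f x = \<zero>\<^bsub>k\<^esub>)"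
  by (auto simp: free_module_def)

lemma module_free:
  assumes "cring k"
  shows "module k (free_module k X)"
proof -
  interpret cring k by fact
  have add: "(\<lambda>x. f x \<oplus>\<^bsub>k\<^esub> g x) \<in> carrier (free_module k X)"
    if "f \<in> carrier (free_module k X)" "g \<in> carrier (free_module k X)" for f g
  proof -
    have "{x. f x \<oplus>\<^bsub>k\<^esub> g x \<noteq> \<zero>\<^bsub>k\<^esub>} \<subseteq> {x. f x \<noteq> \<zero>\<^bsub>k\<^esub>} \<union> {x. g x \<noteq> \<zero>\<^bsub>k\<^esub>}" by auto
    then have "finite {x. f x \<oplus>\<^bsub>k\<^esub> g x \<noteq> \<zero>\<^bsub>k\<^esub>}"
      by (rule finite_subset) (use that in \<open>simp add: free_module_carrier\<close>)
    then show ?thesis using that by (auto simp: free_module_carrier)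
  qed
  have sm: "(\<lambda>x. r \<otimes>\<^bsub>k\<^esub> f x) \<in> carrier (free_module k X)"
    if "f \<in> carrier (free_module k X)" "r \<in> carrier k" for f r
  proof -
    have "{x. r \<otimes>\<^bsub>k\<^esub> f x \<noteq> \<zero>\<^bsub>k\<^esub>} \<subseteq> {x. f x \<noteq> \<zero>\<^bsub>k\<^esub>}" using that by auto
    then have "finite {x. r \<otimes>\<^bsub>k\<^esub> f x \<noteq> \<zero>\<^bsub>k\<^esub>}"
      by (rule finite_subset) (use that in \<open>simp add: free_module_carrier\<close>)
    then show ?thesis using that by (auto simp: free_module_carrier)
  qed
  \<comment> \<open>The inverse is taken to be the multiple by -1, so that \<open>sm\<close>
    supplies the finite support.\<close>
  have neg: "\<exists>g\<in>carrier (free_module k X). (\<lambda>x. g x \<oplus>\<^bsub>k\<^esub> f x) = (\<lambda>x. \<zero>\<^bsub>k\<^esub>)"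
    if "f \<in> carrier (free_module k X)" for f
    using sm[OF that, of "\<ominus>\<^bsub>k\<^esub> \<one>\<^bsub>k\<^esub>"] that
    by (intro bexI[of _ "\<lambda>x. \<ominus>\<^bsub>k\<^esub> \<one>\<^bsub>k\<^esub> \<otimes>\<^bsub>k\<^esub> f x"]) (auto simp: free_module_carrier l_minus l_neg fun_eq_iff)
  have "abelian_group (free_module k X)"
  proof (rule abelian_groupI)
    fix f g h assume c: "f \<in> carrier (free_module k X)" "g \<in> carrier (free_module k X)"
      "h \<in> carrier (free_module k X)"
    show "f \<oplus>\<^bsub>free_module k X\<^esub> g \<in> carrier (free_module k X)" using add c by simp
    show "f \<oplus>\<^bsub>free_module k X\<^esub> g \<oplus>\<^bsub>free_module k X\<^esub> h
        = f \<oplus>\<^bsub>free_module k X\<^esub> (g \<oplus>\<^bsub>free_module k X\<^esub> h)"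
      using c by (simp add: free_module_carrier a_assoc)
    show "f \<oplus>\<^bsub>free_module k X\<^esub> g = g \<oplus>\<^bsub>free_module k X\<^esub> f"
      using c by (simp add: free_module_carrier fun_eq_iff) (simp add: a_comm)
  next
    fix f assume c: "f \<in> carrier (free_module k X)"
    show "\<exists>g\<in>carrier (free_module k X). g \<oplus>\<^bsub>free_module k X\<^esub> f = \<zero>\<^bsub>free_module k X\<^esub>"
      using neg[OF c] by simp
    show "\<zero>\<^bsub>free_module k X\<^esub> \<oplus>\<^bsub>free_module k X\<^esub> f = f"
      using c by (simp add: free_module_carrier)
  qed (simp add: free_module_carrier)
  then show ?thesis
    by (intro moduleI) (use sm in \<open>auto simp: is_cring l_distr r_distr m_assoc free_module_carrier fun_eq_iff\<close>)
qed

lemma free_gen_closed: "cring k \<Longrightarrow> x \<in> X \<Longrightarrow> free_gen k x \<in> carrier (free_module k X)"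
proof -
  assume "cring k" "x \<in> X"
  then interpret cring k by simp
  have "{y. free_gen k x y \<noteq> \<zero>\<^bsub>k\<^esub>} \<subseteq> {x}" by (auto simp: free_gen_def)
  then have "finite {y. free_gen k x y \<noteq> \<zero>\<^bsub>k\<^esub>}" by (rule finite_subset) simp
  then show ?thesis using \<open>x \<in> X\<close> by (auto simp: free_module_carrier) (auto simp: free_gen_def)
qed

text \<open>The linear extension of \<open>\<phi>\<close> to the free module.
  \<open>linear_ext\<close> is this map applied to the representatives of a coset, so all facts
  about \<open>linear_ext\<close> are derived from it.\<close>

definition free_lift :: "'k ring \<Rightarrow> ('k, 'n, 'z) module_scheme \<Rightarrow> ('x \<Rightarrow> 'n) \<Rightarrow> ('x \<Rightarrow> 'k) \<Rightarrow> 'n" where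
  "free_lift k N \<phi> f = (\<Oplus>\<^bsub>N\<^esub>x\<in>{x. f x \<noteq> \<zero>\<^bsub>k\<^esub>}. f x \<odot>\<^bsub>N\<^esub> \<phi> x)"

text \<open>Terms outside the support vanish. The freedom in the index set allows two functions with
  different supports to be summed over one common set.\<close>

lemma free_lift_superset:
  assumes "module k N" "\<phi> \<in> X \<rightarrow> carrier N" "f \<in> carrier (free_module k X)"
    and "finite Y" "{x. f x \<noteq> \<zero>\<^bsub>k\<^esub>} \<subseteq> Y" "Y \<subseteq> X"
  shows "free_lift k N \<phi> f = (\<Oplus>\<^bsub>N\<^esub>x\<in>Y. f x \<odot>\<^bsub>N\<^esub> \<phi> x)"
proof -
  interpret N: module k N by fact
  show ?thesis
    unfolding free_lift_def
    by (rule N.M.add.finprod_mono_neutral_cong_left)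
      (use assms in \<open>auto simp: free_module_carrier Pi_iff subset_iff\<close>)
qed

lemma free_lift_lin:
  assumes "module k N" "\<phi> \<in> X \<rightarrow> carrier N"
  shows "free_lift k N \<phi> \<in> lin k (free_module k X) N"
proof (rule linI)
  interpret N: module k N by fact
  interpret F: module k "free_module k X" by (rule module_free) (rule N.R.is_cring)
  note [simp] = free_module_carrier
  fix f assume f: "f \<in> carrier (free_module k X)"
  have supp: "{x. f x \<noteq> \<zero>\<^bsub>k\<^esub>} \<subseteq> X" using f by auto
  show "free_lift k N \<phi> f \<in> carrier N"
    unfolding free_lift_def using f assms by (intro N.M.finsum_closed) auto
  { fix g assume g: "g \<in> carrier (free_module k X)"
    let ?Y = "{x. f x \<noteq> \<zero>\<^bsub>k\<^esub>} \<union> {x. g x \<noteq> \<zero>\<^bsub>k\<^esub>}"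
    have Y: "finite ?Y" "?Y \<subseteq> X" using f g by auto
    have "free_lift k N \<phi> (f \<oplus>\<^bsub>free_module k X\<^esub> g) = (\<Oplus>\<^bsub>N\<^esub>x\<in>?Y. (f x \<oplus>\<^bsub>k\<^esub> g x) \<odot>\<^bsub>N\<^esub> \<phi> x)"
      by (subst free_lift_superset[OF assms F.M.a_closed[OF f g] Y(1) _ Y(2)]) auto
    also have "\<dots> = (\<Oplus>\<^bsub>N\<^esub>x\<in>?Y. f x \<odot>\<^bsub>N\<^esub> \<phi> x \<oplus>\<^bsub>N\<^esub> g x \<odot>\<^bsub>N\<^esub> \<phi> x)"
      using assms f g Y by (intro finsum_congI[OF assms(1)]) (auto simp: N.smult_l_distr Pi_iff)
    also have "\<dots> = free_lift k N \<phi> f \<oplus>\<^bsub>N\<^esub> free_lift k N \<phi> g"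
      using assms f g Y
      by (subst finsum_addI[OF assms(1)])
        (auto simp: Pi_iff free_lift_superset[OF assms f Y(1) _ Y(2)] free_lift_superset[OF assms g Y(1) _ Y(2)])
    finally show "free_lift k N \<phi> (f \<oplus>\<^bsub>free_module k X\<^esub> g) = free_lift k N \<phi> f \<oplus>\<^bsub>N\<^esub> free_lift k N \<phi> g" . }
  { fix r assume r: "r \<in> carrier k"
    let ?Y = "{x. f x \<noteq> \<zero>\<^bsub>k\<^esub>}"
    have Y: "finite ?Y" "?Y \<subseteq> X" using f by auto
    have "free_lift k N \<phi> (r \<odot>\<^bsub>free_module k X\<^esub> f) = (\<Oplus>\<^bsub>N\<^esub>x\<in>?Y. (r \<otimes>\<^bsub>k\<^esub> f x) \<odot>\<^bsub>N\<^esub> \<phi> x)"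
      by (subst free_lift_superset[OF assms F.smult_closed[OF r f] Y(1) _ Y(2)]) (use r in auto)
    also have "\<dots> = (\<Oplus>\<^bsub>N\<^esub>x\<in>?Y. r \<odot>\<^bsub>N\<^esub> (f x \<odot>\<^bsub>N\<^esub> \<phi> x))"
      using assms f Y r by (intro finsum_congI[OF assms(1)]) (auto simp: N.smult_assoc1 Pi_iff)
    also have "\<dots> = r \<odot>\<^bsub>N\<^esub> free_lift k N \<phi> f"
      unfolding free_lift_def
      using assms f Y r by (intro finsum_smultI[OF assms(1)]) (auto simp: Pi_iff)
    finally show "free_lift k N \<phi> (r \<odot>\<^bsub>free_module k X\<^esub> f) = r \<odot>\<^bsub>N\<^esub> free_lift k N \<phi> f" . }
qed

lemma free_lift_gen:
  assumes "module k N" "\<phi> x \<in> carrier N"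
  shows "free_lift k N \<phi> (free_gen k x) = \<phi> x"
proof -
  interpret N: module k N by fact
  show ?thesis
  \<comment> \<open>\<open>module k N\<close> makes \<open>k\<close> just a commutative ring, so the
    zero ring is a case of its own: a generator then has empty support, but every module is
    zero.\<close>
  proof (cases "\<one>\<^bsub>k\<^esub> = \<zero>\<^bsub>k\<^esub>")
    case True
    then have "\<phi> x = \<zero>\<^bsub>N\<^esub>" using assms(2) N.smult_one N.smult_l_null by metis
    moreover have "{y. free_gen k x y \<noteq> \<zero>\<^bsub>k\<^esub>} = {}" using True by (auto simp: free_gen_def)
    ultimately show ?thesis by (simp add: free_lift_def)
  next
    case False
    then have "{y. free_gen k x y \<noteq> \<zero>\<^bsub>k\<^esub>} = {x}" by (auto simp: free_gen_def)
    then show ?thesis using assms by (simp add: free_lift_def free_gen_def)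
  qed
qed

lemma free_module_finsum_apply:
  assumes "cring k" "finite Y" "\<And>y. y \<in> Y \<Longrightarrow> F y \<in> carrier (free_module k X)"
  shows "(\<Oplus>\<^bsub>free_module k X\<^esub>y\<in>Y. F y) z = (\<Oplus>\<^bsub>k\<^esub>y\<in>Y. F y z)"
proof -
  interpret cring k by fact
  interpret F: module k "free_module k X" by (rule module_free) (rule assms)
  show ?thesis using assms(2,3)
    by (induction Y rule: finite_induct) (simp_all add: Pi_iff free_module_carrier)
qed

lemma free_module_decompose:
  assumes "cring k" "f \<in> carrier (free_module k X)"
  shows "f = (\<Oplus>\<^bsub>free_module k X\<^esub>x\<in>{x. f x \<noteq> \<zero>\<^bsub>k\<^esub>}. f x \<odot>\<^bsub>free_module k X\<^esub> free_gen k x)"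
proof
  interpret cring k by fact
  interpret F: module k "free_module k X" by (rule module_free) (rule assms)
  fix z
  let ?Y = "{x. f x \<noteq> \<zero>\<^bsub>k\<^esub>}"
  have fin: "finite ?Y" and fc: "\<And>x. f x \<in> carrier k" using assms by (auto simp: free_module_carrier)
  have cl: "f y \<odot>\<^bsub>free_module k X\<^esub> free_gen k y \<in> carrier (free_module k X)" if "y \<in> ?Y" for y
    using that assms by (intro F.smult_closed free_gen_closed) (auto simp: free_module_carrier)
  have "(\<Oplus>\<^bsub>free_module k X\<^esub>x\<in>?Y. f x \<odot>\<^bsub>free_module k X\<^esub> free_gen k x) z = (\<Oplus>\<^bsub>k\<^esub>y\<in>?Y. f y \<otimes>\<^bsub>k\<^esub> free_gen k y z)"
    by (subst free_module_finsum_apply[OF assms(1) fin cl]) auto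
  also have "\<dots> = (\<Oplus>\<^bsub>k\<^esub>y\<in>?Y. if z = y then f y else \<zero>\<^bsub>k\<^esub>)"
    by (rule finsum_cong') (auto simp: free_gen_def fc)
  also have "\<dots> = f z"
  proof (cases "z \<in> ?Y")
    case True then show ?thesis using finsum_singleton[OF True fin] fc by auto
  next
    case False
    then have "(\<Oplus>\<^bsub>k\<^esub>y\<in>?Y. if z = y then f y else \<zero>\<^bsub>k\<^esub>) = \<zero>\<^bsub>k\<^esub>"
      by (intro add.finprod_one_eqI) auto
    then show ?thesis using False by simp
  qed
  finally show "f z = (\<Oplus>\<^bsub>free_module k X\<^esub>x\<in>?Y. f x \<odot>\<^bsub>free_module k X\<^esub> free_gen k x) z" by simp
qed

lemma free_lin_unique:
  assumes "module k N" "h \<in> lin k (free_module k X) N" "f \<in> carrier (free_module k X)"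
  shows "h f = free_lift k N (\<lambda>x. h (free_gen k x)) f"
proof -
  interpret N: module k N by fact
  have F: "module k (free_module k X)" by (rule module_free) (rule N.R.is_cring)
  then interpret F: module k "free_module k X" .
  have cl: "free_gen k y \<in> carrier (free_module k X)" if "f y \<noteq> \<zero>\<^bsub>k\<^esub>" for y
    using that assms by (intro free_gen_closed N.R.is_cring) (auto simp: free_module_carrier)
  have "h f = h (\<Oplus>\<^bsub>free_module k X\<^esub>x\<in>{x. f x \<noteq> \<zero>\<^bsub>k\<^esub>}. f x \<odot>\<^bsub>free_module k X\<^esub> free_gen k x)"
    using free_module_decompose[OF N.R.is_cring assms(3)] by simp
  also have "\<dots> = (\<Oplus>\<^bsub>N\<^esub>x\<in>{x. f x \<noteq> \<zero>\<^bsub>k\<^esub>}. h (f x \<odot>\<^bsub>free_module k X\<^esub> free_gen k x))"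
    using cl assms(3) by (intro lin_finsum[OF F assms(1,2)] F.smult_closed) (auto simp: free_module_carrier)
  also have "\<dots> = (\<Oplus>\<^bsub>N\<^esub>x\<in>{x. f x \<noteq> \<zero>\<^bsub>k\<^esub>}. f x \<odot>\<^bsub>N\<^esub> h (free_gen k x))"
    using cl assms(3)
    by (intro finsum_congI[OF assms(1)] lin_smult[OF assms(2)] N.smult_closed lin_closed[OF assms(2)])
      (auto simp: free_module_carrier)
  finally show ?thesis by (simp add: free_lift_def)
qed

section \<open>Quotients by submodules\<close>

lemma quotient_module_simps [simp]:
  "carrier (quotient_module M H) = a_rcosets\<^bsub>M\<^esub> H"
  "\<zero>\<^bsub>quotient_module M H\<^esub> = H"
  "U \<oplus>\<^bsub>quotient_module M H\<^esub> V = U <+>\<^bsub>M\<^esub> V"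
  "r \<odot>\<^bsub>quotient_module M H\<^esub> U = (\<Union>x\<in>U. H +>\<^bsub>M\<^esub> (r \<odot>\<^bsub>M\<^esub> x))"
  by (simp_all add: quotient_module_def)

lemma submodule_abelian_subgroup:
  assumes "module k M" "submodule H k M"
  shows "abelian_subgroup H M"
  by (rule abelian_subgroupI3)
    (use assms in \<open>auto simp: additive_subgroup_def submodule_def module_def\<close>)

lemma a_rcosetsE:
  assumes "U \<in> a_rcosets\<^bsub>M\<^esub> H"
  obtains x where "x \<in> carrier M" "U = H +>\<^bsub>M\<^esub> x"
  using assms by (auto simp: A_RCOSETS_def' )

text \<open>The cosets in the defining union are all equal, since \<open>r\<close> maps
  \<open>H\<close> into itself, and the union is not empty, since \<open>x\<close> lies in its own
  coset.\<close>

lemma quotient_smult_coset: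
  assumes "module k M" "submodule H k M" "r \<in> carrier k" "x \<in> carrier M"
  shows "r \<odot>\<^bsub>quotient_module M H\<^esub> (H +>\<^bsub>M\<^esub> x) = H +>\<^bsub>M\<^esub> (r \<odot>\<^bsub>M\<^esub> x)"
proof -
  interpret M: module k M by fact
  interpret H: abelian_subgroup H M by (rule submodule_abelian_subgroup[OF assms(1,2)])
  have eq: "H +>\<^bsub>M\<^esub> (r \<odot>\<^bsub>M\<^esub> y) = H +>\<^bsub>M\<^esub> (r \<odot>\<^bsub>M\<^esub> x)" if "y \<in> H +>\<^bsub>M\<^esub> x" for y
  proof -
    obtain h where h: "h \<in> H" "y = h \<oplus>\<^bsub>M\<^esub> x" using \<open>y \<in> H +>\<^bsub>M\<^esub> x\<close> by (auto simp: a_r_coset_def')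
    have hc: "h \<in> carrier M" using h by (rule_tac H.a_Hcarr)
    have "r \<odot>\<^bsub>M\<^esub> y = r \<odot>\<^bsub>M\<^esub> h \<oplus>\<^bsub>M\<^esub> r \<odot>\<^bsub>M\<^esub> x" using h hc assms by (simp add: M.smult_r_distr)
    then have "r \<odot>\<^bsub>M\<^esub> y \<in> H +>\<^bsub>M\<^esub> (r \<odot>\<^bsub>M\<^esub> x)"
      using submodule_smult[OF assms(2,3) h(1)] by (auto simp: a_r_coset_def')
    then show ?thesis using H.a_repr_independence' assms by (metis M.smult_closed)
  qed
  have "x \<in> H +>\<^bsub>M\<^esub> x" using assms by (rule_tac H.a_rcos_self)
  then have ne: "H +>\<^bsub>M\<^esub> x \<noteq> {}" by blast
  have "(\<Union>y\<in>H +>\<^bsub>M\<^esub> x. H +>\<^bsub>M\<^esub> (r \<odot>\<^bsub>M\<^esub> y)) = (\<Union>y\<in>H +>\<^bsub>M\<^esub> x. H +>\<^bsub>M\<^esub> (r \<odot>\<^bsub>M\<^esub> x))"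
    by (intro SUP_cong refl eq)
  then show ?thesis using ne by simp
qed

text \<open>\<open>lin\<close> does not presuppose that its target is a module. So the projection
  can be called linear first, and the module axioms of the quotient are then transported along
  it.\<close>

lemma coset_lin:
  assumes "module k M" "submodule H k M"
  shows "(\<lambda>x. H +>\<^bsub>M\<^esub> x) \<in> lin k M (quotient_module M H)"
proof -
  interpret M: module k M by fact
  interpret H: abelian_subgroup H M by (rule submodule_abelian_subgroup[OF assms])
  show ?thesis
    by (rule linI)
      (auto simp: H.a_rcos_sum quotient_smult_coset[OF assms] simp del: quotient_module_simps(4)
        intro!: M.a_rcosetsI H.a_subset)
qed

lemma module_quotient:
  fixes k :: "'k ring"
  assumes "module k M" "submodule H k M"
  shows "module k (quotient_module M H)"
proof -
  interpret M: module k M by fact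
  interpret H: abelian_subgroup H M by (rule submodule_abelian_subgroup[OF assms])
  let ?Q = "quotient_module M H"
  note cl = lin_closed[OF coset_lin[OF assms]]
  note ad = lin_add[OF coset_lin[OF assms], symmetric]
  note sm = lin_smult[OF coset_lin[OF assms], symmetric]
  have ab: "abelian_group ?Q"
  proof (rule abelian_groupI)
    fix U V W assume "U \<in> carrier ?Q" "V \<in> carrier ?Q" "W \<in> carrier ?Q"
    then obtain x y z where x: "x \<in> carrier M" "U = H +>\<^bsub>M\<^esub> x" and y: "y \<in> carrier M" "V = H +>\<^bsub>M\<^esub> y"
      and z: "z \<in> carrier M" "W = H +>\<^bsub>M\<^esub> z"
      by (auto elim!: a_rcosetsE)
    show "U \<oplus>\<^bsub>?Q\<^esub> V \<in> carrier ?Q"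
      unfolding x(2) y(2) ad[OF x(1) y(1)] by (rule cl) (use x y in simp)
    show "U \<oplus>\<^bsub>?Q\<^esub> V = V \<oplus>\<^bsub>?Q\<^esub> U"
      unfolding x(2) y(2) using x y by (simp add: ad M.M.a_comm del: quotient_module_simps)
    show "U \<oplus>\<^bsub>?Q\<^esub> V \<oplus>\<^bsub>?Q\<^esub> W = U \<oplus>\<^bsub>?Q\<^esub> (V \<oplus>\<^bsub>?Q\<^esub> W)"
      unfolding x(2) y(2) z(2) using x y z by (simp add: ad M.M.a_assoc del: quotient_module_simps)
  next
    have z: "\<zero>\<^bsub>?Q\<^esub> = H +>\<^bsub>M\<^esub> \<zero>\<^bsub>M\<^esub>"
      using H.a_rcos_const[OF submodule_zero[OF assms(2)]] by simp
    show "\<zero>\<^bsub>?Q\<^esub> \<in> carrier ?Q" unfolding z by (rule cl) simp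
    fix U assume "U \<in> carrier ?Q"
    then obtain x where x: "x \<in> carrier M" "U = H +>\<^bsub>M\<^esub> x" by (auto elim!: a_rcosetsE)
    show "\<zero>\<^bsub>?Q\<^esub> \<oplus>\<^bsub>?Q\<^esub> U = U"
      unfolding z x(2) using x by (simp add: ad del: quotient_module_simps)
    have "(H +>\<^bsub>M\<^esub> (\<ominus>\<^bsub>M\<^esub> x)) \<oplus>\<^bsub>?Q\<^esub> U = \<zero>\<^bsub>?Q\<^esub>"
      unfolding z x(2) using x by (simp add: ad M.M.l_neg del: quotient_module_simps)
    then show "\<exists>V\<in>carrier ?Q. V \<oplus>\<^bsub>?Q\<^esub> U = \<zero>\<^bsub>?Q\<^esub>"
      using cl[of "\<ominus>\<^bsub>M\<^esub> x"] x by blast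
  qed
  show ?thesis
  proof (rule moduleI[OF M.R.is_cring ab])
    fix r s U V
    assume r: "r \<in> carrier k" and s: "s \<in> carrier k" and "U \<in> carrier ?Q" "V \<in> carrier ?Q"
    then obtain x y where x: "x \<in> carrier M" "U = H +>\<^bsub>M\<^esub> x" and y: "y \<in> carrier M" "V = H +>\<^bsub>M\<^esub> y"
      by (auto elim!: a_rcosetsE)
    show "r \<odot>\<^bsub>?Q\<^esub> U \<in> carrier ?Q"
      unfolding x(2) sm[OF r x(1)] by (rule cl) (use r x in simp)
    show "(r \<oplus>\<^bsub>k\<^esub> s) \<odot>\<^bsub>?Q\<^esub> U = r \<odot>\<^bsub>?Q\<^esub> U \<oplus>\<^bsub>?Q\<^esub> s \<odot>\<^bsub>?Q\<^esub> U"
      unfolding x(2) using r s x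
      by (simp add: sm ad M.smult_l_distr del: quotient_module_simps)
    show "(r \<otimes>\<^bsub>k\<^esub> s) \<odot>\<^bsub>?Q\<^esub> U = r \<odot>\<^bsub>?Q\<^esub> (s \<odot>\<^bsub>?Q\<^esub> U)"
      unfolding x(2) using r s x
      by (simp add: sm M.smult_assoc1 del: quotient_module_simps)
    show "r \<odot>\<^bsub>?Q\<^esub> (U \<oplus>\<^bsub>?Q\<^esub> V) = r \<odot>\<^bsub>?Q\<^esub> U \<oplus>\<^bsub>?Q\<^esub> r \<odot>\<^bsub>?Q\<^esub> V"
      unfolding x(2) y(2) using r x y
      by (simp add: sm ad M.smult_r_distr del: quotient_module_simps)
  next
    fix U assume "U \<in> carrier ?Q"
    then obtain x where x: "x \<in> carrier M" "U = H +>\<^bsub>M\<^esub> x" by (auto elim!: a_rcosetsE)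
    show "\<one>\<^bsub>k\<^esub> \<odot>\<^bsub>?Q\<^esub> U = U"
      unfolding x(2) using x by (simp add: sm del: quotient_module_simps)
  qed
qed

text \<open>\<open>h\<close> is constant on a coset of \<open>H\<close>; its image of the coset is a
  singleton, and \<open>the_elem\<close> returns the value at any representative.\<close>

lemma coset_lift:
  assumes "module k M" "submodule H k M" "module k N" "h \<in> lin k M N"
    and "\<And>x. x \<in> H \<Longrightarrow> h x = \<zero>\<^bsub>N\<^esub>" "x \<in> carrier M"
  shows "the_elem (h ` (H +>\<^bsub>M\<^esub> x)) = h x"
proof -
  interpret M: module k M by fact
  interpret N: module k N by fact
  interpret H: abelian_subgroup H M by (rule submodule_abelian_subgroup[OF assms(1,2)])
  have "h y = h x" if "y \<in> H +>\<^bsub>M\<^esub> x" for y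
  proof -
    obtain z where z: "z \<in> H" "y = z \<oplus>\<^bsub>M\<^esub> x" using \<open>y \<in> H +>\<^bsub>M\<^esub> x\<close> by (auto simp: a_r_coset_def')
    have "z \<in> carrier M" using z by (rule_tac H.a_Hcarr)
    then show ?thesis using z assms lin_closed[OF assms(4)] by (simp add: lin_add[OF assms(4)])
  qed
  moreover have "x \<in> H +>\<^bsub>M\<^esub> x" using assms by (rule_tac H.a_rcos_self)
  ultimately have "h ` (H +>\<^bsub>M\<^esub> x) = {h x}" by blast
  then show ?thesis by simp
qed

section \<open>Universal property of generators and relations\<close>

lemma module_presented:
  assumes "cring k" "R \<subseteq> carrier (free_module k X)"
  shows "module k (presented k X R)"
  unfolding presented_def
  by (intro module_quotient span_of_submodule module_free assms)

lemma presented_gen_closed: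
  assumes "cring k" "R \<subseteq> carrier (free_module k X)" "x \<in> X"
  shows "presented_gen k X R x \<in> carrier (presented k X R)"
  unfolding presented_def presented_gen_def
  using lin_closed[OF coset_lin[OF module_free[OF assms(1)] span_of_submodule[OF module_free assms(2)]]
      free_gen_closed[OF assms(1,3)]] assms by blast

text \<open>The projection to the quotient is linear and sends each generator to its class, so it is
  the linear extension of \<open>presented_gen\<close>. Relators lie in the submodule that is
  divided out.\<close>

lemma presented_relator:
  assumes "cring k" "R \<subseteq> carrier (free_module k X)" "\<rho> \<in> R"
  shows "free_lift k (presented k X R) (presented_gen k X R) \<rho> = \<zero>\<^bsub>presented k X R\<^esub>"
proof -
  let ?F = "free_module k X" and ?H = "span_of k (free_module k X) R"
  have F: "module k ?F" by (rule module_free[OF assms(1)])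
  have H: "submodule ?H k ?F" by (rule span_of_submodule[OF F assms(2)])
  interpret F: module k ?F by (rule F)
  interpret H: abelian_subgroup ?H ?F by (rule submodule_abelian_subgroup[OF F H])
  have "\<rho> \<in> ?H" using assms(3) by (rule span_of_gen)
  then have "?H +>\<^bsub>?F\<^esub> \<rho> = ?H" by (rule H.a_rcos_const)
  moreover have "?H +>\<^bsub>?F\<^esub> \<rho> = free_lift k (presented k X R) (presented_gen k X R) \<rho>"
    using free_lin_unique[OF module_presented[OF assms(1,2)] coset_lin[OF F H, folded presented_def] ]
      assms by (auto simp: presented_gen_def[abs_def])
  ultimately show ?thesis by (simp add: presented_def)
qed

text \<open>Existence half of the universal property; \<open>presented_eqI\<close> is the uniqueness
  half. Vanishing on the relators passes to their span, and that is what makes the extension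
  constant on cosets.\<close>

lemma presented_ext:
  assumes "module k N" "R \<subseteq> carrier (free_module k X)" "\<phi> \<in> X \<rightarrow> carrier N"
    and "\<And>\<rho>. \<rho> \<in> R \<Longrightarrow> free_lift k N \<phi> \<rho> = \<zero>\<^bsub>N\<^esub>"
  shows presented_ext_lin: "linear_ext k N \<phi> \<in> lin k (presented k X R) N"
    and presented_ext_gen: "x \<in> X \<Longrightarrow> linear_ext k N \<phi> (presented_gen k X R x) = \<phi> x"
proof -
  let ?F = "free_module k X" and ?H = "span_of k (free_module k X) R" and ?h = "free_lift k N \<phi>"
  have k: "cring k" by (rule module_cring[OF assms(1)])
  have F: "module k ?F" by (rule module_free[OF k])
  have H: "submodule ?H k ?F" by (rule span_of_submodule[OF F assms(2)])
  interpret F: module k ?F by (rule F)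
  have h: "?h \<in> lin k ?F N" by (rule free_lift_lin[OF assms(1,3)])
  have van: "?h f = \<zero>\<^bsub>N\<^esub>" if "f \<in> ?H" for f
    using lin_span[OF F assms(1) h submodule_zero_set[OF assms(1)] assms(2) _ that] assms(4) by auto
  have val: "linear_ext k N \<phi> (?H +>\<^bsub>?F\<^esub> f) = ?h f" if "f \<in> carrier ?F" for f
    unfolding linear_ext_def using coset_lift[OF F H assms(1) h van that]
    by (simp add: free_lift_def[abs_def])
  note q = coset_lin[OF F H]
  show "linear_ext k N \<phi> \<in> lin k (presented k X R) N"
    unfolding presented_def
  proof (rule linI)
    fix U assume "U \<in> carrier (quotient_module ?F ?H)"
    then obtain f where f: "f \<in> carrier ?F" "U = ?H +>\<^bsub>?F\<^esub> f" by (auto elim!: a_rcosetsE)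
    show "linear_ext k N \<phi> U \<in> carrier N" using f val lin_closed[OF h] by simp
    { fix r assume r: "r \<in> carrier k"
      have "r \<odot>\<^bsub>quotient_module ?F ?H\<^esub> U = ?H +>\<^bsub>?F\<^esub> (r \<odot>\<^bsub>?F\<^esub> f)"
        using f r lin_smult[OF q] by simp
      then show "linear_ext k N \<phi> (r \<odot>\<^bsub>quotient_module ?F ?H\<^esub> U) = r \<odot>\<^bsub>N\<^esub> linear_ext k N \<phi> U"
        using f r val[of "r \<odot>\<^bsub>?F\<^esub> f"] val[of f] lin_smult[OF h, of r f] F.smult_closed[of r f] by simp }
    fix V assume "V \<in> carrier (quotient_module ?F ?H)"
    then obtain g where g: "g \<in> carrier ?F" "V = ?H +>\<^bsub>?F\<^esub> g" by (auto elim!: a_rcosetsE)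
    have "U \<oplus>\<^bsub>quotient_module ?F ?H\<^esub> V = ?H +>\<^bsub>?F\<^esub> (f \<oplus>\<^bsub>?F\<^esub> g)"
      using f g lin_add[OF q] by simp
    then show "linear_ext k N \<phi> (U \<oplus>\<^bsub>quotient_module ?F ?H\<^esub> V) = linear_ext k N \<phi> U \<oplus>\<^bsub>N\<^esub> linear_ext k N \<phi> V"
      using f g val[of "f \<oplus>\<^bsub>?F\<^esub> g"] val[of f] val[of g] lin_add[OF h, of f g] F.M.a_closed[of f g] by simp
  qed
  show "linear_ext k N \<phi> (presented_gen k X R x) = \<phi> x" if "x \<in> X"
    unfolding presented_gen_def
    using val[OF free_gen_closed[OF k that]] free_lift_gen[OF assms(1), of \<phi> x] that assms(3) by auto
qed

lemma presented_eqI: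
  assumes "module k N" "R \<subseteq> carrier (free_module k X)"
    and "f \<in> lin k (presented k X R) N" "g \<in> lin k (presented k X R) N"
    and "\<And>x. x \<in> X \<Longrightarrow> f (presented_gen k X R x) = g (presented_gen k X R x)"
    and "u \<in> carrier (presented k X R)"
  shows "f u = g u"
proof -
  let ?F = "free_module k X" and ?H = "span_of k (free_module k X) R"
  have k: "cring k" by (rule module_cring[OF assms(1)])
  have F: "module k ?F" by (rule module_free[OF k])
  have H: "submodule ?H k ?F" by (rule span_of_submodule[OF F assms(2)])
  note q = coset_lin[OF F H, folded presented_def]
  obtain v where v: "v \<in> carrier ?F" "u = ?H +>\<^bsub>?F\<^esub> v"
    using assms(6) by (auto simp: presented_def elim!: a_rcosetsE)
  have "f (?H +>\<^bsub>?F\<^esub> v) = free_lift k N (\<lambda>x. f (?H +>\<^bsub>?F\<^esub> free_gen k x)) v"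
    using free_lin_unique[OF assms(1) lin_comp[OF q assms(3)] v(1)] .
  also have "\<dots> = free_lift k N (\<lambda>x. g (?H +>\<^bsub>?F\<^esub> free_gen k x)) v"
    unfolding free_lift_def
  proof (rule finsum_congI[OF assms(1)])
    fix x assume x: "x \<in> {x. v x \<noteq> \<zero>\<^bsub>k\<^esub>}"
    then have X: "x \<in> X" "v x \<in> carrier k" using v by (auto simp: free_module_carrier)
    show "v x \<odot>\<^bsub>N\<^esub> f (?H +>\<^bsub>?F\<^esub> free_gen k x) = v x \<odot>\<^bsub>N\<^esub> g (?H +>\<^bsub>?F\<^esub> free_gen k x)"
      using assms(5)[OF X(1)] by (simp add: presented_gen_def)
    show "v x \<odot>\<^bsub>N\<^esub> g (?H +>\<^bsub>?F\<^esub> free_gen k x) \<in> carrier N"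
      using X by (intro module.smult_closed[OF assms(1)] lin_closed[OF assms(4)] lin_closed[OF q] free_gen_closed k)
  qed
  also have "\<dots> = g (?H +>\<^bsub>?F\<^esub> v)"
    using free_lin_unique[OF assms(1) lin_comp[OF q assms(4)] v(1)] by simp
  finally show ?thesis using v by simp
qed

section \<open>Bilinear maps and tensor products\<close>

definition bilin ::
  "'k ring \<Rightarrow> ('k, 'm, 'x) module_scheme \<Rightarrow> ('k, 'n, 'y) module_scheme \<Rightarrow> ('k, 'p, 'z) module_scheme
    \<Rightarrow> ('m \<Rightarrow> 'n \<Rightarrow> 'p) \<Rightarrow> bool" where
  "bilin k M N P \<beta> \<longleftrightarrow>
     (\<forall>x\<in>carrier M. \<beta> x \<in> lin k N P) \<and> (\<forall>y\<in>carrier N. (\<lambda>x. \<beta> x y) \<in> lin k M P)"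

lemma bilinI:
  assumes "\<And>x. x \<in> carrier M \<Longrightarrow> (\<lambda>y. \<beta> x y) \<in> lin k N P"
    and "\<And>y. y \<in> carrier N \<Longrightarrow> (\<lambda>x. \<beta> x y) \<in> lin k M P"
  shows "bilin k M N P \<beta>"
  using assms by (simp add: bilin_def)

lemma bilin_right: "bilin k M N P \<beta> \<Longrightarrow> x \<in> carrier M \<Longrightarrow> \<beta> x \<in> lin k N P"
  by (simp add: bilin_def)

lemma bilin_left: "bilin k M N P \<beta> \<Longrightarrow> y \<in> carrier N \<Longrightarrow> (\<lambda>x. \<beta> x y) \<in> lin k M P"
  by (simp add: bilin_def)

lemma bilin_closed: "bilin k M N P \<beta> \<Longrightarrow> x \<in> carrier M \<Longrightarrow> y \<in> carrier N \<Longrightarrow> \<beta> x y \<in> carrier P"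
  by (auto simp: bilin_def dest: lin_closed)

lemma bilin_comp:
  assumes "bilin k M N P \<beta>" "f \<in> lin k M' M" "g \<in> lin k N' N" "h \<in> lin k P P'"
  shows "bilin k M' N' P' (\<lambda>x y. h (\<beta> (f x) (g y)))"
proof (rule bilinI)
  fix x assume "x \<in> carrier M'"
  show "(\<lambda>y. h (\<beta> (f x) (g y))) \<in> lin k N' P'"
    by (rule lin_comp[OF lin_comp[OF assms(3) bilin_right[OF assms(1) lin_closed[OF assms(2)]]] assms(4)]) fact
next
  fix y assume "y \<in> carrier N'"
  show "(\<lambda>x. h (\<beta> (f x) (g y))) \<in> lin k M' P'"
    by (rule lin_comp[OF lin_comp[OF assms(2) bilin_left[OF assms(1) lin_closed[OF assms(3)]]] assms(4)]) fact
qed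

lemma bilin_addf:
  assumes "module k P" "bilin k M N P \<beta>" "bilin k M N P \<gamma>"
  shows "bilin k M N P (\<lambda>x y. \<beta> x y \<oplus>\<^bsub>P\<^esub> \<gamma> x y)"
  using assms by (simp add: bilin_def lin_addf)

lemma bilin_signedf:
  assumes "module k P" "bilin k M N P \<beta>"
  shows "bilin k M N P (\<lambda>x y. signed P i (\<beta> x y))"
  using assms by (simp add: bilin_def lin_signedf)

lemma bilin_finsumf:
  assumes "module k P" "\<And>i. i \<in> I \<Longrightarrow> bilin k M N P (\<beta> i)"
  shows "bilin k M N P (\<lambda>x y. \<Oplus>\<^bsub>P\<^esub>i\<in>I. \<beta> i x y)"
  using assms by (simp add: bilin_def lin_finsumf)

lemma lift_difference:
  assumes "module k M" "module k N" "h \<in> lin k M N" "x \<in> carrier M" "y \<in> carrier M" "h x = h y"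
  shows "h (x \<ominus>\<^bsub>M\<^esub> y) = \<zero>\<^bsub>N\<^esub>"
proof -
  interpret N: module k N by fact
  show ?thesis
    using lin_closed[OF assms(3,5)] lin_minus[OF assms(1-5)] assms(6) by (simp add: a_minus_def N.M.r_neg)
qed

lemma eq_of_lift_difference:
  assumes "module k M" "module k N" "h \<in> lin k M N" "x \<in> carrier M" "y \<in> carrier M"
    and "h (x \<ominus>\<^bsub>M\<^esub> y) = \<zero>\<^bsub>N\<^esub>"
  shows "h x = h y"
proof -
  interpret N: module k N by fact
  show ?thesis
    using lin_closed[OF assms(3,5)] lin_closed[OF assms(3,4)] assms(6) lin_minus[OF assms(1-5)]
      N.M.minus_equality[of "h x" "\<ominus>\<^bsub>N\<^esub> h y"] by (simp add: a_minus_def)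
qed

lemma tensor_rels_iff:
  "\<rho> \<in> tensor_rels k M N \<longleftrightarrow>
    (let F = free_module k (carrier M \<times> carrier N); e = (\<lambda>x y. free_gen k (x, y)) in
     (\<exists>x x' y. x \<in> carrier M \<and> x' \<in> carrier M \<and> y \<in> carrier N \<and>
       \<rho> = e (x \<oplus>\<^bsub>M\<^esub> x') y \<ominus>\<^bsub>F\<^esub> (e x y \<oplus>\<^bsub>F\<^esub> e x' y)) \<or>
     (\<exists>x y y'. x \<in> carrier M \<and> y \<in> carrier N \<and> y' \<in> carrier N \<and>
       \<rho> = e x (y \<oplus>\<^bsub>N\<^esub> y') \<ominus>\<^bsub>F\<^esub> (e x y \<oplus>\<^bsub>F\<^esub> e x y')) \<or>
     (\<exists>r x y. r \<in> carrier k \<and> x \<in> carrier M \<and> y \<in> carrier N \<and>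
       \<rho> = e (r \<odot>\<^bsub>M\<^esub> x) y \<ominus>\<^bsub>F\<^esub> (r \<odot>\<^bsub>F\<^esub> e x y)) \<or>
     (\<exists>r x y. r \<in> carrier k \<and> x \<in> carrier M \<and> y \<in> carrier N \<and>
       \<rho> = e x (r \<odot>\<^bsub>N\<^esub> y) \<ominus>\<^bsub>F\<^esub> (r \<odot>\<^bsub>F\<^esub> e x y)))"
  unfolding tensor_rels_def Let_def by (simp only: Un_iff mem_Collect_eq) blast

locale two_modules = M: module k M + N: module k N
  for k :: "'k ring" and M :: "('k, 'm, 'x) module_scheme" and N :: "('k, 'n, 'y) module_scheme"
begin

abbreviation "F \<equiv> free_module k (carrier M \<times> carrier N)"

lemma F_module: "module k F"
  by (rule module_free) (rule M.R.is_cring)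

lemma e_closed: "x \<in> carrier M \<Longrightarrow> y \<in> carrier N \<Longrightarrow> free_gen k (x, y) \<in> carrier F"
  by (rule free_gen_closed) (simp_all add: M.R.is_cring)

lemma rels_subset: "tensor_rels k M N \<subseteq> carrier F"
proof
  interpret F: module k F by (rule F_module)
  fix \<rho> assume "\<rho> \<in> tensor_rels k M N"
  then show "\<rho> \<in> carrier F"
    unfolding tensor_rels_iff Let_def
    by (elim disjE exE conjE) (auto intro!: F.M.minus_closed F.M.a_closed F.smult_closed e_closed
        simp del: free_module_simps)
qed

lemma mem_tensor_rels:
  "x \<in> carrier M \<Longrightarrow> x' \<in> carrier M \<Longrightarrow> y \<in> carrier N \<Longrightarrow>
     free_gen k (x \<oplus>\<^bsub>M\<^esub> x', y) \<ominus>\<^bsub>F\<^esub> (free_gen k (x, y) \<oplus>\<^bsub>F\<^esub> free_gen k (x', y)) \<in> tensor_rels k M N"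
  "x \<in> carrier M \<Longrightarrow> y \<in> carrier N \<Longrightarrow> y' \<in> carrier N \<Longrightarrow>
     free_gen k (x, y \<oplus>\<^bsub>N\<^esub> y') \<ominus>\<^bsub>F\<^esub> (free_gen k (x, y) \<oplus>\<^bsub>F\<^esub> free_gen k (x, y')) \<in> tensor_rels k M N"
  "r \<in> carrier k \<Longrightarrow> x \<in> carrier M \<Longrightarrow> y \<in> carrier N \<Longrightarrow>
     free_gen k (r \<odot>\<^bsub>M\<^esub> x, y) \<ominus>\<^bsub>F\<^esub> (r \<odot>\<^bsub>F\<^esub> free_gen k (x, y)) \<in> tensor_rels k M N"
  "r \<in> carrier k \<Longrightarrow> x \<in> carrier M \<Longrightarrow> y \<in> carrier N \<Longrightarrow>
     free_gen k (x, r \<odot>\<^bsub>N\<^esub> y) \<ominus>\<^bsub>F\<^esub> (r \<odot>\<^bsub>F\<^esub> free_gen k (x, y)) \<in> tensor_rels k M N"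
  unfolding tensor_rels_def Let_def
     apply (rule UnI1, rule UnI1, rule UnI1, rule CollectI, intro exI conjI, rule refl, assumption+)
    apply (rule UnI1, rule UnI1, rule UnI2, rule CollectI, intro exI conjI, rule refl, assumption+)
   apply (rule UnI1, rule UnI2, rule CollectI, intro exI conjI, rule refl, assumption+)
  apply (rule UnI2, rule CollectI, intro exI conjI, rule refl, assumption+)
  done

text \<open>One equivalence for two purposes. Read from left to right for the projection to the
  quotient it gives the bilinearity of \<open>tensor\<close>; read from right to left for the
  extension of a bilinear map it gives the universal property.\<close>

lemma tensor_rels_lift_iff:
  assumes "module k P" "h \<in> lin k F P"
  shows "(\<forall>\<rho>\<in>tensor_rels k M N. h \<rho> = \<zero>\<^bsub>P\<^esub>) \<longleftrightarrow>
     bilin k M N P (\<lambda>x y. h (free_gen k (x, y)))"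
proof -
  interpret P: module k P by fact
  interpret F: module k F by (rule F_module)
  let ?e = "\<lambda>x y. free_gen k (x, y)"
  note dif = lift_difference[OF F_module assms] and fid = eq_of_lift_difference[OF F_module assms]
  note cl = e_closed F.M.a_closed F.smult_closed M.M.a_closed N.M.a_closed M.smult_closed N.smult_closed
  note h = lin_add[OF assms(2)] lin_smult[OF assms(2)] lin_closed[OF assms(2)]
  note [simp del] = free_module_simps
  note mem = mem_tensor_rels
  show ?thesis
  proof
    assume van: "\<forall>\<rho>\<in>tensor_rels k M N. h \<rho> = \<zero>\<^bsub>P\<^esub>"
    have 1: "h (?e (x \<oplus>\<^bsub>M\<^esub> x') y) = h (?e x y \<oplus>\<^bsub>F\<^esub> ?e x' y)"
      if "x \<in> carrier M" "x' \<in> carrier M" "y \<in> carrier N" for x x' y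
      by (rule fid) (use that in \<open>auto intro!: cl van[rule_format] mem\<close>)
    have 2: "h (?e x (y \<oplus>\<^bsub>N\<^esub> y')) = h (?e x y \<oplus>\<^bsub>F\<^esub> ?e x y')"
      if "x \<in> carrier M" "y' \<in> carrier N" "y \<in> carrier N" for x y y'
      by (rule fid) (use that in \<open>auto intro!: cl van[rule_format] mem\<close>)
    have 3: "h (?e (r \<odot>\<^bsub>M\<^esub> x) y) = h (r \<odot>\<^bsub>F\<^esub> ?e x y)"
      if "r \<in> carrier k" "x \<in> carrier M" "y \<in> carrier N" for r x y
      by (rule fid) (use that in \<open>auto intro!: cl van[rule_format] mem\<close>)
    have 4: "h (?e x (r \<odot>\<^bsub>N\<^esub> y)) = h (r \<odot>\<^bsub>F\<^esub> ?e x y)"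
      if "r \<in> carrier k" "x \<in> carrier M" "y \<in> carrier N" for r x y
      by (rule fid) (use that in \<open>auto intro!: cl van[rule_format] mem\<close>)
    show "bilin k M N P (\<lambda>x y. h (?e x y))"
      by (intro bilinI linI) (simp_all add: 1 2 3 4 h cl)
  next
    assume b: "bilin k M N P (\<lambda>x y. h (?e x y))"
    note b1 = lin_add[OF bilin_left[OF b]] lin_smult[OF bilin_left[OF b]]
      lin_add[OF bilin_right[OF b]] lin_smult[OF bilin_right[OF b]]
    show "\<forall>\<rho>\<in>tensor_rels k M N. h \<rho> = \<zero>\<^bsub>P\<^esub>"
    proof
      fix \<rho> assume "\<rho> \<in> tensor_rels k M N"
      then show "h \<rho> = \<zero>\<^bsub>P\<^esub>"
        unfolding tensor_rels_iff Let_def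
        by (elim disjE exE conjE; elim ssubst; intro dif; simp add: b1 h cl)
    qed
  qed
qed

lemma module_tensor: "module k (tensor_module k M N)"
  unfolding tensor_module_def by (intro module_presented rels_subset M.R.is_cring)

lemma tensor_bilin: "bilin k M N (tensor_module k M N) (tensor k M N)"
proof -
  let ?T = "tensor_module k M N"
  let ?\<phi> = "presented_gen k (carrier M \<times> carrier N) (tensor_rels k M N)"
  have cl: "?\<phi> \<in> carrier M \<times> carrier N \<rightarrow> carrier ?T"
    unfolding tensor_module_def by (auto intro!: presented_gen_closed M.R.is_cring rels_subset)
  have "\<forall>\<rho>\<in>tensor_rels k M N. free_lift k ?T ?\<phi> \<rho> = \<zero>\<^bsub>?T\<^esub>"
    unfolding tensor_module_def by (intro ballI presented_relator M.R.is_cring rels_subset)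
  then have b: "bilin k M N ?T (\<lambda>x y. free_lift k ?T ?\<phi> (free_gen k (x, y)))"
    by (subst (asm) tensor_rels_lift_iff[OF module_tensor free_lift_lin[OF module_tensor cl]])
  have eq: "free_lift k ?T ?\<phi> (free_gen k (x, y)) = tensor k M N x y"
    if "x \<in> carrier M" "y \<in> carrier N" for x y
    unfolding tensor_def by (rule free_lift_gen[OF module_tensor]) (use cl that in auto)
  show ?thesis
  proof (rule bilinI)
    show "(\<lambda>y. tensor k M N x y) \<in> lin k N ?T" if "x \<in> carrier M" for x
      by (rule lin_cong[OF bilin_right[OF b that] N.module_axioms]) (simp add: eq that)
    show "(\<lambda>x. tensor k M N x y) \<in> lin k M ?T" if "y \<in> carrier N" for y
      by (rule lin_cong[OF bilin_left[OF b that] M.module_axioms]) (simp add: eq that)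
  qed
qed

lemma tensor_ext:
  assumes "module k P" "bilin k M N P \<beta>"
  shows tensor_ext_lin: "linear_ext k P (\<lambda>(x, y). \<beta> x y) \<in> lin k (tensor_module k M N) P"
    and tensor_ext_tensor: "x \<in> carrier M \<Longrightarrow> y \<in> carrier N \<Longrightarrow>
      linear_ext k P (\<lambda>(x, y). \<beta> x y) (tensor k M N x y) = \<beta> x y"
proof -
  let ?\<phi> = "\<lambda>(x, y). \<beta> x y"
  have cl: "?\<phi> \<in> carrier M \<times> carrier N \<rightarrow> carrier P"
    using bilin_closed[OF assms(2)] by auto
  have eq: "free_lift k P ?\<phi> (free_gen k (x, y)) = \<beta> x y"
    if "x \<in> carrier M" "y \<in> carrier N" for x y
    using free_lift_gen[OF assms(1), of ?\<phi> "(x, y)"] bilin_closed[OF assms(2) that] by simp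
  have "bilin k M N P (\<lambda>x y. free_lift k P ?\<phi> (free_gen k (x, y)))"
  proof (rule bilinI)
    show "(\<lambda>y. free_lift k P ?\<phi> (free_gen k (x, y))) \<in> lin k N P" if "x \<in> carrier M" for x
      by (rule lin_cong[OF bilin_right[OF assms(2) that] N.module_axioms]) (simp add: eq that)
    show "(\<lambda>x. free_lift k P ?\<phi> (free_gen k (x, y))) \<in> lin k M P" if "y \<in> carrier N" for y
      by (rule lin_cong[OF bilin_left[OF assms(2) that] M.module_axioms]) (simp add: eq that)
  qed
  then have van: "free_lift k P ?\<phi> \<rho> = \<zero>\<^bsub>P\<^esub>" if "\<rho> \<in> tensor_rels k M N" for \<rho>
    using tensor_rels_lift_iff[OF assms(1) free_lift_lin[OF assms(1) cl]] that by blast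
  show "linear_ext k P ?\<phi> \<in> lin k (tensor_module k M N) P"
    unfolding tensor_module_def by (rule presented_ext_lin[OF assms(1) rels_subset cl van])
  show "linear_ext k P ?\<phi> (tensor k M N x y) = \<beta> x y" if "x \<in> carrier M" "y \<in> carrier N"
    unfolding tensor_def using presented_ext_gen[OF assms(1) rels_subset cl van, of "(x, y)"] that by simp
qed

lemma tensor_eqI:
  assumes "module k P" "f \<in> lin k (tensor_module k M N) P" "g \<in> lin k (tensor_module k M N) P"
    and "\<And>x y. x \<in> carrier M \<Longrightarrow> y \<in> carrier N \<Longrightarrow> f (tensor k M N x y) = g (tensor k M N x y)"
    and "u \<in> carrier (tensor_module k M N)"
  shows "f u = g u"
  by (rule presented_eqI[OF assms(1) rels_subset assms(2,3)[unfolded tensor_module_def] _ assms(5)[unfolded tensor_module_def]])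
    (use assms(4) in \<open>auto simp: tensor_def\<close>)

end

lemmas two_modulesI = two_modules.intro
lemmas module_tensor = two_modules.module_tensor[OF two_modulesI]
lemmas tensor_bilin = two_modules.tensor_bilin[OF two_modulesI]
lemmas tensor_ext_lin = two_modules.tensor_ext_lin[OF two_modulesI]
lemmas tensor_ext_tensor = two_modules.tensor_ext_tensor[OF two_modulesI]
lemmas tensor_eqI = two_modules.tensor_eqI[OF two_modulesI]
lemma tensor_map_bilin:
  assumes "module k M'" "module k N'" "f \<in> lin k M M'" "g \<in> lin k N N'"
  shows "bilin k M N (tensor_module k M' N') (\<lambda>x y. tensor k M' N' (f x) (g y))"
  by (rule bilin_comp[OF tensor_bilin[OF assms(1,2)] assms(3,4) lin_ident])

lemma tensor_map_lin:
  assumes "module k M" "module k N" "module k M'" "module k N'" "f \<in> lin k M M'" "g \<in> lin k N N'"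
  shows "tensor_map k M' N' f g \<in> lin k (tensor_module k M N) (tensor_module k M' N')"
  unfolding tensor_map_def
  by (rule tensor_ext_lin[OF assms(1,2) module_tensor[OF assms(3,4)] tensor_map_bilin[OF assms(3-6)]])

lemma tensor_map_tensor:
  assumes "module k M" "module k N" "module k M'" "module k N'" "f \<in> lin k M M'" "g \<in> lin k N N'"
    and "x \<in> carrier M" "y \<in> carrier N"
  shows "tensor_map k M' N' f g (tensor k M N x y) = tensor k M' N' (f x) (g y)"
  unfolding tensor_map_def
  by (rule tensor_ext_tensor[OF assms(1,2) module_tensor[OF assms(3,4)] tensor_map_bilin[OF assms(3-6)] assms(7,8)])

section \<open>Bar modules\<close>

definition bar_gens :: "('k, 'a) module \<Rightarrow> nat \<Rightarrow> 'a list set" where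
  "bar_gens A n = {xs. set xs \<subseteq> carrier A \<and> length xs = Suc n}"

definition abar_rels :: "'k ring \<Rightarrow> ('k, 'a) module \<Rightarrow> nat \<Rightarrow> ('a list \<Rightarrow> 'k) set" where
  "abar_rels k A n =
    (let F = free_module k (bar_gens A n); e = free_gen k in
     {e (us @ [a \<oplus>\<^bsub>A\<^esub> b] @ vs) \<ominus>\<^bsub>F\<^esub> (e (us @ [a] @ vs) \<oplus>\<^bsub>F\<^esub> e (us @ [b] @ vs)) | us a b vs.
        us @ [a] @ vs \<in> bar_gens A n \<and> b \<in> carrier A} \<union>
     {e (us @ [r \<odot>\<^bsub>A\<^esub> a] @ vs) \<ominus>\<^bsub>F\<^esub> (r \<odot>\<^bsub>F\<^esub> e (us @ [a] @ vs)) | us r a vs.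
        us @ [a] @ vs \<in> bar_gens A n \<and> r \<in> carrier k} \<union>
     {e (us @ [r \<odot>\<^bsub>A\<^esub> \<one>\<^bsub>A\<^esub>] @ vs) | us r vs.
        us @ [\<one>\<^bsub>A\<^esub>] @ vs \<in> bar_gens A n \<and> r \<in> carrier k \<and> us \<noteq> [] \<and> vs \<noteq> []})"

text \<open>
  Compared with \<^const>\<open>bar_module\<close> the index is shifted by one, so that the augmentation module,
  a copy of \<open>A\<close>, is included in degree \<open>0\<close>; recursions over the length of the lists then need no
  separate treatment of their two outer entries.
\<close>

definition abar :: "'k ring \<Rightarrow> ('k, 'a) module \<Rightarrow> nat \<Rightarrow> ('k, ('a list \<Rightarrow> 'k) set) module" where
  "abar k A n = presented k (bar_gens A n) (abar_rels k A n)"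

definition abt :: "'k ring \<Rightarrow> ('k, 'a) module \<Rightarrow> nat \<Rightarrow> 'a list \<Rightarrow> ('a list \<Rightarrow> 'k) set" where
  "abt k A n xs = presented_gen k (bar_gens A n) (abar_rels k A n) xs"

lemma bar_lists_eq: "bar_lists A n = bar_gens A (Suc n)"
  by (simp add: bar_lists_def bar_gens_def)

lemma bar_rels_eq: "bar_rels k A n = abar_rels k A (Suc n)"
  by (simp add: bar_rels_def abar_rels_def bar_lists_eq)

lemma bar_module_eq: "bar_module k A n = abar k A (Suc n)"
  by (simp add: bar_module_def abar_def bar_lists_eq bar_rels_eq)

lemma bar_tensor_eq: "bar_tensor k A n xs = abt k A (Suc n) xs"
  by (simp add: bar_tensor_def abt_def bar_lists_eq bar_rels_eq)

text \<open>The relators have multiples \<open>r \<odot> 1\<close> as inner entries. Here only the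
  unit itself appears, and homogeneity yields its multiples.\<close>

definition bar_multilinear ::
  "'k ring \<Rightarrow> ('k, 'a) module \<Rightarrow> nat \<Rightarrow> ('k, 'n, 'z) module_scheme \<Rightarrow> ('a list \<Rightarrow> 'n) \<Rightarrow> bool" where
  "bar_multilinear k A n N \<phi> \<longleftrightarrow>
     (\<forall>xs\<in>bar_gens A n. \<phi> xs \<in> carrier N) \<and>
     (\<forall>us a b vs. us @ [a] @ vs \<in> bar_gens A n \<longrightarrow> b \<in> carrier A \<longrightarrow>
        \<phi> (us @ [a \<oplus>\<^bsub>A\<^esub> b] @ vs) = \<phi> (us @ [a] @ vs) \<oplus>\<^bsub>N\<^esub> \<phi> (us @ [b] @ vs)) \<and>
     (\<forall>us r a vs. us @ [a] @ vs \<in> bar_gens A n \<longrightarrow> r \<in> carrier k \<longrightarrow>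
        \<phi> (us @ [r \<odot>\<^bsub>A\<^esub> a] @ vs) = r \<odot>\<^bsub>N\<^esub> \<phi> (us @ [a] @ vs)) \<and>
     (\<forall>us vs. us @ [\<one>\<^bsub>A\<^esub>] @ vs \<in> bar_gens A n \<longrightarrow> us \<noteq> [] \<longrightarrow> vs \<noteq> [] \<longrightarrow>
        \<phi> (us @ [\<one>\<^bsub>A\<^esub>] @ vs) = \<zero>\<^bsub>N\<^esub>)"

lemma bar_multilinearI:
  assumes "\<And>xs. xs \<in> bar_gens A n \<Longrightarrow> \<phi> xs \<in> carrier N"
    and "\<And>us a b vs. us @ [a] @ vs \<in> bar_gens A n \<Longrightarrow> b \<in> carrier A \<Longrightarrow>
        \<phi> (us @ [a \<oplus>\<^bsub>A\<^esub> b] @ vs) = \<phi> (us @ [a] @ vs) \<oplus>\<^bsub>N\<^esub> \<phi> (us @ [b] @ vs)"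
    and "\<And>us r a vs. us @ [a] @ vs \<in> bar_gens A n \<Longrightarrow> r \<in> carrier k \<Longrightarrow>
        \<phi> (us @ [r \<odot>\<^bsub>A\<^esub> a] @ vs) = r \<odot>\<^bsub>N\<^esub> \<phi> (us @ [a] @ vs)"
    and "\<And>us vs. us @ [\<one>\<^bsub>A\<^esub>] @ vs \<in> bar_gens A n \<Longrightarrow> us \<noteq> [] \<Longrightarrow> vs \<noteq> [] \<Longrightarrow>
        \<phi> (us @ [\<one>\<^bsub>A\<^esub>] @ vs) = \<zero>\<^bsub>N\<^esub>"
  shows "bar_multilinear k A n N \<phi>"
  unfolding bar_multilinear_def using assms by (intro conjI ballI allI impI)

lemma bar_multilinearD:
  assumes "bar_multilinear k A n N \<phi>"
  shows "xs \<in> bar_gens A n \<Longrightarrow> \<phi> xs \<in> carrier N"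
    and "us @ [a] @ vs \<in> bar_gens A n \<Longrightarrow> b \<in> carrier A \<Longrightarrow>
        \<phi> (us @ [a \<oplus>\<^bsub>A\<^esub> b] @ vs) = \<phi> (us @ [a] @ vs) \<oplus>\<^bsub>N\<^esub> \<phi> (us @ [b] @ vs)"
    and "us @ [a] @ vs \<in> bar_gens A n \<Longrightarrow> r \<in> carrier k \<Longrightarrow>
        \<phi> (us @ [r \<odot>\<^bsub>A\<^esub> a] @ vs) = r \<odot>\<^bsub>N\<^esub> \<phi> (us @ [a] @ vs)"
    and "us @ [\<one>\<^bsub>A\<^esub>] @ vs \<in> bar_gens A n \<Longrightarrow> us \<noteq> [] \<Longrightarrow> vs \<noteq> [] \<Longrightarrow>
        \<phi> (us @ [\<one>\<^bsub>A\<^esub>] @ vs) = \<zero>\<^bsub>N\<^esub>"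
  using assms unfolding bar_multilinear_def by blast+

lemma bar_gens_Cons: "a # xs \<in> bar_gens A (Suc n) \<longleftrightarrow> a \<in> carrier A \<and> xs \<in> bar_gens A n"
  by (auto simp: bar_gens_def)

lemma bar_gens_0: "xs \<in> bar_gens A 0 \<longleftrightarrow> (\<exists>a\<in>carrier A. xs = [a])"
  by (auto simp: bar_gens_def length_Suc_conv)

lemma bar_gens_SucE:
  assumes "xs \<in> bar_gens A (Suc n)"
  obtains a ys where "xs = a # ys" "a \<in> carrier A" "ys \<in> bar_gens A n"
  using assms by (cases xs) (auto simp: bar_gens_def)

locale kalg = k_algebra k A for k :: "'k ring" and A :: "('k, 'a) module" (structure)
begin

abbreviation "P \<equiv> abar k A"
abbreviation "bt \<equiv> abt k A"

lemma module_A: "module k A" by (rule module_axioms)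

lemma cring_k: "cring k" by (rule R.is_cring)

lemma bar_gens_insert:
  assumes "us @ [a] @ vs \<in> bar_gens A n"
  shows "a \<in> carrier A" "\<And>b. b \<in> carrier A \<Longrightarrow> us @ [b] @ vs \<in> bar_gens A n"
  using assms by (auto simp: bar_gens_def)

lemma mem_abar_rels:
  defines "F \<equiv> \<lambda>n. free_module k (bar_gens A n)"
  shows "us @ [a] @ vs \<in> bar_gens A n \<Longrightarrow> b \<in> carrier A \<Longrightarrow>
      free_gen k (us @ [a \<oplus> b] @ vs) \<ominus>\<^bsub>F n\<^esub> (free_gen k (us @ [a] @ vs) \<oplus>\<^bsub>F n\<^esub> free_gen k (us @ [b] @ vs))
      \<in> abar_rels k A n"
    and "us @ [a] @ vs \<in> bar_gens A n \<Longrightarrow> r \<in> carrier k \<Longrightarrow>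
      free_gen k (us @ [r \<odot> a] @ vs) \<ominus>\<^bsub>F n\<^esub> (r \<odot>\<^bsub>F n\<^esub> free_gen k (us @ [a] @ vs)) \<in> abar_rels k A n"
    and "us @ [\<one>] @ vs \<in> bar_gens A n \<Longrightarrow> us \<noteq> [] \<Longrightarrow> vs \<noteq> [] \<Longrightarrow>
      free_gen k (us @ [\<one>] @ vs) \<in> abar_rels k A n"
  unfolding abar_rels_def Let_def F_def
    apply (rule UnI1, rule UnI1, rule CollectI, intro exI conjI, rule refl, assumption+)
   apply (rule UnI1, rule UnI2, rule CollectI, intro exI conjI, rule refl, assumption+)
  \<comment> \<open>The relator is formulated for multiples of the unit; the scalar is chosen to be
    1.\<close>
  apply (rule UnI2, rule CollectI, rule exI[of _ us], rule exI[of _ "\<one>\<^bsub>k\<^esub>"], rule exI[of _ vs])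
  apply simp
  done

lemma abar_rels_cases:
  assumes "\<rho> \<in> abar_rels k A n"
  obtains (add) us a b vs where "us @ [a] @ vs \<in> bar_gens A n" "b \<in> carrier A"
      "\<rho> = free_gen k (us @ [a \<oplus> b] @ vs) \<ominus>\<^bsub>free_module k (bar_gens A n)\<^esub>
        (free_gen k (us @ [a] @ vs) \<oplus>\<^bsub>free_module k (bar_gens A n)\<^esub> free_gen k (us @ [b] @ vs))"
  | (smult) us r a vs where "us @ [a] @ vs \<in> bar_gens A n" "r \<in> carrier k"
      "\<rho> = free_gen k (us @ [r \<odot> a] @ vs) \<ominus>\<^bsub>free_module k (bar_gens A n)\<^esub>
        (r \<odot>\<^bsub>free_module k (bar_gens A n)\<^esub> free_gen k (us @ [a] @ vs))"
  | (unit) us r vs where "us @ [\<one>] @ vs \<in> bar_gens A n" "r \<in> carrier k" "us \<noteq> []" "vs \<noteq> []"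
      "\<rho> = free_gen k (us @ [r \<odot> \<one>] @ vs)"
  using assms unfolding abar_rels_def Let_def by (elim UnE CollectE exE conjE)

lemma rels_subset: "abar_rels k A n \<subseteq> carrier (free_module k (bar_gens A n))"
proof
  interpret F: module k "free_module k (bar_gens A n)" by (rule module_free) (rule cring_k)
  note [simp del] = free_module_simps
  note cl = F.M.minus_closed F.M.a_closed F.smult_closed free_gen_closed[OF cring_k]
  fix \<rho> assume "\<rho> \<in> abar_rels k A n"
  then show "\<rho> \<in> carrier (free_module k (bar_gens A n))"
  proof (cases rule: abar_rels_cases)
    case add
    with bar_gens_insert[OF add(1)] show ?thesis by (auto intro!: cl)
  next
    case smult
    with bar_gens_insert[OF smult(1)] show ?thesis by (auto intro!: cl)
  next
    case unit
    with bar_gens_insert[OF unit(1)] show ?thesis by (auto intro!: cl)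
  qed
qed

lemma rels_lift:
  assumes "module k N" "h \<in> lin k (free_module k (bar_gens A n)) N"
    and "bar_multilinear k A n N (\<lambda>xs. h (free_gen k xs))" "\<rho> \<in> abar_rels k A n"
  shows "h \<rho> = \<zero>\<^bsub>N\<^esub>"
proof -
  have F: "module k (free_module k (bar_gens A n))" by (rule module_free) (rule cring_k)
  interpret F: module k "free_module k (bar_gens A n)" by (rule F)
  interpret N: module k N by fact
  note [simp del] = free_module_simps
  note cl = F.M.a_closed F.smult_closed free_gen_closed[OF cring_k]
  note dif = lift_difference[OF F assms(1,2)]
  note D = bar_multilinearD[OF assms(3)]
  show ?thesis using assms(4)
  proof (cases rule: abar_rels_cases)
    case add
    note [simp] = bar_gens_insert[OF add(1), simplified]
    show ?thesis unfolding add(3)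
      by (rule dif) (use add D(2)[OF add(1,2)] in \<open>simp_all add: cl lin_add[OF assms(2)]\<close>)
  next
    case smult
    note [simp] = bar_gens_insert[OF smult(1), simplified]
    show ?thesis unfolding smult(3)
      by (rule dif) (use smult D(3)[OF smult(1,2)] in \<open>simp_all add: cl lin_smult[OF assms(2)]\<close>)
  next
    case unit
    show ?thesis unfolding unit(5) using D(3)[OF unit(1,2)] D(4)[OF unit(1,3,4)] unit(2) by simp
  qed
qed

lemma module_P: "module k (P n)"
  unfolding abar_def by (intro module_presented rels_subset cring_k)

lemma bt_closed: "xs \<in> bar_gens A n \<Longrightarrow> bt n xs \<in> carrier (P n)"
  unfolding abar_def abt_def by (intro presented_gen_closed rels_subset cring_k)

lemma bt_multilinear: "bar_multilinear k A n (P n) (bt n)"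
proof -
  let ?h = "free_lift k (P n) (bt n)" and ?F = "free_module k (bar_gens A n)"
  have F: "module k ?F" by (rule module_free) (rule cring_k)
  interpret F: module k ?F by (rule F)
  note [simp del] = free_module_simps
  note cl = F.M.a_closed F.smult_closed free_gen_closed[OF cring_k]
  have h: "?h \<in> lin k ?F (P n)" by (rule free_lift_lin[OF module_P]) (auto intro: bt_closed)
  have val: "?h (free_gen k xs) = bt n xs" if "xs \<in> bar_gens A n" for xs
    using free_lift_gen[OF module_P, of "bt n" xs] bt_closed[OF that] by blast
  have van: "?h \<rho> = \<zero>\<^bsub>P n\<^esub>" if "\<rho> \<in> abar_rels k A n" for \<rho>
    using presented_relator[OF cring_k rels_subset that] by (simp add: abar_def abt_def[abs_def])
  note fid = eq_of_lift_difference[OF F module_P h]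
  show ?thesis
  proof (rule bar_multilinearI)
    fix us a b vs assume *: "us @ [a] @ vs \<in> bar_gens A n" "b \<in> carrier A"
    note i = bar_gens_insert[OF *(1)]
    have "?h (free_gen k (us @ [a \<oplus> b] @ vs)) = ?h (free_gen k (us @ [a] @ vs) \<oplus>\<^bsub>?F\<^esub> free_gen k (us @ [b] @ vs))"
      using * i by (intro fid cl van mem_abar_rels(1)) auto
    then show "bt n (us @ [a \<oplus> b] @ vs) = bt n (us @ [a] @ vs) \<oplus>\<^bsub>P n\<^esub> bt n (us @ [b] @ vs)"
      using * i by (simp add: lin_add[OF h] cl val del: append_Cons)
  next
    fix us r a vs assume *: "us @ [a] @ vs \<in> bar_gens A n" "r \<in> carrier k"
    note i = bar_gens_insert[OF *(1)]
    have "?h (free_gen k (us @ [r \<odot> a] @ vs)) = ?h (r \<odot>\<^bsub>?F\<^esub> free_gen k (us @ [a] @ vs))"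
      using * i by (intro fid cl van mem_abar_rels(2)) auto
    then show "bt n (us @ [r \<odot> a] @ vs) = r \<odot>\<^bsub>P n\<^esub> bt n (us @ [a] @ vs)"
      using * i by (simp add: lin_smult[OF h] cl val del: append_Cons)
  next
    fix us vs assume *: "us @ [\<one>] @ vs \<in> bar_gens A n" "us \<noteq> []" "vs \<noteq> []"
    show "bt n (us @ [\<one>] @ vs) = \<zero>\<^bsub>P n\<^esub>"
      using van[OF mem_abar_rels(3)[OF *]] val[OF *(1)] by simp
  qed (rule bt_closed)
qed

lemma ext:
  assumes "module k N" "bar_multilinear k A n N \<phi>"
  shows ext_lin: "linear_ext k N \<phi> \<in> lin k (P n) N"
    and ext_bt: "xs \<in> bar_gens A n \<Longrightarrow> linear_ext k N \<phi> (bt n xs) = \<phi> xs"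
proof -
  have cl: "\<phi> \<in> bar_gens A n \<rightarrow> carrier N" using bar_multilinearD(1)[OF assms(2)] by auto
  have val: "free_lift k N \<phi> (free_gen k xs) = \<phi> xs" if "xs \<in> bar_gens A n" for xs
    by (rule free_lift_gen[OF assms(1)]) (use cl that in auto)
  have "bar_multilinear k A n N (\<lambda>xs. free_lift k N \<phi> (free_gen k xs))"
  proof (rule bar_multilinearI)
    fix us a b vs assume *: "us @ [a] @ vs \<in> bar_gens A n" "b \<in> carrier A"
    note i = bar_gens_insert[OF *(1)]
    show "free_lift k N \<phi> (free_gen k (us @ [a \<oplus> b] @ vs)) = free_lift k N \<phi> (free_gen k (us @ [a] @ vs))
        \<oplus>\<^bsub>N\<^esub> free_lift k N \<phi> (free_gen k (us @ [b] @ vs))"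
      using bar_multilinearD(2)[OF assms(2) *] * i by (subst (1 2 3) val) auto
  next
    fix us r a vs assume *: "us @ [a] @ vs \<in> bar_gens A n" "r \<in> carrier k"
    note i = bar_gens_insert[OF *(1)]
    show "free_lift k N \<phi> (free_gen k (us @ [r \<odot> a] @ vs)) = r \<odot>\<^bsub>N\<^esub> free_lift k N \<phi> (free_gen k (us @ [a] @ vs))"
      using bar_multilinearD(3)[OF assms(2) *] * i by (subst (1 2) val) auto
  qed (use bar_multilinearD[OF assms(2)] in \<open>simp_all add: val\<close>)
  note van = rels_lift[OF assms(1) free_lift_lin[OF assms(1) cl] this]
  show "linear_ext k N \<phi> \<in> lin k (P n) N"
    unfolding abar_def by (rule presented_ext_lin[OF assms(1) rels_subset cl van])
  show "linear_ext k N \<phi> (bt n xs) = \<phi> xs" if "xs \<in> bar_gens A n"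
    unfolding abt_def by (rule presented_ext_gen[OF assms(1) rels_subset cl van that])
qed

lemma bt_eqI:
  assumes "module k N" "f \<in> lin k (P n) N" "g \<in> lin k (P n) N"
    and "\<And>xs. xs \<in> bar_gens A n \<Longrightarrow> f (bt n xs) = g (bt n xs)" "u \<in> carrier (P n)"
  shows "f u = g u"
  by (rule presented_eqI[OF assms(1) rels_subset assms(2,3)[unfolded abar_def] _ assms(5)[unfolded abar_def]])
    (use assms(4) in \<open>auto simp: abt_def\<close>)

section \<open>Bars built from the front: recursion and equality principles\<close>

definition bcons :: "nat \<Rightarrow> 'a \<Rightarrow> ('a list \<Rightarrow> 'k) set \<Rightarrow> ('a list \<Rightarrow> 'k) set" where
  "bcons n a = linear_ext k (P (Suc n)) (\<lambda>xs. bt (Suc n) (a # xs))"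

lemma cons_multilinear:
  assumes "a \<in> carrier A"
  shows "bar_multilinear k A n (P (Suc n)) (\<lambda>xs. bt (Suc n) (a # xs))"
proof -
  note D = bar_multilinearD[OF bt_multilinear[of "Suc n"]]
  show ?thesis
  proof (rule bar_multilinearI)
    fix us b c vs assume *: "us @ [b] @ vs \<in> bar_gens A n" "c \<in> carrier A"
    show "bt (Suc n) (a # us @ [b \<oplus> c] @ vs) = bt (Suc n) (a # us @ [b] @ vs) \<oplus>\<^bsub>P (Suc n)\<^esub> bt (Suc n) (a # us @ [c] @ vs)"
      using D(2)[of "a # us" b vs c] * assms by (simp add: bar_gens_Cons)
  next
    fix us r b vs assume *: "us @ [b] @ vs \<in> bar_gens A n" "r \<in> carrier k"
    show "bt (Suc n) (a # us @ [r \<odot> b] @ vs) = r \<odot>\<^bsub>P (Suc n)\<^esub> bt (Suc n) (a # us @ [b] @ vs)"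
      using D(3)[of "a # us" b vs r] * assms by (simp add: bar_gens_Cons)
  next
    fix us vs assume *: "us @ [\<one>] @ vs \<in> bar_gens A n" "us \<noteq> []" "vs \<noteq> []"
    show "bt (Suc n) (a # us @ [\<one>] @ vs) = \<zero>\<^bsub>P (Suc n)\<^esub>"
      using D(4)[of "a # us" vs] * assms by (simp add: bar_gens_Cons)
  qed (use assms in \<open>auto intro!: bt_closed simp: bar_gens_Cons\<close>)
qed

lemma bcons_bt: "a \<in> carrier A \<Longrightarrow> xs \<in> bar_gens A n \<Longrightarrow> bcons n a (bt n xs) = bt (Suc n) (a # xs)"
  unfolding bcons_def by (rule ext_bt[OF module_P cons_multilinear])

lemma bcons_lin: "a \<in> carrier A \<Longrightarrow> bcons n a \<in> lin k (P n) (P (Suc n))"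
  unfolding bcons_def by (rule ext_lin[OF module_P cons_multilinear])

lemma bcons_bilin: "bilin k A (P n) (P (Suc n)) (bcons n)"
proof (rule bilinI)
  fix y assume y: "y \<in> carrier (P n)"
  note D = bar_multilinearD[OF bt_multilinear[of "Suc n"]]
  show "(\<lambda>a. bcons n a y) \<in> lin k A (P (Suc n))"
  proof (rule linI)
    fix a b assume ab: "a \<in> carrier A" "b \<in> carrier A"
    show "bcons n (a \<oplus> b) y = bcons n a y \<oplus>\<^bsub>P (Suc n)\<^esub> bcons n b y"
    proof (rule bt_eqI[OF module_P _ _ _ y])
      show "bcons n (a \<oplus> b) (bt n xs) = bcons n a (bt n xs) \<oplus>\<^bsub>P (Suc n)\<^esub> bcons n b (bt n xs)"
        if "xs \<in> bar_gens A n" for xs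
        using D(2)[of "[]" a xs b] ab that by (simp add: bcons_bt bar_gens_Cons)
    qed (use ab in \<open>auto intro!: lin_addf bcons_lin module_P\<close>)
  next
    fix r a assume ra: "r \<in> carrier k" "a \<in> carrier A"
    show "bcons n (r \<odot> a) y = r \<odot>\<^bsub>P (Suc n)\<^esub> bcons n a y"
    proof (rule bt_eqI[OF module_P _ _ _ y])
      show "bcons n (r \<odot> a) (bt n xs) = r \<odot>\<^bsub>P (Suc n)\<^esub> bcons n a (bt n xs)"
        if "xs \<in> bar_gens A n" for xs
        using D(3)[of "[]" a xs r] ra that by (simp add: bcons_bt bar_gens_Cons)
    qed (use ra in \<open>auto intro!: lin_smultf bcons_lin module_P\<close>)
  qed (rule lin_closed[OF bcons_lin y])
qed (rule bcons_lin)

lemma bcons_closed: "a \<in> carrier A \<Longrightarrow> y \<in> carrier (P n) \<Longrightarrow> bcons n a y \<in> carrier (P (Suc n))"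
  by (rule bilin_closed[OF bcons_bilin])

text \<open>The unit is an inner entry: \<open>a\<close> precedes it, and \<open>y\<close> has at
  least one entry. This is the form in which the recursions use normalization.\<close>

lemma bcons_unit:
  assumes "a \<in> carrier A" "y \<in> carrier (P n)"
  shows "bcons (Suc n) a (bcons n \<one> y) = \<zero>\<^bsub>P (Suc (Suc n))\<^esub>"
proof (rule bt_eqI[OF module_P _ _ _ assms(2)])
  show "bcons (Suc n) a (bcons n \<one> (bt n xs)) = \<zero>\<^bsub>P (Suc (Suc n))\<^esub>" if "xs \<in> bar_gens A n" for xs
  proof -
    have "xs \<noteq> []" using that by (auto simp: bar_gens_def)
    then show ?thesis
      using bar_multilinearD(4)[OF bt_multilinear[of "Suc (Suc n)"], of "[a]" xs] that assms
      by (simp add: bcons_bt bar_gens_Cons)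
  qed
qed (use assms in \<open>auto intro!: lin_comp[OF bcons_lin bcons_lin] lin_zerof module_P\<close>)

definition bnil :: "'a \<Rightarrow> ('a list \<Rightarrow> 'k) set" where
  "bnil a = bt 0 [a]"

lemma bnil_lin: "bnil \<in> lin k A (P 0)"
proof (rule linI)
  note D = bar_multilinearD[OF bt_multilinear[of 0]]
  show "bnil x \<in> carrier (P 0)" if "x \<in> carrier A" for x
    using that by (simp add: bnil_def bt_closed bar_gens_0)
  show "bnil (x \<oplus> y) = bnil x \<oplus>\<^bsub>P 0\<^esub> bnil y" if "x \<in> carrier A" "y \<in> carrier A" for x y
    using D(2)[of "[]" x "[]" y] that by (simp add: bnil_def bar_gens_0)
  show "bnil (r \<odot> x) = r \<odot>\<^bsub>P 0\<^esub> bnil x" if "r \<in> carrier k" "x \<in> carrier A" for r x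
    using D(3)[of "[]" x "[]" r] that by (simp add: bnil_def bar_gens_0)
qed

lemma bnil_closed: "a \<in> carrier A \<Longrightarrow> bnil a \<in> carrier (P 0)"
  by (rule lin_closed[OF bnil_lin])

lemma ext0:
  assumes "module k N" "f \<in> lin k A N" "\<And>a. a \<in> carrier A \<Longrightarrow> \<phi> [a] = f a"
  shows ext0_lin: "linear_ext k N \<phi> \<in> lin k (P 0) N"
    and ext0_bnil: "a \<in> carrier A \<Longrightarrow> linear_ext k N \<phi> (bnil a) = f a"
proof -
  have m: "bar_multilinear k A 0 N \<phi>"
  proof (rule bar_multilinearI)
    show "\<phi> xs \<in> carrier N" if "xs \<in> bar_gens A 0" for xs
      using that assms lin_closed[OF assms(2)] by (auto simp: bar_gens_0)
    show "\<phi> (us @ [a \<oplus> b] @ vs) = \<phi> (us @ [a] @ vs) \<oplus>\<^bsub>N\<^esub> \<phi> (us @ [b] @ vs)"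
      if "us @ [a] @ vs \<in> bar_gens A 0" "b \<in> carrier A" for us a b vs
      using that by (auto simp: bar_gens_0 append_eq_Cons_conv assms(3) lin_add[OF assms(2)])
    show "\<phi> (us @ [r \<odot> a] @ vs) = r \<odot>\<^bsub>N\<^esub> \<phi> (us @ [a] @ vs)"
      if "us @ [a] @ vs \<in> bar_gens A 0" "r \<in> carrier k" for us a r vs
      using that by (auto simp: bar_gens_0 append_eq_Cons_conv assms(3) lin_smult[OF assms(2)])
  qed (auto simp: bar_gens_0 append_eq_Cons_conv)
  show "linear_ext k N \<phi> \<in> lin k (P 0) N" by (rule ext_lin[OF assms(1) m])
  show "linear_ext k N \<phi> (bnil a) = f a" if "a \<in> carrier A"
    unfolding bnil_def using ext_bt[OF assms(1) m, of "[a]"] that assms(3) by (simp add: bar_gens_0)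
qed

text \<open>The recursion principle: \<open>P (Suc n)\<close> is the tensor product of
  \<open>A\<close> and \<open>P n\<close> modulo all a \<otimes> (1 \<otimes> y). For
  \<open>n = 0\<close> the premise \<open>van\<close> is void, because the tail consists of the last
  entry of the bar alone. The third conclusion leads back from \<open>bcons\<close> to the function
  on lists that was given.\<close>

lemma extS:
  assumes N: "module k N" and b: "bilin k A (P n) N \<Phi>"
    and van: "\<And>m a y. n = Suc m \<Longrightarrow> a \<in> carrier A \<Longrightarrow> y \<in> carrier (P m) \<Longrightarrow> \<Phi> a (bcons m \<one> y) = \<zero>\<^bsub>N\<^esub>"
    and \<phi>: "\<And>a xs. a \<in> carrier A \<Longrightarrow> xs \<in> bar_gens A n \<Longrightarrow> \<phi> (a # xs) = \<Phi> a (bt n xs)"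
  shows extS_lin: "linear_ext k N \<phi> \<in> lin k (P (Suc n)) N"
    and extS_bcons: "a \<in> carrier A \<Longrightarrow> y \<in> carrier (P n) \<Longrightarrow> linear_ext k N \<phi> (bcons n a y) = \<Phi> a y"
    and extS_bt: "xs \<in> bar_gens A (Suc n) \<Longrightarrow> linear_ext k N \<phi> (bt (Suc n) xs) = \<phi> xs"
proof -
  note D = bar_multilinearD[OF bt_multilinear[of n]]
  note cl = D(1)
  have m: "bar_multilinear k A (Suc n) N \<phi>"
  proof (rule bar_multilinearI)
    show "\<phi> xs \<in> carrier N" if "xs \<in> bar_gens A (Suc n)" for xs
      using that by (auto elim!: bar_gens_SucE simp: \<phi> intro!: bilin_closed[OF b] cl)
  next
    fix us a c vs assume *: "us @ [a] @ vs \<in> bar_gens A (Suc n)" "c \<in> carrier A"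
    show "\<phi> (us @ [a \<oplus> c] @ vs) = \<phi> (us @ [a] @ vs) \<oplus>\<^bsub>N\<^esub> \<phi> (us @ [c] @ vs)"
    proof (cases us)
      case Nil
      with * show ?thesis by (simp add: bar_gens_Cons \<phi> lin_add[OF bilin_left[OF b cl]])
    next
      case (Cons x us')
      with * have x: "x \<in> carrier A" "us' @ [a] @ vs \<in> bar_gens A n" by (simp_all add: bar_gens_Cons)
      note i = bar_gens_insert[OF x(2)]
      show ?thesis
        using Cons x i * D(2)[OF x(2) *(2)] lin_add[OF bilin_right[OF b x(1)]] by (simp add: \<phi> cl)
    qed
  next
    fix us r a vs assume *: "us @ [a] @ vs \<in> bar_gens A (Suc n)" "r \<in> carrier k"
    show "\<phi> (us @ [r \<odot> a] @ vs) = r \<odot>\<^bsub>N\<^esub> \<phi> (us @ [a] @ vs)"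
    proof (cases us)
      case Nil
      with * show ?thesis by (simp add: bar_gens_Cons \<phi> lin_smult[OF bilin_left[OF b cl]])
    next
      case (Cons x us')
      with * have x: "x \<in> carrier A" "us' @ [a] @ vs \<in> bar_gens A n" by (simp_all add: bar_gens_Cons)
      note i = bar_gens_insert[OF x(2)]
      show ?thesis
        using Cons x i * D(3)[OF x(2) *(2)] lin_smult[OF bilin_right[OF b x(1)]] by (simp add: \<phi> cl)
    qed
  next
    fix us vs assume *: "us @ [\<one>] @ vs \<in> bar_gens A (Suc n)" "us \<noteq> []" "vs \<noteq> []"
    then obtain x us' where us: "us = x # us'" by (cases us) auto
    with * have x: "x \<in> carrier A" "us' @ [\<one>] @ vs \<in> bar_gens A n" by (simp_all add: bar_gens_Cons)
    have "\<phi> (us @ [\<one>] @ vs) = \<Phi> x (bt n (us' @ [\<one>] @ vs))" using us x \<phi> by simp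
    also have "\<dots> = \<zero>\<^bsub>N\<^esub>"
    \<comment> \<open>A unit directly behind the first entry is the case of \<open>van\<close>; a
      unit further inside makes the tail zero in \<open>P n\<close>.\<close>
    proof (cases us')
      case Nil
      with x * obtain m where m: "n = Suc m" "vs \<in> bar_gens A m"
        by (cases vs; cases n) (auto simp: bar_gens_def)
      then have "bt n (us' @ [\<one>] @ vs) = bcons m \<one> (bt m vs)" using Nil by (simp add: bcons_bt)
      then show ?thesis using van[OF m(1) x(1) bt_closed[OF m(2)]] by simp
    next
      case (Cons y us'')
      then have "bt n (us' @ [\<one>] @ vs) = \<zero>\<^bsub>P n\<^esub>" using D(4)[OF x(2)] * by simp
      then show ?thesis using lin_zero[OF module_P N bilin_right[OF b x(1)]] by simp
    qed
    finally show "\<phi> (us @ [\<one>] @ vs) = \<zero>\<^bsub>N\<^esub>" .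
  qed
  show l: "linear_ext k N \<phi> \<in> lin k (P (Suc n)) N" by (rule ext_lin[OF N m])
  show e: "linear_ext k N \<phi> (bt (Suc n) xs) = \<phi> xs" if "xs \<in> bar_gens A (Suc n)" for xs
    by (rule ext_bt[OF N m that])
  show "linear_ext k N \<phi> (bcons n a y) = \<Phi> a y" if a: "a \<in> carrier A" and y: "y \<in> carrier (P n)"
    by (rule bt_eqI[OF N lin_comp[OF bcons_lin[OF a] l] bilin_right[OF b a] _ y])
      (simp add: bcons_bt a e bar_gens_Cons \<phi>)
qed

lemma bar0_eqI:
  assumes "module k N" "f \<in> lin k (P 0) N" "g \<in> lin k (P 0) N"
    and "\<And>a. a \<in> carrier A \<Longrightarrow> f (bnil a) = g (bnil a)" "u \<in> carrier (P 0)"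
  shows "f u = g u"
  by (rule bt_eqI[OF assms(1-3) _ assms(5)]) (use assms(4) in \<open>auto simp: bar_gens_0 bnil_def\<close>)

lemma barS_eqI:
  assumes "module k N" "f \<in> lin k (P (Suc n)) N" "g \<in> lin k (P (Suc n)) N"
    and "\<And>a y. a \<in> carrier A \<Longrightarrow> y \<in> carrier (P n) \<Longrightarrow> f (bcons n a y) = g (bcons n a y)"
    and "u \<in> carrier (P (Suc n))"
  shows "f u = g u"
proof (rule bt_eqI[OF assms(1-3) _ assms(5)])
  fix xs assume "xs \<in> bar_gens A (Suc n)"
  then obtain a ys where "xs = a # ys" "a \<in> carrier A" "ys \<in> bar_gens A n" by (rule bar_gens_SucE)
  then show "f (bt (Suc n) xs) = g (bt (Suc n) xs)"
    using assms(4)[of a "bt n ys"] by (simp add: bcons_bt bt_closed)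
qed

end

context kalg
begin

lemma mult_left_lin: "a \<in> carrier A \<Longrightarrow> (\<lambda>b. a \<otimes> b) \<in> lin k A A"
  by (rule linI) (simp_all add: r_distr smult_mult_right)

lemma mult_right_lin: "a \<in> carrier A \<Longrightarrow> (\<lambda>b. b \<otimes> a) \<in> lin k A A"
  by (rule linI) (simp_all add: l_distr smult_mult_left)

text \<open>For a family of linear maps on bars, additivity and homogeneity in the parameter are
  equalities of linear maps, hence can be tested on generators. The next lemma is the same for
  longer bars.\<close>

lemma bilin_P0I:
  assumes N: "module k N" and l: "\<And>a. a \<in> carrier M \<Longrightarrow> F a \<in> lin k (P 0) N"
    and g: "\<And>b. b \<in> carrier A \<Longrightarrow> (\<lambda>a. F a (bnil b)) \<in> lin k M N"
    and M: "module k M"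
  shows "bilin k M (P 0) N F"
proof (rule bilinI)
  interpret N: module k N by (rule N)
  interpret M: module k M by (rule M)
  fix y assume y: "y \<in> carrier (P 0)"
  show "(\<lambda>a. F a y) \<in> lin k M N"
  proof (rule linI)
    fix a b assume ab: "a \<in> carrier M" "b \<in> carrier M"
    show "F (a \<oplus>\<^bsub>M\<^esub> b) y = F a y \<oplus>\<^bsub>N\<^esub> F b y"
      by (rule bar0_eqI[OF N l lin_addf[OF N l l] _ y]) (use ab lin_add[OF g] in auto)
  next
    fix r a assume ra: "r \<in> carrier k" "a \<in> carrier M"
    show "F (r \<odot>\<^bsub>M\<^esub> a) y = r \<odot>\<^bsub>N\<^esub> F a y"
      by (rule bar0_eqI[OF N l lin_smultf[OF N l] _ y]) (use ra lin_smult[OF g] in auto)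
  qed (rule lin_closed[OF l y])
qed (use l in simp)

lemma bilin_PSI:
  assumes N: "module k N" and l: "\<And>a. a \<in> carrier M \<Longrightarrow> F a \<in> lin k (P (Suc n)) N"
    and g: "\<And>b y. b \<in> carrier A \<Longrightarrow> y \<in> carrier (P n) \<Longrightarrow> (\<lambda>a. F a (bcons n b y)) \<in> lin k M N"
    and M: "module k M"
  shows "bilin k M (P (Suc n)) N F"
proof (rule bilinI)
  interpret N: module k N by (rule N)
  interpret M: module k M by (rule M)
  fix y assume y: "y \<in> carrier (P (Suc n))"
  show "(\<lambda>a. F a y) \<in> lin k M N"
  proof (rule linI)
    fix a b assume ab: "a \<in> carrier M" "b \<in> carrier M"
    show "F (a \<oplus>\<^bsub>M\<^esub> b) y = F a y \<oplus>\<^bsub>N\<^esub> F b y"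
      by (rule barS_eqI[OF N l lin_addf[OF N l l] _ y]) (use ab lin_add[OF g] in auto)
  next
    fix r a assume ra: "r \<in> carrier k" "a \<in> carrier M"
    show "F (r \<odot>\<^bsub>M\<^esub> a) y = r \<odot>\<^bsub>N\<^esub> F a y"
      by (rule barS_eqI[OF N l lin_smultf[OF N l] _ y]) (use ra lin_smult[OF g] in auto)
  qed (rule lin_closed[OF l y])
qed (use l in simp)

section \<open>The two actions and the differential of the bar complex\<close>

definition la :: "nat \<Rightarrow> 'a \<Rightarrow> ('a list \<Rightarrow> 'k) set \<Rightarrow> ('a list \<Rightarrow> 'k) set" where
  "la n a = linear_ext k (P n) (\<lambda>xs. bt n ((a \<otimes> hd xs) # tl xs))"

definition ra :: "nat \<Rightarrow> 'a \<Rightarrow> ('a list \<Rightarrow> 'k) set \<Rightarrow> ('a list \<Rightarrow> 'k) set" where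
  "ra n a = linear_ext k (P n) (\<lambda>xs. bt n (butlast xs @ [last xs \<otimes> a]))"

text \<open>In the shifted numbering \<open>gd (Suc n)\<close> is the bar differential in degree
  \<open>Suc n\<close>, and \<open>gd 0\<close> is the multiplication from A \<otimes> A to A, the
  augmentation of the bar resolution.\<close>

definition gd :: "nat \<Rightarrow> ('a list \<Rightarrow> 'k) set \<Rightarrow> ('a list \<Rightarrow> 'k) set" where
  "gd n = linear_ext k (P n) (\<lambda>xs. \<Oplus>\<^bsub>P n\<^esub>i\<in>{..n}. signed (P n) i
     (bt n (take i xs @ [xs ! i \<otimes> xs ! (i + 1)] @ drop (i + 2) xs)))"

lemma la_0:
  assumes "a \<in> carrier A"
  shows la_0_lin: "la 0 a \<in> lin k (P 0) (P 0)"
    and la_bnil: "b \<in> carrier A \<Longrightarrow> la 0 a (bnil b) = bnil (a \<otimes> b)"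
  using ext0[OF module_P lin_comp[OF mult_left_lin[OF assms] bnil_lin],
      of "\<lambda>xs. bt 0 ((a \<otimes> hd xs) # tl xs)"]
  by (simp_all add: la_def bnil_def)

lemma la_S:
  assumes "a \<in> carrier A"
  shows la_S_lin: "la (Suc n) a \<in> lin k (P (Suc n)) (P (Suc n))"
    and la_bcons: "b \<in> carrier A \<Longrightarrow> y \<in> carrier (P n) \<Longrightarrow> la (Suc n) a (bcons n b y) = bcons n (a \<otimes> b) y"
proof -
  note * = extS[OF module_P bilin_comp[OF bcons_bilin mult_left_lin[OF assms] lin_ident lin_ident],
      of n "\<lambda>xs. bt (Suc n) ((a \<otimes> hd xs) # tl xs)"]
  show "la (Suc n) a \<in> lin k (P (Suc n)) (P (Suc n))" unfolding la_def
    by (rule *(1)) (use assms in \<open>auto simp: bcons_bt bcons_unit\<close>)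
  show "la (Suc n) a (bcons n b y) = bcons n (a \<otimes> b) y" if "b \<in> carrier A" "y \<in> carrier (P n)"
    unfolding la_def
    by (rule *(2)) (use assms that in \<open>auto simp: bcons_bt bcons_unit\<close>)
qed

lemma la_lin: "a \<in> carrier A \<Longrightarrow> la n a \<in> lin k (P n) (P n)"
  by (cases n) (simp_all add: la_0_lin la_S_lin)

lemmas la_closed = lin_closed[OF la_lin]

lemma la_bilin: "bilin k A (P n) (P n) (la n)"
proof (cases n)
  case 0
  show ?thesis unfolding 0
  proof (rule bilin_P0I[OF module_P la_lin _ module_A])
    fix b assume b: "b \<in> carrier A"
    show "(\<lambda>a. la 0 a (bnil b)) \<in> lin k A (P 0)"
      by (rule lin_cong[OF lin_comp[OF mult_right_lin[OF b] bnil_lin] module_A]) (simp add: la_bnil b)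
  qed
next
  case (Suc m)
  show ?thesis unfolding Suc
  proof (rule bilin_PSI[OF module_P la_lin _ module_A])
    fix b y assume b: "b \<in> carrier A" and y: "y \<in> carrier (P m)"
    show "(\<lambda>a. la (Suc m) a (bcons m b y)) \<in> lin k A (P (Suc m))"
      by (rule lin_cong[OF lin_comp[OF mult_right_lin[OF b] bilin_left[OF bcons_bilin y]] module_A])
        (simp add: la_bcons b y)
  qed
qed

lemma la_la:
  assumes "a \<in> carrier A" "b \<in> carrier A" "u \<in> carrier (P n)"
  shows "la n a (la n b u) = la n (a \<otimes> b) u"
proof (cases n)
  case 0
  show ?thesis unfolding 0
    by (rule bar0_eqI[OF module_P lin_comp[OF la_lin la_lin] la_lin])
      (use assms 0 in \<open>auto simp: la_bnil m_assoc\<close>)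
next
  case (Suc m)
  show ?thesis unfolding Suc
    by (rule barS_eqI[OF module_P lin_comp[OF la_lin la_lin] la_lin])
      (use assms Suc in \<open>auto simp: la_bcons m_assoc\<close>)
qed

lemma la_one: "u \<in> carrier (P n) \<Longrightarrow> la n \<one> u = u"
proof (cases n)
  case 0
  show "u \<in> carrier (P n) \<Longrightarrow> ?thesis" unfolding 0
    by (rule bar0_eqI[OF module_P la_lin lin_ident]) (auto simp: la_bnil)
next
  case (Suc m)
  show "u \<in> carrier (P n) \<Longrightarrow> ?thesis" unfolding Suc
    by (rule barS_eqI[OF module_P la_lin lin_ident]) (auto simp: la_bcons)
qed

text \<open>Right multiplication takes place in the tail of a bar. It is therefore defined in degree
  \<open>Suc n\<close> by means of degree \<open>n\<close>, and linearity and value have to be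
  established together.\<close>

lemma ra_bt_lin:
  assumes "b \<in> carrier A"
  shows "ra n b \<in> lin k (P n) (P n) \<and>
    (\<forall>xs\<in>bar_gens A n. ra n b (bt n xs) = bt n (butlast xs @ [last xs \<otimes> b]))"
proof (induction n)
  case 0
  show ?case
    using ext0[OF module_P lin_comp[OF mult_right_lin[OF assms] bnil_lin],
      of "\<lambda>xs. bt 0 (butlast xs @ [last xs \<otimes> b])"]
    by (auto simp: ra_def bnil_def bar_gens_0)
next
  case (Suc n)
  have gens: "butlast xs @ [last xs \<otimes> b] \<in> bar_gens A n" if "xs \<in> bar_gens A n" for xs
  proof -
    have "xs \<noteq> []" using that by (auto simp: bar_gens_def)
    then have "last xs \<in> carrier A" "set (butlast xs) \<subseteq> carrier A"
      using that last_in_set[of xs] in_set_butlastD[of _ xs] by (auto simp: bar_gens_def)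
    then show ?thesis using that assms \<open>xs \<noteq> []\<close> by (auto simp: bar_gens_def)
  qed
  note * = extS[OF module_P bilin_comp[OF bcons_bilin lin_ident conjunct1[OF Suc.IH] lin_ident],
      of "\<lambda>xs. bt (Suc n) (butlast xs @ [last xs \<otimes> b])"]
  have p: "bt (Suc n) (butlast (a # xs) @ [last (a # xs) \<otimes> b]) = bcons n a (ra n b (bt n xs))"
    if "a \<in> carrier A" "xs \<in> bar_gens A n" for a xs
    using that Suc.IH gens[OF that(2)] by (auto simp: bcons_bt bar_gens_def)
  \<comment> \<open>In a bar with two or more entries the first is not the last: right
    multiplication leaves a leading unit in place, and normalization still applies.\<close>
  have q: "bcons n a (ra n b (bcons m \<one> y)) = \<zero>\<^bsub>P (Suc n)\<^esub>"
    if m: "n = Suc m" and a: "a \<in> carrier A" and y: "y \<in> carrier (P m)" for a y m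
  proof (rule bt_eqI[OF module_P _ _ _ y])
    have r: "ra n b \<in> lin k (P (Suc m)) (P (Suc m))" using Suc.IH m by simp
    show "(\<lambda>y. bcons n a (ra n b (bcons m \<one> y))) \<in> lin k (P m) (P (Suc n))"
      using lin_comp[OF lin_comp[OF bcons_lin[of \<one> m] r] bcons_lin[of a "Suc m"]] a m by simp
    show "(\<lambda>y. \<zero>\<^bsub>P (Suc n)\<^esub>) \<in> lin k (P m) (P (Suc n))" by (rule lin_zerof[OF module_P])
    fix xs assume xs: "xs \<in> bar_gens A m"
    then obtain ys where ys: "ys \<in> bar_gens A m" "butlast (\<one> # xs) @ [last (\<one> # xs) \<otimes> b] = \<one> # ys"
    proof (cases "xs = []")
      case False
      then have "last xs \<in> carrier A" "set (butlast xs) \<subseteq> carrier A"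
        using xs last_in_set[of xs] in_set_butlastD[of _ xs] by (auto simp: bar_gens_def)
      then show ?thesis using that[of "butlast xs @ [last xs \<otimes> b]"] False xs assms
        by (auto simp: bar_gens_def)
    qed (auto simp: bar_gens_def)
    have "ra n b (bcons m \<one> (bt m xs)) = bcons m \<one> (bt m ys)"
      using Suc.IH xs ys m by (simp add: bcons_bt bar_gens_Cons)
    then show "bcons n a (ra n b (bcons m \<one> (bt m xs))) = \<zero>\<^bsub>P (Suc n)\<^esub>"
      using bcons_unit[OF a bt_closed[OF ys(1)]] m by simp
  qed
  show ?case
    unfolding ra_def[of "Suc n"]
    by (intro conjI ballI *(1,3)) (use p q in auto)
qed

lemma ra_lin: "b \<in> carrier A \<Longrightarrow> ra n b \<in> lin k (P n) (P n)"
  using ra_bt_lin by blast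

lemmas ra_closed = lin_closed[OF ra_lin]

lemma ra_bt: "b \<in> carrier A \<Longrightarrow> xs \<in> bar_gens A n \<Longrightarrow> ra n b (bt n xs) = bt n (butlast xs @ [last xs \<otimes> b])"
  using ra_bt_lin by blast

lemma ra_bnil: "b \<in> carrier A \<Longrightarrow> a \<in> carrier A \<Longrightarrow> ra 0 b (bnil a) = bnil (a \<otimes> b)"
  by (simp add: bnil_def ra_bt bar_gens_0)

lemma ra_bcons:
  assumes "b \<in> carrier A" "a \<in> carrier A" "y \<in> carrier (P n)"
  shows "ra (Suc n) b (bcons n a y) = bcons n a (ra n b y)"
proof (rule bt_eqI[OF module_P lin_comp[OF bcons_lin ra_lin] lin_comp[OF ra_lin bcons_lin] _ assms(3)])
  fix xs assume xs: "xs \<in> bar_gens A n"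
  then have ne: "xs \<noteq> []" by (auto simp: bar_gens_def)
  then have "last xs \<in> carrier A" "set (butlast xs) \<subseteq> carrier A"
    using xs last_in_set[of xs] in_set_butlastD[of _ xs] by (auto simp: bar_gens_def)
  then have "butlast xs @ [last xs \<otimes> b] \<in> bar_gens A n" using xs assms ne by (auto simp: bar_gens_def)
  then show "ra (Suc n) b (bcons n a (bt n xs)) = bcons n a (ra n b (bt n xs))"
    using assms xs ne by (simp add: bcons_bt ra_bt bar_gens_Cons)
qed (use assms in auto)

lemma ra_bilin: "bilin k A (P n) (P n) (ra n)"
proof (induction n)
  case 0
  show ?case
  proof (rule bilin_P0I[OF module_P ra_lin _ module_A])
    fix b assume b: "b \<in> carrier A"
    show "(\<lambda>a. ra 0 a (bnil b)) \<in> lin k A (P 0)"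
      by (rule lin_cong[OF lin_comp[OF mult_left_lin[OF b] bnil_lin] module_A]) (simp add: ra_bnil b)
  qed
next
  case (Suc m)
  show ?case
  proof (rule bilin_PSI[OF module_P ra_lin _ module_A])
    fix b y assume b: "b \<in> carrier A" and y: "y \<in> carrier (P m)"
    show "(\<lambda>a. ra (Suc m) a (bcons m b y)) \<in> lin k A (P (Suc m))"
      by (rule lin_cong[OF lin_comp[OF bilin_left[OF Suc y] bcons_lin[OF b]] module_A])
        (simp add: ra_bcons b y)
  qed
qed

lemma ra_ra:
  assumes "a \<in> carrier A" "b \<in> carrier A" "u \<in> carrier (P n)"
  shows "ra n a (ra n b u) = ra n (b \<otimes> a) u"
  using assms(3)
proof (induction n arbitrary: u)
  case 0
  show ?case
    by (rule bar0_eqI[OF module_P lin_comp[OF ra_lin ra_lin] ra_lin])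
      (use assms 0 in \<open>auto simp: ra_bnil m_assoc\<close>)
next
  case (Suc m)
  show ?case
    by (rule barS_eqI[OF module_P lin_comp[OF ra_lin ra_lin] ra_lin])
      (use assms(1,2) Suc in \<open>auto simp: ra_bcons ra_closed\<close>)
qed

lemma ra_one: "u \<in> carrier (P n) \<Longrightarrow> ra n \<one> u = u"
proof (induction n arbitrary: u)
  case 0
  show ?case by (rule bar0_eqI[OF module_P ra_lin lin_ident]) (use 0 in \<open>auto simp: ra_bnil\<close>)
next
  case (Suc m)
  show ?case by (rule barS_eqI[OF module_P ra_lin lin_ident]) (use Suc in \<open>auto simp: ra_bcons\<close>)
qed

lemma ra_la:
  assumes "a \<in> carrier A" "b \<in> carrier A" "u \<in> carrier (P n)"
  shows "ra n b (la n a u) = la n a (ra n b u)"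
proof (cases n)
  case 0
  show ?thesis unfolding 0
    by (rule bar0_eqI[OF module_P lin_comp[OF la_lin ra_lin] lin_comp[OF ra_lin la_lin]])
      (use assms 0 in \<open>auto simp: la_bnil ra_bnil m_assoc\<close>)
next
  case (Suc m)
  show ?thesis unfolding Suc
    by (rule barS_eqI[OF module_P lin_comp[OF la_lin ra_lin] lin_comp[OF ra_lin la_lin]])
      (use assms Suc in \<open>auto simp: la_bcons ra_bcons ra_closed\<close>)
qed

definition gd_list :: "nat \<Rightarrow> 'a list \<Rightarrow> ('a list \<Rightarrow> 'k) set" where
  "gd_list n xs = (\<Oplus>\<^bsub>P n\<^esub>i\<in>{..n}. signed (P n) i
     (bt n (take i xs @ [xs ! i \<otimes> xs ! (i + 1)] @ drop (i + 2) xs)))"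

lemma gd_eq: "gd n = linear_ext k (P n) (gd_list n)"
  by (simp add: gd_def gd_list_def[abs_def])

lemma merge_gens:
  assumes "xs \<in> bar_gens A (Suc n)" "i \<le> n"
  shows "take i xs @ [xs ! i \<otimes> xs ! (i + 1)] @ drop (i + 2) xs \<in> bar_gens A n"
  using assms set_take_subset[of i xs] set_drop_subset[of "i + 2" xs] nth_mem[of i xs] nth_mem[of "i + 1" xs]
  by (auto simp: bar_gens_def intro!: m_closed)

lemma gd_list_0:
  assumes "a \<in> carrier A" "xs \<in> bar_gens A 0"
  shows "gd_list 0 (a # xs) = la 0 a (bt 0 xs)"
proof -
  interpret P: module k "P 0" by (rule module_P)
  obtain b where b: "b \<in> carrier A" "xs = [b]" using assms(2) by (auto simp: bar_gens_0)
  then show ?thesis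
    using assms bnil_closed[of "a \<otimes> b"] la_bnil[OF assms(1) b(1)]
    by (simp add: gd_list_def bnil_def signed_def)
qed

text \<open>The term with index 0 multiplies \<open>a\<close> into the next entry. All others keep
  \<open>a\<close> in front, and their index exceeds the one in the tail by 1, whence the minus
  sign.\<close>

lemma gd_list_Suc:
  assumes a: "a \<in> carrier A" and xs: "xs \<in> bar_gens A (Suc n)"
  shows "gd_list (Suc n) (a # xs) = la (Suc n) a (bt (Suc n) xs) \<ominus>\<^bsub>P (Suc n)\<^esub> bcons n a (gd_list n xs)"
proof -
  let ?m = "\<lambda>i xs. take i xs @ [xs ! i \<otimes> xs ! (i + 1)] @ drop (i + 2) xs"
  interpret P: module k "P (Suc n)" by (rule module_P)
  note module_P = module_P[of n] module_P[of "Suc n"]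
  have axs: "a # xs \<in> bar_gens A (Suc (Suc n))" using assms by (simp add: bar_gens_Cons)
  have cl: "signed (P (Suc n)) i (bt (Suc n) (?m i (a # xs))) \<in> carrier (P (Suc n))" if "i \<le> Suc n" for i
    by (rule signed_closed[OF module_P(2) bt_closed[OF merge_gens[OF axs that]]])
  have cl': "signed (P n) i (bt n (?m i xs)) \<in> carrier (P n)" if "i \<le> n" for i
    by (rule signed_closed[OF module_P(1) bt_closed[OF merge_gens[OF xs that]]])
  have "gd_list (Suc n) (a # xs) = (\<Oplus>\<^bsub>P (Suc n)\<^esub>i\<in>{..n}. signed (P (Suc n)) (Suc i) (bt (Suc n) (?m (Suc i) (a # xs))))
      \<oplus>\<^bsub>P (Suc n)\<^esub> signed (P (Suc n)) 0 (bt (Suc n) (?m 0 (a # xs)))"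
    unfolding gd_list_def by (rule P.M.finsum_Suc2) (use cl in auto)
  also have "(\<Oplus>\<^bsub>P (Suc n)\<^esub>i\<in>{..n}. signed (P (Suc n)) (Suc i) (bt (Suc n) (?m (Suc i) (a # xs))))
      = (\<Oplus>\<^bsub>P (Suc n)\<^esub>i\<in>{..n}. \<ominus>\<^bsub>P (Suc n)\<^esub> bcons n a (signed (P n) i (bt n (?m i xs))))"
  proof (rule finsum_congI[OF module_P(2)])
    fix i assume i: "i \<in> {..n}"
    have "bcons n a (bt n (?m i xs)) = bt (Suc n) (a # ?m i xs)"
      by (rule bcons_bt[OF a]) (use i merge_gens[OF xs, of i] in auto)
    then have eq: "bt (Suc n) (?m (Suc i) (a # xs)) = bcons n a (bt n (?m i xs))" by simp
    have c: "bt n (?m i xs) \<in> carrier (P n)" using bt_closed[OF merge_gens[OF xs, of i]] i by simp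
    show "signed (P (Suc n)) (Suc i) (bt (Suc n) (?m (Suc i) (a # xs)))
        = \<ominus>\<^bsub>P (Suc n)\<^esub> bcons n a (signed (P n) i (bt n (?m i xs)))"
      unfolding eq lin_signed[OF module_P bcons_lin[OF a] c]
      using bcons_closed[OF a c] by (simp add: signed_def)
    show "\<ominus>\<^bsub>P (Suc n)\<^esub> bcons n a (signed (P n) i (bt n (?m i xs))) \<in> carrier (P (Suc n))"
      using bcons_closed[OF a cl'[of i]] i by simp
  qed
  also have "\<dots> = \<ominus>\<^bsub>P (Suc n)\<^esub> bcons n a (gd_list n xs)"
    unfolding gd_list_def
    by (rule lin_finsum[OF module_P lin_negf[OF module_P(2) bcons_lin[OF a]], symmetric]) (use cl' in auto)
  also have "signed (P (Suc n)) 0 (bt (Suc n) (?m 0 (a # xs))) = la (Suc n) a (bt (Suc n) xs)"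
    using xs a by (auto elim!: bar_gens_SucE simp: signed_def la_bcons bcons_bt[symmetric] bt_closed)
  finally have eq: "gd_list (Suc n) (a # xs) = \<ominus>\<^bsub>P (Suc n)\<^esub> bcons n a (gd_list n xs) \<oplus>\<^bsub>P (Suc n)\<^esub> la (Suc n) a (bt (Suc n) xs)" .
  have "gd_list n xs \<in> carrier (P n)"
    unfolding gd_list_def by (rule module_finsum_closed[OF module_P(1)]) (use cl' in auto)
  then show ?thesis
    unfolding eq using la_closed[OF a bt_closed[OF xs]] bcons_closed[OF a]
    by (simp add: a_minus_def P.M.a_comm)
qed

text \<open>The recursion is d(a \<otimes> y) = a y - a \<otimes> d y, where the second term is
  missing in degree 0. That it respects normalization depends on the same formula one and two
  degrees lower, so linearity, values and recursion go through one strong induction.\<close>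

lemma gd_lin_bt: "gd n \<in> lin k (P (Suc n)) (P n) \<and> (\<forall>xs\<in>bar_gens A (Suc n). gd n (bt (Suc n) xs) = gd_list n xs) \<and>
   (\<forall>a\<in>carrier A. \<forall>y\<in>carrier (P n). gd n (bcons n a y) =
      (case n of 0 \<Rightarrow> la 0 a y | Suc m \<Rightarrow> la n a y \<ominus>\<^bsub>P n\<^esub> bcons m a (gd m y)))"
proof (induction n rule: less_induct)
  case (less n)
  show ?case
  proof (cases n)
    case 0
    note * = extS[OF module_P la_bilin, of 0 "gd_list 0", OF _ gd_list_0]
    show ?thesis unfolding gd_eq 0 using * by simp
  next
    case (Suc n')
    note IH = less.IH[of n', unfolded Suc, simplified]
    have g: "gd n' \<in> lin k (P (Suc n')) (P n')" using IH by simp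
    let ?\<Phi> = "\<lambda>a y. la (Suc n') a y \<ominus>\<^bsub>P (Suc n')\<^esub> bcons n' a (gd n' y)"
    interpret P: module k "P (Suc n')" by (rule module_P)
    interpret P': module k "P n'" by (rule module_P)
    have b: "bilin k A (P (Suc n')) (P (Suc n')) ?\<Phi>"
      by (rule bilinI; rule lin_minusf[OF module_P])
        (auto intro: bilin_left[OF la_bilin] la_lin lin_comp[OF g bcons_lin] bilin_left[OF bcons_bilin] lin_closed[OF g])
    \<comment> \<open>d(1 \<otimes> y) = y - 1 \<otimes> d y, and the subtracted term is annihilated
      when \<open>a\<close> is put in front of it.\<close>
    have gu: "bcons n' a (gd n' (bcons n' \<one> y)) = bcons n' a y"
      if a: "a \<in> carrier A" and y: "y \<in> carrier (P n')" for a y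
    proof (cases n')
      case 0
      then show ?thesis using IH y by (simp add: la_one)
    next
      case (Suc m)
      then have gm: "gd m \<in> lin k (P n') (P m)" using less.IH[of m] \<open>n = Suc n'\<close> by simp
      have gy: "gd m y \<in> carrier (P m)" by (rule lin_closed[OF gm y])
      have bz: "bcons m \<one> (gd m y) \<in> carrier (P n')" using bcons_closed[OF _ gy] Suc by simp
      have z: "bcons n' a (bcons m \<one> (gd m y)) = \<zero>\<^bsub>P (Suc n')\<^esub>" using bcons_unit[OF a gy] Suc by simp
      have "gd n' (bcons n' \<one> y) = y \<ominus>\<^bsub>P n'\<^esub> bcons m \<one> (gd m y)" using IH y Suc by (simp add: la_one)
      then show ?thesis
        using lin_minus[OF module_P module_P bcons_lin[OF a] y bz] z bcons_closed[OF a y]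
        by (simp add: a_minus_def)
    qed
    have van: "?\<Phi> a (bcons n' \<one> y) = \<zero>\<^bsub>P (Suc n')\<^esub>" if a: "a \<in> carrier A" and y: "y \<in> carrier (P n')" for a y
      using gu[OF a y] a y bcons_closed[OF a y] by (simp add: la_bcons a_minus_def P.M.r_neg)
    have gl: "gd_list (Suc n') (a # xs) = ?\<Phi> a (bt (Suc n') xs)" if "a \<in> carrier A" "xs \<in> bar_gens A (Suc n')" for a xs
      using gd_list_Suc[OF that] IH that by simp
    have van': "?\<Phi> a (bcons m \<one> y) = \<zero>\<^bsub>P (Suc n')\<^esub>"
      if "Suc n' = Suc m" "a \<in> carrier A" "y \<in> carrier (P m)" for a y m
      using van that by simp
    show ?thesis unfolding Suc
      using extS[OF module_P b van' gl, folded gd_eq] by simp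
  qed
qed

lemma gd_lin: "gd n \<in> lin k (P (Suc n)) (P n)"
  using gd_lin_bt by blast

lemmas gd_closed = lin_closed[OF gd_lin]

lemma gd_bcons_0: "a \<in> carrier A \<Longrightarrow> y \<in> carrier (P 0) \<Longrightarrow> gd 0 (bcons 0 a y) = la 0 a y"
  using gd_lin_bt[of 0] by simp

lemma gd_bcons_Suc: "a \<in> carrier A \<Longrightarrow> y \<in> carrier (P (Suc n)) \<Longrightarrow>
    gd (Suc n) (bcons (Suc n) a y) = la (Suc n) a y \<ominus>\<^bsub>P (Suc n)\<^esub> bcons n a (gd n y)"
  using gd_lin_bt[of "Suc n"] by simp

lemma gd_la:
  assumes "a \<in> carrier A" "u \<in> carrier (P (Suc n))"
  shows "gd n (la (Suc n) a u) = la n a (gd n u)"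
proof (rule barS_eqI[OF module_P lin_comp[OF la_lin gd_lin] lin_comp[OF gd_lin la_lin] _ assms(2)])
  fix b y assume b: "b \<in> carrier A" and y: "y \<in> carrier (P n)"
  show "gd n (la (Suc n) a (bcons n b y)) = la n a (gd n (bcons n b y))"
  proof (cases n)
    case 0
    with assms b y show ?thesis by (simp add: la_bcons gd_bcons_0 la_la)
  next
    case (Suc m)
    with assms b y show ?thesis
      by (simp add: la_bcons gd_bcons_Suc la_la lin_minus[OF module_P module_P la_lin] la_closed bcons_closed gd_closed)
  qed
qed (use assms in auto)

lemma gd_ra:
  assumes "a \<in> carrier A" "u \<in> carrier (P (Suc n))"
  shows "gd n (ra (Suc n) a u) = ra n a (gd n u)"
  using assms(2)
proof (induction n arbitrary: u)
  case 0
  show ?case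
    by (rule barS_eqI[OF module_P lin_comp[OF ra_lin gd_lin] lin_comp[OF gd_lin ra_lin] _ 0])
      (use assms in \<open>auto simp: ra_bcons gd_bcons_0 ra_closed ra_la\<close>)
next
  case (Suc n)
  show ?case
    by (rule barS_eqI[OF module_P lin_comp[OF ra_lin gd_lin] lin_comp[OF gd_lin ra_lin] _ Suc.prems])
      (use assms Suc.IH in \<open>auto simp: ra_bcons gd_bcons_Suc ra_closed ra_la
        lin_minus[OF module_P module_P ra_lin] la_closed bcons_closed gd_closed\<close>)
qed

section \<open>Functoriality of the bar complex for algebra endomorphisms\<close>

definition algebra_endo :: "('a \<Rightarrow> 'a) \<Rightarrow> bool" where
  "algebra_endo f \<longleftrightarrow> f \<in> lin k A A \<and> f \<one> = \<one> \<and>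
     (\<forall>a\<in>carrier A. \<forall>b\<in>carrier A. f (a \<otimes> b) = f a \<otimes> f b)"

definition bmap :: "nat \<Rightarrow> ('a \<Rightarrow> 'a) \<Rightarrow> ('a list \<Rightarrow> 'k) set \<Rightarrow> ('a list \<Rightarrow> 'k) set" where
  "bmap n f = linear_ext k (P n) (\<lambda>xs. bt n (map f xs))"

lemma bmap_bt:
  assumes "algebra_endo f"
  shows "bmap n f \<in> lin k (P n) (P n) \<and> (\<forall>xs\<in>bar_gens A n. bmap n f (bt n xs) = bt n (map f xs)) \<and>
    (\<forall>m a y. n = Suc m \<longrightarrow> a \<in> carrier A \<longrightarrow> y \<in> carrier (P m) \<longrightarrow> bmap n f (bcons m a y) = bcons m (f a) (bmap m f y))"
proof (induction n)
  case 0
  have f: "f \<in> lin k A A" using assms by (simp add: algebra_endo_def)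
  show ?case
    using ext0[OF module_P lin_comp[OF f bnil_lin], of "\<lambda>xs. bt 0 (map f xs)"]
    by (auto simp: bmap_def bnil_def bar_gens_0)
next
  case (Suc n)
  have f: "f \<in> lin k A A" "f \<one> = \<one>" using assms by (simp_all add: algebra_endo_def)
  have gens: "map f xs \<in> bar_gens A n" if "xs \<in> bar_gens A n" for xs
    using that lin_closed[OF f(1)] by (auto simp: bar_gens_def)
  have m: "bmap n f \<in> lin k (P n) (P n)" using Suc by simp
  note * = extS[OF module_P bilin_comp[OF bcons_bilin f(1) m lin_ident],
      of "\<lambda>xs. bt (Suc n) (map f xs)"]
  have p: "bt (Suc n) (map f (a # xs)) = bcons n (f a) (bmap n f (bt n xs))"
    if "a \<in> carrier A" "xs \<in> bar_gens A n" for a xs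
    using that Suc.IH gens[OF that(2)] lin_closed[OF f(1)] by (auto simp: bcons_bt)
  have q: "bcons n (f a) (bmap n f (bcons m \<one> y)) = \<zero>\<^bsub>P (Suc n)\<^esub>"
    if nm: "n = Suc m" and a: "a \<in> carrier A" and y: "y \<in> carrier (P m)" for a y m
  proof -
    \<comment> \<open>The induction hypothesis covers degree \<open>n\<close>, whereas the
      normalization argument takes a value in the degree below; that this value lies in the carrier
      is obtained directly from multilinearity.\<close>
    have ml: "bmap m f y \<in> carrier (P m)"
      unfolding bmap_def
    proof (rule lin_closed[OF ext_lin[OF module_P] y])
      show "bar_multilinear k A m (P m) (\<lambda>xs. bt m (map f xs))"
      proof (rule bar_multilinearI)
        note D = bar_multilinearD[OF bt_multilinear[of m]]
        have g: "map f xs \<in> bar_gens A m" if "xs \<in> bar_gens A m" for xs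
          using that lin_closed[OF f(1)] by (auto simp: bar_gens_def)
        show "bt m (map f (us @ [a \<oplus> b] @ vs)) = bt m (map f (us @ [a] @ vs)) \<oplus>\<^bsub>P m\<^esub> bt m (map f (us @ [b] @ vs))"
          if "us @ [a] @ vs \<in> bar_gens A m" "b \<in> carrier A" for us a b vs
          using D(2)[of "map f us" "f a" "map f vs" "f b"] g[OF that(1)] that bar_gens_insert[OF that(1)]
          by (simp add: lin_add[OF f(1)] lin_closed[OF f(1)])
        show "bt m (map f (us @ [r \<odot> a] @ vs)) = r \<odot>\<^bsub>P m\<^esub> bt m (map f (us @ [a] @ vs))"
          if "us @ [a] @ vs \<in> bar_gens A m" "r \<in> carrier k" for us a r vs
          using D(3)[of "map f us" "f a" "map f vs" r] g[OF that(1)] that bar_gens_insert[OF that(1)]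
          by (simp add: lin_smult[OF f(1)] lin_closed[OF f(1)])
        show "bt m (map f (us @ [\<one>] @ vs)) = \<zero>\<^bsub>P m\<^esub>"
          if "us @ [\<one>] @ vs \<in> bar_gens A m" "us \<noteq> []" "vs \<noteq> []" for us vs
          using D(4)[of "map f us" "map f vs"] g[OF that(1)] that by (simp add: f(2))
      qed (rule bt_closed, use lin_closed[OF f(1)] in \<open>force simp: bar_gens_def\<close>)
    qed
    have "bmap n f (bcons m \<one> y) = bcons m \<one> (bmap m f y)" using Suc.IH nm y f(2) by auto
    then show ?thesis using bcons_unit[OF lin_closed[OF f(1) a] ml] nm by simp
  qed
  show ?case
    using *[OF q p, folded bmap_def] by auto
qed

lemma bmap_lin: "algebra_endo f \<Longrightarrow> bmap n f \<in> lin k (P n) (P n)"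
  using bmap_bt by blast

lemmas bmap_closed = lin_closed[OF bmap_lin]

lemma bmap_bcons: "algebra_endo f \<Longrightarrow> a \<in> carrier A \<Longrightarrow> y \<in> carrier (P n) \<Longrightarrow>
   bmap (Suc n) f (bcons n a y) = bcons n (f a) (bmap n f y)"
  using bmap_bt by blast

lemma algebra_endoD:
  assumes "algebra_endo f"
  shows "f \<in> lin k A A" "f \<one> = \<one>" "a \<in> carrier A \<Longrightarrow> f a \<in> carrier A"
    "a \<in> carrier A \<Longrightarrow> b \<in> carrier A \<Longrightarrow> f (a \<otimes> b) = f a \<otimes> f b"
  using assms lin_closed[of f k A A a] by (auto simp: algebra_endo_def)

lemma bmap_bnil: "algebra_endo f \<Longrightarrow> a \<in> carrier A \<Longrightarrow> bmap 0 f (bnil a) = bnil (f a)"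
  using bmap_bt[of f 0] by (simp add: bnil_def bar_gens_0)

lemma bmap_la:
  assumes "algebra_endo f" "a \<in> carrier A" "u \<in> carrier (P n)"
  shows "bmap n f (la n a u) = la n (f a) (bmap n f u)"
proof (cases n)
  case 0
  show ?thesis unfolding 0
    by (rule bar0_eqI[OF module_P lin_comp[OF la_lin bmap_lin] lin_comp[OF bmap_lin la_lin]])
      (use assms 0 in \<open>auto simp: la_bnil bmap_bnil algebra_endoD[OF assms(1)]\<close>)
next
  case (Suc m)
  show ?thesis unfolding Suc
    by (rule barS_eqI[OF module_P lin_comp[OF la_lin bmap_lin] lin_comp[OF bmap_lin la_lin]])
      (use assms Suc in \<open>auto simp: la_bcons bmap_bcons algebra_endoD[OF assms(1)] bmap_closed\<close>)
qed

lemma bmap_ra: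
  assumes "algebra_endo f" "a \<in> carrier A" "u \<in> carrier (P n)"
  shows "bmap n f (ra n a u) = ra n (f a) (bmap n f u)"
  using assms(3)
proof (induction n arbitrary: u)
  case 0
  show ?case
    by (rule bar0_eqI[OF module_P lin_comp[OF ra_lin bmap_lin] lin_comp[OF bmap_lin ra_lin]])
      (use assms 0 in \<open>auto simp: ra_bnil bmap_bnil algebra_endoD[OF assms(1)]\<close>)
next
  case (Suc m)
  show ?case
    by (rule barS_eqI[OF module_P lin_comp[OF ra_lin bmap_lin] lin_comp[OF bmap_lin ra_lin]])
      (use assms(1,2) Suc in \<open>auto simp: ra_bcons bmap_bcons algebra_endoD[OF assms(1)] bmap_closed ra_closed\<close>)
qed

lemma bmap_gd:
  assumes "algebra_endo f" "u \<in> carrier (P (Suc n))"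
  shows "bmap n f (gd n u) = gd n (bmap (Suc n) f u)"
  using assms(2)
proof (induction n arbitrary: u)
  case 0
  show ?case
    by (rule barS_eqI[OF module_P lin_comp[OF gd_lin bmap_lin] lin_comp[OF bmap_lin gd_lin] _ 0])
      (use assms in \<open>auto simp: gd_bcons_0 bmap_bcons bmap_closed algebra_endoD[OF assms(1)] bmap_la\<close>)
next
  case (Suc n)
  show ?case
    by (rule barS_eqI[OF module_P lin_comp[OF gd_lin bmap_lin] lin_comp[OF bmap_lin gd_lin] _ Suc.prems])
      (use assms Suc.IH in \<open>auto simp: gd_bcons_Suc bmap_bcons bmap_closed algebra_endoD[OF assms(1)] bmap_la
        lin_minus[OF module_P module_P bmap_lin] la_closed bcons_closed gd_closed\<close>)
qed

lemma bmap_bmap: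
  assumes "algebra_endo f" "algebra_endo g" "algebra_endo h"
    and "\<And>a. a \<in> carrier A \<Longrightarrow> f (g a) = h a" "u \<in> carrier (P n)"
  shows "bmap n f (bmap n g u) = bmap n h u"
  using assms(5)
proof (induction n arbitrary: u)
  case 0
  show ?case
    by (rule bar0_eqI[OF module_P lin_comp[OF bmap_lin bmap_lin] bmap_lin])
      (use assms 0 in \<open>auto simp: bmap_bnil algebra_endoD\<close>)
next
  case (Suc m)
  show ?case
    by (rule barS_eqI[OF module_P lin_comp[OF bmap_lin bmap_lin] bmap_lin])
      (use assms(1-4) Suc in \<open>auto simp: bmap_bcons algebra_endoD bmap_closed\<close>)
qed

lemma bmap_id:
  assumes "algebra_endo f" "\<And>a. a \<in> carrier A \<Longrightarrow> f a = a" "u \<in> carrier (P n)"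
  shows "bmap n f u = u"
  using assms(3)
proof (induction n arbitrary: u)
  case 0
  show ?case
    by (rule bar0_eqI[OF module_P bmap_lin lin_ident]) (use assms 0 in \<open>auto simp: bmap_bnil\<close>)
next
  case (Suc m)
  show ?case
    by (rule barS_eqI[OF module_P bmap_lin lin_ident]) (use assms(1,2) Suc in \<open>auto simp: bmap_bcons\<close>)
qed

end

section \<open>Skew group algebras\<close>

lemma (in group) mult_left_bij: "g \<in> carrier G \<Longrightarrow> bij_betw (\<lambda>h. g \<otimes> h) (carrier G) (carrier G)"
  by (rule bij_betwI[where g = "\<lambda>h. inv g \<otimes> h"]) (auto simp: m_assoc[symmetric])

lemma (in group) mult_right_bij: "g \<in> carrier G \<Longrightarrow> bij_betw (\<lambda>h. h \<otimes> g) (carrier G) (carrier G)"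
  by (rule bij_betwI[where g = "\<lambda>h. h \<otimes> inv g"]) (auto simp: m_assoc)

text \<open>Instantiated twice: with \<open>S\<close> and the given action, and with
  \<open>k\<close> and the trivial action, whose skew group algebra is kG.\<close>

locale skew = S: kalg k S + G: group G
  for k :: "'k ring" and G :: "'g monoid" and S :: "('k, 's) module" and act :: "'g \<Rightarrow> 's \<Rightarrow> 's" +
  assumes fin: "finite (carrier G)"
    and act_lin: "g \<in> carrier G \<Longrightarrow> act g \<in> lin k S S"
    and act_mult: "\<lbrakk>g \<in> carrier G; s \<in> carrier S; t \<in> carrier S\<rbrakk> \<Longrightarrow> act g (s \<otimes>\<^bsub>S\<^esub> t) = act g s \<otimes>\<^bsub>S\<^esub> act g t"
    and act_unit: "g \<in> carrier G \<Longrightarrow> act g \<one>\<^bsub>S\<^esub> = \<one>\<^bsub>S\<^esub>"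
    and act_act: "\<lbrakk>g \<in> carrier G; h \<in> carrier G; s \<in> carrier S\<rbrakk> \<Longrightarrow> act g (act h s) = act (g \<otimes>\<^bsub>G\<^esub> h) s"
    and act_id: "s \<in> carrier S \<Longrightarrow> act \<one>\<^bsub>G\<^esub> s = s"
begin

abbreviation "A \<equiv> skew_group_algebra G S act"

lemmas act_closed = lin_closed[OF act_lin]

lemma skew_simps:
  "carrier A = carrier G \<rightarrow>\<^sub>E carrier S"
  "a \<otimes>\<^bsub>A\<^esub> b = (\<lambda>x\<in>carrier G. \<Oplus>\<^bsub>S\<^esub>g\<in>carrier G. a g \<otimes>\<^bsub>S\<^esub> act g (b (inv\<^bsub>G\<^esub> g \<otimes>\<^bsub>G\<^esub> x)))"
  "\<one>\<^bsub>A\<^esub> = (\<lambda>x\<in>carrier G. if x = \<one>\<^bsub>G\<^esub> then \<one>\<^bsub>S\<^esub> else \<zero>\<^bsub>S\<^esub>)"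
  "\<zero>\<^bsub>A\<^esub> = (\<lambda>x\<in>carrier G. \<zero>\<^bsub>S\<^esub>)"
  "a \<oplus>\<^bsub>A\<^esub> b = (\<lambda>x\<in>carrier G. a x \<oplus>\<^bsub>S\<^esub> b x)"
  "r \<odot>\<^bsub>A\<^esub> a = (\<lambda>x\<in>carrier G. r \<odot>\<^bsub>S\<^esub> a x)"
  by (simp_all add: skew_group_algebra_def)

lemma coeff_closed: "a \<in> carrier A \<Longrightarrow> g \<in> carrier G \<Longrightarrow> a g \<in> carrier S"
  by (auto simp: skew_simps)

lemma add_apply: "x \<in> carrier G \<Longrightarrow> (a \<oplus>\<^bsub>A\<^esub> b) x = a x \<oplus>\<^bsub>S\<^esub> b x"
  by (simp add: skew_simps)

lemma smult_apply: "x \<in> carrier G \<Longrightarrow> (r \<odot>\<^bsub>A\<^esub> a) x = r \<odot>\<^bsub>S\<^esub> a x"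
  by (simp add: skew_simps)

lemma skew_eqI:
  assumes "a \<in> carrier A" "b \<in> carrier A" "\<And>x. x \<in> carrier G \<Longrightarrow> a x = b x"
  shows "a = b"
  using assms unfolding skew_simps by (rule PiE_ext)

lemma module_A: "module k A"
proof (rule moduleI[OF S.cring_k])
  show "abelian_group A"
  proof (rule abelian_groupI)
    fix a assume a: "a \<in> carrier A"
    have "(\<lambda>x\<in>carrier G. \<ominus>\<^bsub>S\<^esub> a x) \<in> carrier A" using a by (auto simp: skew_simps)
    moreover have "(\<lambda>x\<in>carrier G. \<ominus>\<^bsub>S\<^esub> a x) \<oplus>\<^bsub>A\<^esub> a = \<zero>\<^bsub>A\<^esub>"
      using coeff_closed[OF a] by (auto simp: skew_simps S.l_neg intro!: restrict_ext)
    ultimately show "\<exists>b\<in>carrier A. b \<oplus>\<^bsub>A\<^esub> a = \<zero>\<^bsub>A\<^esub>" by blast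
    show "\<zero>\<^bsub>A\<^esub> \<oplus>\<^bsub>A\<^esub> a = a"
      by (rule skew_eqI) (use a coeff_closed[OF a] in \<open>auto simp: skew_simps\<close>)
  next
    fix a b c assume *: "a \<in> carrier A" "b \<in> carrier A" "c \<in> carrier A"
    note [simp] = coeff_closed[OF *(1)] coeff_closed[OF *(2)] coeff_closed[OF *(3)]
    show "a \<oplus>\<^bsub>A\<^esub> b \<in> carrier A" "a \<oplus>\<^bsub>A\<^esub> b = b \<oplus>\<^bsub>A\<^esub> a" "a \<oplus>\<^bsub>A\<^esub> b \<oplus>\<^bsub>A\<^esub> c = a \<oplus>\<^bsub>A\<^esub> (b \<oplus>\<^bsub>A\<^esub> c)"
      by (auto simp: skew_simps(1,5) S.a_ac intro!: restrict_ext)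
  qed (auto simp: skew_simps)
  fix a assume a: "a \<in> carrier A"
  show "\<one>\<^bsub>k\<^esub> \<odot>\<^bsub>A\<^esub> a = a"
    by (rule skew_eqI) (use a coeff_closed[OF a] in \<open>auto simp: skew_simps\<close>)
next
  fix r a assume "r \<in> carrier k" "a \<in> carrier A"
  then show "r \<odot>\<^bsub>A\<^esub> a \<in> carrier A" by (auto simp: skew_simps)
qed (auto simp: skew_simps(5,6) coeff_closed S.smult_l_distr S.smult_r_distr S.smult_assoc1 intro!: restrict_ext)

text \<open>The monomial s g. Monomials span \<open>A\<close> because \<open>G\<close> is finite, so
  linear maps on \<open>A\<close> are determined by them.\<close>

definition el :: "'s \<Rightarrow> 'g \<Rightarrow> 'g \<Rightarrow> 's" where
  "el s g = (\<lambda>x\<in>carrier G. if x = g then s else \<zero>\<^bsub>S\<^esub>)"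

lemma el_closed: "s \<in> carrier S \<Longrightarrow> el s g \<in> carrier A"
  by (auto simp: el_def skew_simps)

lemma el_lin: "(\<lambda>s. el s g) \<in> lin k S A"
  by (rule linI) (auto simp: el_closed, auto simp: el_def skew_simps intro!: restrict_ext)

lemma coeff_lin: "g \<in> carrier G \<Longrightarrow> (\<lambda>a. a g) \<in> lin k A S"
  by (rule linI) (auto simp: skew_simps)

lemma A_finsum_apply:
  assumes "finite I" "\<And>i. i \<in> I \<Longrightarrow> f i \<in> carrier A" "x \<in> carrier G"
  shows "(\<Oplus>\<^bsub>A\<^esub>i\<in>I. f i) x = (\<Oplus>\<^bsub>S\<^esub>i\<in>I. f i x)"
  using lin_finsum[OF module_A S.module_A coeff_lin[OF assms(3)], of I f] assms(2) by simp

lemma A_decompose: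
  assumes a: "a \<in> carrier A"
  shows "a = (\<Oplus>\<^bsub>A\<^esub>g\<in>carrier G. el (a g) g)"
proof (rule skew_eqI[OF a])
  note c = coeff_closed[OF a]
  show "(\<Oplus>\<^bsub>A\<^esub>g\<in>carrier G. el (a g) g) \<in> carrier A"
    by (rule module_finsum_closed[OF module_A]) (rule el_closed[OF c])
  fix x assume x: "x \<in> carrier G"
  have "(\<Oplus>\<^bsub>A\<^esub>g\<in>carrier G. el (a g) g) x = (\<Oplus>\<^bsub>S\<^esub>g\<in>carrier G. el (a g) g x)"
    by (rule A_finsum_apply[OF fin _ x]) (rule el_closed[OF c])
  also have "\<dots> = el (a x) x x"
    by (rule finsum_single[OF S.module_A fin x]) (use x c in \<open>auto simp: el_def\<close>)
  finally show "a x = (\<Oplus>\<^bsub>A\<^esub>g\<in>carrier G. el (a g) g) x" using x by (simp add: el_def)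
qed

lemma A_lin_eqI:
  assumes "module k N" "f \<in> lin k A N" "h \<in> lin k A N"
    and "\<And>s g. s \<in> carrier S \<Longrightarrow> g \<in> carrier G \<Longrightarrow> f (el s g) = h (el s g)" "a \<in> carrier A"
  shows "f a = h a"
proof -
  note c = coeff_closed[OF assms(5)]
  have "f (\<Oplus>\<^bsub>A\<^esub>g\<in>carrier G. el (a g) g) = (\<Oplus>\<^bsub>N\<^esub>g\<in>carrier G. f (el (a g) g))"
    by (rule lin_finsum[OF module_A assms(1,2)]) (rule el_closed[OF c])
  also have "\<dots> = (\<Oplus>\<^bsub>N\<^esub>g\<in>carrier G. h (el (a g) g))"
    by (rule finsum_congI[OF assms(1)]) (use assms(4) c lin_closed[OF assms(3) el_closed[OF c]] in auto)
  also have "\<dots> = h (\<Oplus>\<^bsub>A\<^esub>g\<in>carrier G. el (a g) g)"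
    by (rule lin_finsum[OF module_A assms(1,3), symmetric]) (rule el_closed[OF c])
  finally show ?thesis using A_decompose[OF assms(5)] by simp
qed

lemma sum_lin:
  assumes "module k N" "\<And>g. g \<in> carrier G \<Longrightarrow> F g \<in> lin k S N"
  shows "(\<lambda>a. \<Oplus>\<^bsub>N\<^esub>g\<in>carrier G. F g (a g)) \<in> lin k A N"
  by (rule lin_finsumf[OF assms(1)]) (rule lin_comp[OF coeff_lin assms(2)])

text \<open>All but one summand vanish on a monomial. Together with \<open>sum_lin\<close> this
  makes the sum the linear extension of the prescription \<open>F h s\<close> for s h, the pattern
  by which maps on \<open>A\<close> are defined below.\<close>

lemma sum_el:
  assumes "module k N" "\<And>g. g \<in> carrier G \<Longrightarrow> F g \<in> lin k S N" "s \<in> carrier S" "h \<in> carrier G"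
  shows "(\<Oplus>\<^bsub>N\<^esub>g\<in>carrier G. F g (el s h g)) = F h s"
proof -
  have "(\<Oplus>\<^bsub>N\<^esub>g\<in>carrier G. F g (el s h g)) = F h (el s h h)"
    by (rule finsum_single[OF assms(1) fin assms(4)])
      (use assms lin_closed[OF assms(2)] lin_zero[OF S.module_A assms(1) assms(2)] in \<open>auto simp: el_def\<close>)
  then show ?thesis using assms(4) by (simp add: el_def)
qed

lemma A_mult_apply:
  "x \<in> carrier G \<Longrightarrow> (a \<otimes>\<^bsub>A\<^esub> b) x = (\<Oplus>\<^bsub>S\<^esub>g\<in>carrier G. a g \<otimes>\<^bsub>S\<^esub> act g (b (inv\<^bsub>G\<^esub> g \<otimes>\<^bsub>G\<^esub> x)))"
  by (simp add: skew_simps)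

lemma A_mult_closed:
  assumes "a \<in> carrier A" "b \<in> carrier A"
  shows "a \<otimes>\<^bsub>A\<^esub> b \<in> carrier A"
  using coeff_closed[OF assms(1)] coeff_closed[OF assms(2)]
  by (auto simp: skew_simps(1,2) intro!: module_finsum_closed[OF S.module_A] S.m_closed act_closed)

lemma A_mult_right_lin: "a \<in> carrier A \<Longrightarrow> (\<lambda>b. a \<otimes>\<^bsub>A\<^esub> b) \<in> lin k A A"
proof (rule linI)
  assume a: "a \<in> carrier A"
  note ca = coeff_closed[OF a]
  have l: "(\<lambda>b. (a \<otimes>\<^bsub>A\<^esub> b) x) \<in> lin k A S" if x: "x \<in> carrier G" for x
    unfolding A_mult_apply[OF x]
    by (rule lin_finsumf[OF S.module_A])
      (use ca x in \<open>auto intro!: lin_comp[OF coeff_lin lin_comp[OF act_lin S.mult_left_lin]]\<close>)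
  fix b assume b: "b \<in> carrier A"
  show "a \<otimes>\<^bsub>A\<^esub> b \<in> carrier A" using a b by (rule A_mult_closed)
  { fix c assume c: "c \<in> carrier A"
    show "a \<otimes>\<^bsub>A\<^esub> (b \<oplus>\<^bsub>A\<^esub> c) = a \<otimes>\<^bsub>A\<^esub> b \<oplus>\<^bsub>A\<^esub> a \<otimes>\<^bsub>A\<^esub> c"
      by (rule skew_eqI) (use a b c lin_add[OF l b c] module_add_closed[OF module_A] in
        \<open>auto intro!: A_mult_closed simp: add_apply\<close>) }
  { fix r assume r: "r \<in> carrier k"
    show "a \<otimes>\<^bsub>A\<^esub> (r \<odot>\<^bsub>A\<^esub> b) = r \<odot>\<^bsub>A\<^esub> (a \<otimes>\<^bsub>A\<^esub> b)"
      by (rule skew_eqI) (use a b r lin_smult[OF l r b] module.smult_closed[OF module_A] in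
        \<open>auto intro!: A_mult_closed simp: smult_apply\<close>) }
qed

lemma A_mult_left_lin: "b \<in> carrier A \<Longrightarrow> (\<lambda>a. a \<otimes>\<^bsub>A\<^esub> b) \<in> lin k A A"
proof (rule linI)
  assume b: "b \<in> carrier A"
  note cb = coeff_closed[OF b]
  have l: "(\<lambda>a. (a \<otimes>\<^bsub>A\<^esub> b) x) \<in> lin k A S" if x: "x \<in> carrier G" for x
    unfolding A_mult_apply[OF x]
    by (rule lin_finsumf[OF S.module_A])
      (use cb x in \<open>auto intro!: lin_comp[OF coeff_lin S.mult_right_lin] act_closed\<close>)
  fix a assume a: "a \<in> carrier A"
  show "a \<otimes>\<^bsub>A\<^esub> b \<in> carrier A" using a b by (rule A_mult_closed)
  { fix c assume c: "c \<in> carrier A"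
    show "(a \<oplus>\<^bsub>A\<^esub> c) \<otimes>\<^bsub>A\<^esub> b = a \<otimes>\<^bsub>A\<^esub> b \<oplus>\<^bsub>A\<^esub> c \<otimes>\<^bsub>A\<^esub> b"
      by (rule skew_eqI) (use a b c lin_add[OF l a c] module_add_closed[OF module_A] in
        \<open>auto intro!: A_mult_closed simp: add_apply\<close>) }
  { fix r assume r: "r \<in> carrier k"
    show "(r \<odot>\<^bsub>A\<^esub> a) \<otimes>\<^bsub>A\<^esub> b = r \<odot>\<^bsub>A\<^esub> (a \<otimes>\<^bsub>A\<^esub> b)"
      by (rule skew_eqI) (use a b r lin_smult[OF l r a] module.smult_closed[OF module_A] in
        \<open>auto intro!: A_mult_closed simp: smult_apply\<close>) }
qed

lemma el_mult:
  assumes "s \<in> carrier S" "t \<in> carrier S" "g \<in> carrier G" "h \<in> carrier G"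
  shows "el s g \<otimes>\<^bsub>A\<^esub> el t h = el (s \<otimes>\<^bsub>S\<^esub> act g t) (g \<otimes>\<^bsub>G\<^esub> h)"
proof (rule skew_eqI)
  note c = el_closed[OF assms(1), of g] el_closed[OF assms(2), of h]
  show "el s g \<otimes>\<^bsub>A\<^esub> el t h \<in> carrier A" using c by (rule A_mult_closed)
  show "el (s \<otimes>\<^bsub>S\<^esub> act g t) (g \<otimes>\<^bsub>G\<^esub> h) \<in> carrier A" using assms by (intro el_closed S.m_closed act_closed)
  fix x assume x: "x \<in> carrier G"
  have "(el s g \<otimes>\<^bsub>A\<^esub> el t h) x = s \<otimes>\<^bsub>S\<^esub> act g (el t h (inv\<^bsub>G\<^esub> g \<otimes>\<^bsub>G\<^esub> x))"
    unfolding A_mult_apply[OF x]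
    by (rule sum_el[OF S.module_A, where F = "\<lambda>g' s. s \<otimes>\<^bsub>S\<^esub> act g' (el t h (inv\<^bsub>G\<^esub> g' \<otimes>\<^bsub>G\<^esub> x))"])
      (use assms x in \<open>auto intro!: S.mult_right_lin act_closed coeff_closed[OF c(2)]\<close>)
  also have "\<dots> = el (s \<otimes>\<^bsub>S\<^esub> act g t) (g \<otimes>\<^bsub>G\<^esub> h) x"
  proof -
    have "inv\<^bsub>G\<^esub> g \<otimes>\<^bsub>G\<^esub> x = h \<longleftrightarrow> x = g \<otimes>\<^bsub>G\<^esub> h"
      using assms x by (metis G.inv_closed G.inv_solve_left G.inv_solve_left')
    then show ?thesis using assms x lin_zero[OF S.module_A S.module_A act_lin[OF assms(3)]]
      by (auto simp: el_def)
  qed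
  finally show "(el s g \<otimes>\<^bsub>A\<^esub> el t h) x = el (s \<otimes>\<^bsub>S\<^esub> act g t) (g \<otimes>\<^bsub>G\<^esub> h) x" .
qed

lemma A_one: "\<one>\<^bsub>A\<^esub> = el \<one>\<^bsub>S\<^esub> \<one>\<^bsub>G\<^esub>"
  by (simp add: el_def skew_simps)

lemma k_algebra_A: "k_algebra k A"
proof -
  note rl = A_mult_right_lin and ll = A_mult_left_lin
  have one: "\<one>\<^bsub>A\<^esub> \<in> carrier A" unfolding A_one by (rule el_closed) simp
  have l_one: "\<one>\<^bsub>A\<^esub> \<otimes>\<^bsub>A\<^esub> a = a" if "a \<in> carrier A" for a
    by (rule A_lin_eqI[OF module_A rl[OF one] lin_ident _ that])
      (simp add: A_one el_mult act_id)
  have r_one: "a \<otimes>\<^bsub>A\<^esub> \<one>\<^bsub>A\<^esub> = a" if "a \<in> carrier A" for a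
    by (rule A_lin_eqI[OF module_A ll[OF one] lin_ident _ that])
      (simp add: A_one el_mult act_unit)
  \<comment> \<open>Associativity is checked on monomials, where it expresses that \<open>G\<close>
    acts by multiplicative maps, and then extended by linearity to one argument after the other,
    from the last to the first.\<close>
  have e: "(el s g \<otimes>\<^bsub>A\<^esub> el t h) \<otimes>\<^bsub>A\<^esub> el u x = el s g \<otimes>\<^bsub>A\<^esub> (el t h \<otimes>\<^bsub>A\<^esub> el u x)"
    if "s \<in> carrier S" "g \<in> carrier G" "t \<in> carrier S" "h \<in> carrier G" "u \<in> carrier S" "x \<in> carrier G" for s g t h u x
    using that by (simp add: el_mult act_closed act_mult act_act S.m_assoc G.m_assoc)
  have 1: "(el s g \<otimes>\<^bsub>A\<^esub> el t h) \<otimes>\<^bsub>A\<^esub> c = el s g \<otimes>\<^bsub>A\<^esub> (el t h \<otimes>\<^bsub>A\<^esub> c)"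
    if "s \<in> carrier S" "g \<in> carrier G" "t \<in> carrier S" "h \<in> carrier G" "c \<in> carrier A" for s g t h c
    by (rule A_lin_eqI[OF module_A rl lin_comp[OF rl rl] _ that(5)])
      (use that in \<open>auto intro!: el_closed A_mult_closed e\<close>)
  have 2: "(el s g \<otimes>\<^bsub>A\<^esub> b) \<otimes>\<^bsub>A\<^esub> c = el s g \<otimes>\<^bsub>A\<^esub> (b \<otimes>\<^bsub>A\<^esub> c)"
    if "s \<in> carrier S" "g \<in> carrier G" "b \<in> carrier A" "c \<in> carrier A" for s g b c
    by (rule A_lin_eqI[OF module_A lin_comp[OF rl ll] lin_comp[OF ll rl] _ that(3)])
      (use that in \<open>auto intro!: el_closed A_mult_closed 1\<close>)
  have assoc: "(a \<otimes>\<^bsub>A\<^esub> b) \<otimes>\<^bsub>A\<^esub> c = a \<otimes>\<^bsub>A\<^esub> (b \<otimes>\<^bsub>A\<^esub> c)"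
    if "a \<in> carrier A" "b \<in> carrier A" "c \<in> carrier A" for a b c
    by (rule A_lin_eqI[OF module_A lin_comp[OF ll ll] ll _ that(1)])
      (use that in \<open>auto intro!: el_closed A_mult_closed 2\<close>)
  have "ring A"
  proof (rule ringI)
    show "abelian_group A" by (rule module_abelian[OF module_A])
    show "monoid A" by (rule monoidI) (use one assoc l_one r_one A_mult_closed in auto)
  qed (simp_all add: lin_add[OF rl] lin_add[OF ll])
  then show ?thesis
    by (intro k_algebra.intro k_algebra_axioms.intro module_A)
      (simp_all add: lin_smult[OF rl] lin_smult[OF ll])
qed

sublocale A: kalg k A
  by (rule kalg.intro) (rule k_algebra_A)

lemma A_bar0_eqI:
  assumes "module k N" "f \<in> lin k (A.P 0) N" "h \<in> lin k (A.P 0) N"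
    and "\<And>s g. s \<in> carrier S \<Longrightarrow> g \<in> carrier G \<Longrightarrow> f (A.bnil (el s g)) = h (A.bnil (el s g))"
    and "u \<in> carrier (A.P 0)"
  shows "f u = h u"
  by (rule A.bar0_eqI[OF assms(1-3) _ assms(5)],
    rule A_lin_eqI[OF assms(1) lin_comp[OF A.bnil_lin assms(2)] lin_comp[OF A.bnil_lin assms(3)]])
    (use assms(4) in auto)

lemma A_barS_eqI:
  assumes "module k N" "f \<in> lin k (A.P (Suc n)) N" "h \<in> lin k (A.P (Suc n)) N"
    and "\<And>s g y. s \<in> carrier S \<Longrightarrow> g \<in> carrier G \<Longrightarrow> y \<in> carrier (A.P n) \<Longrightarrow>
      f (A.bcons n (el s g) y) = h (A.bcons n (el s g) y)"
    and "u \<in> carrier (A.P (Suc n))"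
  shows "f u = h u"
proof (rule A.barS_eqI[OF assms(1-3) _ assms(5)])
  fix a y assume a: "a \<in> carrier A" and y: "y \<in> carrier (A.P n)"
  show "f (A.bcons n a y) = h (A.bcons n a y)"
    by (rule A_lin_eqI[OF assms(1) lin_comp[OF bilin_left[OF A.bcons_bilin y] assms(2)]
      lin_comp[OF bilin_left[OF A.bcons_bilin y] assms(3)] _ a]) (rule assms(4)[OF _ _ y])
qed

end

section \<open>The shuffle map\<close>

text \<open>\<open>k\<close> as an algebra over itself, written exactly as in
  \<open>group_algebra\<close>, so that the group algebra is literally an instance of
  \<open>skew_group_algebra\<close>.\<close>

abbreviation ground :: "'k ring \<Rightarrow> ('k, 'k) module" where
  "ground k \<equiv> ring.extend k (module.fields (mult k))"

lemma ground_simps [simp]: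
  "carrier (ground k) = carrier k" "x \<oplus>\<^bsub>ground k\<^esub> y = x \<oplus>\<^bsub>k\<^esub> y" "x \<otimes>\<^bsub>ground k\<^esub> y = x \<otimes>\<^bsub>k\<^esub> y"
  "\<zero>\<^bsub>ground k\<^esub> = \<zero>\<^bsub>k\<^esub>" "\<one>\<^bsub>ground k\<^esub> = \<one>\<^bsub>k\<^esub>" "r \<odot>\<^bsub>ground k\<^esub> x = r \<otimes>\<^bsub>k\<^esub> x"
  by (simp_all add: ring.defs module.defs)

lemma k_algebra_ground:
  assumes "cring k"
  shows "k_algebra k (ground k)"
proof -
  interpret cring k by fact
  have r: "ring (ground k)"
    by (rule ringI; (rule abelian_groupI monoidI)?)
      (auto simp: a_ac m_assoc l_distr r_distr intro: bexI[of _ "\<ominus>\<^bsub>k\<^esub> _"] l_neg)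
  show ?thesis
    by (intro k_algebra.intro k_algebra_axioms.intro moduleI r assms ring.is_abelian_group[OF r])
      (auto simp: l_distr r_distr m_assoc m_comm m_lcomm)
qed

locale twist = skew k G S act + kG: skew k G "ground k" "\<lambda>g r. r"
  for k :: "'k ring" and G :: "'g monoid" and S :: "('k, 's) module" and act :: "'g \<Rightarrow> 's \<Rightarrow> 's"

lemma (in skew) twist: "twist k G S act"
proof -
  have "skew k G (ground k) (\<lambda>g r. r)"
    by (intro skew.intro skew_axioms.intro kalg.intro k_algebra_ground S.cring_k G.group_axioms fin)
      (simp_all add: lin_ident)
  then show ?thesis by (intro twist.intro skew_axioms)
qed

lemma scalar_lin: "module k N \<Longrightarrow> y \<in> carrier N \<Longrightarrow> (\<lambda>r. r \<odot>\<^bsub>N\<^esub> y) \<in> lin k (ground k) N"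
  by (rule linI) (auto simp: module.smult_l_distr module.smult_assoc1 module.smult_closed)

lemma scalar_bilin:
  assumes "module k N"
  shows "bilin k (ground k) N N (\<lambda>r y. r \<odot>\<^bsub>N\<^esub> y)"
  by (rule bilinI) (use assms scalar_lin lin_smultf[OF assms lin_ident] in auto)

lemma bilin_two_lin:
  assumes "bilin k M N P \<beta>" "f \<in> lin k M' M" "g \<in> lin k N' N"
  shows "bilin k M' N' P (\<lambda>x y. \<beta> (f x) (g y))"
  using bilin_comp[OF assms lin_ident] .

lemma bilin_zero_left:
  "module k M \<Longrightarrow> module k P \<Longrightarrow> bilin k M N P \<beta> \<Longrightarrow> y \<in> carrier N \<Longrightarrow> \<beta> \<zero>\<^bsub>M\<^esub> y = \<zero>\<^bsub>P\<^esub>"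
  using lin_zero[of k M P "\<lambda>x. \<beta> x y"] by (simp add: bilin_left)

lemma bilin_zero_right:
  "module k N \<Longrightarrow> module k P \<Longrightarrow> bilin k M N P \<beta> \<Longrightarrow> x \<in> carrier M \<Longrightarrow> \<beta> x \<zero>\<^bsub>N\<^esub> = \<zero>\<^bsub>P\<^esub>"
  by (rule lin_zero[OF _ _ bilin_right])

context twist
begin

abbreviation "PG \<equiv> kG.A.P"
abbreviation "PS \<equiv> S.P"
abbreviation "PA \<equiv> A.P"

definition ge :: "'g \<Rightarrow> 'g \<Rightarrow> 'k" where
  "ge g = kG.el \<one>\<^bsub>k\<^esub> g"

lemma ge_closed: "ge g \<in> carrier kG.A"
  unfolding ge_def by (rule kG.el_closed) simp

lemma ge_mult: "g \<in> carrier G \<Longrightarrow> h \<in> carrier G \<Longrightarrow> ge g \<otimes>\<^bsub>kG.A\<^esub> ge h = ge (g \<otimes>\<^bsub>G\<^esub> h)"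
  unfolding ge_def by (simp add: kG.el_mult)

lemma ge_one: "ge \<one>\<^bsub>G\<^esub> = \<one>\<^bsub>kG.A\<^esub>"
  unfolding ge_def kG.A_one by simp

lemma el_eq_smult: "r \<in> carrier k \<Longrightarrow> kG.el r g = r \<odot>\<^bsub>kG.A\<^esub> ge g"
  using lin_smult[OF kG.el_lin, of r "\<one>\<^bsub>k\<^esub>" g] by (simp add: ge_def)

lemma kG_lin_eqI:
  assumes "module k N" "f \<in> lin k kG.A N" "h \<in> lin k kG.A N"
    and "\<And>g. g \<in> carrier G \<Longrightarrow> f (ge g) = h (ge g)" "a \<in> carrier kG.A"
  shows "f a = h a"
  by (rule kG.A_lin_eqI[OF assms(1-3) _ assms(5)])
    (simp add: el_eq_smult lin_smult[OF assms(2)] lin_smult[OF assms(3)] ge_closed assms(4))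

lemma G_bar0_eqI:
  assumes "module k N" "f \<in> lin k (PG 0) N" "h \<in> lin k (PG 0) N"
    and "\<And>g. g \<in> carrier G \<Longrightarrow> f (kG.A.bnil (ge g)) = h (kG.A.bnil (ge g))"
    and "u \<in> carrier (PG 0)"
  shows "f u = h u"
  by (rule kG.A.bar0_eqI[OF assms(1-3) _ assms(5)],
    rule kG_lin_eqI[OF assms(1) lin_comp[OF kG.A.bnil_lin assms(2)] lin_comp[OF kG.A.bnil_lin assms(3)]])
    (use assms(4) in auto)

lemma G_barS_eqI:
  assumes "module k N" "f \<in> lin k (PG (Suc n)) N" "h \<in> lin k (PG (Suc n)) N"
    and "\<And>g y. g \<in> carrier G \<Longrightarrow> y \<in> carrier (PG n) \<Longrightarrow>
      f (kG.A.bcons n (ge g) y) = h (kG.A.bcons n (ge g) y)"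
    and "u \<in> carrier (PG (Suc n))"
  shows "f u = h u"
proof (rule kG.A.barS_eqI[OF assms(1-3) _ assms(5)])
  fix a y assume a: "a \<in> carrier kG.A" and y: "y \<in> carrier (PG n)"
  show "f (kG.A.bcons n a y) = h (kG.A.bcons n a y)"
    by (rule kG_lin_eqI[OF assms(1) lin_comp[OF bilin_left[OF kG.A.bcons_bilin y] assms(2)]
      lin_comp[OF bilin_left[OF kG.A.bcons_bilin y] assms(3)] _ a]) (rule assms(4)[OF _ y])
qed

section \<open>Augmentation of kG, embedding of S, conjugate contractions\<close>

definition aug :: "(('g \<Rightarrow> 'k) list \<Rightarrow> 'k) set \<Rightarrow> 'k" where
  "aug = linear_ext k (ground k) (\<lambda>xs. \<Oplus>\<^bsub>ground k\<^esub>g\<in>carrier G. hd xs g)"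

lemma aug: "aug \<in> lin k (PG 0) (ground k)" "g \<in> carrier G \<Longrightarrow> aug (kG.A.bnil (ge g)) = \<one>\<^bsub>k\<^esub>"
proof -
  note * = kG.A.ext0[OF kG.S.module_A kG.sum_lin[OF kG.S.module_A lin_ident],
      of "\<lambda>xs. \<Oplus>\<^bsub>ground k\<^esub>g\<in>carrier G. hd xs g", folded aug_def]
  show "aug \<in> lin k (PG 0) (ground k)" by (rule *) simp
  show "aug (kG.A.bnil (ge g)) = \<one>\<^bsub>k\<^esub>" if "g \<in> carrier G"
    using *(2)[OF _ ge_closed, of g] kG.sum_el[OF kG.S.module_A lin_ident, of "\<one>\<^bsub>k\<^esub>" g] that by (simp add: ge_def)
qed

lemmas aug_closed = lin_closed[OF aug(1), simplified]

lemma aug_la: "g \<in> carrier G \<Longrightarrow> u \<in> carrier (PG 0) \<Longrightarrow> aug (kG.A.la 0 (ge g) u) = aug u"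
  by (rule G_bar0_eqI[OF kG.S.module_A lin_comp[OF kG.A.la_lin aug(1)] aug(1)])
    (simp_all add: ge_closed kG.A.la_bnil ge_mult aug)

text \<open>This invariance is the source of \<open>Sh_right_G\<close>: the last group entry of a
  bar will enter the shuffle map through \<open>aug\<close> alone.\<close>

lemma aug_ra: "g \<in> carrier G \<Longrightarrow> u \<in> carrier (PG 0) \<Longrightarrow> aug (kG.A.ra 0 (ge g) u) = aug u"
  by (rule G_bar0_eqI[OF kG.S.module_A lin_comp[OF kG.A.ra_lin aug(1)] aug(1)])
    (simp_all add: ge_closed kG.A.ra_bnil ge_mult aug)

definition emb :: "('s list \<Rightarrow> 'k) set \<Rightarrow> (('g \<Rightarrow> 's) list \<Rightarrow> 'k) set" where
  "emb = linear_ext k (PA 0) (\<lambda>xs. A.bnil (el (hd xs) \<one>\<^bsub>G\<^esub>))"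

lemma emb: "emb \<in> lin k (PS 0) (PA 0)" "s \<in> carrier S \<Longrightarrow> emb (S.bnil s) = A.bnil (el s \<one>\<^bsub>G\<^esub>)"
  using S.ext0[OF A.module_P lin_comp[OF el_lin A.bnil_lin],
    of "\<lambda>xs. A.bnil (el (hd xs) \<one>\<^bsub>G\<^esub>)" "\<one>\<^bsub>G\<^esub>", folded emb_def] by simp_all

lemmas emb_closed = lin_closed[OF emb(1)]

text \<open>The conjugate by \<open>g\<close> of the contraction \<open>y \<mapsto> 1 \<otimes> y\<close> of the bar complex, multiplied by \<open>s\<close>.\<close>

definition kap :: "nat \<Rightarrow> 's \<Rightarrow> 'g \<Rightarrow> (('g \<Rightarrow> 's) list \<Rightarrow> 'k) set \<Rightarrow> (('g \<Rightarrow> 's) list \<Rightarrow> 'k) set" where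
  "kap n s g y = A.la (Suc n) (el s g) (A.bcons n \<one>\<^bsub>A\<^esub> (A.la n (el \<one>\<^bsub>S\<^esub> (inv\<^bsub>G\<^esub> g)) y))"

lemma kap_bilin:
  assumes "g \<in> carrier G"
  shows "bilin k S (PA n) (PA (Suc n)) (\<lambda>s y. kap n s g y)"
  unfolding kap_def
  by (rule bilin_two_lin[OF A.la_bilin el_lin lin_comp[OF A.la_lin A.bcons_lin]])
    (simp_all add: el_closed)

lemma kap_closed: "g \<in> carrier G \<Longrightarrow> s \<in> carrier S \<Longrightarrow> y \<in> carrier (PA n) \<Longrightarrow> kap n s g y \<in> carrier (PA (Suc n))"
  by (rule bilin_closed[OF kap_bilin])

lemma kap_eq:
  assumes "g \<in> carrier G" "s \<in> carrier S" "y \<in> carrier (PA n)"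
  shows "kap n s g y = A.bcons n (el s g) (A.la n (el \<one>\<^bsub>S\<^esub> (inv\<^bsub>G\<^esub> g)) y)"
  using assms by (simp add: kap_def A.la_bcons el_closed A.la_closed)

text \<open>The inverse of \<open>g\<close> in the outer map cancels the \<open>g\<close> at the
  head of the inner value, which leaves a unit as second entry. So a conjugate contraction squares
  to zero, but the composition of two different conjugates need not vanish.\<close>

lemma kap_kap:
  assumes "g \<in> carrier G" "s \<in> carrier S" "y \<in> carrier (PA n)"
  shows "kap (Suc n) s g (kap n \<one>\<^bsub>S\<^esub> g y) = \<zero>\<^bsub>PA (Suc (Suc n))\<^esub>"
  using assms
  by (simp add: kap_eq[OF _ _ kap_closed], simp add: kap_eq A.la_bcons el_closed A.la_closed el_mult
      act_unit A_one[symmetric] A.bcons_unit)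

text \<open>The bilinear extension of the prescription \<open>kap s g (W g u v)\<close> for the pair
  of bars g u and s v. As both arguments are classes of lists, it is one \<open>linear_ext\<close>
  nested in another.\<close>

definition sh_ext where
  "sh_ext i j (W :: 'g \<Rightarrow> (('g \<Rightarrow> 'k) list \<Rightarrow> 'k) set \<Rightarrow> ('s list \<Rightarrow> 'k) set \<Rightarrow> (('g \<Rightarrow> 's) list \<Rightarrow> 'k) set) u v =
     linear_ext k (PA (Suc (i + j))) (\<lambda>us. linear_ext k (PA (Suc (i + j))) (\<lambda>vs.
       \<Oplus>\<^bsub>PA (Suc (i + j))\<^esub>g\<in>carrier G. hd us g \<odot>\<^bsub>PA (Suc (i + j))\<^esub>
         kap (i + j) (hd vs) g (W g (kG.A.bt i (tl us)) (S.bt j (tl vs)))) v) u"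

text \<open>\<open>vG\<close> and \<open>vS\<close> say that a unit at the head of either tail is
  annihilated. They are the premises of \<open>extS\<close> for bars over kG and for bars over
  \<open>S\<close>. Before the outer extension can be formed, the inner one has to be bilinear in
  head and tail of the outer bar.\<close>

lemma sh_ext:
  assumes W: "\<And>g. g \<in> carrier G \<Longrightarrow> bilin k (PG i) (PS j) (PA (i + j)) (W g)"
    and vG: "\<And>m g s u v. i = Suc m \<Longrightarrow> g \<in> carrier G \<Longrightarrow> s \<in> carrier S \<Longrightarrow> u \<in> carrier (PG m) \<Longrightarrow> v \<in> carrier (PS j)
      \<Longrightarrow> kap (i + j) s g (W g (kG.A.bcons m \<one>\<^bsub>kG.A\<^esub> u) v) = \<zero>\<^bsub>PA (Suc (i + j))\<^esub>"
    and vS: "\<And>m g s u v. j = Suc m \<Longrightarrow> g \<in> carrier G \<Longrightarrow> s \<in> carrier S \<Longrightarrow> u \<in> carrier (PG i) \<Longrightarrow> v \<in> carrier (PS m)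
      \<Longrightarrow> kap (i + j) s g (W g u (S.bcons m \<one>\<^bsub>S\<^esub> v)) = \<zero>\<^bsub>PA (Suc (i + j))\<^esub>"
  shows sh_ext_bilin: "bilin k (PG (Suc i)) (PS (Suc j)) (PA (Suc (i + j))) (sh_ext i j W)"
    and sh_ext_bcons: "\<lbrakk>r \<in> carrier kG.A; u \<in> carrier (PG i); s \<in> carrier S; v \<in> carrier (PS j)\<rbrakk> \<Longrightarrow>
      sh_ext i j W (kG.A.bcons i r u) (S.bcons j s v) =
        (\<Oplus>\<^bsub>PA (Suc (i + j))\<^esub>g\<in>carrier G. r g \<odot>\<^bsub>PA (Suc (i + j))\<^esub> kap (i + j) s g (W g u v))"
proof -
  let ?N = "PA (Suc (i + j))"
  let ?T = "\<lambda>g c s u v. c \<odot>\<^bsub>?N\<^esub> kap (i + j) s g (W g u v)"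
  let ?\<Psi> = "\<lambda>r u s v. \<Oplus>\<^bsub>?N\<^esub>g\<in>carrier G. ?T g (r g) s u v"
  let ?IN = "\<lambda>r u V. linear_ext k ?N (\<lambda>vs. ?\<Psi> r u (hd vs) (S.bt j (tl vs))) V"
  note N = A.module_P[of "Suc (i + j)"]
  interpret N: module k ?N by (rule N)
  note cl = kap_closed bilin_closed[OF W]
  have rg: "r g \<in> carrier k" if "r \<in> carrier kG.A" "g \<in> carrier G" for r g
    using kG.coeff_closed[OF that] by simp
  have lr: "(\<lambda>r. ?\<Psi> r u s v) \<in> lin k kG.A ?N" if "u \<in> carrier (PG i)" "s \<in> carrier S" "v \<in> carrier (PS j)" for u s v
    by (rule kG.sum_lin[OF N scalar_lin[OF N]]) (use that in \<open>auto intro!: cl\<close>)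
  have lu: "(\<lambda>u. ?\<Psi> r u s v) \<in> lin k (PG i) ?N" if "r \<in> carrier kG.A" "s \<in> carrier S" "v \<in> carrier (PS j)" for r s v
    by (rule lin_finsumf[OF N], rule lin_smultf[OF N], rule lin_comp[OF bilin_left[OF W] bilin_right[OF kap_bilin]])
      (use that in \<open>auto intro!: rg\<close>)
  have ls: "(\<lambda>s. ?\<Psi> r u s v) \<in> lin k S ?N" if "r \<in> carrier kG.A" "u \<in> carrier (PG i)" "v \<in> carrier (PS j)" for r u v
    by (rule lin_finsumf[OF N], rule lin_smultf[OF N], rule bilin_left[OF kap_bilin])
      (use that in \<open>auto intro!: rg bilin_closed[OF W]\<close>)
  have lv: "(\<lambda>v. ?\<Psi> r u s v) \<in> lin k (PS j) ?N" if "r \<in> carrier kG.A" "u \<in> carrier (PG i)" "s \<in> carrier S" for r u s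
    by (rule lin_finsumf[OF N], rule lin_smultf[OF N], rule lin_comp[OF bilin_right[OF W] bilin_right[OF kap_bilin]])
      (use that in \<open>auto intro!: rg\<close>)
  have b: "bilin k S (PS j) ?N (?\<Psi> r u)" if "r \<in> carrier kG.A" "u \<in> carrier (PG i)" for r u
    by (rule bilinI) (use that ls lv in auto)
  have vS': "?\<Psi> r u s (S.bcons m \<one>\<^bsub>S\<^esub> v) = \<zero>\<^bsub>?N\<^esub>"
    if "r \<in> carrier kG.A" "u \<in> carrier (PG i)" "j = Suc m" "s \<in> carrier S" "v \<in> carrier (PS m)" for r u m s v
    by (rule finsum_zeroI[OF N]) (use that vS[OF that(3)] in \<open>simp add: rg module.smult_r_null[OF A.module_P]\<close>)
  have vG': "?\<Psi> r (kG.A.bcons m \<one>\<^bsub>kG.A\<^esub> u) s v = \<zero>\<^bsub>?N\<^esub>"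
    if "r \<in> carrier kG.A" "u \<in> carrier (PG m)" "i = Suc m" "s \<in> carrier S" "v \<in> carrier (PS j)" for r u m s v
    by (rule finsum_zeroI[OF N]) (use that vG[OF that(3)] in \<open>simp add: rg module.smult_r_null[OF A.module_P]\<close>)
  have IN_lin: "?IN r u \<in> lin k (PS (Suc j)) ?N" if "r \<in> carrier kG.A" "u \<in> carrier (PG i)" for r u
    by (rule S.extS_lin[OF N b[OF that] vS'[OF that]]) auto
  have IN_val: "?IN r u (S.bcons j s v) = ?\<Psi> r u s v"
    if "r \<in> carrier kG.A" "u \<in> carrier (PG i)" "s \<in> carrier S" "v \<in> carrier (PS j)" for r u s v
    by (rule S.extS_bcons[OF N b[OF that(1,2)] vS'[OF that(1,2)] _ that(3,4)]) auto
  \<comment> \<open>Linearity in the head \<open>r\<close> of the first bar is known on generators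
    of the second bar only, and \<open>bilin_PSI\<close> extends it to all \<open>V\<close>; the
    tail \<open>u\<close> is treated in the same way.\<close>
  have IN_r: "(\<lambda>r. ?IN r u V) \<in> lin k kG.A ?N" if u: "u \<in> carrier (PG i)" and V: "V \<in> carrier (PS (Suc j))" for u V
  proof (rule bilin_left[OF S.bilin_PSI[OF N _ _ kG.module_A] V])
    show "?IN r u \<in> lin k (PS (Suc j)) ?N" if "r \<in> carrier kG.A" for r using that u by (rule IN_lin)
    fix s v assume sv: "s \<in> carrier S" "v \<in> carrier (PS j)"
    show "(\<lambda>r. ?IN r u (S.bcons j s v)) \<in> lin k kG.A ?N"
      by (rule lin_cong[OF lr[OF u sv] kG.module_A]) (rule IN_val[OF _ u sv])
  qed
  have IN_u: "(\<lambda>u. ?IN r u V) \<in> lin k (PG i) ?N" if r: "r \<in> carrier kG.A" and V: "V \<in> carrier (PS (Suc j))" for r V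
  proof (rule bilin_left[OF S.bilin_PSI[OF N _ _ kG.A.module_P] V])
    show "?IN r u \<in> lin k (PS (Suc j)) ?N" if "u \<in> carrier (PG i)" for u using r that by (rule IN_lin)
    fix s v assume sv: "s \<in> carrier S" "v \<in> carrier (PS j)"
    show "(\<lambda>u. ?IN r u (S.bcons j s v)) \<in> lin k (PG i) ?N"
      by (rule lin_cong[OF lu[OF r sv] kG.A.module_P]) (rule IN_val[OF r _ sv])
  qed
  have INb: "bilin k kG.A (PG i) ?N (\<lambda>r u. ?IN r u V)" if "V \<in> carrier (PS (Suc j))" for V
    by (rule bilinI) (use that IN_r IN_u in auto)
  have INz: "?IN r (kG.A.bcons m \<one>\<^bsub>kG.A\<^esub> u) V = \<zero>\<^bsub>?N\<^esub>"
    if V: "V \<in> carrier (PS (Suc j))" and m: "i = Suc m" and r: "r \<in> carrier kG.A" and u: "u \<in> carrier (PG m)" for r u V m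
  proof -
    have u1: "kG.A.bcons m \<one>\<^bsub>kG.A\<^esub> u \<in> carrier (PG i)" unfolding m by (rule kG.A.bcons_closed) (use u in auto)
    show ?thesis
      by (rule S.barS_eqI[OF N IN_lin[OF r u1] lin_zerof[OF N] _ V])
        (simp only: IN_val[OF r u1] vG'[OF r u m])
  qed
  have l: "(\<lambda>u. sh_ext i j W u V) \<in> lin k (PG (Suc i)) ?N" if "V \<in> carrier (PS (Suc j))" for V
    unfolding sh_ext_def
    by (rule kG.A.extS_lin[OF N INb[OF that] INz[OF that]]) auto
  have v: "sh_ext i j W (kG.A.bcons i r u) V = ?IN r u V"
    if "V \<in> carrier (PS (Suc j))" "r \<in> carrier kG.A" "u \<in> carrier (PG i)" for r u V
    unfolding sh_ext_def
    by (rule kG.A.extS_bcons[OF N INb[OF that(1)] INz[OF that(1)] _ that(2,3)]) auto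
  \<comment> \<open>The arguments are exchanged because \<open>bilin_PSI\<close> tests on bars in
    the second argument, and here these are the bars over kG.\<close>
  have "bilin k (PS (Suc j)) (PG (Suc i)) ?N (\<lambda>V u. sh_ext i j W u V)"
  proof (rule kG.A.bilin_PSI[OF N l _ S.module_P])
    fix r u assume ru: "r \<in> carrier kG.A" "u \<in> carrier (PG i)"
    show "(\<lambda>V. sh_ext i j W (kG.A.bcons i r u) V) \<in> lin k (PS (Suc j)) ?N"
      by (rule lin_cong[OF IN_lin[OF ru] S.module_P]) (rule v[OF _ ru])
  qed
  then show "bilin k (PG (Suc i)) (PS (Suc j)) ?N (sh_ext i j W)" by (simp add: bilin_def)
  show "sh_ext i j W (kG.A.bcons i r u) (S.bcons j s v) = ?\<Psi> r u s v"
    if "r \<in> carrier kG.A" "u \<in> carrier (PG i)" "s \<in> carrier S" "v \<in> carrier (PS j)"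
    using v[OF S.bcons_closed[OF that(3,4)] that(1,2)] IN_val[OF that] by simp
qed

text \<open>
  On \<open>g u \<otimes> s v\<close> the shuffle map is \<open>kap\<close> applied to \<open>W g u v\<close>, the image under lower shuffle maps
  of the differential of \<open>g u \<otimes> 1 v\<close> without the terms that \<open>kap\<close> annihilates.
\<close>

fun Sh :: "nat \<Rightarrow> nat \<Rightarrow> (('g \<Rightarrow> 'k) list \<Rightarrow> 'k) set \<Rightarrow> ('s list \<Rightarrow> 'k) set \<Rightarrow> (('g \<Rightarrow> 's) list \<Rightarrow> 'k) set" where
  "Sh 0 0 = sh_ext 0 0 (\<lambda>g u v. aug u \<odot>\<^bsub>PA 0\<^esub> emb v)"
| "Sh (Suc i) 0 = sh_ext (Suc i) 0 (\<lambda>g u v. Sh i 0 (kG.A.la (Suc i) (ge g) u) (S.bcons 0 \<one>\<^bsub>S\<^esub> v))"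
| "Sh 0 (Suc j) = sh_ext 0 (Suc j) (\<lambda>g u v. Sh 0 j (kG.A.bcons 0 (ge g) u) v)"
| "Sh (Suc i) (Suc j) = sh_ext (Suc i) (Suc j) (\<lambda>g u v.
     Sh i (Suc j) (kG.A.la (Suc i) (ge g) u) (S.bcons (Suc j) \<one>\<^bsub>S\<^esub> v) \<oplus>\<^bsub>PA (Suc (Suc (i + j)))\<^esub>
     signed (PA (Suc (Suc (i + j)))) (Suc i) (Sh (Suc i) j (kG.A.bcons (Suc i) (ge g) u) v))"

text \<open>The inner maps of \<open>Sh\<close>, repeated under a name of their own;
  \<open>Sh_eq\<close> identifies the two. The summands come from d(g \<otimes> u) = g u - g
  \<otimes> d u and d(1 \<otimes> v) = v - 1 \<otimes> d v. The subtracted terms have shuffles in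
  the image of \<open>kap\<close> for the same \<open>g\<close> and are dropped. The sign exponent
  \<open>Suc i\<close> is the bar degree of g \<otimes> u.\<close>

fun W :: "nat \<Rightarrow> nat \<Rightarrow> 'g \<Rightarrow> (('g \<Rightarrow> 'k) list \<Rightarrow> 'k) set \<Rightarrow> ('s list \<Rightarrow> 'k) set \<Rightarrow> (('g \<Rightarrow> 's) list \<Rightarrow> 'k) set" where
  "W 0 0 g u v = aug u \<odot>\<^bsub>PA 0\<^esub> emb v"
| "W (Suc i) 0 g u v = Sh i 0 (kG.A.la (Suc i) (ge g) u) (S.bcons 0 \<one>\<^bsub>S\<^esub> v)"
| "W 0 (Suc j) g u v = Sh 0 j (kG.A.bcons 0 (ge g) u) v"
| "W (Suc i) (Suc j) g u v =
     Sh i (Suc j) (kG.A.la (Suc i) (ge g) u) (S.bcons (Suc j) \<one>\<^bsub>S\<^esub> v) \<oplus>\<^bsub>PA (Suc (Suc (i + j)))\<^esub>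
     signed (PA (Suc (Suc (i + j)))) (Suc i) (Sh (Suc i) j (kG.A.bcons (Suc i) (ge g) u) v)"

lemma W_ext:
  "W 0 0 g = (\<lambda>u v. aug u \<odot>\<^bsub>PA 0\<^esub> emb v)"
  "W (Suc i) 0 g = (\<lambda>u v. Sh i 0 (kG.A.la (Suc i) (ge g) u) (S.bcons 0 \<one>\<^bsub>S\<^esub> v))"
  "W 0 (Suc j) g = (\<lambda>u v. Sh 0 j (kG.A.bcons 0 (ge g) u) v)"
  "W (Suc i) (Suc j) g = (\<lambda>u v.
     Sh i (Suc j) (kG.A.la (Suc i) (ge g) u) (S.bcons (Suc j) \<one>\<^bsub>S\<^esub> v) \<oplus>\<^bsub>PA (Suc (Suc (i + j)))\<^esub>
     signed (PA (Suc (Suc (i + j)))) (Suc i) (Sh (Suc i) j (kG.A.bcons (Suc i) (ge g) u) v))"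
  by (simp_all add: fun_eq_iff)

lemma Sh_eq: "Sh i j = sh_ext i j (W i j)"
  by (cases i; cases j) (simp_all add: fun_eq_iff sh_ext_def)

text \<open>Carried through the induction as one statement, because the recursion formula in lower
  bidegrees is what shows that \<open>Sh\<close> is well defined in the next one.\<close>

definition sh_rule :: "nat \<Rightarrow> nat \<Rightarrow> bool" where
  "sh_rule i j \<longleftrightarrow> bilin k (PG (Suc i)) (PS (Suc j)) (PA (Suc (i + j))) (Sh i j) \<and>
     (\<forall>g\<in>carrier G. bilin k (PG i) (PS j) (PA (i + j)) (W i j g)) \<and>
     (\<forall>g\<in>carrier G. \<forall>s\<in>carrier S. \<forall>u\<in>carrier (PG i). \<forall>v\<in>carrier (PS j).
        Sh i j (kG.A.bcons i (ge g) u) (S.bcons j s v) = kap (i + j) s g (W i j g u v))"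

lemma sh_ruleI:
  assumes W: "\<And>g. g \<in> carrier G \<Longrightarrow> bilin k (PG i) (PS j) (PA (i + j)) (W i j g)"
    and vG: "\<And>m g s u v. i = Suc m \<Longrightarrow> g \<in> carrier G \<Longrightarrow> s \<in> carrier S \<Longrightarrow> u \<in> carrier (PG m) \<Longrightarrow> v \<in> carrier (PS j)
      \<Longrightarrow> kap (i + j) s g (W i j g (kG.A.bcons m \<one>\<^bsub>kG.A\<^esub> u) v) = \<zero>\<^bsub>PA (Suc (i + j))\<^esub>"
    and vS: "\<And>m g s u v. j = Suc m \<Longrightarrow> g \<in> carrier G \<Longrightarrow> s \<in> carrier S \<Longrightarrow> u \<in> carrier (PG i) \<Longrightarrow> v \<in> carrier (PS m)
      \<Longrightarrow> kap (i + j) s g (W i j g u (S.bcons m \<one>\<^bsub>S\<^esub> v)) = \<zero>\<^bsub>PA (Suc (i + j))\<^esub>"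
  shows "sh_rule i j"
proof -
  note N = A.module_P[of "Suc (i + j)"]
  have b: "bilin k (PG (Suc i)) (PS (Suc j)) (PA (Suc (i + j))) (Sh i j)"
    unfolding Sh_eq by (rule sh_ext_bilin[OF W vG vS])
  have val: "Sh i j (kG.A.bcons i r u) (S.bcons j s v) =
        (\<Oplus>\<^bsub>PA (Suc (i + j))\<^esub>g\<in>carrier G. r g \<odot>\<^bsub>PA (Suc (i + j))\<^esub> kap (i + j) s g (W i j g u v))"
    if "r \<in> carrier kG.A" "u \<in> carrier (PG i)" "s \<in> carrier S" "v \<in> carrier (PS j)" for r u s v
    unfolding Sh_eq by (rule sh_ext_bcons[OF W vG vS that])
  have "Sh i j (kG.A.bcons i (ge g) u) (S.bcons j s v) = kap (i + j) s g (W i j g u v)"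
    if "g \<in> carrier G" "s \<in> carrier S" "u \<in> carrier (PG i)" "v \<in> carrier (PS j)" for g s u v
  proof -
    note c = kap_closed[OF _ that(2) bilin_closed[OF W that(3,4)]]
    have "Sh i j (kG.A.bcons i (ge g) u) (S.bcons j s v)
        = \<one>\<^bsub>k\<^esub> \<odot>\<^bsub>PA (Suc (i + j))\<^esub> kap (i + j) s g (W i j g u v)"
      unfolding val[OF ge_closed that(3,2,4)] unfolding ge_def
      by (rule kG.sum_el[OF N scalar_lin[OF N c]]) (use that in auto)
    then show ?thesis using module.smult_one[OF N c[OF that(1) that(1)]] by simp
  qed
  then show ?thesis using b W by (simp add: sh_rule_def)
qed

lemma sh_ruleD:
  assumes "sh_rule i j"
  shows "bilin k (PG (Suc i)) (PS (Suc j)) (PA (Suc (i + j))) (Sh i j)"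
    and "g \<in> carrier G \<Longrightarrow> bilin k (PG i) (PS j) (PA (i + j)) (W i j g)"
    and "\<lbrakk>g \<in> carrier G; s \<in> carrier S; u \<in> carrier (PG i); v \<in> carrier (PS j)\<rbrakk> \<Longrightarrow>
        Sh i j (kG.A.bcons i (ge g) u) (S.bcons j s v) = kap (i + j) s g (W i j g u v)"
  using assms by (simp_all add: sh_rule_def)

lemma la_bcons_one:
  "g \<in> carrier G \<Longrightarrow> u \<in> carrier (PG m) \<Longrightarrow> kG.A.la (Suc m) (ge g) (kG.A.bcons m \<one>\<^bsub>kG.A\<^esub> u) = kG.A.bcons m (ge g) u"
  by (simp add: kG.A.la_bcons ge_closed)

text \<open>If a tail begins with a unit, then what normalization leaves of \<open>W\<close> is, up
  to sign, a lower shuffle whose value has the form of \<open>kap\<close> for the unit of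
  \<open>S\<close> and the same \<open>g\<close>. By \<open>kap_kap\<close> the outer
  \<open>kap\<close> annihilates it, which is the condition for \<open>Sh\<close> to be well
  defined.\<close>

lemma sh_rule: "sh_rule i j"
proof (induction i j rule: Sh.induct)
  case 1
  show ?case
  proof (rule sh_ruleI)
    show "bilin k (PG 0) (PS 0) (PA (0 + 0)) (W 0 0 g)" for g
      using bilin_two_lin[OF scalar_bilin[OF A.module_P] aug(1) emb(1)] by (simp add: W_ext)
  qed auto
next
  case (2 i)
  note Q = sh_ruleD[OF 2, simplified]
  show ?case
  proof (rule sh_ruleI)
    show "bilin k (PG (Suc i)) (PS 0) (PA (Suc i + 0)) (W (Suc i) 0 g)" if "g \<in> carrier G" for g
      using bilin_two_lin[OF Q(1) kG.A.la_lin[OF ge_closed] S.bcons_lin[of "\<one>\<^bsub>S\<^esub>" 0]] by (simp add: W_ext)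
    fix m g s u v
    assume "Suc i = Suc m" and *: "g \<in> carrier G" "s \<in> carrier S" "u \<in> carrier (PG m)" "v \<in> carrier (PS 0)"
    then have m: "m = i" by simp
    show "kap (Suc i + 0) s g (W (Suc i) 0 g (kG.A.bcons m \<one>\<^bsub>kG.A\<^esub> u) v) = \<zero>\<^bsub>PA (Suc (Suc i + 0))\<^esub>"
      using * unfolding m using kap_kap[of g s "W i 0 g u v" i] bilin_closed[OF Q(2)] by (simp add: la_bcons_one Q(3))
  qed auto
next
  case (3 j)
  note Q = sh_ruleD[OF 3, simplified]
  show ?case
  proof (rule sh_ruleI)
    show "bilin k (PG 0) (PS (Suc j)) (PA (0 + Suc j)) (W 0 (Suc j) g)" if "g \<in> carrier G" for g
      using bilin_two_lin[OF Q(1) kG.A.bcons_lin[OF ge_closed] lin_ident] by (simp add: W_ext)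
    fix m g s u v
    assume "Suc j = Suc m" and *: "g \<in> carrier G" "s \<in> carrier S" "u \<in> carrier (PG 0)" "v \<in> carrier (PS m)"
    then have m: "m = j" by simp
    show "kap (0 + Suc j) s g (W 0 (Suc j) g u (S.bcons m \<one>\<^bsub>S\<^esub> v)) = \<zero>\<^bsub>PA (Suc (0 + Suc j))\<^esub>"
      using * unfolding m using kap_kap[of g s "W 0 j g u v" j] bilin_closed[OF Q(2)] by (simp add: Q(3))
  qed auto
next
  case (4 i j)
  note Q1 = sh_ruleD[OF 4(1), simplified] and Q2 = sh_ruleD[OF 4(2), simplified]
  let ?N = "PA (Suc (Suc (i + j)))"
  have z: "signed ?N n \<zero>\<^bsub>?N\<^esub> = \<zero>\<^bsub>?N\<^esub>" for n
    using lin_zero[OF A.module_P A.module_P lin_signedf[OF A.module_P lin_ident]] by simp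
  note sc = signed_closed[OF A.module_P]
  note c1 = bilin_closed[OF Q1(1)] and c2 = bilin_closed[OF Q2(1)]
  interpret N: module k ?N by (rule A.module_P)
  have lW1: "kG.A.la (Suc i) (ge g) u \<in> carrier (PG (Suc i))" if "u \<in> carrier (PG (Suc i))" for u g
    using that by (intro kG.A.la_closed ge_closed)
  show ?case
  proof (rule sh_ruleI)
    show "bilin k (PG (Suc i)) (PS (Suc j)) (PA (Suc i + Suc j)) (W (Suc i) (Suc j) g)" if "g \<in> carrier G" for g
    proof -
      note b1 = bilin_two_lin[OF Q1(1) kG.A.la_lin[OF ge_closed, of "Suc i" g] S.bcons_lin[OF S.one_closed]]
      note b2 = bilin_two_lin[OF Q2(1) kG.A.bcons_lin[OF ge_closed, of "Suc i" g] lin_ident]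
      show ?thesis
        using bilin_addf[OF A.module_P b1 bilin_signedf[OF A.module_P b2, of "Suc i"]] by (simp add: W_ext)
    qed
  next
    fix m g s u v
    assume "Suc i = Suc m" and *: "g \<in> carrier G" "s \<in> carrier S" "v \<in> carrier (PS (Suc j))" and "u \<in> carrier (PG m)"
    then have u: "u \<in> carrier (PG i)" and m: "m = i" by simp_all
    have "W (Suc i) (Suc j) g (kG.A.bcons i \<one>\<^bsub>kG.A\<^esub> u) v = kap (Suc (i + j)) \<one>\<^bsub>S\<^esub> g (W i (Suc j) g u v)"
      using * u bilin_zero_left[OF kG.A.module_P A.module_P Q2(1)] kap_closed[OF *(1) _ bilin_closed[OF Q1(2)]]
      by (simp add: la_bcons_one Q1(3) kG.A.bcons_unit ge_closed z)
    then show "kap (Suc i + Suc j) s g (W (Suc i) (Suc j) g (kG.A.bcons m \<one>\<^bsub>kG.A\<^esub> u) v) = \<zero>\<^bsub>PA (Suc (Suc i + Suc j))\<^esub>"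
      using kap_kap[of g s "W i (Suc j) g u v" "Suc (i + j)"] bilin_closed[OF Q1(2)] * u m
      by (simp del: W.simps)
  next
    fix m g s u v
    assume "Suc j = Suc m" and *: "g \<in> carrier G" "s \<in> carrier S" "u \<in> carrier (PG (Suc i))" and "v \<in> carrier (PS m)"
    then have v: "v \<in> carrier (PS j)" and m: "m = j" by simp_all
    have "W (Suc i) (Suc j) g u (S.bcons j \<one>\<^bsub>S\<^esub> v) = signed ?N (Suc i) (kap (Suc (i + j)) \<one>\<^bsub>S\<^esub> g (W (Suc i) j g u v))"
      using * v bilin_zero_right[OF S.module_P A.module_P Q1(1)] kap_closed[OF *(1) _ bilin_closed[OF Q2(2)]] lW1
      by (simp add: Q2(3) S.bcons_unit sc)
    then show "kap (Suc i + Suc j) s g (W (Suc i) (Suc j) g u (S.bcons m \<one>\<^bsub>S\<^esub> v)) = \<zero>\<^bsub>PA (Suc (Suc i + Suc j))\<^esub>"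
      using kap_kap[of g s "W (Suc i) j g u v" "Suc (i + j)"] bilin_closed[OF Q2(2)] * v m
        lin_signed[OF A.module_P A.module_P bilin_right[OF kap_bilin[OF *(1)] *(2)], of "kap (Suc (i + j)) \<one>\<^bsub>S\<^esub> g (W (Suc i) j g u v)" "Suc (Suc (i + j))" "Suc i"]
        kap_closed[OF *(1) _ bilin_closed[OF Q2(2)]]
        lin_zero[OF A.module_P A.module_P lin_signedf[OF A.module_P lin_ident]]
      by (simp del: W.simps)
  qed
qed

lemmas Sh_bilin = sh_ruleD(1)[OF sh_rule]
  and W_bilin = sh_ruleD(2)[OF sh_rule]
  and Sh_bcons = sh_ruleD(3)[OF sh_rule]

lemmas Sh_closed = bilin_closed[OF Sh_bilin]
  and W_closed = bilin_closed[OF W_bilin]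

lemma Sh_eqI:
  assumes N: "module k N" and b: "bilin k (PG (Suc i)) (PS (Suc j)) N \<beta>" "bilin k (PG (Suc i)) (PS (Suc j)) N \<gamma>"
    and eq: "\<And>g u s v. g \<in> carrier G \<Longrightarrow> u \<in> carrier (PG i) \<Longrightarrow> s \<in> carrier S \<Longrightarrow> v \<in> carrier (PS j) \<Longrightarrow>
      \<beta> (kG.A.bcons i (ge g) u) (S.bcons j s v) = \<gamma> (kG.A.bcons i (ge g) u) (S.bcons j s v)"
    and U: "U \<in> carrier (PG (Suc i))" and V: "V \<in> carrier (PS (Suc j))"
  shows "\<beta> U V = \<gamma> U V"
proof (rule G_barS_eqI[OF N bilin_left[OF b(1) V] bilin_left[OF b(2) V] _ U])
  fix g u assume g: "g \<in> carrier G" and u: "u \<in> carrier (PG i)"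
  have c: "kG.A.bcons i (ge g) u \<in> carrier (PG (Suc i))" using u by (intro kG.A.bcons_closed ge_closed)
  show "\<beta> (kG.A.bcons i (ge g) u) V = \<gamma> (kG.A.bcons i (ge g) u) V"
    by (rule S.barS_eqI[OF N bilin_right[OF b(1) c] bilin_right[OF b(2) c] eq[OF g u] V])
qed

end

lemma module_l_zero: "module k M \<Longrightarrow> x \<in> carrier M \<Longrightarrow> \<zero>\<^bsub>M\<^esub> \<oplus>\<^bsub>M\<^esub> x = x"
  by (drule module_abelian) (simp add: abelian_group.axioms(1) abelian_monoid.l_zero)

lemma module_r_zero: "module k M \<Longrightarrow> x \<in> carrier M \<Longrightarrow> x \<oplus>\<^bsub>M\<^esub> \<zero>\<^bsub>M\<^esub> = x"
  by (drule module_abelian) (simp add: abelian_group.axioms(1) abelian_monoid.r_zero)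

lemma module_minus_closed:
  "module k M \<Longrightarrow> x \<in> carrier M \<Longrightarrow> y \<in> carrier M \<Longrightarrow> x \<ominus>\<^bsub>M\<^esub> y \<in> carrier M"
  by (drule module_abelian) (simp add: abelian_group.minus_closed)

context twist
begin

section \<open>Equivariance of the shuffle map\<close>

lemma act_endo: "g \<in> carrier G \<Longrightarrow> S.algebra_endo (act g)"
  unfolding S.algebra_endo_def by (simp add: act_lin act_unit act_mult)

lemma kap_left:
  assumes "s \<in> carrier S" "t \<in> carrier S" "g \<in> carrier G" "y \<in> carrier (PA n)"
  shows "A.la (Suc n) (el s \<one>\<^bsub>G\<^esub>) (kap n t g y) = kap n (s \<otimes>\<^bsub>S\<^esub> t) g y"
  using assms by (simp add: kap_eq A.la_bcons A.la_closed el_closed el_mult act_id)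

text \<open>The group permutes the conjugate contractions, because the inverse of h g times
  \<open>h\<close> is the inverse of \<open>g\<close>.\<close>

lemma kap_left_G:
  assumes "h \<in> carrier G" "t \<in> carrier S" "g \<in> carrier G" "y \<in> carrier (PA n)"
  shows "A.la (Suc n) (el \<one>\<^bsub>S\<^esub> h) (kap n t g y) = kap n (act h t) (h \<otimes>\<^bsub>G\<^esub> g) (A.la n (el \<one>\<^bsub>S\<^esub> h) y)"
proof -
  have "inv\<^bsub>G\<^esub> (h \<otimes>\<^bsub>G\<^esub> g) \<otimes>\<^bsub>G\<^esub> h = inv\<^bsub>G\<^esub> g"
    using assms by (simp add: G.inv_mult_group G.m_assoc)
  then show ?thesis
    using assms by (simp add: kap_eq A.la_bcons A.la_closed el_closed el_mult act_closed A.la_la act_unit)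
qed

lemma kap_right:
  assumes "s \<in> carrier S" "g \<in> carrier G" "b \<in> carrier A" "y \<in> carrier (PA n)"
  shows "A.ra (Suc n) b (kap n s g y) = kap n s g (A.ra n b y)"
  using assms by (simp add: kap_eq A.ra_bcons A.ra_la A.la_closed A.ra_closed el_closed)

lemma gd_kap_0:
  assumes "s \<in> carrier S" "g \<in> carrier G" "y \<in> carrier (PA 0)"
  shows "A.gd 0 (kap 0 s g y) = A.la 0 (el s \<one>\<^bsub>G\<^esub>) y"
  using assms by (simp add: kap_eq A.gd_bcons_0 A.la_closed el_closed A.la_la el_mult act_unit)

text \<open>The contraction identity d h + h d = 1, conjugated by \<open>g\<close> and multiplied by
  \<open>s\<close>.\<close>

lemma gd_kap_Suc:
  assumes "s \<in> carrier S" "g \<in> carrier G" "y \<in> carrier (PA (Suc n))"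
  shows "A.gd (Suc n) (kap (Suc n) s g y) = A.la (Suc n) (el s \<one>\<^bsub>G\<^esub>) y \<ominus>\<^bsub>PA (Suc n)\<^esub> kap n s g (A.gd n y)"
  using assms
  by (simp add: kap_eq A.gd_bcons_Suc A.la_closed el_closed A.la_la el_mult act_unit A.gd_la A.gd_closed)

lemma emb_la: "s \<in> carrier S \<Longrightarrow> v \<in> carrier (PS 0) \<Longrightarrow> emb (S.la 0 s v) = A.la 0 (el s \<one>\<^bsub>G\<^esub>) (emb v)"
  by (rule S.bar0_eqI[OF A.module_P lin_comp[OF S.la_lin emb(1)] lin_comp[OF emb(1) A.la_lin]])
    (simp_all add: S.la_bnil emb A.la_bnil el_closed el_mult act_id)

lemma emb_ra: "s \<in> carrier S \<Longrightarrow> v \<in> carrier (PS 0) \<Longrightarrow> emb (S.ra 0 s v) = A.ra 0 (el s \<one>\<^bsub>G\<^esub>) (emb v)"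
  by (rule S.bar0_eqI[OF A.module_P lin_comp[OF S.ra_lin emb(1)] lin_comp[OF emb(1) A.ra_lin]])
    (simp_all add: S.ra_bnil emb A.ra_bnil el_closed el_mult act_id)

text \<open>Conjugation by \<open>h\<close>, the counterpart on bars over \<open>A\<close> of the
  diagonal action of \<open>h\<close> on bars over \<open>S\<close>.\<close>

definition conj :: "nat \<Rightarrow> 'g \<Rightarrow> (('g \<Rightarrow> 's) list \<Rightarrow> 'k) set \<Rightarrow> (('g \<Rightarrow> 's) list \<Rightarrow> 'k) set" where
  "conj n h y = A.la n (el \<one>\<^bsub>S\<^esub> h) (A.ra n (el \<one>\<^bsub>S\<^esub> (inv\<^bsub>G\<^esub> h)) y)"

lemma conj_lin: "conj n h \<in> lin k (PA n) (PA n)"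
  unfolding conj_def by (rule lin_comp[OF A.ra_lin A.la_lin]) (simp_all add: el_closed)

lemma conj_kap:
  "\<lbrakk>h \<in> carrier G; s \<in> carrier S; g \<in> carrier G; y \<in> carrier (PA n)\<rbrakk>
    \<Longrightarrow> conj (Suc n) h (kap n s g y) = kap n (act h s) (h \<otimes>\<^bsub>G\<^esub> g) (conj n h y)"
  by (simp add: conj_def kap_right kap_left_G el_closed A.ra_closed)

lemma emb_conj:
  "h \<in> carrier G \<Longrightarrow> v \<in> carrier (PS 0) \<Longrightarrow> emb (S.bmap 0 (act h) v) = conj 0 h (emb v)"
  by (rule S.bar0_eqI[OF A.module_P lin_comp[OF S.bmap_lin emb(1)] lin_comp[OF emb(1) conj_lin]])
    (simp_all add: act_endo S.bmap_bnil emb act_closed conj_def A.ra_bnil A.la_bnil el_closed el_mult act_id)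

text \<open>\<open>fG n\<close> operates on degree \<open>Suc n\<close>, where \<open>fU n\<close> is its effect on the tail of a tensor.\<close>

lemma Sh_natural:
  assumes p: "\<And>g. g \<in> carrier G \<Longrightarrow> p g \<in> carrier G"
    and q: "\<And>s. s \<in> carrier S \<Longrightarrow> q s \<in> carrier S" "q \<one>\<^bsub>S\<^esub> = \<one>\<^bsub>S\<^esub>"
    and fG: "\<And>n. fG n \<in> lin k (PG (Suc n)) (PG (Suc n))"
    and fU: "\<And>n. fU n \<in> lin k (PG n) (PG n)"
    and fS: "\<And>n. fS n \<in> lin k (PS n) (PS n)"
    and F: "\<And>n. F n \<in> lin k (PA n) (PA n)"
    and fG_bcons: "\<And>n g u. g \<in> carrier G \<Longrightarrow> u \<in> carrier (PG n) \<Longrightarrow>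
      fG n (kG.A.bcons n (ge g) u) = kG.A.bcons n (ge (p g)) (fU n u)"
    and fG_la: "\<And>n g u. g \<in> carrier G \<Longrightarrow> u \<in> carrier (PG (Suc n)) \<Longrightarrow>
      fG n (kG.A.la (Suc n) (ge g) u) = kG.A.la (Suc n) (ge (p g)) (fU (Suc n) u)"
    and aug_fU: "\<And>u. u \<in> carrier (PG 0) \<Longrightarrow> aug (fU 0 u) = aug u"
    and fS_bcons: "\<And>n s v. s \<in> carrier S \<Longrightarrow> v \<in> carrier (PS n) \<Longrightarrow>
      fS (Suc n) (S.bcons n s v) = S.bcons n (q s) (fS n v)"
    and emb_fS: "\<And>v. v \<in> carrier (PS 0) \<Longrightarrow> emb (fS 0 v) = F 0 (emb v)"
    and F_kap: "\<And>n s g y. s \<in> carrier S \<Longrightarrow> g \<in> carrier G \<Longrightarrow> y \<in> carrier (PA n) \<Longrightarrow>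
      F (Suc n) (kap n s g y) = kap n (q s) (p g) (F n y)"
    and U: "U \<in> carrier (PG (Suc i))" and V: "V \<in> carrier (PS (Suc j))"
  shows "Sh i j (fG i U) (fS (Suc j) V) = F (Suc (i + j)) (Sh i j U V)"
proof -
  note cl = lin_closed[OF fU] lin_closed[OF fS] lin_closed[OF fG] lin_closed[OF F]
  \<comment> \<open>By the recursion for \<open>Sh\<close>, compatibility of the inner maps
    \<open>W\<close> is enough; the induction then runs over the cases of their definition.\<close>
  have step: "\<forall>U\<in>carrier (PG (Suc i)). \<forall>V\<in>carrier (PS (Suc j)).
      Sh i j (fG i U) (fS (Suc j) V) = F (Suc (i + j)) (Sh i j U V)"
    if W: "\<And>g u v. g \<in> carrier G \<Longrightarrow> u \<in> carrier (PG i) \<Longrightarrow> v \<in> carrier (PS j) \<Longrightarrow>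
      W i j (p g) (fU i u) (fS j v) = F (i + j) (W i j g u v)" for i j
  proof (intro ballI)
    fix U V assume "U \<in> carrier (PG (Suc i))" "V \<in> carrier (PS (Suc j))"
    then show "Sh i j (fG i U) (fS (Suc j) V) = F (Suc (i + j)) (Sh i j U V)"
      by (rule Sh_eqI[OF A.module_P bilin_two_lin[OF Sh_bilin fG fS] bilin_comp[OF Sh_bilin lin_ident lin_ident F], rotated 1])
        (simp add: fG_bcons fS_bcons Sh_bcons cl p q W F_kap W_closed)
  qed
  have "\<forall>U\<in>carrier (PG (Suc i)). \<forall>V\<in>carrier (PS (Suc j)).
      Sh i j (fG i U) (fS (Suc j) V) = F (Suc (i + j)) (Sh i j U V)"
  proof (induction i j rule: Sh.induct)
    case 1
    show ?case
      by (rule step) (simp add: aug_fU emb_fS aug_closed emb_closed lin_smult[OF F])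
  next
    case (2 i)
    show ?case
    proof (rule step)
      fix g u v assume *: "g \<in> carrier G" "u \<in> carrier (PG (Suc i))" "v \<in> carrier (PS 0)"
      then show "W (Suc i) 0 (p g) (fU (Suc i) u) (fS 0 v) = F (Suc i + 0) (W (Suc i) 0 g u v)"
        using 2[rule_format, of "kG.A.la (Suc i) (ge g) u" "S.bcons 0 \<one>\<^bsub>S\<^esub> v"]
        by (simp add: fG_la fS_bcons q kG.A.la_closed ge_closed S.bcons_closed)
    qed
  next
    case (3 j)
    show ?case
    proof (rule step)
      fix g u v assume *: "g \<in> carrier G" "u \<in> carrier (PG 0)" "v \<in> carrier (PS (Suc j))"
      then show "W 0 (Suc j) (p g) (fU 0 u) (fS (Suc j) v) = F (0 + Suc j) (W 0 (Suc j) g u v)"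
        using 3[rule_format, of "kG.A.bcons 0 (ge g) u" v]
        by (simp add: fG_bcons ge_closed kG.A.bcons_closed)
    qed
  next
    case (4 i j)
    show ?case
    proof (rule step)
      fix g u v assume *: "g \<in> carrier G" "u \<in> carrier (PG (Suc i))" "v \<in> carrier (PS (Suc j))"
      let ?X1 = "Sh i (Suc j) (kG.A.la (Suc i) (ge g) u) (S.bcons (Suc j) \<one>\<^bsub>S\<^esub> v)"
      let ?X2 = "Sh (Suc i) j (kG.A.bcons (Suc i) (ge g) u) v"
      have c: "?X1 \<in> carrier (PA (Suc (Suc (i + j))))" "?X2 \<in> carrier (PA (Suc (Suc (i + j))))"
        using * Sh_closed[of _ i _ "Suc j"] Sh_closed[of _ "Suc i" _ j]
        by (auto simp: kG.A.la_closed ge_closed S.bcons_closed kG.A.bcons_closed)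
      show "W (Suc i) (Suc j) (p g) (fU (Suc i) u) (fS (Suc j) v) = F (Suc i + Suc j) (W (Suc i) (Suc j) g u v)"
        using 4(1)[rule_format, of "kG.A.la (Suc i) (ge g) u" "S.bcons (Suc j) \<one>\<^bsub>S\<^esub> v"]
          4(2)[rule_format, of "kG.A.bcons (Suc i) (ge g) u" v] *
          lin_add[OF F c(1) signed_closed[OF A.module_P c(2)]]
          lin_signed[OF A.module_P A.module_P F c(2)]
        by (simp add: fG_la fG_bcons fS_bcons q kG.A.la_closed ge_closed S.bcons_closed kG.A.bcons_closed)
    qed
  qed
  then show ?thesis using U V by blast
qed

text \<open>\<open>s\<close> multiplies the head of the bar over \<open>S\<close> only, and
  \<open>kap\<close> passes this factor on to the result, so no recursion is involved.\<close>

lemma Sh_left_S: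
  assumes "s \<in> carrier S" "U \<in> carrier (PG (Suc i))" "V \<in> carrier (PS (Suc j))"
  shows "Sh i j U (S.la (Suc j) s V) = A.la (Suc (i + j)) (el s \<one>\<^bsub>G\<^esub>) (Sh i j U V)"
  by (rule Sh_eqI[OF A.module_P bilin_two_lin[OF Sh_bilin lin_ident S.la_lin]
      bilin_comp[OF Sh_bilin lin_ident lin_ident A.la_lin] _ assms(2,3)])
    (use assms(1) in \<open>simp_all add: S.la_bcons Sh_bcons kap_left W_closed el_closed\<close>)

text \<open>On a bar over kG, left multiplication by \<open>h\<close> changes the head alone, so the
  map on tails is the identity. On bars over \<open>S\<close> the group acts on every entry, and
  over \<open>A\<close> this becomes conjugation because the contractions are conjugated
  too.\<close>

lemma Sh_conj:
  assumes "h \<in> carrier G" "U \<in> carrier (PG (Suc i))" "V \<in> carrier (PS (Suc j))"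
  shows "Sh i j (kG.A.la (Suc i) (ge h) U) (S.bmap (Suc j) (act h) V) = conj (Suc (i + j)) h (Sh i j U V)"
  by (rule Sh_natural[where p = "\<lambda>g. h \<otimes>\<^bsub>G\<^esub> g" and q = "act h" and fG = "\<lambda>n. kG.A.la (Suc n) (ge h)"
      and fU = "\<lambda>n u. u" and fS = "\<lambda>n. S.bmap n (act h)" and F = "\<lambda>n. conj n h"])
    (use assms in \<open>auto simp: kG.A.la_bcons kG.A.la_la ge_closed ge_mult S.bmap_bcons act_endo emb_conj conj_kap intro!: act_closed act_unit
      kG.A.la_lin ge_closed lin_ident S.bmap_lin act_endo conj_lin\<close>)

lemma Sh_right_S:
  assumes "t \<in> carrier S" "U \<in> carrier (PG (Suc i))" "V \<in> carrier (PS (Suc j))"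
  shows "Sh i j U (S.ra (Suc j) t V) = A.ra (Suc (i + j)) (el t \<one>\<^bsub>G\<^esub>) (Sh i j U V)"
  by (rule Sh_natural[where p = "\<lambda>g. g" and q = "\<lambda>s. s" and fG = "\<lambda>n u. u"
      and fU = "\<lambda>n u. u" and fS = "\<lambda>n. S.ra n t" and F = "\<lambda>n. A.ra n (el t \<one>\<^bsub>G\<^esub>)"])
    (use assms in \<open>auto simp: S.ra_bcons emb_ra kap_right el_closed intro!:
      lin_ident S.ra_lin A.ra_lin el_closed\<close>)

text \<open>The last entry over kG reaches the result through \<open>aug\<close>, which is
  invariant. This is what admits chain maps \<open>\<iota>G\<close> that do not respect the grading
  by \<open>G\<close>.\<close>

lemma Sh_right_G:
  assumes "h \<in> carrier G" "U \<in> carrier (PG (Suc i))" "V \<in> carrier (PS (Suc j))"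
  shows "Sh i j (kG.A.ra (Suc i) (ge h) U) V = Sh i j U V"
  by (rule Sh_natural[where p = "\<lambda>g. g" and q = "\<lambda>s. s" and fG = "\<lambda>n. kG.A.ra (Suc n) (ge h)"
      and fU = "\<lambda>n. kG.A.ra n (ge h)" and fS = "\<lambda>n v. v" and F = "\<lambda>n y. y"])
    (use assms in \<open>auto simp: kG.A.ra_bcons kG.A.ra_la ge_closed aug_ra intro!:
      lin_ident kG.A.ra_lin ge_closed\<close>)

text \<open>The value of \<open>Sh\<close> on the differential of u \<otimes> v. In bidegree (0,0)
  the augmentations take the place of the differential, and on the two axes one of the summands is
  absent.\<close>

fun E :: "nat \<Rightarrow> nat \<Rightarrow> (('g \<Rightarrow> 'k) list \<Rightarrow> 'k) set \<Rightarrow> ('s list \<Rightarrow> 'k) set \<Rightarrow> (('g \<Rightarrow> 's) list \<Rightarrow> 'k) set" where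
  "E 0 0 u v = aug (kG.A.gd 0 u) \<odot>\<^bsub>PA 0\<^esub> emb (S.gd 0 v)"
| "E (Suc i) 0 u v = Sh i 0 (kG.A.gd (Suc i) u) v"
| "E 0 (Suc j) u v = Sh 0 j u (S.gd (Suc j) v)"
| "E (Suc i) (Suc j) u v = Sh i (Suc j) (kG.A.gd (Suc i) u) v \<oplus>\<^bsub>PA (Suc (Suc (i + j)))\<^esub>
     signed (PA (Suc (Suc (i + j)))) (Suc i) (Sh (Suc i) j u (S.gd (Suc j) v))"

lemma E_bilin: "bilin k (PG (Suc i)) (PS (Suc j)) (PA (i + j)) (E i j)"
proof (cases i; cases j)
  assume "i = 0" "j = 0"
  moreover have "E 0 0 = (\<lambda>u v. aug (kG.A.gd 0 u) \<odot>\<^bsub>PA 0\<^esub> emb (S.gd 0 v))" by (simp add: fun_eq_iff)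
  ultimately show ?thesis
    using bilin_two_lin[OF scalar_bilin[OF A.module_P] lin_comp[OF kG.A.gd_lin aug(1)] lin_comp[OF S.gd_lin emb(1)]]
    by simp
next
  fix i' assume "i = Suc i'" "j = 0"
  moreover have "E (Suc i') 0 = (\<lambda>u v. Sh i' 0 (kG.A.gd (Suc i') u) v)" by (simp add: fun_eq_iff)
  ultimately show ?thesis
    using bilin_two_lin[OF Sh_bilin[of i' 0] kG.A.gd_lin lin_ident] by simp
next
  fix j' assume "i = 0" "j = Suc j'"
  moreover have "E 0 (Suc j') = (\<lambda>u v. Sh 0 j' u (S.gd (Suc j') v))" by (simp add: fun_eq_iff)
  ultimately show ?thesis
    using bilin_two_lin[OF Sh_bilin[of 0 j'] lin_ident S.gd_lin] by simp
next
  fix i' j' assume ij: "i = Suc i'" "j = Suc j'"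
  have e: "E (Suc i') (Suc j') = (\<lambda>u v. Sh i' (Suc j') (kG.A.gd (Suc i') u) v \<oplus>\<^bsub>PA (Suc (Suc (i' + j')))\<^esub>
     signed (PA (Suc (Suc (i' + j')))) (Suc i') (Sh (Suc i') j' u (S.gd (Suc j') v)))" by (simp add: fun_eq_iff)
  note b1 = bilin_two_lin[OF Sh_bilin[of i' "Suc j'"] kG.A.gd_lin lin_ident]
  note b2 = bilin_two_lin[OF Sh_bilin[of "Suc i'" j'] lin_ident S.gd_lin]
  show ?thesis
    using bilin_addf[OF A.module_P b1 bilin_signedf[OF A.module_P, of _ _ _ _ "Suc i'"], simplified, OF b2[simplified]]
    unfolding ij e by simp
qed

text \<open>Bookkeeping for the chain map property in positive bidegrees: \<open>p\<close> enters
  through both differentials with opposite signs and cancels.\<close>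

lemma signed_identity:
  assumes "module k M" "a \<in> carrier M" "p \<in> carrier M" "q \<in> carrier M" "r \<in> carrier M" "b \<in> carrier M"
  shows "a \<oplus>\<^bsub>M\<^esub> signed M i (p \<ominus>\<^bsub>M\<^esub> q) \<oplus>\<^bsub>M\<^esub> signed M (Suc i) ((p \<ominus>\<^bsub>M\<^esub> r) \<oplus>\<^bsub>M\<^esub> b)
    = (a \<oplus>\<^bsub>M\<^esub> signed M i r) \<oplus>\<^bsub>M\<^esub> signed M (Suc i) (q \<oplus>\<^bsub>M\<^esub> b)"
proof -
  interpret M: module k M by fact
  have 1: "x \<oplus>\<^bsub>M\<^esub> (\<ominus>\<^bsub>M\<^esub> x \<oplus>\<^bsub>M\<^esub> y) = y" if "x \<in> carrier M" "y \<in> carrier M" for x y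
    using that by (rule M.M.r_neg2)
  have 2: "\<ominus>\<^bsub>M\<^esub> x \<oplus>\<^bsub>M\<^esub> (x \<oplus>\<^bsub>M\<^esub> y) = y" if "x \<in> carrier M" "y \<in> carrier M" for x y
    using that by (rule M.M.r_neg1)
  show ?thesis
    using assms(2-) by (auto simp: signed_def a_minus_def M.M.minus_add M.M.a_ac 1 2)
qed

lemma split_signed_identity:
  assumes "module k M" "p \<in> carrier M" "q \<in> carrier M" "x \<in> carrier M" "y \<in> carrier M"
  shows "(p \<ominus>\<^bsub>M\<^esub> q) \<oplus>\<^bsub>M\<^esub> signed M i (x \<ominus>\<^bsub>M\<^esub> y)
    = (p \<oplus>\<^bsub>M\<^esub> signed M i x) \<ominus>\<^bsub>M\<^esub> (q \<oplus>\<^bsub>M\<^esub> signed M i y)"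
proof -
  interpret M: module k M by fact
  show ?thesis
    using assms(2-) by (auto simp: signed_def a_minus_def M.M.minus_add M.M.a_ac)
qed

text \<open>By the contraction identity, the differential of the shuffle of g u and s v is
  \<open>s\<close> times \<open>W\<close> minus \<open>kap\<close> of the differential of
  \<open>W\<close>. The first part consists of the terms with g u and s v multiplied out. By
  induction the differential of \<open>W\<close> is given by the inner maps for d u and d v, and
  \<open>kap\<close> of these are the shuffles with g \<otimes> d u and s \<otimes> d v.\<close>

lemma gd_Sh:
  assumes "U \<in> carrier (PG (Suc i))" "V \<in> carrier (PS (Suc j))"
  shows "A.gd (i + j) (Sh i j U V) = E i j U V"
proof -
  note [simp] = ge_closed el_closed kG.A.la_closed kG.A.bcons_closed kG.A.gd_closed
    S.la_closed S.bcons_closed S.gd_closed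
  note shc = Sh_closed[simplified]
  have step: "\<forall>U\<in>carrier (PG (Suc i)). \<forall>V\<in>carrier (PS (Suc j)). A.gd (i + j) (Sh i j U V) = E i j U V"
    if gen: "\<And>g u s v. g \<in> carrier G \<Longrightarrow> u \<in> carrier (PG i) \<Longrightarrow> s \<in> carrier S \<Longrightarrow> v \<in> carrier (PS j) \<Longrightarrow>
      A.gd (i + j) (kap (i + j) s g (W i j g u v)) = E i j (kG.A.bcons i (ge g) u) (S.bcons j s v)" for i j
  proof (intro ballI)
    fix U V assume "U \<in> carrier (PG (Suc i))" "V \<in> carrier (PS (Suc j))"
    then show "A.gd (i + j) (Sh i j U V) = E i j U V"
      by (rule Sh_eqI[OF A.module_P bilin_comp[OF Sh_bilin lin_ident lin_ident A.gd_lin] E_bilin, rotated 1])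
        (simp add: Sh_bcons gen)
  qed
  have "\<forall>U\<in>carrier (PG (Suc i)). \<forall>V\<in>carrier (PS (Suc j)). A.gd (i + j) (Sh i j U V) = E i j U V"
  proof (induction i j rule: Sh.induct)
    case 1
    show ?case
    proof (rule step)
      fix g u s v assume "g \<in> carrier G" "u \<in> carrier (PG 0)" "s \<in> carrier S" "v \<in> carrier (PS 0)"
      then show "A.gd (0 + 0) (kap (0 + 0) s g (W 0 0 g u v)) = E 0 0 (kG.A.bcons 0 (ge g) u) (S.bcons 0 s v)"
        using W_closed[of g u 0 v 0]
        by (simp add: gd_kap_0 kG.A.gd_bcons_0 S.gd_bcons_0 aug_la emb_la lin_smult[OF A.la_lin] aug_closed emb_closed)
    qed
  next
    case (2 i)
    show ?case
    proof (rule step)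
      fix g u s v assume *: "g \<in> carrier G" "u \<in> carrier (PG (Suc i))" "s \<in> carrier S" "v \<in> carrier (PS 0)"
      let ?W = "Sh i 0 (kG.A.la (Suc i) (ge g) u) (S.bcons 0 \<one>\<^bsub>S\<^esub> v)"
      have Wc: "?W \<in> carrier (PA (Suc i))" using * shc[of _ i _ 0] by simp
      have "A.gd i ?W = E i 0 (kG.A.la (Suc i) (ge g) u) (S.bcons 0 \<one>\<^bsub>S\<^esub> v)"
        using 2[rule_format, of "kG.A.la (Suc i) (ge g) u" "S.bcons 0 \<one>\<^bsub>S\<^esub> v"] * by simp
      also have "\<dots> = W i 0 g (kG.A.gd i u) v"
        using * by (cases i) (simp_all add: kG.A.gd_la S.gd_bcons_0 S.la_one aug_la)
      finally have gW: "A.gd i ?W = W i 0 g (kG.A.gd i u) v" .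
      have "A.gd (Suc i) (kap (Suc i) s g ?W) = A.la (Suc i) (el s \<one>\<^bsub>G\<^esub>) ?W \<ominus>\<^bsub>PA (Suc i)\<^esub> kap i s g (W i 0 g (kG.A.gd i u) v)"
        using * Wc gW by (simp add: gd_kap_Suc)
      also have "A.la (Suc i) (el s \<one>\<^bsub>G\<^esub>) ?W = Sh i 0 (kG.A.la (Suc i) (ge g) u) (S.bcons 0 s v)"
        using Sh_left_S[of s "kG.A.la (Suc i) (ge g) u" i "S.bcons 0 \<one>\<^bsub>S\<^esub> v" 0] * by (simp add: S.la_bcons)
      also have "kap i s g (W i 0 g (kG.A.gd i u) v) = Sh i 0 (kG.A.bcons i (ge g) (kG.A.gd i u)) (S.bcons 0 s v)"
        using Sh_bcons[of g s "kG.A.gd i u" i v 0] * by simp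
      finally show "A.gd (Suc i + 0) (kap (Suc i + 0) s g (W (Suc i) 0 g u v)) = E (Suc i) 0 (kG.A.bcons (Suc i) (ge g) u) (S.bcons 0 s v)"
        using * lin_minus[OF kG.A.module_P A.module_P bilin_left[OF Sh_bilin[of i 0]]]
        by (simp add: kG.A.gd_bcons_Suc)
    qed
  next
    case (3 j)
    show ?case
    proof (rule step)
      fix g u s v assume *: "g \<in> carrier G" "u \<in> carrier (PG 0)" "s \<in> carrier S" "v \<in> carrier (PS (Suc j))"
      let ?W = "Sh 0 j (kG.A.bcons 0 (ge g) u) v"
      have Wc: "?W \<in> carrier (PA (Suc j))" using * shc[of _ 0 _ j] by simp
      have "A.gd j ?W = E 0 j (kG.A.bcons 0 (ge g) u) v"
        using 3[rule_format, of "kG.A.bcons 0 (ge g) u" v] * by simp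
      also have "\<dots> = W 0 j g u (S.gd j v)"
        using * by (cases j) (simp_all add: kG.A.gd_bcons_0 aug_la)
      finally have gW: "A.gd j ?W = W 0 j g u (S.gd j v)" .
      have "A.gd (Suc j) (kap (Suc j) s g ?W) = A.la (Suc j) (el s \<one>\<^bsub>G\<^esub>) ?W \<ominus>\<^bsub>PA (Suc j)\<^esub> kap j s g (W 0 j g u (S.gd j v))"
        using * Wc gW by (simp add: gd_kap_Suc)
      also have "A.la (Suc j) (el s \<one>\<^bsub>G\<^esub>) ?W = Sh 0 j (kG.A.bcons 0 (ge g) u) (S.la (Suc j) s v)"
        using Sh_left_S[of s "kG.A.bcons 0 (ge g) u" 0 v j] * by simp
      also have "kap j s g (W 0 j g u (S.gd j v)) = Sh 0 j (kG.A.bcons 0 (ge g) u) (S.bcons j s (S.gd j v))"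
        using Sh_bcons[of g s u 0 "S.gd j v" j] * by simp
      finally show "A.gd (0 + Suc j) (kap (0 + Suc j) s g (W 0 (Suc j) g u v)) = E 0 (Suc j) (kG.A.bcons 0 (ge g) u) (S.bcons (Suc j) s v)"
        using * lin_minus[OF S.module_P A.module_P bilin_right[OF Sh_bilin[of 0 j]]]
        by (simp add: S.gd_bcons_Suc)
    qed
  next
    case (4 i j)
    show ?case
    proof (rule step)
      fix g u s v assume *: "g \<in> carrier G" "u \<in> carrier (PG (Suc i))" "s \<in> carrier S" "v \<in> carrier (PS (Suc j))"
      let ?N = "PA (Suc (i + j))" and ?N2 = "PA (Suc (Suc (i + j)))"
      let ?gu = "kG.A.la (Suc i) (ge g) u" and ?cu = "kG.A.bcons (Suc i) (ge g) u"
      let ?du = "kG.A.gd i u" and ?dv = "S.gd j v" and ?sv = "S.bcons (Suc j) \<one>\<^bsub>S\<^esub> v"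
      let ?X1 = "Sh i (Suc j) ?gu ?sv" and ?X2 = "Sh (Suc i) j ?cu v"
      let ?W1 = "W i (Suc j) g ?du v" and ?W2 = "W (Suc i) j g u ?dv"
      interpret N: module k ?N by (rule A.module_P)
      interpret N2: module k ?N2 by (rule A.module_P)
      have X: "?X1 \<in> carrier ?N2" "?X2 \<in> carrier ?N2"
        using * shc[of ?gu i ?sv "Suc j"] shc[of ?cu "Suc i" v j] by simp_all
      have Wc: "?W1 \<in> carrier ?N" "?W2 \<in> carrier ?N"
        using * W_closed[of g ?du i v "Suc j"] W_closed[of g u "Suc i" ?dv j] by simp_all
      \<comment> \<open>\<open>a\<close> and \<open>b\<close> are the terms with d u and with d v
        that exist only for positive \<open>i\<close> and positive \<open>j\<close>. Setting them to
        zero otherwise lets one computation cover all cases.\<close>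
      define a where "a = (case i of 0 \<Rightarrow> \<zero>\<^bsub>?N\<^esub> | Suc i' \<Rightarrow> Sh i' (Suc j) (kG.A.la i (ge g) ?du) ?sv)"
      define b where "b = (case j of 0 \<Rightarrow> \<zero>\<^bsub>?N\<^esub> | Suc j' \<Rightarrow> signed ?N (Suc i) (Sh (Suc i) j' ?cu ?dv))"
      let ?p = "Sh i j ?gu v" and ?q = "Sh i j ?gu (S.bcons j \<one>\<^bsub>S\<^esub> ?dv)" and ?r = "Sh i j (kG.A.bcons i (ge g) ?du) v"
      have ac: "a \<in> carrier ?N"
      proof (cases i)
        case (Suc i')
        then have "kG.A.la i (ge g) ?du \<in> carrier (PG (Suc i'))" "?sv \<in> carrier (PS (Suc (Suc j)))" using * by simp_all
        then show ?thesis using Suc shc[of _ i' _ "Suc j"] by (simp add: a_def)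
      qed (simp add: a_def module_zero_closed[OF A.module_P])
      have bc: "b \<in> carrier ?N"
      proof (cases j)
        case (Suc j')
        then have "?dv \<in> carrier (PS (Suc j'))" "?cu \<in> carrier (PG (Suc (Suc i)))" using * by simp_all
        then show ?thesis using Suc shc[of _ "Suc i" _ j'] by (simp add: b_def signed_closed[OF A.module_P])
      qed (simp add: b_def module_zero_closed[OF A.module_P])
      have pqr: "?p \<in> carrier ?N" "?q \<in> carrier ?N" "?r \<in> carrier ?N"
        using * by (auto intro!: shc)
      have E1: "E i (Suc j) ?gu ?sv = a \<oplus>\<^bsub>?N\<^esub> signed ?N i (?p \<ominus>\<^bsub>?N\<^esub> ?q)"
      proof -
        have d: "S.gd (Suc j) ?sv = v \<ominus>\<^bsub>PS (Suc j)\<^esub> S.bcons j \<one>\<^bsub>S\<^esub> ?dv"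
          using * by (simp add: S.gd_bcons_Suc S.la_one)
        have "Sh i j ?gu (S.gd (Suc j) ?sv) = ?p \<ominus>\<^bsub>?N\<^esub> ?q"
          unfolding d using * lin_minus[OF S.module_P A.module_P bilin_right[OF Sh_bilin[of i j]]] by simp
        then show ?thesis
          using * pqr by (cases i) (simp_all add: a_def kG.A.gd_la signed_def module_l_zero[OF A.module_P] module_minus_closed[OF A.module_P])
      qed
      have E2: "E (Suc i) j ?cu v = (?p \<ominus>\<^bsub>?N\<^esub> ?r) \<oplus>\<^bsub>?N\<^esub> b"
      proof -
        have "Sh i j (kG.A.gd (Suc i) ?cu) v = ?p \<ominus>\<^bsub>?N\<^esub> ?r"
          using * lin_minus[OF kG.A.module_P A.module_P bilin_left[OF Sh_bilin[of i j]]]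
          by (simp add: kG.A.gd_bcons_Suc)
        then show ?thesis
          using * pqr by (cases j) (simp_all add: b_def module_r_zero[OF A.module_P] module_minus_closed[OF A.module_P])
      qed
      have W1: "?W1 = a \<oplus>\<^bsub>?N\<^esub> signed ?N i ?r"
        using * pqr by (cases i) (simp_all add: a_def signed_def module_l_zero[OF A.module_P])
      have W2: "?W2 = ?q \<oplus>\<^bsub>?N\<^esub> b"
        using * pqr by (cases j) (simp_all add: b_def module_r_zero[OF A.module_P] module_minus_closed[OF A.module_P])
      \<comment> \<open>The inner maps satisfy the same formula as the shuffles themselves:
        differentiating \<open>W\<close> gives \<open>W\<close> for d u and, with the sign of the
        total complex, \<open>W\<close> for d v.\<close>
      have "A.gd (Suc (i + j)) (W (Suc i) (Suc j) g u v) = A.gd (Suc (i + j)) ?X1 \<oplus>\<^bsub>?N\<^esub> signed ?N (Suc i) (A.gd (Suc (i + j)) ?X2)"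
        using lin_add[OF A.gd_lin X(1) signed_closed[OF A.module_P X(2)]]
          lin_signed[OF A.module_P A.module_P A.gd_lin X(2)] by simp
      also have "\<dots> = E i (Suc j) ?gu ?sv \<oplus>\<^bsub>?N\<^esub> signed ?N (Suc i) (E (Suc i) j ?cu v)"
        using 4(1)[rule_format, of ?gu ?sv] 4(2)[rule_format, of ?cu v] * by simp
      also have "\<dots> = ?W1 \<oplus>\<^bsub>?N\<^esub> signed ?N (Suc i) ?W2"
        unfolding E1 E2 W1 W2 by (rule signed_identity[OF A.module_P ac pqr bc])
      finally have gW: "A.gd (Suc (i + j)) (W (Suc i) (Suc j) g u v) = ?W1 \<oplus>\<^bsub>?N\<^esub> signed ?N (Suc i) ?W2" .
      have WW: "W (Suc i) (Suc j) g u v = ?X1 \<oplus>\<^bsub>?N2\<^esub> signed ?N2 (Suc i) ?X2" by simp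
      let ?K = "kap (Suc (i + j)) s g" and ?L = "A.la (Suc (Suc (i + j))) (el s \<one>\<^bsub>G\<^esub>)"
      have Kl: "?K \<in> lin k ?N ?N2" using bilin_right[OF kap_bilin] * by simp
      have Ll: "?L \<in> lin k ?N2 ?N2" using A.la_lin * by simp
      have "A.gd (Suc (Suc (i + j))) (kap (Suc (Suc (i + j))) s g (W (Suc i) (Suc j) g u v))
          = ?L (W (Suc i) (Suc j) g u v) \<ominus>\<^bsub>?N2\<^esub> ?K (?W1 \<oplus>\<^bsub>?N\<^esub> signed ?N (Suc i) ?W2)"
        using * W_closed[of g u "Suc i" v "Suc j"] gW by (simp add: gd_kap_Suc del: W.simps)
      also have "?L (W (Suc i) (Suc j) g u v) = ?L ?X1 \<oplus>\<^bsub>?N2\<^esub> signed ?N2 (Suc i) (?L ?X2)"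
        unfolding WW using lin_add[OF Ll X(1) signed_closed[OF A.module_P X(2)]]
          lin_signed[OF A.module_P A.module_P Ll X(2)] by simp
      also have "?K (?W1 \<oplus>\<^bsub>?N\<^esub> signed ?N (Suc i) ?W2) = ?K ?W1 \<oplus>\<^bsub>?N2\<^esub> signed ?N2 (Suc i) (?K ?W2)"
        using lin_add[OF Kl Wc(1) signed_closed[OF A.module_P Wc(2)]]
          lin_signed[OF A.module_P A.module_P Kl Wc(2)] by simp
      also have "(?L ?X1 \<oplus>\<^bsub>?N2\<^esub> signed ?N2 (Suc i) (?L ?X2)) \<ominus>\<^bsub>?N2\<^esub> (?K ?W1 \<oplus>\<^bsub>?N2\<^esub> signed ?N2 (Suc i) (?K ?W2))
          = (?L ?X1 \<ominus>\<^bsub>?N2\<^esub> ?K ?W1) \<oplus>\<^bsub>?N2\<^esub> signed ?N2 (Suc i) (?L ?X2 \<ominus>\<^bsub>?N2\<^esub> ?K ?W2)"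
        by (rule split_signed_identity[OF A.module_P, symmetric])
          (auto intro!: lin_closed[OF Ll] lin_closed[OF Kl] X Wc)
      also have "?L ?X1 \<ominus>\<^bsub>?N2\<^esub> ?K ?W1 = Sh i (Suc j) (kG.A.gd (Suc i) ?cu) (S.bcons (Suc j) s v)"
      proof -
        have 1: "?L ?X1 = Sh i (Suc j) ?gu (S.bcons (Suc j) s v)"
          using Sh_left_S[of s ?gu i ?sv "Suc j"] * by (simp add: S.la_bcons)
        have 2: "?K ?W1 = Sh i (Suc j) (kG.A.bcons i (ge g) ?du) (S.bcons (Suc j) s v)"
          using Sh_bcons[of g s ?du i v "Suc j"] * by simp
        show ?thesis unfolding 1 2
          using * lin_minus[OF kG.A.module_P A.module_P bilin_left[OF Sh_bilin[of i "Suc j"]]]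
          by (simp add: kG.A.gd_bcons_Suc)
      qed
      also have "?L ?X2 \<ominus>\<^bsub>?N2\<^esub> ?K ?W2 = Sh (Suc i) j ?cu (S.gd (Suc j) (S.bcons (Suc j) s v))"
      proof -
        have 1: "?L ?X2 = Sh (Suc i) j ?cu (S.la (Suc j) s v)"
          using Sh_left_S[of s ?cu "Suc i" v j] * by simp
        have 2: "?K ?W2 = Sh (Suc i) j ?cu (S.bcons j s ?dv)"
          using Sh_bcons[of g s u "Suc i" ?dv j] * by simp
        show ?thesis unfolding 1 2
          using * lin_minus[OF S.module_P A.module_P bilin_right[OF Sh_bilin[of "Suc i" j]]]
          by (simp add: S.gd_bcons_Suc)
      qed
      finally show "A.gd (Suc i + Suc j) (kap (Suc i + Suc j) s g (W (Suc i) (Suc j) g u v))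
          = E (Suc i) (Suc j) (kG.A.bcons (Suc i) (ge g) u) (S.bcons (Suc j) s v)"
        by (simp del: W.simps)
    qed
  qed
  then show ?thesis using assms by blast
qed

end

section \<open>The Alexander-Whitney map\<close>

text \<open>Tested on pure tensors. It is used to see that the left action on tensor products of
  bars depends linearly on the coefficient in \<open>S\<close>.\<close>

lemma tensor_map_param:
  assumes X: "module k X" "module k X'" "module k N" "module k N'" and f: "f \<in> lin k X X'" and M: "module k M"
    and b: "bilin k M N N' \<beta>"
  shows "bilin k M (tensor_module k X N) (tensor_module k X' N') (\<lambda>s. tensor_map k X' N' f (\<beta> s))"
proof (rule bilinI)
  let ?T = "tensor_module k X' N'"
  interpret M: module k M by (rule M)
  note T = module_tensor[OF X(2,4)]
  note l = tensor_map_lin[OF X(1,3,2,4) f bilin_right[OF b]]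
  note v = tensor_map_tensor[OF X(1,3,2,4) f bilin_right[OF b]]
  note t = bilin_right[OF tensor_bilin[OF X(2,4)] lin_closed[OF f]]
  show "tensor_map k X' N' f (\<beta> s) \<in> lin k (tensor_module k X N) ?T" if "s \<in> carrier M" for s by (rule l[OF that])
  fix x assume x: "x \<in> carrier (tensor_module k X N)"
  show "(\<lambda>s. tensor_map k X' N' f (\<beta> s) x) \<in> lin k M ?T"
  proof (rule linI)
    fix s assume s: "s \<in> carrier M"
    show "tensor_map k X' N' f (\<beta> s) x \<in> carrier ?T" by (rule lin_closed[OF l[OF s] x])
    { fix s' assume s': "s' \<in> carrier M"
      show "tensor_map k X' N' f (\<beta> (s \<oplus>\<^bsub>M\<^esub> s')) x = tensor_map k X' N' f (\<beta> s) x \<oplus>\<^bsub>?T\<^esub> tensor_map k X' N' f (\<beta> s') x"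
        by (rule tensor_eqI[OF X(1,3) T l lin_addf[OF T l l] _ x])
          (use s s' in \<open>simp_all add: v lin_add[OF bilin_left[OF b]] lin_add[OF t] bilin_closed[OF b]\<close>) }
    { fix r assume r: "r \<in> carrier k"
      show "tensor_map k X' N' f (\<beta> (r \<odot>\<^bsub>M\<^esub> s)) x = r \<odot>\<^bsub>?T\<^esub> tensor_map k X' N' f (\<beta> s) x"
        by (rule tensor_eqI[OF X(1,3) T l lin_smultf[OF T l] _ x])
          (use s r in \<open>simp_all add: v lin_smult[OF bilin_left[OF b]] lin_smult[OF t] bilin_closed[OF b]\<close>) }
  qed
qed

context twist
begin

section \<open>Tensor products of bars; dropping the last group entry\<close>

abbreviation "T i j \<equiv> tensor_module k (PG (Suc i)) (PS (Suc j))"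
abbreviation "tt i j \<equiv> tensor k (PG (Suc i)) (PS (Suc j))"
abbreviation "tm i j \<equiv> tensor_map k (PG (Suc i)) (PS (Suc j))"

lemmas module_T = module_tensor[OF kG.A.module_P S.module_P]
lemmas tt_bilin = tensor_bilin[OF kG.A.module_P S.module_P]
lemmas tt_closed = bilin_closed[OF tt_bilin]
lemmas tm_lin = tensor_map_lin[OF kG.A.module_P S.module_P kG.A.module_P S.module_P]
lemmas tm_tt = tensor_map_tensor[OF kG.A.module_P S.module_P kG.A.module_P S.module_P]
lemmas T_eqI = tensor_eqI[OF kG.A.module_P S.module_P]
text \<open>\<open>tau\<close> replaces the last entry of a bar by its augmentation.\<close>

primrec tau :: "nat \<Rightarrow> (('g \<Rightarrow> 'k) list \<Rightarrow> 'k) set \<Rightarrow> (('g \<Rightarrow> 'k) list \<Rightarrow> 'k) set" where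
  "tau 0 = (\<lambda>u. aug u \<odot>\<^bsub>PG 0\<^esub> kG.A.bnil (ge \<one>\<^bsub>G\<^esub>))"
| "tau (Suc n) = linear_ext k (PG (Suc n)) (\<lambda>xs. kG.A.bcons n (hd xs) (tau n (kG.A.bt n (tl xs))))"

lemma tau_rule: "tau n \<in> lin k (PG n) (PG n) \<and>
   (\<forall>m r u. n = Suc m \<longrightarrow> r \<in> carrier kG.A \<longrightarrow> u \<in> carrier (PG m) \<longrightarrow> tau n (kG.A.bcons m r u) = kG.A.bcons m r (tau m u) \<and> tau m u \<in> carrier (PG m))"
proof (induction n)
  case 0
  show ?case
    using lin_comp[OF aug(1) scalar_lin[OF kG.A.module_P kG.A.bnil_closed[OF ge_closed]]] by simp
next
  case (Suc n)
  then have l: "tau n \<in> lin k (PG n) (PG n)" by simp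
  note b = bilin_two_lin[OF kG.A.bcons_bilin[of n] lin_ident l]
  have van: "kG.A.bcons n r (tau n (kG.A.bcons m \<one>\<^bsub>kG.A\<^esub> u)) = \<zero>\<^bsub>PG (Suc n)\<^esub>"
    if "n = Suc m" "r \<in> carrier kG.A" "u \<in> carrier (PG m)" for m r u
    using Suc that by (auto simp: kG.A.bcons_unit)
  show ?case
    using kG.A.extS[OF kG.A.module_P b van, of "\<lambda>xs. kG.A.bcons n (hd xs) (tau n (kG.A.bt n (tl xs)))", folded tau.simps(2)]
      lin_closed[OF l] by auto
qed

lemma tau_lin: "tau n \<in> lin k (PG n) (PG n)"
  using tau_rule by blast

lemmas tau_closed = lin_closed[OF tau_lin]

lemma tau_bcons: "r \<in> carrier kG.A \<Longrightarrow> u \<in> carrier (PG n) \<Longrightarrow> tau (Suc n) (kG.A.bcons n r u) = kG.A.bcons n r (tau n u)"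
  using tau_rule by blast

lemma tau_bnil: "g \<in> carrier G \<Longrightarrow> tau 0 (kG.A.bnil (ge g)) = kG.A.bnil (ge \<one>\<^bsub>G\<^esub>)"
  using module.smult_one[OF kG.A.module_P kG.A.bnil_closed[OF ge_closed]] by (simp add: aug)

declare tau.simps [simp del]

text \<open>In a bar with at least two entries the first one is not the last, so the two operations
  concern different entries.\<close>

lemma tau_la:
  assumes "r \<in> carrier kG.A" "u \<in> carrier (PG (Suc n))"
  shows "tau (Suc n) (kG.A.la (Suc n) r u) = kG.A.la (Suc n) r (tau (Suc n) u)"
  by (rule G_barS_eqI[OF kG.A.module_P lin_comp[OF kG.A.la_lin tau_lin] lin_comp[OF tau_lin kG.A.la_lin] _ assms(2)])
    (use assms in \<open>simp_all add: kG.A.la_bcons ge_closed tau_bcons tau_closed\<close>)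

text \<open>A map that is invariant under right multiplication by \<open>G\<close> has the same
  value for every choice of the last group entry, and \<open>tau\<close> chooses the unit. It is
  applied below to \<open>Fc\<close> after \<open>\<pi>G\<close>.\<close>

lemma tau_invariant:
  assumes N: "module k N" and f: "f \<in> lin k (PG n) N"
    and inv: "\<And>g u. g \<in> carrier G \<Longrightarrow> u \<in> carrier (PG n) \<Longrightarrow> f (kG.A.ra n (ge g) u) = f u"
    and u: "u \<in> carrier (PG n)"
  shows "f (tau n u) = f u"
  using f inv u
proof (induction n arbitrary: f u)
  case 0
  have "f (kG.A.bnil (ge \<one>\<^bsub>G\<^esub>)) = f (kG.A.bnil (ge g))" if "g \<in> carrier G" for g
    using "0.prems"(2)[OF that kG.A.bnil_closed[OF ge_closed], of "\<one>\<^bsub>G\<^esub>"] that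
    by (simp add: kG.A.ra_bnil ge_closed ge_mult)
  then show ?case
    using G_bar0_eqI[OF N lin_comp[OF tau_lin "0.prems"(1)] "0.prems"(1) _ "0.prems"(3)]
    by (simp add: tau_bnil)
next
  case (Suc n)
  show ?case
  proof (rule G_barS_eqI[OF N lin_comp[OF tau_lin Suc.prems(1)] Suc.prems(1) _ Suc.prems(3)])
    fix g y assume g: "g \<in> carrier G" and y: "y \<in> carrier (PG n)"
    have "f (kG.A.bcons n (ge g) (tau n y)) = f (kG.A.bcons n (ge g) y)"
    proof (rule Suc.IH[OF lin_comp[OF kG.A.bcons_lin[OF ge_closed] Suc.prems(1)] _ y])
      fix x z assume "x \<in> carrier G" "z \<in> carrier (PG n)"
      then show "f (kG.A.bcons n (ge g) (kG.A.ra n (ge x) z)) = f (kG.A.bcons n (ge g) z)"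
        using Suc.prems(2)[of x "kG.A.bcons n (ge g) z"]
        by (simp add: kG.A.ra_bcons ge_closed kG.A.bcons_closed)
    qed
    then show "f (tau (Suc n) (kG.A.bcons n (ge g) y)) = f (kG.A.bcons n (ge g) y)"
      using y by (simp add: tau_bcons ge_closed)
  qed
qed

text \<open>
  On a bar with entries \<open>s\<^sub>i g\<^sub>i\<close>, \<open>psi n \<gamma>\<close> vanishes unless the product of all \<open>g\<^sub>i\<close> is \<open>\<gamma>\<close>, and then moves
  the group elements to the right, past the entries that follow them, and drops them.
\<close>

primrec psi :: "nat \<Rightarrow> 'g \<Rightarrow> (('g \<Rightarrow> 's) list \<Rightarrow> 'k) set \<Rightarrow> ('s list \<Rightarrow> 'k) set" where
  "psi 0 = (\<lambda>\<gamma>. linear_ext k (PS 0) (\<lambda>xs. S.bnil (hd xs \<gamma>)))"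
| "psi (Suc n) = (\<lambda>\<gamma>. linear_ext k (PS (Suc n)) (\<lambda>xs. \<Oplus>\<^bsub>PS (Suc n)\<^esub>g\<in>carrier G.
     S.bcons n (hd xs g) (S.bmap n (act g) (psi n (inv\<^bsub>G\<^esub> g \<otimes>\<^bsub>G\<^esub> \<gamma>) (A.bt n (tl xs))))))"

lemma sum_bilin:
  assumes N: "module k N" and b: "\<And>g. g \<in> carrier G \<Longrightarrow> bilin k S M N (B g)"
  shows "bilin k A M N (\<lambda>a y. \<Oplus>\<^bsub>N\<^esub>g\<in>carrier G. B g (a g) y)"
proof (rule bilinI)
  show "(\<lambda>y. \<Oplus>\<^bsub>N\<^esub>g\<in>carrier G. B g (a g) y) \<in> lin k M N" if "a \<in> carrier A" for a
    by (rule lin_finsumf[OF N bilin_right[OF b coeff_closed[OF that]]])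
  show "(\<lambda>a. \<Oplus>\<^bsub>N\<^esub>g\<in>carrier G. B g (a g) y) \<in> lin k A N" if "y \<in> carrier M" for y
    by (rule sum_lin[OF N bilin_left[OF b that]])
qed

lemma sum_bilin_el:
  assumes N: "module k N" and b: "\<And>g. g \<in> carrier G \<Longrightarrow> bilin k S M N (B g)"
    and "s \<in> carrier S" "h \<in> carrier G" "y \<in> carrier M"
  shows "(\<Oplus>\<^bsub>N\<^esub>g\<in>carrier G. B g (el s h g) y) = B h s y"
  by (rule sum_el[OF N bilin_left[OF b assms(5)] assms(3,4)])

text \<open>\<open>extS\<close> over \<open>A\<close> with the first entry split into monomials;
  \<open>B g\<close> prescribes the value for group part \<open>g\<close>.\<close>

lemma sum_ext:
  assumes N: "module k N" and b: "\<And>g. g \<in> carrier G \<Longrightarrow> bilin k S (PA n) N (B g)"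
    and van: "\<And>m g s y. n = Suc m \<Longrightarrow> g \<in> carrier G \<Longrightarrow> s \<in> carrier S \<Longrightarrow> y \<in> carrier (PA m) \<Longrightarrow>
      B g s (A.bcons m \<one>\<^bsub>A\<^esub> y) = \<zero>\<^bsub>N\<^esub>"
    and \<phi>: "\<And>a xs. \<phi> (a # xs) = (\<Oplus>\<^bsub>N\<^esub>g\<in>carrier G. B g (a g) (A.bt n xs))"
  shows sum_ext_lin: "linear_ext k N \<phi> \<in> lin k (PA (Suc n)) N"
    and sum_ext_bcons: "\<lbrakk>s \<in> carrier S; h \<in> carrier G; y \<in> carrier (PA n)\<rbrakk> \<Longrightarrow>
      linear_ext k N \<phi> (A.bcons n (el s h) y) = B h s y"
proof -
  note B = sum_bilin[of N "PA n" B, OF N b]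
  have van': "(\<Oplus>\<^bsub>N\<^esub>g\<in>carrier G. B g (a g) (A.bcons m \<one>\<^bsub>A\<^esub> y)) = \<zero>\<^bsub>N\<^esub>"
    if "n = Suc m" "a \<in> carrier A" "y \<in> carrier (PA m)" for m a y
    by (rule finsum_zeroI[OF N]) (use that in \<open>auto intro!: van coeff_closed\<close>)
  show "linear_ext k N \<phi> \<in> lin k (PA (Suc n)) N"
    by (rule A.extS_lin[OF N B van' \<phi>])
  show "linear_ext k N \<phi> (A.bcons n (el s h) y) = B h s y" if "s \<in> carrier S" "h \<in> carrier G" "y \<in> carrier (PA n)"
  proof -
    have "linear_ext k N \<phi> (A.bcons n (el s h) y) = (\<Oplus>\<^bsub>N\<^esub>g\<in>carrier G. B g (el s h g) y)"
      by (rule A.extS_bcons[OF N B van' \<phi> el_closed]) (use that in auto)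
    also have "\<dots> = B h s y"
      by (rule sum_bilin_el[OF N b that])
    finally show ?thesis .
  qed
qed

text \<open>The unit of \<open>A\<close> is the unit of \<open>S\<close> at the neutral element.
  \<open>psi\<close> turns it into a unit of \<open>S\<close>, which the action of \<open>G\<close>
  fixes, so normalization over \<open>S\<close> makes the recursion well defined.\<close>

lemma psi_rule: "\<forall>\<gamma>\<in>carrier G. psi n \<gamma> \<in> lin k (PA n) (PS n) \<and>
   (\<forall>m t h y. n = Suc m \<longrightarrow> t \<in> carrier S \<longrightarrow> h \<in> carrier G \<longrightarrow> y \<in> carrier (PA m) \<longrightarrow>
      psi n \<gamma> (A.bcons m (el t h) y) = S.bcons m t (S.bmap m (act h) (psi m (inv\<^bsub>G\<^esub> h \<otimes>\<^bsub>G\<^esub> \<gamma>) y)) \<and>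
      psi m (inv\<^bsub>G\<^esub> h \<otimes>\<^bsub>G\<^esub> \<gamma>) y \<in> carrier (PS m))"
proof (induction n)
  case 0
  show ?case
    using A.ext0_lin[OF S.module_P lin_comp[OF coeff_lin S.bnil_lin]] by auto
next
  case (Suc n)
  show ?case
  proof
    fix \<gamma> assume \<gamma>: "\<gamma> \<in> carrier G"
    let ?B = "\<lambda>g s y. S.bcons n s (S.bmap n (act g) (psi n (inv\<^bsub>G\<^esub> g \<otimes>\<^bsub>G\<^esub> \<gamma>) y))"
    have l: "psi n (inv\<^bsub>G\<^esub> g \<otimes>\<^bsub>G\<^esub> \<gamma>) \<in> lin k (PA n) (PS n)" if "g \<in> carrier G" for g
      using Suc that \<gamma> by simp
    have b: "bilin k S (PA n) (PS (Suc n)) (?B g)" if "g \<in> carrier G" for g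
      using bilin_two_lin[OF S.bcons_bilin lin_ident lin_comp[OF l S.bmap_lin]] that act_endo by simp
    have van: "?B g s (A.bcons m \<one>\<^bsub>A\<^esub> y) = \<zero>\<^bsub>PS (Suc n)\<^esub>"
      if n: "n = Suc m" and g: "g \<in> carrier G" and s: "s \<in> carrier S" and y: "y \<in> carrier (PA m)" for m g s y
    proof -
      let ?\<delta> = "inv\<^bsub>G\<^esub> g \<otimes>\<^bsub>G\<^esub> \<gamma>"
      have d: "?\<delta> \<in> carrier G" using g \<gamma> by simp
      have "psi n ?\<delta> (A.bcons m \<one>\<^bsub>A\<^esub> y)
          = S.bcons m \<one>\<^bsub>S\<^esub> (S.bmap m (act \<one>\<^bsub>G\<^esub>) (psi m (inv\<^bsub>G\<^esub> \<one>\<^bsub>G\<^esub> \<otimes>\<^bsub>G\<^esub> ?\<delta>) y))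
          \<and> psi m (inv\<^bsub>G\<^esub> \<one>\<^bsub>G\<^esub> \<otimes>\<^bsub>G\<^esub> ?\<delta>) y \<in> carrier (PS m)"
        using Suc[rule_format, OF d, THEN conjunct2, rule_format, OF n S.one_closed G.one_closed y]
        by (simp only: A_one)
      then show ?thesis
        using n g s by (simp add: S.bmap_bcons act_endo S.bmap_closed act_unit S.bcons_unit)
    qed
    have "psi (Suc n) \<gamma> \<in> lin k (PA (Suc n)) (PS (Suc n))"
      unfolding psi.simps by (rule sum_ext_lin[OF S.module_P b van]) simp_all
    moreover have "psi (Suc n) \<gamma> (A.bcons n (el t h) y) = ?B h t y"
      if "t \<in> carrier S" "h \<in> carrier G" "y \<in> carrier (PA n)" for t h y
      unfolding psi.simps by (rule sum_ext_bcons[OF S.module_P b van]) (use that in simp_all)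
    ultimately show "psi (Suc n) \<gamma> \<in> lin k (PA (Suc n)) (PS (Suc n)) \<and>
      (\<forall>m t h y. Suc n = Suc m \<longrightarrow> t \<in> carrier S \<longrightarrow> h \<in> carrier G \<longrightarrow> y \<in> carrier (PA m) \<longrightarrow>
      psi (Suc n) \<gamma> (A.bcons m (el t h) y) = S.bcons m t (S.bmap m (act h) (psi m (inv\<^bsub>G\<^esub> h \<otimes>\<^bsub>G\<^esub> \<gamma>) y)) \<and>
      psi m (inv\<^bsub>G\<^esub> h \<otimes>\<^bsub>G\<^esub> \<gamma>) y \<in> carrier (PS m))"
      using lin_closed[OF l] by simp
  qed
qed

lemma psi_lin: "\<gamma> \<in> carrier G \<Longrightarrow> psi n \<gamma> \<in> lin k (PA n) (PS n)"
  using psi_rule by blast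

lemmas psi_closed = lin_closed[OF psi_lin]

lemma psi_bcons:
  "\<lbrakk>\<gamma> \<in> carrier G; t \<in> carrier S; h \<in> carrier G; y \<in> carrier (PA n)\<rbrakk> \<Longrightarrow>
    psi (Suc n) \<gamma> (A.bcons n (el t h) y) = S.bcons n t (S.bmap n (act h) (psi n (inv\<^bsub>G\<^esub> h \<otimes>\<^bsub>G\<^esub> \<gamma>) y))"
  using psi_rule[of "Suc n"] by blast

lemma psi_bnil: "\<gamma> \<in> carrier G \<Longrightarrow> a \<in> carrier A \<Longrightarrow> psi 0 \<gamma> (A.bnil a) = S.bnil (a \<gamma>)"
  using A.ext0_bnil[OF S.module_P lin_comp[OF coeff_lin S.bnil_lin], of \<gamma> "\<lambda>xs. S.bnil (hd xs \<gamma>)"] by simp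

declare psi.simps [simp del]

lemma bnil_zero: "S.bnil \<zero>\<^bsub>S\<^esub> = \<zero>\<^bsub>PS 0\<^esub>"
  by (rule lin_zero[OF S.module_A S.module_P S.bnil_lin])

lemma psi_bnil_el: "\<gamma> \<in> carrier G \<Longrightarrow> s \<in> carrier S \<Longrightarrow> g \<in> carrier G \<Longrightarrow>
    psi 0 \<gamma> (A.bnil (el s g)) = (if \<gamma> = g then S.bnil s else \<zero>\<^bsub>PS 0\<^esub>)"
  by (simp add: psi_bnil el_closed bnil_zero) (simp add: el_def bnil_zero)

lemma inv_mult_eq_iff: "h \<in> carrier G \<Longrightarrow> \<gamma> \<in> carrier G \<Longrightarrow> g \<in> carrier G \<Longrightarrow> inv\<^bsub>G\<^esub> h \<otimes>\<^bsub>G\<^esub> \<gamma> = g \<longleftrightarrow> \<gamma> = h \<otimes>\<^bsub>G\<^esub> g"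
  by (metis G.inv_closed G.inv_solve_left G.inv_solve_left')

lemma mult_inv_eq_iff: "h \<in> carrier G \<Longrightarrow> \<gamma> \<in> carrier G \<Longrightarrow> g \<in> carrier G \<Longrightarrow> \<gamma> \<otimes>\<^bsub>G\<^esub> inv\<^bsub>G\<^esub> h = g \<longleftrightarrow> \<gamma> = g \<otimes>\<^bsub>G\<^esub> h"
  by (metis G.inv_closed G.inv_solve_right G.inv_solve_right')

lemma inv_mult_assoc: "h \<in> carrier G \<Longrightarrow> \<gamma> \<in> carrier G \<Longrightarrow> g \<in> carrier G \<Longrightarrow>
   inv\<^bsub>G\<^esub> (h \<otimes>\<^bsub>G\<^esub> g) \<otimes>\<^bsub>G\<^esub> \<gamma> = inv\<^bsub>G\<^esub> g \<otimes>\<^bsub>G\<^esub> (inv\<^bsub>G\<^esub> h \<otimes>\<^bsub>G\<^esub> \<gamma>)"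
  by (simp add: G.inv_mult_group G.m_assoc)

lemma bmap_act: "\<lbrakk>g \<in> carrier G; h \<in> carrier G; v \<in> carrier (PS n)\<rbrakk> \<Longrightarrow>
   S.bmap n (act g) (S.bmap n (act h) v) = S.bmap n (act (g \<otimes>\<^bsub>G\<^esub> h)) v"
  by (rule S.bmap_bmap) (simp_all add: act_endo act_act)

lemma bmap_act_one: "v \<in> carrier (PS n) \<Longrightarrow> S.bmap n (act \<one>\<^bsub>G\<^esub>) v = v"
  by (rule S.bmap_id) (simp_all add: act_endo act_id)

lemma bmap_zero: "g \<in> carrier G \<Longrightarrow> S.bmap n (act g) \<zero>\<^bsub>PS n\<^esub> = \<zero>\<^bsub>PS n\<^esub>"
  by (rule lin_zero[OF S.module_P S.module_P S.bmap_lin[OF act_endo]])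

lemma la_zero: "s \<in> carrier S \<Longrightarrow> S.la n s \<zero>\<^bsub>PS n\<^esub> = \<zero>\<^bsub>PS n\<^esub>"
  by (rule lin_zero[OF S.module_P S.module_P S.la_lin])

lemma ra_zero: "s \<in> carrier S \<Longrightarrow> S.ra n s \<zero>\<^bsub>PS n\<^esub> = \<zero>\<^bsub>PS n\<^esub>"
  by (rule lin_zero[OF S.module_P S.module_P S.ra_lin])

lemma psi_la:
  assumes "\<gamma> \<in> carrier G" "t \<in> carrier S" "h \<in> carrier G" "y \<in> carrier (PA n)"
  shows "psi n \<gamma> (A.la n (el t h) y) = S.la n t (S.bmap n (act h) (psi n (inv\<^bsub>G\<^esub> h \<otimes>\<^bsub>G\<^esub> \<gamma>) y))"
proof (cases n)
  case 0
  show ?thesis unfolding 0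
    by (rule A_bar0_eqI[OF S.module_P lin_comp[OF A.la_lin psi_lin] lin_comp[OF psi_lin lin_comp[OF S.bmap_lin S.la_lin]]])
      (use assms 0 in \<open>auto simp: A.la_bnil el_closed el_mult psi_bnil_el act_closed act_endo S.bmap_bnil S.la_bnil
        inv_mult_eq_iff bmap_zero la_zero\<close>)
next
  case (Suc m)
  show ?thesis unfolding Suc
    by (rule A_barS_eqI[OF S.module_P lin_comp[OF A.la_lin psi_lin] lin_comp[OF psi_lin lin_comp[OF S.bmap_lin S.la_lin]]])
      (use assms Suc in \<open>auto simp: A.la_bcons el_closed el_mult psi_bcons act_closed act_endo S.bmap_bcons S.la_bcons
        inv_mult_assoc psi_closed S.bmap_closed bmap_act\<close>)
qed

text \<open>The group parts in front of the new factor t h have product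
  \<open>\<gamma> h^-1\<close>, and moving them to the right past \<open>t\<close> makes them act on
  it.\<close>

lemma psi_ra:
  assumes "\<gamma> \<in> carrier G" "t \<in> carrier S" "h \<in> carrier G" "y \<in> carrier (PA n)"
  shows "psi n \<gamma> (A.ra n (el t h) y) = S.ra n (act (\<gamma> \<otimes>\<^bsub>G\<^esub> inv\<^bsub>G\<^esub> h) t) (psi n (\<gamma> \<otimes>\<^bsub>G\<^esub> inv\<^bsub>G\<^esub> h) y)"
  using assms(1,4)
proof (induction n arbitrary: y \<gamma>)
  case 0
  show ?case
    by (rule A_bar0_eqI[OF S.module_P lin_comp[OF A.ra_lin psi_lin] lin_comp[OF psi_lin S.ra_lin]])
      (use assms 0 in \<open>auto simp: A.ra_bnil el_closed el_mult psi_bnil_el act_closed S.ra_bnil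
        mult_inv_eq_iff ra_zero G.m_assoc\<close>)
next
  case (Suc n)
  have e: "g \<otimes>\<^bsub>G\<^esub> (inv\<^bsub>G\<^esub> g \<otimes>\<^bsub>G\<^esub> \<gamma> \<otimes>\<^bsub>G\<^esub> inv\<^bsub>G\<^esub> h) = \<gamma> \<otimes>\<^bsub>G\<^esub> inv\<^bsub>G\<^esub> h" if "g \<in> carrier G" for g
    using that Suc.prems assms by (simp add: G.m_assoc[symmetric])
  show ?case
    by (rule A_barS_eqI[OF S.module_P lin_comp[OF A.ra_lin psi_lin] lin_comp[OF psi_lin S.ra_lin]])
      (use assms Suc.prems in \<open>auto simp: A.ra_bcons el_closed psi_bcons act_closed act_endo S.ra_bcons Suc.IH A.ra_closed
        psi_closed S.bmap_closed S.bmap_ra act_act e G.m_assoc[symmetric]\<close>)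
qed

text \<open>Multiplying neighbours, s g times s' g', gives s (act g s') g g': the group parts may be
  moved to the right before or after, and their total product is unchanged.\<close>

lemma psi_gd:
  assumes "\<gamma> \<in> carrier G" "y \<in> carrier (PA (Suc n))"
  shows "psi n \<gamma> (A.gd n y) = S.gd n (psi (Suc n) \<gamma> y)"
  using assms
proof (induction n arbitrary: y \<gamma>)
  case 0
  show ?case
    by (rule A_barS_eqI[OF S.module_P lin_comp[OF A.gd_lin psi_lin] lin_comp[OF psi_lin S.gd_lin]])
      (use 0 in \<open>auto simp: A.gd_bcons_0 el_closed psi_bcons psi_la S.gd_bcons_0 S.bmap_closed act_endo psi_closed\<close>)
next
  case (Suc n)
  show ?case
    by (rule A_barS_eqI[OF S.module_P lin_comp[OF A.gd_lin psi_lin] lin_comp[OF psi_lin S.gd_lin]])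
      (use Suc.prems in \<open>auto simp: A.gd_bcons_Suc el_closed psi_bcons psi_la S.gd_bcons_Suc S.bmap_closed act_endo psi_closed
        lin_minus[OF A.module_P S.module_P psi_lin] A.la_closed A.bcons_closed A.gd_closed Suc.IH S.bmap_gd\<close>)
qed

lemma psi_emb: "\<gamma> \<in> carrier G \<Longrightarrow> v \<in> carrier (PS 0) \<Longrightarrow> psi 0 \<gamma> (emb v) = (if \<gamma> = \<one>\<^bsub>G\<^esub> then v else \<zero>\<^bsub>PS 0\<^esub>)"
proof -
  assume "\<gamma> \<in> carrier G" "v \<in> carrier (PS 0)"
  moreover have "(\<lambda>v. if \<gamma> = \<one>\<^bsub>G\<^esub> then v else \<zero>\<^bsub>PS 0\<^esub>) \<in> lin k (PS 0) (PS 0)"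
    using lin_ident[of k "PS 0"] lin_zerof[OF S.module_P[of 0], of "PS 0"] by (cases "\<gamma> = \<one>\<^bsub>G\<^esub>") auto
  ultimately show ?thesis
    using S.bar0_eqI[OF S.module_P lin_comp[OF emb(1) psi_lin], of \<gamma> "\<lambda>v. if \<gamma> = \<one>\<^bsub>G\<^esub> then v else \<zero>\<^bsub>PS 0\<^esub>" v]
    by (simp add: emb psi_bnil_el)
qed

end

context twist
begin

section \<open>Actions, contraction and differentials on tensor products of bars\<close>

definition unit_G :: "'g \<Rightarrow> (('g \<Rightarrow> 'k) list \<Rightarrow> 'k) set" where
  "unit_G g = kG.A.bcons 0 (ge g) (kG.A.bnil (ge \<one>\<^bsub>G\<^esub>))"

text \<open>The action of the monomial s g: \<open>g\<close> acts on both factors, \<open>s\<close>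
  on the second. \<open>ac_ac\<close> shows that it is multiplicative, so the tensor product of bars
  is a left module over \<open>A\<close> before any twisting.\<close>

definition ac where
  "ac i j s g = tm i j (kG.A.la (Suc i) (ge g)) (\<lambda>v. S.la (Suc j) s (S.bmap (Suc j) (act g) v))"

text \<open>The contraction of the bar complex of kG, applied to the first factor.\<close>

definition sg where
  "sg i j = tm (Suc i) j (kG.A.bcons (Suc i) (ge \<one>\<^bsub>G\<^esub>)) (\<lambda>v. v)"

definition rt where
  "rt i j t = tm i j (\<lambda>u. u) (S.ra (Suc j) t)"

definition tT where
  "tT i j = tm i j (tau (Suc i)) (\<lambda>v. v)"

text \<open>The differential on the first factor, corrected by \<open>tau\<close>. The values of
  \<open>aw\<close> have 1 as last group entry, but the last face of the differential multiplies
  this 1 into its neighbour; \<open>tau\<close> restores the normal form.\<close>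

definition dG where
  "dG i j = tm i j (\<lambda>u. tau (Suc i) (kG.A.gd (Suc i) u)) (\<lambda>v. v)"

definition dS where
  "dS i j = tm i j (\<lambda>u. u) (S.gd (Suc j))"

definition augT where
  "augT j = linear_ext k (PS (Suc j)) (\<lambda>(u, v). aug (kG.A.gd 0 u) \<odot>\<^bsub>PS (Suc j)\<^esub> v)"

lemma unit_G_closed: "unit_G g \<in> carrier (PG (Suc 0))"
  unfolding unit_G_def by (intro kG.A.bcons_closed kG.A.bnil_closed ge_closed)

lemma ac: assumes "s \<in> carrier S" "g \<in> carrier G"
  shows ac_lin: "ac i j s g \<in> lin k (T i j) (T i j)"
    and ac_tt: "u \<in> carrier (PG (Suc i)) \<Longrightarrow> v \<in> carrier (PS (Suc j)) \<Longrightarrow>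
      ac i j s g (tt i j u v) = tt i j (kG.A.la (Suc i) (ge g) u) (S.la (Suc j) s (S.bmap (Suc j) (act g) v))"
  unfolding ac_def
  by (rule tm_lin tm_tt; (rule kG.A.la_lin lin_comp[OF S.bmap_lin S.la_lin])?; simp add: ge_closed act_endo assms)+

lemma ac_bilin: "g \<in> carrier G \<Longrightarrow> bilin k S (T i j) (T i j) (\<lambda>s. ac i j s g)"
  unfolding ac_def
  by (rule tensor_map_param[OF kG.A.module_P kG.A.module_P S.module_P S.module_P kG.A.la_lin[OF ge_closed] S.module_A
      bilin_two_lin[OF S.la_bilin lin_ident S.bmap_lin[OF act_endo]]])

lemma sg_lin: "sg i j \<in> lin k (T i j) (T (Suc i) j)"
  unfolding sg_def by (rule tm_lin[OF kG.A.bcons_lin[OF ge_closed] lin_ident])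

lemma sg_tt: "u \<in> carrier (PG (Suc i)) \<Longrightarrow> v \<in> carrier (PS (Suc j)) \<Longrightarrow>
   sg i j (tt i j u v) = tt (Suc i) j (kG.A.bcons (Suc i) (ge \<one>\<^bsub>G\<^esub>) u) v"
  unfolding sg_def by (rule tm_tt[OF kG.A.bcons_lin[OF ge_closed] lin_ident])

lemma rt_lin: "t \<in> carrier S \<Longrightarrow> rt i j t \<in> lin k (T i j) (T i j)"
  unfolding rt_def by (rule tm_lin[OF lin_ident S.ra_lin])

lemma rt_tt: "t \<in> carrier S \<Longrightarrow> u \<in> carrier (PG (Suc i)) \<Longrightarrow> v \<in> carrier (PS (Suc j)) \<Longrightarrow>
   rt i j t (tt i j u v) = tt i j u (S.ra (Suc j) t v)"
  unfolding rt_def by (rule tm_tt[OF lin_ident S.ra_lin])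

lemma tT_lin: "tT i j \<in> lin k (T i j) (T i j)"
  unfolding tT_def by (rule tm_lin[OF tau_lin lin_ident])

lemma tT_tt: "u \<in> carrier (PG (Suc i)) \<Longrightarrow> v \<in> carrier (PS (Suc j)) \<Longrightarrow>
   tT i j (tt i j u v) = tt i j (tau (Suc i) u) v"
  unfolding tT_def by (rule tm_tt[OF tau_lin lin_ident])

lemma dG_lin: "dG i j \<in> lin k (T (Suc i) j) (T i j)"
  unfolding dG_def by (rule tm_lin[OF lin_comp[OF kG.A.gd_lin tau_lin] lin_ident])

lemma dG_tt: "u \<in> carrier (PG (Suc (Suc i))) \<Longrightarrow> v \<in> carrier (PS (Suc j)) \<Longrightarrow>
   dG i j (tt (Suc i) j u v) = tt i j (tau (Suc i) (kG.A.gd (Suc i) u)) v"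
  unfolding dG_def by (rule tm_tt[OF lin_comp[OF kG.A.gd_lin tau_lin] lin_ident])

lemma dS_lin: "dS i j \<in> lin k (T i (Suc j)) (T i j)"
  unfolding dS_def by (rule tm_lin[OF lin_ident S.gd_lin])

lemma dS_tt: "u \<in> carrier (PG (Suc i)) \<Longrightarrow> v \<in> carrier (PS (Suc (Suc j))) \<Longrightarrow>
   dS i j (tt i (Suc j) u v) = tt i j u (S.gd (Suc j) v)"
  unfolding dS_def by (rule tm_tt[OF lin_ident S.gd_lin])

lemma augT: "augT j \<in> lin k (T 0 j) (PS (Suc j))"
  "u \<in> carrier (PG (Suc 0)) \<Longrightarrow> v \<in> carrier (PS (Suc j)) \<Longrightarrow>
     augT j (tt 0 j u v) = aug (kG.A.gd 0 u) \<odot>\<^bsub>PS (Suc j)\<^esub> v"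
  unfolding augT_def
  using tensor_ext_lin[OF kG.A.module_P S.module_P S.module_P
      bilin_two_lin[OF scalar_bilin[OF S.module_P] lin_comp[OF kG.A.gd_lin aug(1)] lin_ident]]
    tensor_ext_tensor[OF kG.A.module_P S.module_P S.module_P
      bilin_two_lin[OF scalar_bilin[OF S.module_P] lin_comp[OF kG.A.gd_lin aug(1)] lin_ident]]
  by blast+

lemmas T_simps = ac_tt sg_tt rt_tt tT_tt dG_tt dS_tt augT(2) ge_closed act_endo act_closed
  kG.A.la_closed kG.A.ra_closed kG.A.bcons_closed kG.A.gd_closed tau_closed
  S.la_closed S.ra_closed S.bcons_closed S.gd_closed S.bmap_closed

lemma ac_ac:
  assumes "t \<in> carrier S" "h \<in> carrier G" "s \<in> carrier S" "g \<in> carrier G" "x \<in> carrier (T i j)"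
  shows "ac i j t h (ac i j s g x) = ac i j (t \<otimes>\<^bsub>S\<^esub> act h s) (h \<otimes>\<^bsub>G\<^esub> g) x"
  by (rule T_eqI[OF module_T lin_comp[OF ac_lin ac_lin] ac_lin])
    (use assms in \<open>auto simp: T_simps kG.A.la_la ge_mult S.bmap_la bmap_act S.la_la\<close>)

lemma ac_rt:
  assumes "t \<in> carrier S" "s \<in> carrier S" "g \<in> carrier G" "x \<in> carrier (T i j)"
  shows "ac i j s g (rt i j t x) = rt i j (act g t) (ac i j s g x)"
  by (rule T_eqI[OF module_T lin_comp[OF rt_lin ac_lin] lin_comp[OF ac_lin rt_lin]])
    (use assms in \<open>auto simp: T_simps S.bmap_ra S.ra_la\<close>)

lemma sg_rt:
  assumes "t \<in> carrier S" "x \<in> carrier (T i j)"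
  shows "sg i j (rt i j t x) = rt (Suc i) j t (sg i j x)"
  by (rule T_eqI[OF module_T lin_comp[OF rt_lin sg_lin] lin_comp[OF sg_lin rt_lin]])
    (use assms in \<open>auto simp: T_simps\<close>)

lemma ac_tT:
  assumes "s \<in> carrier S" "g \<in> carrier G" "x \<in> carrier (T i j)"
  shows "tT i j (ac i j s g x) = ac i j s g (tT i j x)"
  by (rule T_eqI[OF module_T lin_comp[OF ac_lin tT_lin] lin_comp[OF tT_lin ac_lin]])
    (use assms in \<open>auto simp: T_simps tau_la\<close>)

lemma sg_tT:
  assumes "x \<in> carrier (T i j)"
  shows "tT (Suc i) j (sg i j x) = sg i j (tT i j x)"
  by (rule T_eqI[OF module_T lin_comp[OF sg_lin tT_lin] lin_comp[OF tT_lin sg_lin]])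
    (use assms in \<open>auto simp: T_simps tau_bcons\<close>)

lemma dG_ac:
  assumes "s \<in> carrier S" "g \<in> carrier G" "x \<in> carrier (T (Suc i) j)"
  shows "dG i j (ac (Suc i) j s g x) = ac i j s g (dG i j x)"
  by (rule T_eqI[OF module_T lin_comp[OF ac_lin dG_lin] lin_comp[OF dG_lin ac_lin]])
    (use assms in \<open>auto simp: T_simps tau_la kG.A.gd_la\<close>)

lemma dS_ac:
  assumes "s \<in> carrier S" "g \<in> carrier G" "x \<in> carrier (T i (Suc j))"
  shows "dS i j (ac i (Suc j) s g x) = ac i j s g (dS i j x)"
  by (rule T_eqI[OF module_T lin_comp[OF ac_lin dS_lin] lin_comp[OF dS_lin ac_lin]])
    (use assms in \<open>auto simp: T_simps S.gd_la S.bmap_gd\<close>)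

lemma dS_sg:
  assumes "x \<in> carrier (T i (Suc j))"
  shows "dS (Suc i) j (sg i (Suc j) x) = sg i j (dS i j x)"
  by (rule T_eqI[OF module_T lin_comp[OF sg_lin dS_lin] lin_comp[OF dS_lin sg_lin]])
    (use assms in \<open>auto simp: T_simps\<close>)

lemma tt_minus_left: "\<lbrakk>u \<in> carrier (PG (Suc i)); u' \<in> carrier (PG (Suc i)); v \<in> carrier (PS (Suc j))\<rbrakk> \<Longrightarrow>
   tt i j (u \<ominus>\<^bsub>PG (Suc i)\<^esub> u') v = tt i j u v \<ominus>\<^bsub>T i j\<^esub> tt i j u' v"
  by (rule lin_minus[OF kG.A.module_P module_T bilin_left[OF tt_bilin]])

lemma tt_minus_right: "\<lbrakk>u \<in> carrier (PG (Suc i)); v' \<in> carrier (PS (Suc j)); v \<in> carrier (PS (Suc j))\<rbrakk> \<Longrightarrow>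
   tt i j u (v \<ominus>\<^bsub>PS (Suc j)\<^esub> v') = tt i j u v \<ominus>\<^bsub>T i j\<^esub> tt i j u v'"
  by (rule lin_minus[OF S.module_P module_T bilin_right[OF tt_bilin]])

lemma tt_scalar: "\<lbrakk>r \<in> carrier k; u \<in> carrier (PG (Suc i)); v \<in> carrier (PS (Suc j))\<rbrakk> \<Longrightarrow>
   tt i j (r \<odot>\<^bsub>PG (Suc i)\<^esub> u) v = tt i j u (r \<odot>\<^bsub>PS (Suc j)\<^esub> v)"
  using lin_smult[OF bilin_left[OF tt_bilin], of v "Suc j" r u "Suc i"] lin_smult[OF bilin_right[OF tt_bilin], of u "Suc i" r v "Suc j"] by simp

lemma tt_zero: "v \<in> carrier (PS (Suc j)) \<Longrightarrow> tt i j \<zero>\<^bsub>PG (Suc i)\<^esub> v = \<zero>\<^bsub>T i j\<^esub>"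
  "u \<in> carrier (PG (Suc i)) \<Longrightarrow> tt i j u \<zero>\<^bsub>PS (Suc j)\<^esub> = \<zero>\<^bsub>T i j\<^esub>"
  by (rule bilin_zero_left[OF kG.A.module_P module_T tt_bilin] bilin_zero_right[OF S.module_P module_T tt_bilin]; assumption)+

lemma tau_bcons_0: "g \<in> carrier G \<Longrightarrow> u \<in> carrier (PG 0) \<Longrightarrow>
   tau (Suc 0) (kG.A.bcons 0 (ge g) u) = aug u \<odot>\<^bsub>PG (Suc 0)\<^esub> unit_G g"
  using lin_smult[OF kG.A.bcons_lin[OF ge_closed, of 0 g] aug_closed kG.A.bnil_closed[OF ge_closed]]
  by (simp add: tau_bcons ge_closed tau.simps(1) unit_G_def)

text \<open>The contraction identity d(1 \<otimes> u) = u - 1 \<otimes> d u in degree 0. Here d u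
  lies in a copy of kG, of which \<open>tau\<close> keeps the augmentation only.\<close>

lemma dG_sg_0:
  assumes "x \<in> carrier (T 0 j)"
  shows "dG 0 j (sg 0 j x) = tT 0 j x \<ominus>\<^bsub>T 0 j\<^esub> tt 0 j (unit_G \<one>\<^bsub>G\<^esub>) (augT j x)"
proof (rule T_eqI[OF module_T lin_comp[OF sg_lin dG_lin] lin_minusf[OF module_T tT_lin lin_comp[OF augT(1) bilin_right[OF tt_bilin unit_G_closed]]] _ assms])
  fix u v assume u: "u \<in> carrier (PG (Suc 0))" and v: "v \<in> carrier (PS (Suc j))"
  have "tau (Suc 0) (kG.A.gd (Suc 0) (kG.A.bcons (Suc 0) (ge \<one>\<^bsub>G\<^esub>) u))
      = tau (Suc 0) u \<ominus>\<^bsub>PG (Suc 0)\<^esub> aug (kG.A.gd 0 u) \<odot>\<^bsub>PG (Suc 0)\<^esub> unit_G \<one>\<^bsub>G\<^esub>"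
    using u lin_minus[OF kG.A.module_P kG.A.module_P tau_lin, of u "Suc 0" "kG.A.bcons 0 (ge \<one>\<^bsub>G\<^esub>) (kG.A.gd 0 u)"]
    by (simp add: kG.A.gd_bcons_Suc ge_closed kG.A.bcons_closed kG.A.gd_closed tau_bcons_0)
      (simp add: ge_one kG.A.la_one)
  then show "dG 0 j (sg 0 j (tt 0 j u v)) = tT 0 j (tt 0 j u v) \<ominus>\<^bsub>T 0 j\<^esub> tt 0 j (unit_G \<one>\<^bsub>G\<^esub>) (augT j (tt 0 j u v))"
    using u v by (simp add: T_simps tt_minus_left tt_scalar aug_closed unit_G_closed module.smult_closed[OF kG.A.module_P])
qed

lemma dG_sg_Suc:
  assumes "x \<in> carrier (T (Suc i) j)"
  shows "dG (Suc i) j (sg (Suc i) j x) = tT (Suc i) j x \<ominus>\<^bsub>T (Suc i) j\<^esub> sg i j (dG i j x)"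
proof (rule T_eqI[OF module_T lin_comp[OF sg_lin dG_lin] lin_minusf[OF module_T tT_lin lin_comp[OF dG_lin sg_lin]] _ assms])
  fix u v assume u: "u \<in> carrier (PG (Suc (Suc i)))" and v: "v \<in> carrier (PS (Suc j))"
  have "tau (Suc (Suc i)) (kG.A.gd (Suc (Suc i)) (kG.A.bcons (Suc (Suc i)) (ge \<one>\<^bsub>G\<^esub>) u))
      = tau (Suc (Suc i)) u \<ominus>\<^bsub>PG (Suc (Suc i))\<^esub> kG.A.bcons (Suc i) (ge \<one>\<^bsub>G\<^esub>) (tau (Suc i) (kG.A.gd (Suc i) u))"
    using u lin_minus[OF kG.A.module_P kG.A.module_P tau_lin, of u "Suc (Suc i)" "kG.A.bcons (Suc i) (ge \<one>\<^bsub>G\<^esub>) (kG.A.gd (Suc i) u)"]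
    by (simp add: kG.A.gd_bcons_Suc ge_closed kG.A.bcons_closed kG.A.gd_closed tau_bcons)
      (simp add: ge_one kG.A.la_one)
  then show "dG (Suc i) j (sg (Suc i) j (tt (Suc i) j u v)) = tT (Suc i) j (tt (Suc i) j u v) \<ominus>\<^bsub>T (Suc i) j\<^esub> sg i j (dG i j (tt (Suc i) j u v))"
    using u v by (simp add: T_simps tt_minus_left)
qed

text \<open>
  Front face tensor back face: the group elements of the first \<open>i + 1\<close> entries, followed by \<open>1\<close>, form
  a bar over \<open>kG\<close>; these entries act on the image under \<open>psi\<close> of the others, preceded by \<open>1\<close>.
\<close>

primrec aw :: "nat \<Rightarrow> nat \<Rightarrow> 'g \<Rightarrow> (('g \<Rightarrow> 's) list \<Rightarrow> 'k) set \<Rightarrow>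
    ((('g \<Rightarrow> 'k) list \<Rightarrow> 'k) set \<times> ('s list \<Rightarrow> 'k) set \<Rightarrow> 'k) set" where
  "aw 0 = (\<lambda>j \<gamma>. linear_ext k (T 0 j) (\<lambda>xs. \<Oplus>\<^bsub>T 0 j\<^esub>g\<in>carrier G.
     tt 0 j (unit_G g) (S.bcons j (hd xs g) (S.bmap j (act g) (psi j (inv\<^bsub>G\<^esub> g \<otimes>\<^bsub>G\<^esub> \<gamma>) (A.bt j (tl xs)))))))"
| "aw (Suc i) = (\<lambda>j \<gamma>. linear_ext k (T (Suc i) j) (\<lambda>xs. \<Oplus>\<^bsub>T (Suc i) j\<^esub>g\<in>carrier G.
     ac (Suc i) j (hd xs g) g (sg i j (aw i j (inv\<^bsub>G\<^esub> g \<otimes>\<^bsub>G\<^esub> \<gamma>) (A.bt (Suc (i + j)) (tl xs))))))"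

text \<open>The value of \<open>aw\<close> on a bar with first entry s g and tail \<open>y\<close>,
  named so that both cases of the recursion can be treated alike.\<close>

fun awB where
  "awB 0 j \<gamma> g s y = tt 0 j (unit_G g) (S.bcons j s (S.bmap j (act g) (psi j (inv\<^bsub>G\<^esub> g \<otimes>\<^bsub>G\<^esub> \<gamma>) y)))"
| "awB (Suc i) j \<gamma> g s y = ac (Suc i) j s g (sg i j (aw i j (inv\<^bsub>G\<^esub> g \<otimes>\<^bsub>G\<^esub> \<gamma>) y))"

lemma aw_eq: "aw i j \<gamma> = linear_ext k (T i j) (\<lambda>xs. \<Oplus>\<^bsub>T i j\<^esub>g\<in>carrier G. awB i j \<gamma> g (hd xs g) (A.bt (i + j) (tl xs)))"
  by (cases i) simp_all

lemma psi_unit: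
  "\<gamma> \<in> carrier G \<Longrightarrow> y \<in> carrier (PA n) \<Longrightarrow> psi (Suc n) \<gamma> (A.bcons n \<one>\<^bsub>A\<^esub> y) = S.bcons n \<one>\<^bsub>S\<^esub> (psi n \<gamma> y)"
  by (simp add: A_one psi_bcons bmap_act_one psi_closed)

definition aw_rule where
  "aw_rule i \<longleftrightarrow> (\<forall>j. \<forall>\<gamma>\<in>carrier G. aw i j \<gamma> \<in> lin k (PA (Suc (i + j))) (T i j) \<and>
     (\<forall>g\<in>carrier G. bilin k S (PA (i + j)) (T i j) (\<lambda>s. awB i j \<gamma> g s)) \<and>
     (\<forall>s\<in>carrier S. \<forall>g\<in>carrier G. \<forall>y\<in>carrier (PA (i + j)). aw i j \<gamma> (A.bcons (i + j) (el s g) y) = awB i j \<gamma> g s y))"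

lemma aw_ruleI:
  assumes b: "\<And>j \<gamma> g. \<gamma> \<in> carrier G \<Longrightarrow> g \<in> carrier G \<Longrightarrow> bilin k S (PA (i + j)) (T i j) (\<lambda>s. awB i j \<gamma> g s)"
    and van: "\<And>j \<gamma> m g s y. \<gamma> \<in> carrier G \<Longrightarrow> i + j = Suc m \<Longrightarrow> g \<in> carrier G \<Longrightarrow> s \<in> carrier S \<Longrightarrow> y \<in> carrier (PA m)
      \<Longrightarrow> awB i j \<gamma> g s (A.bcons m \<one>\<^bsub>A\<^esub> y) = \<zero>\<^bsub>T i j\<^esub>"
  shows "aw_rule i"
proof -
  have "aw i j \<gamma> \<in> lin k (PA (Suc (i + j))) (T i j)" if "\<gamma> \<in> carrier G" for j \<gamma>
    unfolding aw_eq by (rule sum_ext_lin[OF module_T b van]) (use that in simp_all)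
  moreover have "aw i j \<gamma> (A.bcons (i + j) (el s g) y) = awB i j \<gamma> g s y"
    if "\<gamma> \<in> carrier G" "s \<in> carrier S" "g \<in> carrier G" "y \<in> carrier (PA (i + j))" for j \<gamma> s g y
    unfolding aw_eq by (rule sum_ext_bcons[OF module_T b van]) (use that in simp_all)
  ultimately show ?thesis using b by (simp add: aw_rule_def)
qed

lemma ac_lin_zero: "s \<in> carrier S \<Longrightarrow> g \<in> carrier G \<Longrightarrow> ac i j s g \<zero>\<^bsub>T i j\<^esub> = \<zero>\<^bsub>T i j\<^esub>"
  by (rule lin_zero[OF module_T module_T ac_lin])

text \<open>Two contractions in a row put one unit in front of another; the monomial acting in
  between is the unit of \<open>A\<close>.\<close>

lemma sg_sg:
  assumes "x \<in> carrier (T i j)"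
  shows "sg (Suc i) j (ac (Suc i) j \<one>\<^bsub>S\<^esub> \<one>\<^bsub>G\<^esub> (sg i j x)) = \<zero>\<^bsub>T (Suc (Suc i)) j\<^esub>"
  by (rule T_eqI[OF module_T lin_comp[OF sg_lin lin_comp[OF ac_lin sg_lin]] lin_zerof[OF module_T] _ assms])
    (simp_all add: T_simps ge_one kG.A.la_one kG.A.bcons_unit tt_zero)

text \<open>Strong induction, because a unit at the head of the tail makes the map for
  \<open>Suc i\<close> unfold twice. Two contractions then meet and \<open>sg_sg\<close> applies,
  or, when the second unfolding reaches the base case, the contraction meets a bar consisting of
  units.\<close>

lemma aw_rule: "aw_rule i"
proof (induction i rule: less_induct)
  case (less n)
  show ?case
  proof (cases n)
  case 0
  show ?thesis unfolding 0
  proof (rule aw_ruleI)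
    fix j \<gamma> g assume g: "\<gamma> \<in> carrier G" "g \<in> carrier G"
    have "awB 0 j \<gamma> g = (\<lambda>s y. tt 0 j (unit_G g) (S.bcons j s (S.bmap j (act g) (psi j (inv\<^bsub>G\<^esub> g \<otimes>\<^bsub>G\<^esub> \<gamma>) y))))"
      by (simp add: fun_eq_iff)
    then show "bilin k S (PA (0 + j)) (T 0 j) (\<lambda>s. awB 0 j \<gamma> g s)"
      using bilin_comp[OF S.bcons_bilin lin_ident lin_comp[OF psi_lin S.bmap_lin[OF act_endo]] bilin_right[OF tt_bilin unit_G_closed]] g
      by simp
  next
    fix j \<gamma> m g s y
    assume "\<gamma> \<in> carrier G" "0 + j = Suc m" "g \<in> carrier G" "s \<in> carrier S" "y \<in> carrier (PA m)"
    then show "awB 0 j \<gamma> g s (A.bcons m \<one>\<^bsub>A\<^esub> y) = \<zero>\<^bsub>T 0 j\<^esub>"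
      by (simp add: psi_unit S.bmap_bcons act_endo psi_closed S.bmap_closed act_unit S.bcons_unit tt_zero unit_G_closed)
  qed
next
  case (Suc i)
  have l: "aw i j \<gamma> \<in> lin k (PA (Suc (i + j))) (T i j)" if "\<gamma> \<in> carrier G" for j \<gamma>
    using less.IH[of i] Suc that by (simp add: aw_rule_def)
  have v: "aw i j \<gamma> (A.bcons (i + j) (el s g) y) = awB i j \<gamma> g s y"
    if "\<gamma> \<in> carrier G" "s \<in> carrier S" "g \<in> carrier G" "y \<in> carrier (PA (i + j))" for j \<gamma> s g y
    using less.IH[of i] Suc that by (simp add: aw_rule_def)
  show ?thesis unfolding Suc
  proof (rule aw_ruleI)
    fix j \<gamma> g assume g: "\<gamma> \<in> carrier G" "g \<in> carrier G"
    have "awB (Suc i) j \<gamma> g = (\<lambda>s y. ac (Suc i) j s g (sg i j (aw i j (inv\<^bsub>G\<^esub> g \<otimes>\<^bsub>G\<^esub> \<gamma>) y)))"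
      by (simp add: fun_eq_iff)
    then show "bilin k S (PA (Suc i + j)) (T (Suc i) j) (\<lambda>s. awB (Suc i) j \<gamma> g s)"
      using bilin_two_lin[OF ac_bilin lin_ident lin_comp[OF l sg_lin]] g by simp
  next
    fix j \<gamma> m g s y
    assume \<gamma>: "\<gamma> \<in> carrier G" and m: "Suc i + j = Suc m" and g: "g \<in> carrier G" and s: "s \<in> carrier S" and y: "y \<in> carrier (PA m)"
    let ?\<delta> = "inv\<^bsub>G\<^esub> g \<otimes>\<^bsub>G\<^esub> \<gamma>"
    have y': "y \<in> carrier (PA (i + j))" and d: "?\<delta> \<in> carrier G" and m': "m = i + j" using m y g \<gamma> by simp_all
    have "sg i j (awB i j ?\<delta> \<one>\<^bsub>G\<^esub> \<one>\<^bsub>S\<^esub> y) = \<zero>\<^bsub>T (Suc i) j\<^esub>"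
    proof (cases i)
      case 0
      then show ?thesis using d y'
        by (simp add: T_simps unit_G_closed psi_closed)
          (simp add: unit_G_def ge_one kG.A.bcons_unit kG.A.bnil_closed[of "\<one>\<^bsub>kG.A\<^esub>"] tt_zero T_simps psi_closed)
    next
      case (Suc i')
      have "aw_rule i'" using less.IH[of i'] Suc \<open>n = Suc i\<close> by simp
      then have "aw i' j ?\<delta> \<in> lin k (PA (Suc (i' + j))) (T i' j)"
        using d by (simp add: aw_rule_def)
      then have "aw i' j ?\<delta> y \<in> carrier (T i' j)"
        by (rule lin_closed) (use y' Suc in simp)
      then show ?thesis using Suc d sg_sg by simp
    qed
    then show "awB (Suc i) j \<gamma> g s (A.bcons m \<one>\<^bsub>A\<^esub> y) = \<zero>\<^bsub>T (Suc i) j\<^esub>"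
      using v[OF d S.one_closed G.one_closed y'] g s unfolding m' A_one by (simp add: ac_lin_zero)
  qed
  qed
qed

lemma aw_lin: "\<gamma> \<in> carrier G \<Longrightarrow> aw i j \<gamma> \<in> lin k (PA (Suc (i + j))) (T i j)"
  using aw_rule by (simp add: aw_rule_def)

lemma aw_bcons: "\<lbrakk>\<gamma> \<in> carrier G; s \<in> carrier S; g \<in> carrier G; y \<in> carrier (PA (i + j))\<rbrakk> \<Longrightarrow>
   aw i j \<gamma> (A.bcons (i + j) (el s g) y) = awB i j \<gamma> g s y"
  using aw_rule by (simp add: aw_rule_def)

lemmas aw_closed = lin_closed[OF aw_lin]

lemma aw_bcons_0: "\<lbrakk>\<gamma> \<in> carrier G; s \<in> carrier S; g \<in> carrier G; y \<in> carrier (PA j)\<rbrakk> \<Longrightarrow>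
   aw 0 j \<gamma> (A.bcons j (el s g) y) = tt 0 j (unit_G g) (S.bcons j s (S.bmap j (act g) (psi j (inv\<^bsub>G\<^esub> g \<otimes>\<^bsub>G\<^esub> \<gamma>) y)))"
  using aw_bcons[of \<gamma> s g y 0 j] by simp

lemma aw_bcons_Suc: "\<lbrakk>\<gamma> \<in> carrier G; s \<in> carrier S; g \<in> carrier G; y \<in> carrier (PA (Suc (i + j)))\<rbrakk> \<Longrightarrow>
   aw (Suc i) j \<gamma> (A.bcons (Suc (i + j)) (el s g) y) = ac (Suc i) j s g (sg i j (aw i j (inv\<^bsub>G\<^esub> g \<otimes>\<^bsub>G\<^esub> \<gamma>) y))"
  using aw_bcons[of \<gamma> s g y "Suc i" j] by simp

declare aw.simps [simp del] awB.simps [simp del]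

lemma unit_G_la: "h \<in> carrier G \<Longrightarrow> g \<in> carrier G \<Longrightarrow> kG.A.la (Suc 0) (ge h) (unit_G g) = unit_G (h \<otimes>\<^bsub>G\<^esub> g)"
  by (simp add: unit_G_def kG.A.la_bcons ge_closed kG.A.bnil_closed ge_mult)

text \<open>Taken over all total degrees together, the maps are linear over \<open>A\<close>: the
  left action of t h shifts the total degree by \<open>h\<close>.\<close>

lemma aw_la:
  assumes "\<gamma> \<in> carrier G" "t \<in> carrier S" "h \<in> carrier G" "y \<in> carrier (PA (Suc (i + j)))"
  shows "aw i j \<gamma> (A.la (Suc (i + j)) (el t h) y) = ac i j t h (aw i j (inv\<^bsub>G\<^esub> h \<otimes>\<^bsub>G\<^esub> \<gamma>) y)"
proof (rule A_barS_eqI[OF module_T lin_comp[OF A.la_lin aw_lin] lin_comp[OF aw_lin ac_lin] _ assms(4)])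
  fix s g y assume sgy: "s \<in> carrier S" "g \<in> carrier G" "y \<in> carrier (PA (i + j))"
  show "aw i j \<gamma> (A.la (Suc (i + j)) (el t h) (A.bcons (i + j) (el s g) y))
      = ac i j t h (aw i j (inv\<^bsub>G\<^esub> h \<otimes>\<^bsub>G\<^esub> \<gamma>) (A.bcons (i + j) (el s g) y))"
  proof (cases i)
    case 0
    then show ?thesis
      using sgy assms by (simp add: A.la_bcons el_closed el_mult act_closed aw_bcons_0 T_simps unit_G_closed unit_G_la
        psi_closed S.bmap_bcons S.la_bcons bmap_act inv_mult_assoc)
  next
    case (Suc i')
    then show ?thesis
      using sgy assms lin_closed[OF sg_lin aw_closed] by (simp add: A.la_bcons el_closed el_mult act_closed aw_bcons_Suc ac_ac inv_mult_assoc)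
  qed
qed (use assms in \<open>auto simp: el_closed\<close>)

lemma aw_ra:
  assumes "\<gamma> \<in> carrier G" "t \<in> carrier S" "h \<in> carrier G" "y \<in> carrier (PA (Suc (i + j)))"
  shows "aw i j \<gamma> (A.ra (Suc (i + j)) (el t h) y) = rt i j (act (\<gamma> \<otimes>\<^bsub>G\<^esub> inv\<^bsub>G\<^esub> h) t) (aw i j (\<gamma> \<otimes>\<^bsub>G\<^esub> inv\<^bsub>G\<^esub> h) y)"
  using assms(1,4)
proof (induction i arbitrary: y \<gamma>)
  have e: "g \<otimes>\<^bsub>G\<^esub> (inv\<^bsub>G\<^esub> g \<otimes>\<^bsub>G\<^esub> \<gamma> \<otimes>\<^bsub>G\<^esub> inv\<^bsub>G\<^esub> h) = \<gamma> \<otimes>\<^bsub>G\<^esub> inv\<^bsub>G\<^esub> h" if "g \<in> carrier G" "\<gamma> \<in> carrier G" for g \<gamma>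
    using that assms by (simp add: G.m_assoc[symmetric])
  {
    case 0
    show ?case unfolding add_0
      by (rule A_barS_eqI[OF module_T lin_comp[OF A.ra_lin aw_lin[of \<gamma> 0 j, simplified]] lin_comp[OF aw_lin[of _ 0 j, simplified] rt_lin]])
        (use assms 0 in \<open>auto simp: A.ra_bcons el_closed aw_bcons_0 A.ra_closed psi_ra T_simps unit_G_closed psi_closed
          S.bmap_ra S.ra_bcons act_act e G.m_assoc[symmetric]\<close>)
  next
    case (Suc i)
    show ?case
      by (rule A_barS_eqI[OF module_T lin_comp[OF A.ra_lin aw_lin] lin_comp[OF aw_lin rt_lin]])
        (use assms Suc.prems in \<open>auto simp: A.ra_bcons el_closed aw_bcons_Suc A.ra_closed Suc.IH sg_rt aw_closed ac_rt
          lin_closed[OF sg_lin] act_closed act_act e G.m_assoc[symmetric]\<close>)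
  }
qed

text \<open>The first factor starts out as \<open>unit_G g\<close>, whose last entry is 1, and
  neither the action nor the contraction touches the last entry.\<close>

lemma aw_tau:
  assumes "\<gamma> \<in> carrier G" "y \<in> carrier (PA (Suc (i + j)))"
  shows "tT i j (aw i j \<gamma> y) = aw i j \<gamma> y"
  using assms
proof (induction i arbitrary: y \<gamma>)
  case 0
  have "tau (Suc 0) (unit_G g) = unit_G g" if "g \<in> carrier G" for g
    using that by (simp add: unit_G_def tau_bcons ge_closed kG.A.bnil_closed tau_bnil)
  then show ?case unfolding add_0
    using A_barS_eqI[OF module_T lin_comp[OF aw_lin[of \<gamma> 0 j, simplified] tT_lin] aw_lin[of \<gamma> 0 j, simplified]] 0
    by (simp add: aw_bcons_0 T_simps unit_G_closed psi_closed)
next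
  case (Suc i)
  show ?case
    by (rule A_barS_eqI[OF module_T lin_comp[OF aw_lin tT_lin] aw_lin])
      (use Suc.prems in \<open>auto simp: aw_bcons_Suc ac_tT sg_tT aw_closed lin_closed[OF sg_lin] Suc.IH\<close>)
qed

lemma aug_unit_G: "g \<in> carrier G \<Longrightarrow> aug (kG.A.gd 0 (unit_G g)) = \<one>\<^bsub>k\<^esub>"
  by (simp add: unit_G_def kG.A.gd_bcons_0 ge_closed kG.A.bnil_closed aug_la aug)

text \<open>For \<open>i = 0\<close> the first factor is one group element followed by 1. Augmenting
  it leaves the second factor, which is what the recursion for \<open>psi\<close> produces.\<close>

lemma augT_aw:
  assumes "\<gamma> \<in> carrier G" "y \<in> carrier (PA (Suc j))"
  shows "augT j (aw 0 j \<gamma> y) = psi (Suc j) \<gamma> y"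
  by (rule A_barS_eqI[OF S.module_P lin_comp[OF aw_lin[of \<gamma> 0 j, simplified] augT(1)] psi_lin])
    (use assms in \<open>auto simp: aw_bcons_0 T_simps unit_G_closed psi_closed aug_unit_G psi_bcons module.smult_one[OF S.module_P]\<close>)

lemma minus_add_minus:
  assumes "module k M" "x \<in> carrier M" "a \<in> carrier M" "b \<in> carrier M"
  shows "(x \<ominus>\<^bsub>M\<^esub> a) \<oplus>\<^bsub>M\<^esub> (a \<ominus>\<^bsub>M\<^esub> b) = x \<ominus>\<^bsub>M\<^esub> b"
proof -
  interpret M: module k M by fact
  show ?thesis using assms(2-)
    by (simp add: a_minus_def M.M.a_assoc M.M.r_neg1)
qed

lemma minus_signed:
  assumes "module k M" "x \<in> carrier M" "a \<in> carrier M" "b \<in> carrier M"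
  shows "(x \<ominus>\<^bsub>M\<^esub> a) \<oplus>\<^bsub>M\<^esub> signed M (Suc i) b = x \<ominus>\<^bsub>M\<^esub> (a \<oplus>\<^bsub>M\<^esub> signed M i b)"
proof -
  interpret M: module k M by fact
  show ?thesis using assms(2-)
    by (auto simp: signed_def a_minus_def M.M.minus_add M.M.a_ac)
qed

text \<open>For a bar with first entry t h and tail z, the differential is t h z minus t h \<otimes>
  d z. The contraction identities for \<open>sg\<close> match these terms with \<open>dG\<close> of
  the map with the longer front face; the \<open>tT\<close> occurring in them disappears by
  \<open>aw_tau\<close>. Induction supplies the terms with d z.\<close>

lemma aw_gd:
  assumes "\<gamma> \<in> carrier G" "y \<in> carrier (PA (Suc (Suc (i + j))))"
  shows "aw i j \<gamma> (A.gd (Suc (i + j)) y) =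
    dG i j (aw (Suc i) j \<gamma> y) \<oplus>\<^bsub>T i j\<^esub> signed (T i j) i (dS i j (aw i (Suc j) \<gamma> y))"
  using assms
proof (induction i arbitrary: y \<gamma>)
  case 0
  have aw_lin0: "aw 0 j \<gamma> \<in> lin k (PA (Suc j)) (T 0 j)" if "\<gamma> \<in> carrier G" for \<gamma> j
    using aw_lin[OF that, of 0 j] by simp
  have aw_lin1: "aw (Suc 0) j \<gamma> \<in> lin k (PA (Suc (Suc j))) (T (Suc 0) j)" if "\<gamma> \<in> carrier G" for \<gamma> j
    using aw_lin[OF that, of "Suc 0" j] by simp
  have "aw 0 j \<gamma> (A.gd (Suc j) y) = dG 0 j (aw (Suc 0) j \<gamma> y) \<oplus>\<^bsub>T 0 j\<^esub> dS 0 j (aw 0 (Suc j) \<gamma> y)"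
  proof (rule A_barS_eqI[OF module_T lin_comp[OF A.gd_lin aw_lin0]
      lin_addf[OF module_T lin_comp[OF aw_lin1 dG_lin] lin_comp[OF aw_lin0 dS_lin]]])
    fix t h z assume th: "t \<in> carrier S" "h \<in> carrier G" and z: "z \<in> carrier (PA (Suc j))"
    let ?\<delta> = "inv\<^bsub>G\<^esub> h \<otimes>\<^bsub>G\<^esub> \<gamma>" and ?u = "unit_G \<one>\<^bsub>G\<^esub>" and ?a = "ac 0 j t h"
    let ?x = "aw 0 j ?\<delta> z" and ?p = "psi (Suc j) ?\<delta> z"
    have d: "?\<delta> \<in> carrier G" using th 0 by simp
    have x: "?x \<in> carrier (T 0 j)" using lin_closed[OF aw_lin0 z] d by simp
    have p: "?p \<in> carrier (PS (Suc j))" using psi_closed d z by simp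
    have q: "S.bcons j \<one>\<^bsub>S\<^esub> (S.gd j ?p) \<in> carrier (PS (Suc j))" using p by (simp add: S.bcons_closed S.gd_closed)
    note c = tt_closed[OF unit_G_closed p, of "\<one>\<^bsub>G\<^esub>"] tt_closed[OF unit_G_closed q, of "\<one>\<^bsub>G\<^esub>"]
    \<comment> \<open>The base case of the recursion, rewritten as the action of t h on a tensor in
      which both bars start with a unit. It brings all terms under the common operator
      \<open>?a\<close>.\<close>
    have B: "aw 0 j' \<gamma> (A.bcons j' (el t h) w) = ac 0 j' t h (tt 0 j' ?u (S.bcons j' \<one>\<^bsub>S\<^esub> (psi j' ?\<delta> w)))"
      if "w \<in> carrier (PA j')" for w j'
      using that th d 0 by (simp add: aw_bcons_0 T_simps unit_G_closed unit_G_la psi_closed S.bmap_bcons act_unit S.la_bcons)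
    have "aw 0 j \<gamma> (A.gd (Suc j) (A.bcons (Suc j) (el t h) z))
        = aw 0 j \<gamma> (A.la (Suc j) (el t h) z) \<ominus>\<^bsub>T 0 j\<^esub> aw 0 j \<gamma> (A.bcons j (el t h) (A.gd j z))"
      using th z 0 by (simp add: A.gd_bcons_Suc el_closed lin_minus[OF A.module_P module_T aw_lin0] A.la_closed A.bcons_closed A.gd_closed)
    also have "aw 0 j \<gamma> (A.la (Suc j) (el t h) z) = ?a ?x"
      using aw_la[of \<gamma> t h z 0 j] th z 0 by simp
    also have "aw 0 j \<gamma> (A.bcons j (el t h) (A.gd j z)) = ?a (tt 0 j ?u (S.bcons j \<one>\<^bsub>S\<^esub> (S.gd j ?p)))"
      using B[of "A.gd j z" j] z d by (simp add: A.gd_closed psi_gd)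
    also have "?a ?x \<ominus>\<^bsub>T 0 j\<^esub> ?a (tt 0 j ?u (S.bcons j \<one>\<^bsub>S\<^esub> (S.gd j ?p)))
        = ?a (?x \<ominus>\<^bsub>T 0 j\<^esub> tt 0 j ?u (S.bcons j \<one>\<^bsub>S\<^esub> (S.gd j ?p)))"
      by (rule lin_minus[OF module_T module_T ac_lin[OF th] x c(2), symmetric])
    \<comment> \<open>The inserted term is the face shared by the two maps: the last face of the
      longer front part and the first face of the longer back part, which cancel.\<close>
    also have "?x \<ominus>\<^bsub>T 0 j\<^esub> tt 0 j ?u (S.bcons j \<one>\<^bsub>S\<^esub> (S.gd j ?p))
        = (?x \<ominus>\<^bsub>T 0 j\<^esub> tt 0 j ?u ?p) \<oplus>\<^bsub>T 0 j\<^esub> (tt 0 j ?u ?p \<ominus>\<^bsub>T 0 j\<^esub> tt 0 j ?u (S.bcons j \<one>\<^bsub>S\<^esub> (S.gd j ?p)))"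
      by (rule minus_add_minus[OF module_T x c, symmetric])
    also have "?a \<dots> = ?a (?x \<ominus>\<^bsub>T 0 j\<^esub> tt 0 j ?u ?p) \<oplus>\<^bsub>T 0 j\<^esub> ?a (tt 0 j ?u ?p \<ominus>\<^bsub>T 0 j\<^esub> tt 0 j ?u (S.bcons j \<one>\<^bsub>S\<^esub> (S.gd j ?p)))"
      by (rule lin_add[OF ac_lin[OF th]]) (intro module_minus_closed[OF module_T] x c)+
    also have "?a (?x \<ominus>\<^bsub>T 0 j\<^esub> tt 0 j ?u ?p) = dG 0 j (aw (Suc 0) j \<gamma> (A.bcons (Suc j) (el t h) z))"
      using aw_bcons_Suc[of \<gamma> t h z 0 j] th z 0 d x lin_closed[OF sg_lin x] aw_tau[OF d, of z 0 j]
      by (simp add: dG_ac dG_sg_0 augT_aw)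
    also have "?a (tt 0 j ?u ?p \<ominus>\<^bsub>T 0 j\<^esub> tt 0 j ?u (S.bcons j \<one>\<^bsub>S\<^esub> (S.gd j ?p))) = dS 0 j (aw 0 (Suc j) \<gamma> (A.bcons (Suc j) (el t h) z))"
      unfolding B[OF z] using th p q
      by (simp add: dS_ac tt_closed unit_G_closed S.bcons_closed T_simps(6) S.gd_bcons_Suc S.la_one tt_minus_right)
    finally show "aw 0 j \<gamma> (A.gd (Suc j) (A.bcons (Suc j) (el t h) z))
      = dG 0 j (aw (Suc 0) j \<gamma> (A.bcons (Suc j) (el t h) z)) \<oplus>\<^bsub>T 0 j\<^esub> dS 0 j (aw 0 (Suc j) \<gamma> (A.bcons (Suc j) (el t h) z))" .
  qed (use 0 in simp_all)
  then show ?case by (simp add: signed_def)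
next
  case (Suc i)
  let ?S = "signed (T (Suc i) j) (Suc i)"
  have aw_lin1: "aw (Suc i) (Suc j) \<gamma> \<in> lin k (PA (Suc (Suc (Suc (i + j))))) (T (Suc i) (Suc j))" if "\<gamma> \<in> carrier G" for \<gamma>
    using aw_lin[OF that, of "Suc i" "Suc j"] by simp
  have "aw (Suc i) j \<gamma> (A.gd (Suc (Suc (i + j))) y) = dG (Suc i) j (aw (Suc (Suc i)) j \<gamma> y) \<oplus>\<^bsub>T (Suc i) j\<^esub> ?S (dS (Suc i) j (aw (Suc i) (Suc j) \<gamma> y))"
  proof (rule A_barS_eqI[OF module_T lin_comp[OF A.gd_lin aw_lin[of _ "Suc i" j, simplified]]
      lin_addf[OF module_T lin_comp[OF aw_lin[of _ "Suc (Suc i)" j, simplified] dG_lin] lin_signedf[OF module_T lin_comp[OF aw_lin1 dS_lin]]]])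
    fix t h z assume th: "t \<in> carrier S" "h \<in> carrier G" and z: "z \<in> carrier (PA (Suc (Suc (i + j))))"
    let ?\<delta> = "inv\<^bsub>G\<^esub> h \<otimes>\<^bsub>G\<^esub> \<gamma>" and ?a = "ac (Suc i) j t h"
    let ?x = "aw (Suc i) j ?\<delta> z" and ?w = "aw i (Suc j) ?\<delta> z"
    have d: "?\<delta> \<in> carrier G" using th Suc.prems by simp
    have x: "?x \<in> carrier (T (Suc i) j)" using aw_closed[OF d, of z "Suc i" j] z by simp
    have w: "?w \<in> carrier (T i (Suc j))" using aw_closed[OF d, of z i "Suc j"] z by simp
    have dx: "dG i j ?x \<in> carrier (T i j)" by (rule lin_closed[OF dG_lin x])
    have dw: "dS i j ?w \<in> carrier (T i j)" by (rule lin_closed[OF dS_lin w])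
    note sx = lin_closed[OF sg_lin dx] and sw = lin_closed[OF sg_lin dw]
    have "aw (Suc i) j \<gamma> (A.gd (Suc (Suc (i + j))) (A.bcons (Suc (Suc (i + j))) (el t h) z))
        = aw (Suc i) j \<gamma> (A.la (Suc (Suc (i + j))) (el t h) z) \<ominus>\<^bsub>T (Suc i) j\<^esub> aw (Suc i) j \<gamma> (A.bcons (Suc (i + j)) (el t h) (A.gd (Suc (i + j)) z))"
      using th z Suc.prems by (simp add: A.gd_bcons_Suc el_closed lin_minus[OF A.module_P module_T aw_lin[of _ "Suc i" j, simplified]] A.la_closed A.bcons_closed A.gd_closed)
    also have "aw (Suc i) j \<gamma> (A.la (Suc (Suc (i + j))) (el t h) z) = ?a ?x"
      using aw_la[of \<gamma> t h z "Suc i" j] th z Suc.prems by simp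
    also have "aw (Suc i) j \<gamma> (A.bcons (Suc (i + j)) (el t h) (A.gd (Suc (i + j)) z)) = ?a (sg i j (aw i j ?\<delta> (A.gd (Suc (i + j)) z)))"
      using th z Suc.prems by (simp add: aw_bcons_Suc A.gd_closed)
    also have "aw i j ?\<delta> (A.gd (Suc (i + j)) z) = dG i j ?x \<oplus>\<^bsub>T i j\<^esub> signed (T i j) i (dS i j ?w)"
      using Suc.IH[OF d] z by simp
    also have "sg i j \<dots> = sg i j (dG i j ?x) \<oplus>\<^bsub>T (Suc i) j\<^esub> signed (T (Suc i) j) i (sg i j (dS i j ?w))"
      using lin_add[OF sg_lin dx signed_closed[OF module_T dw]] lin_signed[OF module_T module_T sg_lin dw] by simp
    also have "?a ?x \<ominus>\<^bsub>T (Suc i) j\<^esub> ?a (sg i j (dG i j ?x) \<oplus>\<^bsub>T (Suc i) j\<^esub> signed (T (Suc i) j) i (sg i j (dS i j ?w)))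
        = ?a (?x \<ominus>\<^bsub>T (Suc i) j\<^esub> (sg i j (dG i j ?x) \<oplus>\<^bsub>T (Suc i) j\<^esub> signed (T (Suc i) j) i (sg i j (dS i j ?w))))"
      by (rule lin_minus[OF module_T module_T ac_lin[OF th] x, symmetric])
        (intro module_add_closed[OF module_T] signed_closed[OF module_T] sx sw)
    also have "?x \<ominus>\<^bsub>T (Suc i) j\<^esub> (sg i j (dG i j ?x) \<oplus>\<^bsub>T (Suc i) j\<^esub> signed (T (Suc i) j) i (sg i j (dS i j ?w)))
        = (?x \<ominus>\<^bsub>T (Suc i) j\<^esub> sg i j (dG i j ?x)) \<oplus>\<^bsub>T (Suc i) j\<^esub> ?S (sg i j (dS i j ?w))"
      by (rule minus_signed[OF module_T x sx sw, symmetric])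
    also have "?a \<dots> = ?a (?x \<ominus>\<^bsub>T (Suc i) j\<^esub> sg i j (dG i j ?x)) \<oplus>\<^bsub>T (Suc i) j\<^esub> ?a (?S (sg i j (dS i j ?w)))"
      by (rule lin_add[OF ac_lin[OF th]]) (intro module_minus_closed[OF module_T] signed_closed[OF module_T] x sx sw)+
    also have "?a (?x \<ominus>\<^bsub>T (Suc i) j\<^esub> sg i j (dG i j ?x)) = dG (Suc i) j (aw (Suc (Suc i)) j \<gamma> (A.bcons (Suc (Suc (i + j))) (el t h) z))"
      using aw_bcons_Suc[of \<gamma> t h z "Suc i" j] th z Suc.prems d x lin_closed[OF sg_lin x] aw_tau[OF d, of z "Suc i" j]
      by (simp add: dG_ac dG_sg_Suc)
    also have "?a (?S (sg i j (dS i j ?w))) = ?S (dS (Suc i) j (aw (Suc i) (Suc j) \<gamma> (A.bcons (Suc (Suc (i + j))) (el t h) z)))"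
      using aw_bcons_Suc[of \<gamma> t h z i "Suc j"] th z Suc.prems w lin_closed[OF sg_lin w] lin_signed[OF module_T module_T ac_lin[OF th] sw, of "Suc i"]
      by (simp add: dS_ac dS_sg)
    finally show "aw (Suc i) j \<gamma> (A.gd (Suc (Suc (i + j))) (A.bcons (Suc (Suc (i + j))) (el t h) z))
      = dG (Suc i) j (aw (Suc (Suc i)) j \<gamma> (A.bcons (Suc (Suc (i + j))) (el t h) z)) \<oplus>\<^bsub>T (Suc i) j\<^esub>
        ?S (dS (Suc i) j (aw (Suc i) (Suc j) \<gamma> (A.bcons (Suc (Suc (i + j))) (el t h) z)))" .
  qed (use Suc.prems in simp_all)
  then show ?case by simp
qed

end

context twist
begin

section \<open>Alexander-Whitney after shuffle\<close>

lemma aug_tau: "U \<in> carrier (PG (Suc 0)) \<Longrightarrow> aug (kG.A.gd 0 (tau (Suc 0) U)) = aug (kG.A.gd 0 U)"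
proof (rule G_barS_eqI[OF kG.S.module_A lin_comp[OF lin_comp[OF tau_lin kG.A.gd_lin] aug(1)] lin_comp[OF kG.A.gd_lin aug(1)]])
  fix g u assume g: "g \<in> carrier G" and u: "u \<in> carrier (PG 0)"
  have "aug (tau 0 u) = aug u"
    using lin_smult[OF aug(1) aug_closed[OF u] kG.A.bnil_closed[OF ge_closed, of "\<one>\<^bsub>G\<^esub>"]] aug_closed[OF u]
    by (simp add: tau.simps(1) aug S.m_comm)
  then show "aug (kG.A.gd 0 (tau (Suc 0) (kG.A.bcons 0 (ge g) u))) = aug (kG.A.gd 0 (kG.A.bcons 0 (ge g) u))"
    using g u by (simp add: tau_bcons ge_closed kG.A.gd_bcons_0 tau_closed aug_la)
qed

text \<open>The counterpart of \<open>kap\<close> on tensor products, the contraction conjugated by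
  \<open>g\<close> and multiplied by \<open>s\<close>. \<open>aw\<close> transforms
  \<open>kap\<close> into this operator.\<close>

lemma conj_tt:
  assumes "g \<in> carrier G" "s \<in> carrier S" "U \<in> carrier (PG (Suc i))" "V \<in> carrier (PS (Suc j))"
  shows "ac (Suc i) j s g (sg i j (ac i j \<one>\<^bsub>S\<^esub> (inv\<^bsub>G\<^esub> g) (tt i j U V)))
    = tt (Suc i) j (kG.A.bcons (Suc i) (ge g) (kG.A.la (Suc i) (ge (inv\<^bsub>G\<^esub> g)) U)) (S.la (Suc j) s V)"
  using assms by (simp add: T_simps kG.A.la_bcons ge_mult S.bmap_la bmap_act bmap_act_one S.la_la act_unit)

text \<open>All pairs of bidegrees with the same total degree are treated at once, since the mixed
  compositions must vanish and the recursion relates neighbouring bidegrees. The result involves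
  \<open>tau\<close> because the shuffle forgets the last group entry.\<close>

definition aw_Sh_rule where
  "aw_Sh_rule n \<longleftrightarrow> (\<forall>i j i' j' \<gamma> U V. i + j = n \<longrightarrow> i' + j' = n \<longrightarrow> \<gamma> \<in> carrier G \<longrightarrow> U \<in> carrier (PG (Suc i)) \<longrightarrow> V \<in> carrier (PS (Suc j)) \<longrightarrow>
     aw i' j' \<gamma> (Sh i j U V) = (if \<gamma> = \<one>\<^bsub>G\<^esub> \<and> i' = i then tt i j (tau (Suc i) U) V else \<zero>\<^bsub>T i' j'\<^esub>))"

text \<open>\<open>psi\<close> is the augmented Alexander-Whitney map for a front face with one
  entry, so its values on shuffles follow from the rule in the same total degree.\<close>

lemma psi_Sh:
  assumes "aw_Sh_rule (a + b)" "\<gamma> \<in> carrier G" "U \<in> carrier (PG (Suc a))" "V \<in> carrier (PS (Suc b))"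
  shows "psi (Suc (a + b)) \<gamma> (Sh a b U V) = (if \<gamma> = \<one>\<^bsub>G\<^esub> \<and> a = 0 then aug (kG.A.gd 0 U) \<odot>\<^bsub>PS (Suc b)\<^esub> V else \<zero>\<^bsub>PS (Suc (a + b))\<^esub>)"
proof -
  have "psi (Suc (a + b)) \<gamma> (Sh a b U V) = augT (a + b) (aw 0 (a + b) \<gamma> (Sh a b U V))"
    using augT_aw[OF assms(2), of "Sh a b U V" "a + b"] Sh_closed[OF assms(3,4)] by simp
  also have "aw 0 (a + b) \<gamma> (Sh a b U V) = (if \<gamma> = \<one>\<^bsub>G\<^esub> \<and> 0 = a then tt a b (tau (Suc a) U) V else \<zero>\<^bsub>T 0 (a + b)\<^esub>)"
    using assms by (simp add: aw_Sh_rule_def)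
  finally show ?thesis
    using assms lin_zero[OF module_T S.module_P augT(1)]
    by (auto simp: T_simps aug_tau)
qed

text \<open>\<open>aw\<close> of \<open>kap\<close> is the conjugate contraction of
  \<open>aw\<close> of \<open>W\<close>, and in positive total degree \<open>W\<close> is made of
  lower shuffles. The summand with g u contributes on the diagonal and yields g \<otimes> u again.
  The summand with g \<otimes> u would contribute one step beside the diagonal, where the
  contraction leaves a unit behind \<open>g\<close> and normalization removes it. For
  \<open>i' = 0\<close> normalization over \<open>S\<close> plays this part.\<close>

lemma aw_Sh_bcons:
  assumes IH: "\<And>m. m < i + j \<Longrightarrow> aw_Sh_rule m" and n: "i' + j' = i + j" and \<gamma>: "\<gamma> \<in> carrier G"
    and g: "g \<in> carrier G" and u: "u \<in> carrier (PG i)" and s: "s \<in> carrier S" and v: "v \<in> carrier (PS j)"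
  shows "aw i' j' \<gamma> (kap (i + j) s g (W i j g u v)) =
    (if \<gamma> = \<one>\<^bsub>G\<^esub> \<and> i' = i then tt i j (kG.A.bcons i (ge g) (tau i u)) (S.bcons j s v) else \<zero>\<^bsub>T i' j'\<^esub>)"
proof -
  let ?w = "W i j g u v" and ?gi = "inv\<^bsub>G\<^esub> g"
  note [simp] = ge_closed kG.A.la_closed kG.A.bcons_closed S.bcons_closed tau_closed act_endo S.bmap_closed act_closed S.la_closed
  have w: "?w \<in> carrier (PA (i + j))" using W_closed[OF g u v] .
  have gg: "?gi \<in> carrier G" "inv\<^bsub>G\<^esub> ?gi \<otimes>\<^bsub>G\<^esub> (?gi \<otimes>\<^bsub>G\<^esub> \<gamma>) = \<gamma>"
    using g \<gamma> by (simp_all add: G.m_assoc[symmetric])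
  have k: "kap (i + j) s g ?w = A.bcons (i' + j') (el s g) (A.la (i' + j') (el \<one>\<^bsub>S\<^esub> ?gi) ?w)"
    using kap_eq[OF g s w] n by simp
  have w': "A.la (i' + j') (el \<one>\<^bsub>S\<^esub> ?gi) ?w \<in> carrier (PA (i' + j'))"
    using w n by (intro A.la_closed el_closed) auto
  have sub: "aw i'' j' \<gamma> (Sh a b U V) = (if \<gamma> = \<one>\<^bsub>G\<^esub> \<and> i'' = a then tt a b (tau (Suc a) U) V else \<zero>\<^bsub>T i'' j'\<^esub>)"
    if "a + b < i + j" "i'' + j' = a + b" "U \<in> carrier (PG (Suc a))" "V \<in> carrier (PS (Suc b))" for i'' a b U V
    using IH[OF that(1)] that \<gamma> by (simp add: aw_Sh_rule_def)
  show ?thesis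
  proof (cases i')
    case 0
    with n have j': "j' = i + j" by simp
    \<comment> \<open>The translation by the inverse of \<open>g\<close> inside \<open>kap\<close>
      brings the total degree of the tail back to \<open>\<gamma>\<close>; the diagonal action of
      the inverse is undone by the outer \<open>g\<close>.\<close>
    have pl: "psi j' (?gi \<otimes>\<^bsub>G\<^esub> \<gamma>) (A.la j' (el \<one>\<^bsub>S\<^esub> ?gi) ?w) = S.bmap j' (act ?gi) (psi j' \<gamma> ?w)"
      using psi_la[of "?gi \<otimes>\<^bsub>G\<^esub> \<gamma>" "\<one>\<^bsub>S\<^esub>" ?gi ?w j'] g \<gamma> w gg unfolding j'
      by (simp add: S.la_one psi_closed)
    have pc: "psi j' \<gamma> ?w \<in> carrier (PS j')" using psi_closed[OF \<gamma>] w j' by simp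
    have "aw i' j' \<gamma> (kap (i + j) s g ?w) = tt 0 j' (unit_G g) (S.bcons j' s (S.bmap j' (act g) (S.bmap j' (act ?gi) (psi j' \<gamma> ?w))))"
      unfolding k using aw_bcons_0[OF \<gamma> s g, of "A.la j' (el \<one>\<^bsub>S\<^esub> ?gi) ?w" j'] w' pl 0 by simp
    also have "S.bmap j' (act g) (S.bmap j' (act ?gi) (psi j' \<gamma> ?w)) = psi j' \<gamma> ?w"
      using g gg pc by (simp add: bmap_act bmap_act_one)
    finally have L: "aw i' j' \<gamma> (kap (i + j) s g ?w) = tt 0 j' (unit_G g) (S.bcons j' s (psi j' \<gamma> ?w))" .
    have Z: "tt 0 j' (unit_G g) (S.bcons j' s \<zero>\<^bsub>PS j'\<^esub>) = \<zero>\<^bsub>T 0 j'\<^esub>"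
      using lin_zero[OF S.module_P S.module_P S.bcons_lin[OF s]] by (simp add: tt_zero unit_G_closed)
    have N: "tt 0 j' (unit_G g) (S.bcons j' s (aug u \<odot>\<^bsub>PS j'\<^esub> v)) = tt 0 j (kG.A.bcons 0 (ge g) (tau 0 u)) (S.bcons j s v)"
      if "i = 0"
      using that u v j' g lin_smult[OF S.bcons_lin[OF s], of "aug u" v j] tau_bcons_0[of g u]
      by (simp add: aug_closed tau_bcons tt_scalar unit_G_closed s)
    \<comment> \<open>For positive \<open>i\<close> the back face of \<open>W\<close> is zero or a
      multiple of a bar that starts with the unit of \<open>S\<close>, and it vanishes behind
      \<open>s\<close>. So the component with \<open>i' = 0\<close> is zero, as it should
      be.\<close>
    have Q: "tt 0 j' (unit_G g) (S.bcons j' s (r \<odot>\<^bsub>PS j'\<^esub> S.bcons b \<one>\<^bsub>S\<^esub> x)) = \<zero>\<^bsub>T 0 j'\<^esub>"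
      if "r \<in> carrier k" "x \<in> carrier (PS b)" "j' = Suc b" for r x b
      using that s lin_smult[OF S.bcons_lin[OF s, of "Suc b"] that(1), of "S.bcons b \<one>\<^bsub>S\<^esub> x"]
      by (simp add: S.bcons_unit tt_zero unit_G_closed module.smult_r_null[OF S.module_P])
    show ?thesis
    proof (cases i)
      case i: 0
      show ?thesis
      proof (cases j)
        case j: 0
        have "psi j' \<gamma> ?w = (if \<gamma> = \<one>\<^bsub>G\<^esub> then aug u \<odot>\<^bsub>PS j'\<^esub> v else \<zero>\<^bsub>PS j'\<^esub>)"
          using i j j' u v \<gamma> lin_smult[OF psi_lin[OF \<gamma>, of 0] aug_closed emb_closed, of u v]
          by (simp add: psi_emb module.smult_r_null[OF S.module_P] aug_closed)
        then show ?thesis using L N Z 0 i j' by simp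
      next
        case j: (Suc b)
        have "psi (Suc (0 + b)) \<gamma> (Sh 0 b (kG.A.bcons 0 (ge g) u) v) =
            (if \<gamma> = \<one>\<^bsub>G\<^esub> \<and> (0::nat) = 0 then aug (kG.A.gd 0 (kG.A.bcons 0 (ge g) u)) \<odot>\<^bsub>PS (Suc b)\<^esub> v else \<zero>\<^bsub>PS (Suc (0 + b))\<^esub>)"
          by (rule psi_Sh[OF IH \<gamma>]) (use i j u v in auto)
        then have "psi j' \<gamma> ?w = (if \<gamma> = \<one>\<^bsub>G\<^esub> then aug u \<odot>\<^bsub>PS j'\<^esub> v else \<zero>\<^bsub>PS j'\<^esub>)"
          using i j j' u g by (simp add: kG.A.gd_bcons_0 aug_la)
        then show ?thesis using L N Z 0 i j' by simp
      qed
    next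
      case i: (Suc a)
      show ?thesis
      proof (cases j)
        case j: 0
        have "psi (Suc (a + 0)) \<gamma> (Sh a 0 (kG.A.la (Suc a) (ge g) u) (S.bcons 0 \<one>\<^bsub>S\<^esub> v)) =
            (if \<gamma> = \<one>\<^bsub>G\<^esub> \<and> a = 0 then aug (kG.A.gd 0 (kG.A.la (Suc a) (ge g) u)) \<odot>\<^bsub>PS (Suc 0)\<^esub> S.bcons 0 \<one>\<^bsub>S\<^esub> v else \<zero>\<^bsub>PS (Suc (a + 0))\<^esub>)"
          by (rule psi_Sh[OF IH \<gamma>]) (use i j u v in auto)
        then show ?thesis
          using L Z 0 i j j' u v Q[of "aug (kG.A.gd 0 (kG.A.la (Suc a) (ge g) u))" v 0]
          by (auto simp: aug_closed kG.A.gd_closed)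
      next
        case j: (Suc b)
        let ?X1 = "Sh a (Suc b) (kG.A.la (Suc a) (ge g) u) (S.bcons (Suc b) \<one>\<^bsub>S\<^esub> v)"
        let ?X2 = "Sh (Suc a) b (kG.A.bcons (Suc a) (ge g) u) v"
        have u': "u \<in> carrier (PG (Suc a))" and v': "v \<in> carrier (PS (Suc b))" using u v i j by simp_all
        have X: "?X1 \<in> carrier (PA (Suc (Suc (a + b))))" "?X2 \<in> carrier (PA (Suc (Suc (a + b))))"
          using Sh_closed[of "kG.A.la (Suc a) (ge g) u" a "S.bcons (Suc b) \<one>\<^bsub>S\<^esub> v" "Suc b"]
            Sh_closed[of "kG.A.bcons (Suc a) (ge g) u" "Suc a" v b] u' v' by simp_all
        have 1: "psi (Suc (a + Suc b)) \<gamma> ?X1 =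
            (if \<gamma> = \<one>\<^bsub>G\<^esub> \<and> a = 0 then aug (kG.A.gd 0 (kG.A.la (Suc a) (ge g) u)) \<odot>\<^bsub>PS (Suc (Suc b))\<^esub> S.bcons (Suc b) \<one>\<^bsub>S\<^esub> v else \<zero>\<^bsub>PS (Suc (a + Suc b))\<^esub>)"
          by (rule psi_Sh[OF IH \<gamma>]) (use i j u' v' in auto)
        have 2: "psi (Suc (Suc a + b)) \<gamma> ?X2 =
            (if \<gamma> = \<one>\<^bsub>G\<^esub> \<and> Suc a = 0 then aug (kG.A.gd 0 (kG.A.bcons (Suc a) (ge g) u)) \<odot>\<^bsub>PS (Suc b)\<^esub> v else \<zero>\<^bsub>PS (Suc (Suc a + b))\<^esub>)"
          by (rule psi_Sh[OF IH \<gamma>]) (use i j u' v' in auto)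
        have "psi j' \<gamma> ?w = psi j' \<gamma> ?X1 \<oplus>\<^bsub>PS j'\<^esub> signed (PS j') (Suc a) (psi j' \<gamma> ?X2)"
          using i j j' lin_add[OF psi_lin[OF \<gamma>] X(1) signed_closed[OF A.module_P X(2)]]
            lin_signed[OF A.module_P S.module_P psi_lin[OF \<gamma>] X(2)] by simp
        also have "psi j' \<gamma> ?X2 = \<zero>\<^bsub>PS j'\<^esub>" using 2 i j j' by simp
        also have "signed (PS j') (Suc a) \<zero>\<^bsub>PS j'\<^esub> = \<zero>\<^bsub>PS j'\<^esub>"
          by (rule lin_zero[OF S.module_P S.module_P lin_signedf[OF S.module_P lin_ident]])
        finally have "psi j' \<gamma> ?w = psi j' \<gamma> ?X1"
          using psi_closed[OF \<gamma>, of ?X1 j'] X i j j' by (simp add: module_r_zero[OF S.module_P])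
        then show ?thesis
          using 1 L Z 0 i j j' u' v' Q[of "aug (kG.A.gd 0 (kG.A.la (Suc a) (ge g) u))" v "Suc b"]
          by (auto simp: aug_closed kG.A.gd_closed)
      qed
    qed
  next
    case (Suc i'')
    then have ij: "Suc (i'' + j') = i + j" using n by simp
    have wc: "?w \<in> carrier (PA (Suc (i'' + j')))" using w ij by simp
    let ?K = "\<lambda>x. ac (Suc i'') j' s g (sg i'' j' (ac i'' j' \<one>\<^bsub>S\<^esub> ?gi x))"
    have Kl: "?K \<in> lin k (T i'' j') (T (Suc i'') j')"
      by (rule lin_comp[OF lin_comp[OF ac_lin sg_lin] ac_lin]) (use g s gg in auto)
    have L: "aw i' j' \<gamma> (kap (i + j) s g ?w) = ?K (aw i'' j' \<gamma> ?w)"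
      unfolding k using aw_bcons_Suc[OF \<gamma> s g, of "A.la (Suc (i'' + j')) (el \<one>\<^bsub>S\<^esub> ?gi) ?w" i'' j'] w' Suc
        aw_la[of "?gi \<otimes>\<^bsub>G\<^esub> \<gamma>" "\<one>\<^bsub>S\<^esub>" ?gi ?w i'' j'] g \<gamma> wc gg by simp
    have Z: "?K \<zero>\<^bsub>T i'' j'\<^esub> = \<zero>\<^bsub>T i' j'\<^esub>" unfolding Suc by (rule lin_zero[OF module_T module_T Kl])
    \<comment> \<open>Conjugation undoes the multiplication in g u: the contraction gives
      \<open>g\<close> followed by the inverse of \<open>g\<close> times g u, that is,
      \<open>g\<close> followed by \<open>u\<close>.\<close>
    have K1: "?K (tt i'' j' (tau (Suc i'') (kG.A.la (Suc i'') (ge g) x)) (S.bcons j' \<one>\<^bsub>S\<^esub> y))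
        = tt i' j' (kG.A.bcons i' (ge g) (tau i' x)) (S.bcons j' s y)"
      if "x \<in> carrier (PG i')" "y \<in> carrier (PS j')" for x y
      using that g s Suc gg
      by (simp add: conj_tt tau_la kG.A.la_la ge_mult ge_one kG.A.la_one S.la_bcons)
    \<comment> \<open>Here the inverse of \<open>g\<close> meets a bar that starts with
      \<open>g\<close>; a unit follows the new head and the tensor is zero.\<close>
    have K2: "?K (tt i'' j' (tau (Suc i'') (kG.A.bcons i'' (ge g) x)) y) = \<zero>\<^bsub>T i' j'\<^esub>"
      if "x \<in> carrier (PG i'')" "y \<in> carrier (PS (Suc j'))" for x y
      using that g s Suc gg
      by (simp add: conj_tt tau_bcons kG.A.la_bcons ge_mult ge_one kG.A.bcons_unit tt_zero)
    show ?thesis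
    proof (cases i)
      case i: 0
      with ij obtain b where j: "j = Suc b" "i'' + j' = b" by (cases j) auto
      have "aw i'' j' \<gamma> (Sh 0 b (kG.A.bcons 0 (ge g) u) v)
          = (if \<gamma> = \<one>\<^bsub>G\<^esub> \<and> i'' = 0 then tt 0 b (tau (Suc 0) (kG.A.bcons 0 (ge g) u)) v else \<zero>\<^bsub>T i'' j'\<^esub>)"
        by (rule sub) (use i j u v in auto)
      then have K: "aw i' j' \<gamma> (kap (i + j) s g ?w)
          = ?K (if \<gamma> = \<one>\<^bsub>G\<^esub> \<and> i'' = 0 then tt 0 b (tau (Suc 0) (kG.A.bcons 0 (ge g) u)) v else \<zero>\<^bsub>T i'' j'\<^esub>)"
        using L i j by simp
      have "?K (if \<gamma> = \<one>\<^bsub>G\<^esub> \<and> i'' = 0 then tt 0 b (tau (Suc 0) (kG.A.bcons 0 (ge g) u)) v else \<zero>\<^bsub>T i'' j'\<^esub>) = \<zero>\<^bsub>T i' j'\<^esub>"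
      proof (cases "\<gamma> = \<one>\<^bsub>G\<^esub> \<and> i'' = 0")
        case True
        then have e': "i'' = 0" "j' = b" using j by auto
        show ?thesis using K2[of u v] u v i j True unfolding e' by simp
      next
        case False
        then show ?thesis using Z by (simp only: if_False)
      qed
      then show ?thesis unfolding K using Suc i by simp
    next
      case i: (Suc a)
      show ?thesis
      proof (cases j)
        case j: 0
        have "aw i'' j' \<gamma> (Sh a 0 (kG.A.la (Suc a) (ge g) u) (S.bcons 0 \<one>\<^bsub>S\<^esub> v))
            = (if \<gamma> = \<one>\<^bsub>G\<^esub> \<and> i'' = a then tt a 0 (tau (Suc a) (kG.A.la (Suc a) (ge g) u)) (S.bcons 0 \<one>\<^bsub>S\<^esub> v) else \<zero>\<^bsub>T i'' j'\<^esub>)"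
          by (rule sub) (use i j u v ij in auto)
        then have K: "aw i' j' \<gamma> (kap (i + j) s g ?w) = ?K (if \<gamma> = \<one>\<^bsub>G\<^esub> \<and> i'' = a
            then tt a 0 (tau (Suc a) (kG.A.la (Suc a) (ge g) u)) (S.bcons 0 \<one>\<^bsub>S\<^esub> v) else \<zero>\<^bsub>T i'' j'\<^esub>)"
          using L i j by simp
        show ?thesis
        proof (cases "\<gamma> = \<one>\<^bsub>G\<^esub> \<and> i'' = a")
          case True
          then have e': "i'' = a" "j' = 0" "i' = Suc a" using ij i j Suc by auto
          show ?thesis unfolding K using K1[of u v] u v True unfolding e' i j by simp
        next
          case False
          then have "\<not> (\<gamma> = \<one>\<^bsub>G\<^esub> \<and> i' = i)" using Suc i by auto
          then show ?thesis unfolding K using Z False by (simp only: if_False)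
        qed
      next
        case j: (Suc b)
        let ?X1 = "Sh a (Suc b) (kG.A.la (Suc a) (ge g) u) (S.bcons (Suc b) \<one>\<^bsub>S\<^esub> v)"
        let ?X2 = "Sh (Suc a) b (kG.A.bcons (Suc a) (ge g) u) v"
        have u': "u \<in> carrier (PG (Suc a))" and v': "v \<in> carrier (PS (Suc b))" using u v i j by simp_all
        have e: "i'' + j' = Suc (a + b)" using ij i j by simp
        have X: "?X1 \<in> carrier (PA (Suc (i'' + j')))" "?X2 \<in> carrier (PA (Suc (i'' + j')))"
          using Sh_closed[of "kG.A.la (Suc a) (ge g) u" a "S.bcons (Suc b) \<one>\<^bsub>S\<^esub> v" "Suc b"]
            Sh_closed[of "kG.A.bcons (Suc a) (ge g) u" "Suc a" v b] u' v' e by simp_all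
        have 1: "aw i'' j' \<gamma> ?X1
            = (if \<gamma> = \<one>\<^bsub>G\<^esub> \<and> i'' = a then tt a (Suc b) (tau (Suc a) (kG.A.la (Suc a) (ge g) u)) (S.bcons (Suc b) \<one>\<^bsub>S\<^esub> v) else \<zero>\<^bsub>T i'' j'\<^esub>)"
          by (rule sub) (use i j u' v' e in auto)
        have 2: "aw i'' j' \<gamma> ?X2
            = (if \<gamma> = \<one>\<^bsub>G\<^esub> \<and> i'' = Suc a then tt (Suc a) b (tau (Suc (Suc a)) (kG.A.bcons (Suc a) (ge g) u)) v else \<zero>\<^bsub>T i'' j'\<^esub>)"
          by (rule sub) (use i j u' v' e in auto)
        note ac1 = aw_closed[OF \<gamma> X(1)] and ac2 = aw_closed[OF \<gamma> X(2)]
        have "?w = ?X1 \<oplus>\<^bsub>PA (Suc (i'' + j'))\<^esub> signed (PA (Suc (i'' + j'))) (Suc a) ?X2" using i j e by simp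
        then have "aw i'' j' \<gamma> ?w = aw i'' j' \<gamma> ?X1 \<oplus>\<^bsub>T i'' j'\<^esub> signed (T i'' j') (Suc a) (aw i'' j' \<gamma> ?X2)"
          using lin_add[OF aw_lin[OF \<gamma>] X(1) signed_closed[OF A.module_P X(2)]]
            lin_signed[OF A.module_P module_T aw_lin[OF \<gamma>] X(2)] by simp
        then have "?K (aw i'' j' \<gamma> ?w) = ?K (aw i'' j' \<gamma> ?X1) \<oplus>\<^bsub>T (Suc i'') j'\<^esub> signed (T (Suc i'') j') (Suc a) (?K (aw i'' j' \<gamma> ?X2))"
          using lin_add[OF Kl ac1 signed_closed[OF module_T ac2]] lin_signed[OF module_T module_T Kl ac2] by simp
        also have "?K (aw i'' j' \<gamma> ?X2) = \<zero>\<^bsub>T i' j'\<^esub>"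
        proof (cases "\<gamma> = \<one>\<^bsub>G\<^esub> \<and> i'' = Suc a")
          case True
          then have e': "i'' = Suc a" "j' = b" using e by auto
          show ?thesis unfolding 2 using K2[of u v] u' v' True unfolding e' by simp
        next
          case False
          then show ?thesis unfolding 2 using Z by (simp only: if_False)
        qed
        also have "signed (T (Suc i'') j') (Suc a) \<zero>\<^bsub>T i' j'\<^esub> = \<zero>\<^bsub>T (Suc i'') j'\<^esub>"
          unfolding Suc by (rule lin_zero[OF module_T module_T lin_signedf[OF module_T lin_ident]])
        also have "?K (aw i'' j' \<gamma> ?X1) \<oplus>\<^bsub>T (Suc i'') j'\<^esub> \<zero>\<^bsub>T (Suc i'') j'\<^esub> = ?K (aw i'' j' \<gamma> ?X1)"
          by (rule module_r_zero[OF module_T lin_closed[OF Kl ac1]])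
        finally have K: "aw i' j' \<gamma> (kap (i + j) s g ?w) = ?K (aw i'' j' \<gamma> ?X1)" using L by simp
        show ?thesis
        proof (cases "\<gamma> = \<one>\<^bsub>G\<^esub> \<and> i'' = a")
          case True
          then have e': "i'' = a" "j' = Suc b" "i' = Suc a" using e Suc by auto
          show ?thesis unfolding K 1 using K1[of u v] u' v' True unfolding e' i j by simp
        next
          case False
          then have "\<not> (\<gamma> = \<one>\<^bsub>G\<^esub> \<and> i' = i)" using Suc i by auto
          then show ?thesis unfolding K 1 using Z False by (simp only: if_False)
        qed
      qed
    qed
  qed
qed

lemma aw_Sh_rule: "aw_Sh_rule n"
proof (induction n rule: less_induct)
  case (less n)
  show ?case
    unfolding aw_Sh_rule_def
  proof (intro allI impI)
    fix i j i' j' \<gamma> U V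
    assume *: "i + j = n" "i' + j' = n" "\<gamma> \<in> carrier G" "U \<in> carrier (PG (Suc i))" "V \<in> carrier (PS (Suc j))"
    let ?R = "\<lambda>U V. if \<gamma> = \<one>\<^bsub>G\<^esub> \<and> i' = i then tt i j (tau (Suc i) U) V else \<zero>\<^bsub>T i' j'\<^esub>"
    have b: "bilin k (PG (Suc i)) (PS (Suc j)) (T i' j') ?R"
    proof (cases "\<gamma> = \<one>\<^bsub>G\<^esub> \<and> i' = i")
      case True
      then show ?thesis using bilin_two_lin[OF tt_bilin tau_lin lin_ident] * by auto
    next
      case False
      then show ?thesis by (auto intro!: bilinI lin_zerof[OF module_T])
    qed
    have l: "aw i' j' \<gamma> \<in> lin k (PA (Suc (i + j))) (T i' j')"
      using aw_lin[OF *(3), of i' j'] * by simp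
    show "aw i' j' \<gamma> (Sh i j U V) = ?R U V"
    proof (rule Sh_eqI[OF module_T bilin_comp[OF Sh_bilin lin_ident lin_ident l] b _ *(4,5)])
      fix g u s v assume "g \<in> carrier G" "u \<in> carrier (PG i)" "s \<in> carrier S" "v \<in> carrier (PS j)"
      then show "aw i' j' \<gamma> (Sh i j (kG.A.bcons i (ge g) u) (S.bcons j s v)) = ?R (kG.A.bcons i (ge g) u) (S.bcons j s v)"
        using aw_Sh_bcons[of i j i' j' \<gamma> g u s v] * less by (simp add: Sh_bcons tau_bcons ge_closed)
    qed
  qed
qed

lemma aw_Sh:
  "\<lbrakk>i' + j' = i + j; \<gamma> \<in> carrier G; U \<in> carrier (PG (Suc i)); V \<in> carrier (PS (Suc j))\<rbrakk> \<Longrightarrow>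
     aw i' j' \<gamma> (Sh i j U V) = (if \<gamma> = \<one>\<^bsub>G\<^esub> \<and> i' = i then tt i j (tau (Suc i) U) V else \<zero>\<^bsub>T i' j'\<^esub>)"
  using aw_Sh_rule[of "i + j"] by (auto simp: aw_Sh_rule_def)

end

section \<open>Internal gradings on bar modules\<close>

lemma coset_eq_iff:
  assumes "module k M" "submodule H k M" "x \<in> carrier M"
  shows "H +>\<^bsub>M\<^esub> x = H \<longleftrightarrow> x \<in> H"
proof -
  interpret M: module k M by fact
  interpret H: abelian_subgroup H M by (rule submodule_abelian_subgroup[OF assms(1,2)])
  show ?thesis
    using H.a_rcos_const[of x] H.a_rcos_self[OF assms(3)] by auto
qed

text \<open>
  Vanishing criteria, such as \<open>barS_eqI\<close> with right hand side \<open>0\<close>, yield membership criteria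
  when they are applied to the quotient by a submodule.
\<close>

lemma mem_submoduleI:
  fixes N :: "('k, 'n) module"
  assumes M: "module k N" "submodule H k N" and f: "f \<in> lin k M N"
    and crit: "\<And>q. q \<in> lin k M (quotient_module N H) \<Longrightarrow> (\<And>x. x \<in> X \<Longrightarrow> q x = \<zero>\<^bsub>quotient_module N H\<^esub>) \<Longrightarrow>
      q u = \<zero>\<^bsub>quotient_module N H\<^esub>"
    and X: "\<And>x. x \<in> X \<Longrightarrow> x \<in> carrier M \<and> f x \<in> H" and u: "u \<in> carrier M"
  shows "f u \<in> H"
proof -
  have "(\<lambda>x. H +>\<^bsub>N\<^esub> f x) u = \<zero>\<^bsub>quotient_module N H\<^esub>"
    by (rule crit[OF lin_comp[OF f coset_lin[OF M]]])
      (use X coset_eq_iff[OF M lin_closed[OF f]] in auto)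
  then show ?thesis using coset_eq_iff[OF M lin_closed[OF f u]] by simp
qed

context kalg
begin

section \<open>Homogeneous pieces of bar modules\<close>

definition alg_grading :: "(int \<Rightarrow> 'a set) \<Rightarrow> bool" where
  "alg_grading gr \<longleftrightarrow> (\<forall>m. submodule (gr m) k A) \<and> \<one> \<in> gr 0 \<and>
     (\<forall>m n. \<forall>x\<in>gr m. \<forall>y\<in>gr n. x \<otimes> y \<in> gr (m + n))"

lemma alg_gradingD:
  assumes "alg_grading gr"
  shows "submodule (gr m) k A" "\<one> \<in> gr 0" "x \<in> gr m \<Longrightarrow> y \<in> gr n \<Longrightarrow> x \<otimes> y \<in> gr (m + n)"
    "x \<in> gr m \<Longrightarrow> x \<in> carrier A"
  using assms submodule_subset[of "gr m" k A] by (auto simp: alg_grading_def)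

definition gbar_gens :: "(int \<Rightarrow> 'a set) \<Rightarrow> nat \<Rightarrow> int \<Rightarrow> ('a list \<Rightarrow> 'k) set set" where
  "gbar_gens gr n m = {bt n xs | xs ms. xs \<in> bar_gens A n \<and>
     list_all2 (\<lambda>x j. x \<in> gr j) xs ms \<and> sum_list ms = m}"

definition gbar :: "(int \<Rightarrow> 'a set) \<Rightarrow> nat \<Rightarrow> int \<Rightarrow> ('a list \<Rightarrow> 'k) set set" where
  "gbar gr n m = span_of k (P n) (gbar_gens gr n m)"

lemma bar_grading_eq: "bar_grading k A gr n m = gbar gr (Suc n) m"
  by (simp add: bar_grading_def gbar_def gbar_gens_def bar_module_eq bar_tensor_eq bar_lists_eq)

lemma gbar_gens_subset: "gbar_gens gr n m \<subseteq> carrier (P n)"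
  by (auto simp: gbar_gens_def bt_closed)

lemma gbar_submodule: "submodule (gbar gr n m) k (P n)"
  unfolding gbar_def by (rule span_of_submodule[OF module_P gbar_gens_subset])

lemma gbar_closed: "y \<in> gbar gr n m \<Longrightarrow> y \<in> carrier (P n)"
  using submodule_subset[OF gbar_submodule] by blast

lemma gbar_lin:
  assumes "module k N" "f \<in> lin k (P n) N" "submodule K k N" "\<And>x. x \<in> gbar_gens gr n m \<Longrightarrow> f x \<in> K"
    and "y \<in> gbar gr n m"
  shows "f y \<in> K"
  using lin_span[OF module_P assms(1-3) gbar_gens_subset assms(4)] assms(5) by (simp add: gbar_def)

lemma bnil_gbar: "x \<in> gr m \<Longrightarrow> x \<in> carrier A \<Longrightarrow> bnil x \<in> gbar gr 0 m"
  unfolding gbar_def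
  by (rule span_of_gen) (auto simp: gbar_gens_def bnil_def bar_gens_0 list_all2_Cons1 intro!: exI[of _ "[x]"] exI[of _ "[m]"])

lemma bcons_gbar:
  assumes "x \<in> gr a" "x \<in> carrier A" "y \<in> gbar gr n m"
  shows "bcons n x y \<in> gbar gr (Suc n) (a + m)"
proof (rule gbar_lin[OF module_P bcons_lin[OF assms(2)] gbar_submodule _ assms(3)])
  fix z assume "z \<in> gbar_gens gr n m"
  then obtain xs ms where z: "z = bt n xs" "xs \<in> bar_gens A n" "list_all2 (\<lambda>x j. x \<in> gr j) xs ms" "sum_list ms = m"
    by (auto simp: gbar_gens_def)
  then have "bcons n x z \<in> gbar_gens gr (Suc n) (a + m)"
    using assms unfolding gbar_gens_def
    by (auto simp: bcons_bt bar_gens_Cons intro!: exI[of _ "x # xs"] exI[of _ "a # ms"])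
  then show "bcons n x z \<in> gbar gr (Suc n) (a + m)" unfolding gbar_def by (rule span_of_gen)
qed

lemma gbar_0_lin:
  assumes "module k N" "f \<in> lin k (P 0) N" "submodule K k N"
    and "\<And>x. x \<in> gr m \<Longrightarrow> x \<in> carrier A \<Longrightarrow> f (bnil x) \<in> K" "y \<in> gbar gr 0 m"
  shows "f y \<in> K"
  by (rule gbar_lin[OF assms(1-3) _ assms(5)])
    (use assms(4) in \<open>auto simp: gbar_gens_def bar_gens_0 list_all2_Cons1 bnil_def\<close>)

text \<open>A generator of a homogeneous piece has a homogeneous head and a homogeneous tail with
  degrees adding up to \<open>m\<close>, which allows degrees to be followed by recursion on the
  length.\<close>

lemma gbar_Suc_lin:
  assumes "module k N" "f \<in> lin k (P (Suc n)) N" "submodule K k N"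
    and "\<And>x a y. x \<in> gr a \<Longrightarrow> x \<in> carrier A \<Longrightarrow> y \<in> gbar gr n (m - a) \<Longrightarrow> f (bcons n x y) \<in> K" "y \<in> gbar gr (Suc n) m"
  shows "f y \<in> K"
proof (rule gbar_lin[OF assms(1-3) _ assms(5)])
  fix z assume "z \<in> gbar_gens gr (Suc n) m"
  then obtain xs ms where z: "z = bt (Suc n) xs" "xs \<in> bar_gens A (Suc n)" "list_all2 (\<lambda>x j. x \<in> gr j) xs ms" "sum_list ms = m"
    by (auto simp: gbar_gens_def)
  from z(2) obtain x ys where xs: "xs = x # ys" "x \<in> carrier A" "ys \<in> bar_gens A n" by (rule bar_gens_SucE)
  with z(3) obtain a ns where ms: "ms = a # ns" "x \<in> gr a" "list_all2 (\<lambda>x j. x \<in> gr j) ys ns"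
    by (auto simp: list_all2_Cons1)
  have "bt n ys \<in> gbar gr n (m - a)"
    unfolding gbar_def by (rule span_of_gen)
      (use xs ms z(4) in \<open>auto simp: gbar_gens_def intro!: exI[of _ ys] exI[of _ ns]\<close>)
  from assms(4)[OF ms(2) xs(2) this] show "f z \<in> K" by (simp add: z(1) xs bcons_bt)
qed

lemma la_gbar:
  assumes gr: "alg_grading gr" and x: "x \<in> gr a" and y: "y \<in> gbar gr n m"
  shows "la n x y \<in> gbar gr n (a + m)"
proof (cases n)
  case 0
  have xc: "x \<in> carrier A" by (rule alg_gradingD(4)[OF gr x])
  show ?thesis using y unfolding 0
    by (rule gbar_0_lin[OF module_P la_lin[OF xc] gbar_submodule, rotated])
      (use x xc in \<open>auto simp: la_bnil intro!: bnil_gbar alg_gradingD(3)[OF gr]\<close>)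
next
  case (Suc n')
  have xc: "x \<in> carrier A" by (rule alg_gradingD(4)[OF gr x])
  show ?thesis using y unfolding Suc
  proof (rule gbar_Suc_lin[OF module_P la_lin[OF xc] gbar_submodule, rotated])
    fix z b w assume *: "z \<in> gr b" "z \<in> carrier A" "w \<in> gbar gr n' (m - b)"
    have "bcons n' (x \<otimes> z) w \<in> gbar gr (Suc n') ((a + b) + (m - b))"
      by (rule bcons_gbar) (use * x xc in \<open>auto intro!: alg_gradingD(3)[OF gr]\<close>)
    then show "la (Suc n') x (bcons n' z w) \<in> gbar gr (Suc n') (a + m)"
      using * xc gbar_closed[OF *(3)] by (simp add: la_bcons)
  qed
qed

lemma ra_gbar:
  assumes gr: "alg_grading gr" and x: "x \<in> gr a" and y: "y \<in> gbar gr n m"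
  shows "ra n x y \<in> gbar gr n (m + a)"
  using y
proof (induction n arbitrary: y m)
  case 0
  have xc: "x \<in> carrier A" by (rule alg_gradingD(4)[OF gr x])
  show ?case
    by (rule gbar_0_lin[OF module_P ra_lin[OF xc] gbar_submodule _ 0])
      (use x xc in \<open>auto simp: ra_bnil intro!: bnil_gbar alg_gradingD(3)[OF gr]\<close>)
next
  case (Suc n)
  have xc: "x \<in> carrier A" by (rule alg_gradingD(4)[OF gr x])
  show ?case
  proof (rule gbar_Suc_lin[OF module_P ra_lin[OF xc] gbar_submodule _ Suc.prems])
    fix z b w assume *: "z \<in> gr b" "z \<in> carrier A" "w \<in> gbar gr n (m - b)"
    have "bcons n z (ra n x w) \<in> gbar gr (Suc n) (b + (m - b + a))"
      by (rule bcons_gbar[OF *(1,2) Suc.IH[OF *(3)]])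
    then show "ra (Suc n) x (bcons n z w) \<in> gbar gr (Suc n) (m + a)"
      using * xc gbar_closed[OF *(3)] by (simp add: ra_bcons)
  qed
qed

lemma bmap_gbar:
  assumes f: "algebra_endo f" and fg: "\<And>m x. x \<in> gr m \<Longrightarrow> f x \<in> gr m" and y: "y \<in> gbar gr n m"
  shows "bmap n f y \<in> gbar gr n m"
  using y
proof (induction n arbitrary: y m)
  case 0
  show ?case
    by (rule gbar_0_lin[OF module_P bmap_lin[OF f] gbar_submodule _ 0])
      (auto simp: bmap_bnil f intro!: bnil_gbar fg algebra_endoD[OF f])
next
  case (Suc n)
  show ?case
  proof (rule gbar_Suc_lin[OF module_P bmap_lin[OF f] gbar_submodule _ Suc.prems])
    fix z b w assume *: "z \<in> gr b" "z \<in> carrier A" "w \<in> gbar gr n (m - b)"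
    have "bcons n (f z) (bmap n f w) \<in> gbar gr (Suc n) (b + (m - b))"
      by (rule bcons_gbar[OF fg[OF *(1)] algebra_endoD(3)[OF f *(2)] Suc.IH[OF *(3)]])
    then show "bmap (Suc n) f (bcons n z w) \<in> gbar gr (Suc n) m"
      using * gbar_closed[OF *(3)] by (simp add: bmap_bcons f)
  qed
qed

end

context twist
begin

section \<open>Degrees under the shuffle and Alexander-Whitney maps\<close>

definition act_grading :: "(int \<Rightarrow> 's set) \<Rightarrow> bool" where
  "act_grading gr \<longleftrightarrow> S.alg_grading gr \<and> (\<forall>g\<in>carrier G. \<forall>m. \<forall>s\<in>gr m. act g s \<in> gr m)"

lemma skew_grading_apply: "a \<in> skew_grading G gr m \<Longrightarrow> g \<in> carrier G \<Longrightarrow> a g \<in> gr m"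
  by (auto simp: skew_grading_def)

lemma skew_alg_grading:
  assumes "act_grading gr"
  shows "A.alg_grading (skew_grading G gr)"
proof -
  have gr: "S.alg_grading gr" and ga: "\<And>g m s. g \<in> carrier G \<Longrightarrow> s \<in> gr m \<Longrightarrow> act g s \<in> gr m"
    using assms by (auto simp: act_grading_def)
  note D = S.alg_gradingD[OF gr]
  show ?thesis
    unfolding A.alg_grading_def
  proof (intro conjI allI ballI)
    fix m
    show "submodule (skew_grading G gr m) k A"
    proof (rule module.submoduleI[OF module_A])
      show sub: "skew_grading G gr m \<subseteq> carrier A" using D(4) by (auto simp: skew_grading_def skew_simps(1))
      show "\<zero>\<^bsub>A\<^esub> \<in> skew_grading G gr m" using submodule_zero[OF D(1)] by (auto simp: skew_grading_def skew_simps(4))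
      show "a \<oplus>\<^bsub>A\<^esub> b \<in> skew_grading G gr m" if "a \<in> skew_grading G gr m" "b \<in> skew_grading G gr m" for a b
        using that by (auto simp: skew_grading_def skew_simps(5) intro!: submodule_add[OF D(1)] dest: PiE_mem)
      show sm: "r \<odot>\<^bsub>A\<^esub> b \<in> skew_grading G gr m" if "r \<in> carrier k" "b \<in> skew_grading G gr m" for r b
        using that submodule_smult[OF D(1)] by (auto simp: skew_grading_def skew_simps(6))
      show "\<ominus>\<^bsub>A\<^esub> a \<in> skew_grading G gr m" if "a \<in> skew_grading G gr m" for a
        using sm[of "\<ominus>\<^bsub>k\<^esub> \<one>\<^bsub>k\<^esub>" a] that sub module.smult_l_minus[OF module_A, of "\<one>\<^bsub>k\<^esub>" a] by auto
    qed
  next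
    show "\<one>\<^bsub>A\<^esub> \<in> skew_grading G gr 0"
      using D(2) submodule_zero[OF D(1)] by (auto simp: skew_grading_def skew_simps(3))
  next
    fix m n x y assume xy: "x \<in> skew_grading G gr m" "y \<in> skew_grading G gr n"
    show "x \<otimes>\<^bsub>A\<^esub> y \<in> skew_grading G gr (m + n)"
      using xy unfolding skew_simps(2)
      by (auto simp: skew_grading_def intro!: submodule_finsum[OF S.module_A D(1)] D(3) ga)
  qed
qed

lemma el_grading: "act_grading gr \<Longrightarrow> s \<in> gr m \<Longrightarrow> el s g \<in> skew_grading G gr m"
  using submodule_zero[OF S.alg_gradingD(1)] by (auto simp: el_def skew_grading_def act_grading_def)

lemma el_one_grading: "act_grading gr \<Longrightarrow> el \<one>\<^bsub>S\<^esub> g \<in> skew_grading G gr 0"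
  by (rule el_grading) (auto simp: act_grading_def S.alg_grading_def)

abbreviation "gS \<equiv> S.gbar"
abbreviation "gA gr \<equiv> A.gbar (skew_grading G gr)"

text \<open>With \<open>G\<close> in degree 0, a homogeneous element of \<open>A\<close> is a sum of
  monomials whose coefficients are homogeneous of the same degree.\<close>

lemma skew_decompose_mem:
  assumes "act_grading gr" "x \<in> skew_grading G gr a" "module k N" "f \<in> lin k A N" "submodule K k N"
    and "\<And>s g. s \<in> gr a \<Longrightarrow> s \<in> carrier S \<Longrightarrow> g \<in> carrier G \<Longrightarrow> f (el s g) \<in> K"
  shows "f x \<in> K"
proof -
  have xc: "x \<in> carrier A" by (rule A.alg_gradingD(4)[OF skew_alg_grading[OF assms(1)] assms(2)])
  note c = coeff_closed[OF xc]
  have "f x = (\<Oplus>\<^bsub>N\<^esub>g\<in>carrier G. f (el (x g) g))"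
    using lin_finsum[OF module_A assms(3,4), of "carrier G" "\<lambda>g. el (x g) g"] el_closed[OF c]
      A_decompose[OF xc] by simp
  then show ?thesis
    using submodule_finsum[OF assms(3,5), of "carrier G" "\<lambda>g. f (el (x g) g)"] assms(6) c
      skew_grading_apply[OF assms(2)] by simp
qed

lemma gA_0_lin:
  assumes gr: "act_grading gr" and "module k N" "f \<in> lin k (PA 0) N" "submodule K k N"
    and "\<And>s g. s \<in> gr m \<Longrightarrow> s \<in> carrier S \<Longrightarrow> g \<in> carrier G \<Longrightarrow> f (A.bnil (el s g)) \<in> K" "y \<in> gA gr 0 m"
  shows "f y \<in> K"
  by (rule A.gbar_0_lin[OF assms(2-4) _ assms(6)])
    (rule skew_decompose_mem[OF gr _ assms(2) lin_comp[OF A.bnil_lin assms(3)] assms(4,5)])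

lemma gA_Suc_lin:
  assumes gr: "act_grading gr" and "module k N" "f \<in> lin k (PA (Suc n)) N" "submodule K k N"
    and "\<And>s a g y. s \<in> gr a \<Longrightarrow> s \<in> carrier S \<Longrightarrow> g \<in> carrier G \<Longrightarrow> y \<in> gA gr n (m - a) \<Longrightarrow> f (A.bcons n (el s g) y) \<in> K"
    and "y \<in> gA gr (Suc n) m"
  shows "f y \<in> K"
proof (rule A.gbar_Suc_lin[OF assms(2-4) _ assms(6)])
  fix x a y assume x: "x \<in> skew_grading G gr a" and y: "y \<in> gA gr n (m - a)"
  show "f (A.bcons n x y) \<in> K"
    by (rule skew_decompose_mem[OF gr x assms(2) lin_comp[OF bilin_left[OF A.bcons_bilin A.gbar_closed[OF y]] assms(3)] assms(4)])
      (rule assms(5)[OF _ _ _ y])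
qed

lemma emb_grading:
  assumes gr: "act_grading gr" and v: "v \<in> gS gr 0 m"
  shows "emb v \<in> gA gr 0 m"
  by (rule S.gbar_0_lin[OF A.module_P emb(1) A.gbar_submodule _ v])
    (auto simp: emb intro!: A.bnil_gbar el_grading[OF gr] el_closed)

lemma kap_grading:
  assumes gr: "act_grading gr" and s: "s \<in> gr a" "s \<in> carrier S" and g: "g \<in> carrier G" and y: "y \<in> gA gr n m"
  shows "kap n s g y \<in> gA gr (Suc n) (a + m)"
proof -
  note sk = skew_alg_grading[OF gr]
  have "A.la n (el \<one>\<^bsub>S\<^esub> (inv\<^bsub>G\<^esub> g)) y \<in> gA gr n (0 + m)"
    by (rule A.la_gbar[OF sk el_one_grading[OF gr] y])
  then have "A.bcons n (el s g) (A.la n (el \<one>\<^bsub>S\<^esub> (inv\<^bsub>G\<^esub> g)) y) \<in> gA gr (Suc n) (a + (0 + m))"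
    by (rule A.bcons_gbar[where gr = "skew_grading G gr", OF el_grading[OF gr s(1)] el_closed[OF s(2)]])
  then show ?thesis using kap_eq[OF g s(2) A.gbar_closed[OF y]] by simp
qed

text \<open>Bars over kG are placed in degree 0, so \<open>U\<close> is arbitrary and the degree
  comes from \<open>V\<close>. The recursion prepends units, multiplies by group elements and
  applies \<open>kap\<close>, which adds the degree of its coefficient.\<close>

lemma Sh_grading:
  assumes gr: "act_grading gr"
  shows "\<forall>m. \<forall>U\<in>carrier (PG (Suc i)). \<forall>V\<in>gS gr (Suc j) m. Sh i j U V \<in> gA gr (Suc (i + j)) m"
proof -
  have S: "S.alg_grading gr" using gr by (simp add: act_grading_def)
  note [simp] = ge_closed kG.A.la_closed kG.A.bcons_closed
  have sv: "S.bcons n \<one>\<^bsub>S\<^esub> v \<in> gS gr (Suc n) m" if "v \<in> gS gr n m" for n v m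
    using S.bcons_gbar[OF S.alg_gradingD(2)[OF S] _ that] by simp
  have step: "\<forall>m. \<forall>U\<in>carrier (PG (Suc i)). \<forall>V\<in>gS gr (Suc j) m. Sh i j U V \<in> gA gr (Suc (i + j)) m"
    if W: "\<And>g u v m. g \<in> carrier G \<Longrightarrow> u \<in> carrier (PG i) \<Longrightarrow> v \<in> gS gr j m \<Longrightarrow> W i j g u v \<in> gA gr (i + j) m" for i j
  proof (intro allI ballI)
    fix m U V assume U: "U \<in> carrier (PG (Suc i))" and V: "V \<in> gS gr (Suc j) m"
    show "Sh i j U V \<in> gA gr (Suc (i + j)) m"
    proof (rule S.gbar_Suc_lin[OF A.module_P bilin_right[OF Sh_bilin U] A.gbar_submodule _ V])
      fix s a v assume s: "s \<in> gr a" "s \<in> carrier S" and v: "v \<in> gS gr j (m - a)"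
      note vc = S.gbar_closed[OF v]
      have V': "S.bcons j s v \<in> carrier (PS (Suc j))" by (rule S.bcons_closed[OF s(2) vc])
      show "Sh i j U (S.bcons j s v) \<in> gA gr (Suc (i + j)) m"
      \<comment> \<open>\<open>U\<close> ranges over the whole bar module, where reduction to
        generators is available for equalities only. Membership is therefore read as vanishing in
        the quotient by the homogeneous piece.\<close>
      proof (rule mem_submoduleI[OF A.module_P A.gbar_submodule bilin_left[OF Sh_bilin V'],
            where X = "{kG.A.bcons i (ge g) u | g u. g \<in> carrier G \<and> u \<in> carrier (PG i)}"])
        let ?Q = "quotient_module (PA (Suc (i + j))) (gA gr (Suc (i + j)) m)"
        have Q: "module k ?Q" by (rule module_quotient[OF A.module_P A.gbar_submodule])
        fix q assume "q \<in> lin k (PG (Suc i)) ?Q"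
          and "\<And>x. x \<in> {kG.A.bcons i (ge g) u | g u. g \<in> carrier G \<and> u \<in> carrier (PG i)} \<Longrightarrow> q x = \<zero>\<^bsub>?Q\<^esub>"
        then show "q U = \<zero>\<^bsub>?Q\<^esub>"
          using G_barS_eqI[OF Q _ lin_zerof[OF Q] _ U, of q] by blast
      next
        fix x assume "x \<in> {kG.A.bcons i (ge g) u | g u. g \<in> carrier G \<and> u \<in> carrier (PG i)}"
        then obtain g u where g: "g \<in> carrier G" and u: "u \<in> carrier (PG i)" and x: "x = kG.A.bcons i (ge g) u" by blast
        have "kap (i + j) s g (W i j g u v) \<in> gA gr (Suc (i + j)) (a + (m - a))"
          by (rule kap_grading[OF gr s g W[OF g u v]])
        then show "x \<in> carrier (PG (Suc i)) \<and> Sh i j x (S.bcons j s v) \<in> gA gr (Suc (i + j)) m"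
          using x g u s vc by (simp add: Sh_bcons)
      qed (rule U)
    qed
  qed
  show ?thesis
  proof (induction i j rule: Sh.induct)
    case 1
    show ?case
      by (rule step) (auto intro!: submodule_smult[OF A.gbar_submodule] aug_closed emb_grading[OF gr])
  next
    case (2 i)
    show ?case by (rule step) (use 2 sv in simp)
  next
    case (3 j)
    show ?case by (rule step) (use 3 in simp)
  next
    case (4 i j)
    show ?case
      by (rule step) (use 4 sv in \<open>simp add: submodule_add[OF A.gbar_submodule] submodule_signed[OF A.module_P A.gbar_submodule]\<close>)
  qed
qed

lemma psi_grading:
  assumes gr: "act_grading gr" and "\<gamma> \<in> carrier G" "y \<in> gA gr n m"
  shows "psi n \<gamma> y \<in> gS gr n m"
  using assms(2,3)
proof (induction n arbitrary: y \<gamma> m)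
  case 0
  show ?case
    by (rule gA_0_lin[OF gr S.module_P psi_lin[OF 0(1)] S.gbar_submodule _ 0(2)])
      (use 0 submodule_zero[OF S.gbar_submodule] in \<open>auto simp: psi_bnil_el intro!: S.bnil_gbar\<close>)
next
  case (Suc n)
  have ga: "act g s \<in> gr m" if "g \<in> carrier G" "s \<in> gr m" for g s m using gr that by (auto simp: act_grading_def)
  show ?case
  proof (rule gA_Suc_lin[OF gr S.module_P psi_lin[OF Suc.prems(1)] S.gbar_submodule _ Suc.prems(2)])
    fix s a g y assume *: "s \<in> gr a" "s \<in> carrier S" "g \<in> carrier G" "y \<in> gA gr n (m - a)"
    have "S.bcons n s (S.bmap n (act g) (psi n (inv\<^bsub>G\<^esub> g \<otimes>\<^bsub>G\<^esub> \<gamma>) y)) \<in> gS gr (Suc n) (a + (m - a))"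
      by (rule S.bcons_gbar[OF *(1,2) S.bmap_gbar[OF act_endo ga Suc.IH]]) (use * Suc.prems in auto)
    then show "psi (Suc n) \<gamma> (A.bcons n (el s g) y) \<in> gS gr (Suc n) m"
      using * Suc.prems A.gbar_closed[OF *(4)] by (simp add: psi_bcons)
  qed
qed

definition gT_gens where
  "gT_gens gr i j m = {tt i j U V | U V. U \<in> carrier (PG (Suc i)) \<and> V \<in> gS gr (Suc j) m}"

definition gT where
  "gT gr i j m = span_of k (T i j) (gT_gens gr i j m)"

lemma gT_gens_subset: "gT_gens gr i j m \<subseteq> carrier (T i j)"
  by (auto simp: gT_gens_def intro!: tt_closed S.gbar_closed)

lemma gT_submodule: "submodule (gT gr i j m) k (T i j)"
  unfolding gT_def by (rule span_of_submodule[OF module_T gT_gens_subset])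

lemma tt_gT: "U \<in> carrier (PG (Suc i)) \<Longrightarrow> V \<in> gS gr (Suc j) m \<Longrightarrow> tt i j U V \<in> gT gr i j m"
  unfolding gT_def by (rule span_of_gen) (auto simp: gT_gens_def)

lemma gT_lin:
  assumes "module k N" "f \<in> lin k (T i j) N" "submodule K k N"
    and "\<And>U V. U \<in> carrier (PG (Suc i)) \<Longrightarrow> V \<in> gS gr (Suc j) m \<Longrightarrow> f (tt i j U V) \<in> K" "x \<in> gT gr i j m"
  shows "f x \<in> K"
  by (rule lin_span[OF module_T assms(1-3) gT_gens_subset _ assms(5)[unfolded gT_def]])
    (use assms(4) in \<open>auto simp: gT_gens_def\<close>)

lemma ac_gT:
  assumes gr: "act_grading gr" and s: "s \<in> gr a" "s \<in> carrier S" and g: "g \<in> carrier G" and x: "x \<in> gT gr i j m"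
  shows "ac i j s g x \<in> gT gr i j (a + m)"
proof (rule gT_lin[OF module_T ac_lin[OF s(2) g] gT_submodule _ x])
  have S: "S.alg_grading gr" and ga: "act g s \<in> gr m" if "s \<in> gr m" for s m
    using gr g that by (auto simp: act_grading_def)
  have S: "S.alg_grading gr" using gr by (simp add: act_grading_def)
  fix U V assume "U \<in> carrier (PG (Suc i))" and V: "V \<in> gS gr (Suc j) m"
  then show "ac i j s g (tt i j U V) \<in> gT gr i j (a + m)"
    using s g S.gbar_closed[OF V]
    by (auto simp: ac_tt intro!: tt_gT kG.A.la_closed ge_closed S.la_gbar[OF S s(1)] S.bmap_gbar[OF act_endo[OF g] ga])
qed

lemma sg_gT:
  assumes x: "x \<in> gT gr i j m"
  shows "sg i j x \<in> gT gr (Suc i) j m"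
  by (rule gT_lin[OF module_T sg_lin gT_submodule _ x])
    (auto simp: sg_tt S.gbar_closed intro!: tt_gT kG.A.bcons_closed ge_closed)

lemma aw_grading:
  assumes gr: "act_grading gr" and "\<gamma> \<in> carrier G" "y \<in> gA gr (Suc (i + j)) m"
  shows "aw i j \<gamma> y \<in> gT gr i j m"
  using assms(2,3)
proof (induction i arbitrary: y \<gamma> m)
  case 0
  have ga: "act g s \<in> gr m" if "g \<in> carrier G" "s \<in> gr m" for g s m using gr that by (auto simp: act_grading_def)
  show ?case
  proof (rule gA_Suc_lin[OF gr module_T aw_lin[OF 0(1)] gT_submodule _ 0(2)])
    fix s a g y assume *: "s \<in> gr a" "s \<in> carrier S" "g \<in> carrier G" "y \<in> gA gr (0 + j) (m - a)"
    have "S.bcons j s (S.bmap j (act g) (psi j (inv\<^bsub>G\<^esub> g \<otimes>\<^bsub>G\<^esub> \<gamma>) y)) \<in> gS gr (Suc j) (a + (m - a))"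
      by (rule S.bcons_gbar[OF *(1,2) S.bmap_gbar[OF act_endo ga psi_grading[OF gr]]]) (use * 0 in auto)
    then show "aw 0 j \<gamma> (A.bcons (0 + j) (el s g) y) \<in> gT gr 0 j m"
      using * 0 A.gbar_closed[OF *(4)] by (auto simp: aw_bcons_0 intro!: tt_gT unit_G_closed)
  qed
next
  case (Suc i)
  show ?case
  proof (rule gA_Suc_lin[OF gr module_T aw_lin[OF Suc.prems(1)] gT_submodule _ Suc.prems(2)])
    fix s a g y assume *: "s \<in> gr a" "s \<in> carrier S" "g \<in> carrier G" "y \<in> gA gr (Suc i + j) (m - a)"
    have "ac (Suc i) j s g (sg i j (aw i j (inv\<^bsub>G\<^esub> g \<otimes>\<^bsub>G\<^esub> \<gamma>) y)) \<in> gT gr (Suc i) j (a + (m - a))"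
      by (rule ac_gT[OF gr *(1-3) sg_gT[OF Suc.IH]]) (use * Suc.prems in auto)
    then show "aw (Suc i) j \<gamma> (A.bcons (Suc i + j) (el s g) y) \<in> gT gr (Suc i) j m"
      using * Suc.prems A.gbar_closed[OF *(4)] by (simp add: aw_bcons_Suc)
  qed
qed

end

section \<open>Bimodules and homogeneous components\<close>

lemma with_actions_simps [simp]:
  "carrier (with_actions M l r) = carrier M" "zero (with_actions M l r) = zero M"
  "add (with_actions M l r) = add M" "smult (with_actions M l r) = smult M"
  "lact (with_actions M l r) = l" "ract (with_actions M l r) = r"
  by (simp_all add: with_actions_def module.defs bimodule.defs)

lemma module_with_actions:
  assumes "module k M"
  shows "module k (with_actions M l r)"
proof -
  interpret module k M by fact
  show ?thesis
    by (intro moduleI abelian_groupI R.is_cring)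
      (auto simp: M.a_ac smult_l_distr smult_r_distr smult_assoc1 intro!: bexI[of _ "\<ominus>\<^bsub>M\<^esub> _"] M.l_neg)
qed

lemma bimodule_homD:
  assumes "f \<in> bimodule_hom A M N"
  shows "x \<in> carrier M \<Longrightarrow> f x \<in> carrier N"
    and "x \<in> carrier M \<Longrightarrow> y \<in> carrier M \<Longrightarrow> f (x \<oplus>\<^bsub>M\<^esub> y) = f x \<oplus>\<^bsub>N\<^esub> f y"
    and "a \<in> carrier A \<Longrightarrow> x \<in> carrier M \<Longrightarrow> f (a \<triangleright>\<^bsub>M\<^esub> x) = a \<triangleright>\<^bsub>N\<^esub> f x"
    and "a \<in> carrier A \<Longrightarrow> x \<in> carrier M \<Longrightarrow> f (x \<triangleleft>\<^bsub>M\<^esub> a) = f x \<triangleleft>\<^bsub>N\<^esub> a"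
  using assms by (auto simp: bimodule_hom_def)

context k_bimodule
begin

lemma module_M: "module k M"
  by (rule M.module_axioms)

lemma scalar_mult:
  assumes "r \<in> carrier k" "a \<in> carrier A"
  shows "(r \<odot>\<^bsub>A\<^esub> \<one>\<^bsub>A\<^esub>) \<otimes>\<^bsub>A\<^esub> a = r \<odot>\<^bsub>A\<^esub> a" "a \<otimes>\<^bsub>A\<^esub> (r \<odot>\<^bsub>A\<^esub> \<one>\<^bsub>A\<^esub>) = r \<odot>\<^bsub>A\<^esub> a"
  using assms by (simp_all add: A.smult_mult_left A.smult_mult_right)

text \<open>Homogeneity is derived: a scalar acts as a multiple of the unit, and the associativity
  of the action moves it from one place to the other.\<close>

lemma lact_bilin: "bilin k A M M (\<lambda>a x. a \<triangleright> x)"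
proof (intro bilinI linI)
  fix r a x assume *: "r \<in> carrier k" "a \<in> carrier A" "x \<in> carrier M"
  have c: "r \<odot>\<^bsub>A\<^esub> \<one>\<^bsub>A\<^esub> \<in> carrier A" using * by simp
  show "(r \<odot>\<^bsub>A\<^esub> a) \<triangleright> x = r \<odot> (a \<triangleright> x)"
    using mult_lact[OF c *(2,3)] scalar_mult[OF *(1,2)] scalar_lact[OF *(1) lact_closed[OF *(2,3)]] by simp
  then show "a \<triangleright> (r \<odot> x) = r \<odot> (a \<triangleright> x)"
    using mult_lact[OF *(2) c *(3)] scalar_mult[OF *(1,2)] scalar_lact[OF *(1,3)] by simp
qed (auto intro: lact_closed lact_add add_lact)

lemma ract_bilin: "bilin k A M M (\<lambda>a x. x \<triangleleft> a)"
proof (intro bilinI linI)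
  fix r a x assume *: "r \<in> carrier k" "a \<in> carrier A" "x \<in> carrier M"
  have c: "r \<odot>\<^bsub>A\<^esub> \<one>\<^bsub>A\<^esub> \<in> carrier A" using * by simp
  show "x \<triangleleft> (r \<odot>\<^bsub>A\<^esub> a) = r \<odot> (x \<triangleleft> a)"
    using ract_mult[OF *(2) c *(3)] scalar_mult[OF *(1,2)] scalar_ract[OF *(1) ract_closed[OF *(2,3)]] by simp
  then show "(r \<odot> x) \<triangleleft> a = r \<odot> (x \<triangleleft> a)"
    using ract_mult[OF c *(2,3)] scalar_mult[OF *(1,2)] scalar_ract[OF *(1,3)] by simp
qed (auto intro: ract_closed ract_add add_ract)

end

text \<open>Scalars act through multiples of the unit of \<open>A\<close>, so equivariance over
  \<open>A\<close> contains homogeneity over \<open>k\<close>.\<close>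

lemma bimodule_hom_lin:
  assumes M: "k_bimodule k A M" and N: "k_bimodule k A N" and f: "f \<in> bimodule_hom A M N"
  shows "f \<in> lin k M N"
proof (rule linI)
  interpret M: k_bimodule k A M by fact
  fix r x assume *: "r \<in> carrier k" "x \<in> carrier M"
  have c: "r \<odot>\<^bsub>A\<^esub> \<one>\<^bsub>A\<^esub> \<in> carrier A" using * by simp
  show "f (r \<odot>\<^bsub>M\<^esub> x) = r \<odot>\<^bsub>N\<^esub> f x"
    using bimodule_homD(3)[OF f c *(2)] M.scalar_lact[OF *]
      k_bimodule.scalar_lact[OF N *(1) bimodule_homD(1)[OF f *(2)]] by simp
qed (auto intro: bimodule_homD[OF f])

context kalg
begin

section \<open>The reduced bar complex in terms of \<open>la\<close>, \<open>ra\<close> and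
  \<open>gd\<close>\<close>

lemma bar_bimodule_simps:
  "carrier (bar_bimodule k A n) = carrier (P (Suc n))" "zero (bar_bimodule k A n) = zero (P (Suc n))"
  "add (bar_bimodule k A n) = add (P (Suc n))" "smult (bar_bimodule k A n) = smult (P (Suc n))"
  "lact (bar_bimodule k A n) a u = la (Suc n) a u" "ract (bar_bimodule k A n) u a = ra (Suc n) a u"
  by (simp_all add: bar_bimodule_def bar_module_eq bar_tensor_eq la_def ra_def)

lemma lin_bar_bimodule:
  "lin k (bar_bimodule k A n) N = lin k (P (Suc n)) N" "lin k M (bar_bimodule k A n) = lin k M (P (Suc n))"
  by (simp_all add: lin_def bar_bimodule_simps)

lemma bar_diff_eq: "bar_diff k A (Suc n) = gd (Suc n)"
  by (simp add: bar_diff_def gd_def bar_module_eq bar_tensor_eq Let_def)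

lemma k_bimodule_bar: "k_bimodule k A (bar_bimodule k A n)"
proof -
  have M: "module k (bar_bimodule k A n)"
    unfolding bar_bimodule_def bar_module_eq by (rule module_with_actions[OF module_P])
  note lb = la_bilin[of "Suc n"] and rb = ra_bilin[of "Suc n"]
  show ?thesis
  proof (intro k_bimodule.intro k_bimodule_axioms.intro)
    show "k_algebra k A" by (rule k_algebra_axioms)
    show "module k (bar_bimodule k A n)" by (rule M)
  qed (auto simp: bar_bimodule_simps la_closed ra_closed la_la la_one ra_ra ra_one ra_la
      lin_add[OF bilin_left[OF lb]] lin_add[OF bilin_right[OF lb]] lin_add[OF bilin_left[OF rb]] lin_add[OF bilin_right[OF rb]]
      lin_smult[OF bilin_left[OF lb]] lin_smult[OF bilin_left[OF rb]])
qed

end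

section \<open>Components of a finite direct sum\<close>

lemma finsum_support:
  assumes M: "module k M" and I: "finite I" and u: "\<And>i. i \<in> I \<Longrightarrow> u i \<in> carrier M"
  shows "(\<Oplus>\<^bsub>M\<^esub>i\<in>{i \<in> I. u i \<noteq> \<zero>\<^bsub>M\<^esub>}. u i) = (\<Oplus>\<^bsub>M\<^esub>i\<in>I. u i)"
proof -
  interpret module k M by fact
  show ?thesis by (rule add.finprod_mono_neutral_cong_left) (use I u in auto)
qed

context
  fixes k :: "'k ring" and M :: "('k, 'm, 'z) module_scheme" and I :: "'i set" and N
  assumes M: "module k M" and ds: "internal_direct_sum k M I N" and I: "finite I"
begin

lemma summand_submodule: "i \<in> I \<Longrightarrow> submodule (N i) k M"
  using ds by (auto simp: internal_direct_sum_def)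

lemma summand_closed: "i \<in> I \<Longrightarrow> x \<in> N i \<Longrightarrow> x \<in> carrier M"
  using submodule_subset[OF summand_submodule] by blast

text \<open>Over a finite index set the support is finite anyway, and the sum may run over all
  indices; this removes the support from the description of components.\<close>

lemma family_iff: "u \<in> Pi\<^sub>E I N \<and> finite {i\<in>I. u i \<noteq> \<zero>\<^bsub>M\<^esub>} \<and> x = (\<Oplus>\<^bsub>M\<^esub>i\<in>{i\<in>I. u i \<noteq> \<zero>\<^bsub>M\<^esub>}. u i) \<longleftrightarrow>
    u \<in> Pi\<^sub>E I N \<and> x = (\<Oplus>\<^bsub>M\<^esub>i\<in>I. u i)"
proof (cases "u \<in> Pi\<^sub>E I N")
  case True
  then have "(\<Oplus>\<^bsub>M\<^esub>i\<in>{i \<in> I. u i \<noteq> \<zero>\<^bsub>M\<^esub>}. u i) = (\<Oplus>\<^bsub>M\<^esub>i\<in>I. u i)"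
    by (intro finsum_support[OF M I] summand_closed) auto
  then show ?thesis using True I by auto
qed auto

text \<open>The description used by \<open>component\<close> is met by exactly one family. Linearity
  and the behaviour under maps are then read off from \<open>component_unique\<close>.\<close>

lemma component_family:
  assumes x: "x \<in> carrier M"
  shows component_mem: "i \<in> I \<Longrightarrow> component M I N i x \<in> N i"
    and component_sum: "(\<Oplus>\<^bsub>M\<^esub>i\<in>I. component M I N i x) = x"
    and component_unique: "\<lbrakk>\<And>i. i \<in> I \<Longrightarrow> v i \<in> N i; (\<Oplus>\<^bsub>M\<^esub>i\<in>I. v i) = x; i \<in> I\<rbrakk> \<Longrightarrow> component M I N i x = v i"
proof -
  have ex1: "\<exists>!u. u \<in> Pi\<^sub>E I N \<and> x = (\<Oplus>\<^bsub>M\<^esub>i\<in>I. u i)"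
    using ds x unfolding internal_direct_sum_def family_iff by blast
  define u where "u = (THE u. u \<in> Pi\<^sub>E I N \<and> x = (\<Oplus>\<^bsub>M\<^esub>i\<in>I. u i))"
  have u: "u \<in> Pi\<^sub>E I N" "x = (\<Oplus>\<^bsub>M\<^esub>i\<in>I. u i)" using theI'[OF ex1] by (auto simp: u_def)
  have c: "component M I N i x = u i" for i unfolding component_def family_iff u_def ..
  show "i \<in> I \<Longrightarrow> component M I N i x \<in> N i" using u c by auto
  show "(\<Oplus>\<^bsub>M\<^esub>i\<in>I. component M I N i x) = x" using u c by simp
  assume v: "\<And>i. i \<in> I \<Longrightarrow> v i \<in> N i" "(\<Oplus>\<^bsub>M\<^esub>i\<in>I. v i) = x" and i: "i \<in> I"
  have "(\<Oplus>\<^bsub>M\<^esub>i\<in>I. restrict v I i) = (\<Oplus>\<^bsub>M\<^esub>i\<in>I. v i)"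
    by (rule finsum_congI[OF M]) (auto intro: summand_closed v)
  then have "restrict v I \<in> Pi\<^sub>E I N \<and> x = (\<Oplus>\<^bsub>M\<^esub>i\<in>I. restrict v I i)" using v by auto
  then have "u = restrict v I" using ex1 u by blast
  then show "component M I N i x = v i" using c i by simp
qed

lemma component_closed: "x \<in> carrier M \<Longrightarrow> i \<in> I \<Longrightarrow> component M I N i x \<in> carrier M"
  using summand_closed component_mem by blast

lemma component_lin:
  assumes i: "i \<in> I"
  shows "component M I N i \<in> lin k M M"
proof (rule linI)
  interpret module k M by (rule M)
  show "component M I N i x \<in> carrier M" if "x \<in> carrier M" for x by (rule component_closed[OF that i])
  show "component M I N i (x \<oplus>\<^bsub>M\<^esub> y) = component M I N i x \<oplus>\<^bsub>M\<^esub> component M I N i y"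
    if "x \<in> carrier M" "y \<in> carrier M" for x y
    by (rule component_unique[OF _ _ _ i])
      (use that in \<open>auto simp: finsum_addI[OF M] component_closed component_sum
         intro!: submodule_add[OF summand_submodule] component_mem\<close>)
  show "component M I N i (r \<odot>\<^bsub>M\<^esub> x) = r \<odot>\<^bsub>M\<^esub> component M I N i x"
    if "r \<in> carrier k" "x \<in> carrier M" for r x
    by (rule component_unique[OF _ _ _ i])
      (use that in \<open>auto simp: finsum_smultI[OF M I] component_closed component_sum
         intro!: submodule_smult[OF summand_submodule] component_mem\<close>)
qed

lemma component_homogeneous:
  assumes "j \<in> I" "x \<in> N j" "i \<in> I"
  shows "component M I N i x = (if i = j then x else \<zero>\<^bsub>M\<^esub>)"
  by (rule component_unique[OF summand_closed[OF assms(1,2)] _ _ assms(3)])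
    (use assms submodule_zero[OF summand_submodule] finsum_single[OF M I assms(1), of "\<lambda>i. if i = j then x else \<zero>\<^bsub>M\<^esub>"]
      in \<open>auto simp: summand_closed\<close>)

end

text \<open>Applying \<open>f\<close> to the decomposition of \<open>x\<close> and reindexing by
  \<open>q\<close> gives a decomposition of \<open>f x\<close>, and decompositions are unique. The
  permutation \<open>q\<close> is there for translations by group elements, which shift
  degrees.\<close>

lemma component_map:
  assumes M: "module k M" "internal_direct_sum k M I N" and I: "finite I"
    and M': "module k M'" "internal_direct_sum k M' I N'" and q: "bij_betw q I I" and f: "f \<in> lin k M M'"
    and N': "\<And>i x. i \<in> I \<Longrightarrow> x \<in> N (q i) \<Longrightarrow> f x \<in> N' i" and x: "x \<in> carrier M" and i: "i \<in> I"
  shows "component M' I N' i (f x) = f (component M I N (q i) x)"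
proof -
  have q': "q i \<in> I" if "i \<in> I" for i using q that bij_betwE by blast
  note cc = component_closed[OF M I x]
  have "(\<Oplus>\<^bsub>M'\<^esub>i\<in>I. f (component M I N (q i) x)) = (\<Oplus>\<^bsub>M'\<^esub>i\<in>I. f (component M I N i x))"
    by (rule finsum_reindexI[OF M'(1) q, symmetric]) (rule lin_closed[OF f cc])
  also have "\<dots> = f (\<Oplus>\<^bsub>M\<^esub>i\<in>I. component M I N i x)"
    by (rule lin_finsum[OF M(1) M'(1) f, symmetric]) (rule cc)
  finally have "(\<Oplus>\<^bsub>M'\<^esub>i\<in>I. f (component M I N (q i) x)) = f x" by (simp add: component_sum[OF M I x])
  then show ?thesis
    by (intro component_unique[OF M' I lin_closed[OF f x] _ _ i] N' component_mem[OF M I x] q')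
qed


lemma projective_resolutionD:
  assumes "projective_resolution k A X \<epsilon>"
  shows "k_bimodule k A (Obj X n)" "Diff X (Suc n) \<in> bimodule_hom A (Obj X (Suc n)) (Obj X n)"
  using assms by (auto simp: projective_resolution_def projective_bimodule_def)

text \<open>The hypotheses of the theorem in the language of the preceding sections:
  \<open>kG.A\<close> for the group algebra and \<open>bmap\<close> for the diagonal action on
  bars.\<close>

locale twisted_maps = twist k G S act
  for k :: "'k ring" and G :: "'g monoid" and S :: "('k, 's) module" and act :: "'g \<Rightarrow> 's \<Rightarrow> 's" +
  fixes C :: "('k, 'g \<Rightarrow> 'k, 'c) bimodule_complex" and \<epsilon>C :: "'c \<Rightarrow> 'g \<Rightarrow> 'k" and grC :: "nat \<Rightarrow> 'g \<Rightarrow> 'c set"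
    and D :: "('k, 's, 'd) bimodule_complex" and \<epsilon>D :: "'d \<Rightarrow> 's" and actD :: "nat \<Rightarrow> 'g \<Rightarrow> 'd \<Rightarrow> 'd"
    and \<iota>G :: "nat \<Rightarrow> 'c \<Rightarrow> (('g \<Rightarrow> 'k) list \<Rightarrow> 'k) set" and \<pi>G :: "nat \<Rightarrow> (('g \<Rightarrow> 'k) list \<Rightarrow> 'k) set \<Rightarrow> 'c"
    and \<iota>S :: "nat \<Rightarrow> 'd \<Rightarrow> ('s list \<Rightarrow> 'k) set" and \<pi>S :: "nat \<Rightarrow> ('s list \<Rightarrow> 'k) set \<Rightarrow> 'd"
  assumes resC: "group_graded_resolution k G C \<epsilon>C grC"
    and resD: "equivariant_resolution k G S act D \<epsilon>D actD"
    and \<iota>G: "chain_map kG.A C (reduced_bar k kG.A) \<iota>G" and \<pi>G: "chain_map kG.A (reduced_bar k kG.A) C \<pi>G"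
    and \<iota>S: "chain_map S D (reduced_bar k S) \<iota>S" and \<pi>S: "chain_map S (reduced_bar k S) D \<pi>S"
    and \<iota>S_act: "\<And>n g x. g \<in> carrier G \<Longrightarrow> x \<in> carrier (Obj D n) \<Longrightarrow>
      \<iota>S n (actD n g x) = S.bmap (Suc n) (act g) (\<iota>S n x)"
    and \<pi>S_act: "\<And>n g x. g \<in> carrier G \<Longrightarrow> x \<in> carrier (PS (Suc n)) \<Longrightarrow>
      \<pi>S n (S.bmap (Suc n) (act g) x) = actD n g (\<pi>S n x)"
    and \<pi>\<iota>G: "\<And>n x. x \<in> carrier (Obj C n) \<Longrightarrow> \<pi>G n (\<iota>G n x) = x"
    and \<pi>\<iota>S: "\<And>n x. x \<in> carrier (Obj D n) \<Longrightarrow> \<pi>S n (\<iota>S n x) = x"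
begin

lemma group_elem_eq: "group_elem k G g = ge g"
  by (auto simp: group_elem_def ge_def kG.el_def intro!: restrict_ext)

lemma group_algebra_eq: "group_algebra k G = kG.A"
  by (simp add: group_algebra_def)

lemmas resC' = resC[unfolded group_graded_resolution_def group_elem_eq group_algebra_eq]

lemmas resC_parts = resC'[THEN conjunct1] resC'[THEN conjunct2, THEN conjunct1]
  resC'[THEN conjunct2, THEN conjunct2, THEN conjunct1]
  resC'[THEN conjunct2, THEN conjunct2, THEN conjunct2, THEN conjunct1]

lemma projC: "projective_resolution k kG.A C \<epsilon>C"
  and dsC: "internal_direct_sum k (Obj C i) (carrier G) (grC i)"
  and shiftC: "\<lbrakk>g1 \<in> carrier G; g2 \<in> carrier G; g3 \<in> carrier G; c \<in> grC i g2\<rbrakk> \<Longrightarrow>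
     (ge g1 \<triangleright>\<^bsub>Obj C i\<^esub> c) \<triangleleft>\<^bsub>Obj C i\<^esub> ge g3 \<in> grC i (g1 \<otimes>\<^bsub>G\<^esub> g2 \<otimes>\<^bsub>G\<^esub> g3)"
  and diff_grC: "g \<in> carrier G \<Longrightarrow> c \<in> grC (Suc i) g \<Longrightarrow> Diff C (Suc i) c \<in> grC i g"
proof -
  show "projective_resolution k kG.A C \<epsilon>C" by (rule resC_parts(1))
  show "internal_direct_sum k (Obj C i) (carrier G) (grC i)" using resC_parts(2) by simp
  show "(ge g1 \<triangleright>\<^bsub>Obj C i\<^esub> c) \<triangleleft>\<^bsub>Obj C i\<^esub> ge g3 \<in> grC i (g1 \<otimes>\<^bsub>G\<^esub> g2 \<otimes>\<^bsub>G\<^esub> g3)"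
    if "g1 \<in> carrier G" "g2 \<in> carrier G" "g3 \<in> carrier G" "c \<in> grC i g2"
    using resC_parts(3)[rule_format, of g1 g2 g3 i] that by blast
  show "Diff C (Suc i) c \<in> grC i g" if "g \<in> carrier G" "c \<in> grC (Suc i) g"
    using resC_parts(4) that by blast
qed

lemmas bimodC = projective_resolutionD(1)[OF projC]
  and homC = projective_resolutionD(2)[OF projC]

lemma projD: "projective_resolution k S D \<epsilon>D"
  and actionD: "group_action G (carrier (Obj D j)) (actD j)"
  and actD_lact: "\<lbrakk>g \<in> carrier G; s \<in> carrier S; x \<in> carrier (Obj D j)\<rbrakk> \<Longrightarrow>
        actD j g (s \<triangleright>\<^bsub>Obj D j\<^esub> x) = act g s \<triangleright>\<^bsub>Obj D j\<^esub> actD j g x"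
  and actD_ract: "\<lbrakk>g \<in> carrier G; s \<in> carrier S; x \<in> carrier (Obj D j)\<rbrakk> \<Longrightarrow>
        actD j g (x \<triangleleft>\<^bsub>Obj D j\<^esub> s) = actD j g x \<triangleleft>\<^bsub>Obj D j\<^esub> act g s"
  and diff_actD: "g \<in> carrier G \<Longrightarrow> y \<in> carrier (Obj D (Suc j)) \<Longrightarrow>
        Diff D (Suc j) (actD (Suc j) g y) = actD j g (Diff D (Suc j) y)"
  using resD unfolding equivariant_resolution_def by blast+

lemma actD_closed: "g \<in> carrier G \<Longrightarrow> x \<in> carrier (Obj D j) \<Longrightarrow> actD j g x \<in> carrier (Obj D j)"
  by (rule group_action.element_image[OF actionD]) auto

lemma actD_lin: "g \<in> carrier G \<Longrightarrow> actD j g \<in> lin k (Obj D j) (Obj D j)"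
  using resD unfolding equivariant_resolution_def by (intro linI actD_closed) blast+

lemma actD_actD: "\<lbrakk>g \<in> carrier G; h \<in> carrier G; x \<in> carrier (Obj D j)\<rbrakk> \<Longrightarrow>
   actD j g (actD j h x) = actD j (g \<otimes>\<^bsub>G\<^esub> h) x"
  by (rule group_action.composition_rule[OF actionD, symmetric])

lemma actD_one: "x \<in> carrier (Obj D j) \<Longrightarrow> actD j \<one>\<^bsub>G\<^esub> x = x"
  using fun_cong[OF group_action.id_eq_one[OF actionD[of j]], of x] by simp

lemmas bimodD = projective_resolutionD(1)[OF projD]
  and homD = projective_resolutionD(2)[OF projD]

lemmas modC = k_bimodule.module_M[OF bimodC]
  and modD = k_bimodule.module_M[OF bimodD]

lemmas dC_lin = bimodule_hom_lin[OF bimodC bimodC homC]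
  and dD_lin = bimodule_hom_lin[OF bimodD bimodD homD]

section \<open>Translations by group elements and homogeneous components of C\<close>

definition gl :: "nat \<Rightarrow> 'g \<Rightarrow> 'c \<Rightarrow> 'c" where
  "gl i g c = ge g \<triangleright>\<^bsub>Obj C i\<^esub> c"

definition gr :: "nat \<Rightarrow> 'g \<Rightarrow> 'c \<Rightarrow> 'c" where
  "gr i g c = c \<triangleleft>\<^bsub>Obj C i\<^esub> ge g"

lemma gl_lin: "gl i g \<in> lin k (Obj C i) (Obj C i)"
  unfolding gl_def[abs_def] by (rule bilin_right[OF k_bimodule.lact_bilin[OF bimodC] ge_closed])

lemma gr_lin: "gr i g \<in> lin k (Obj C i) (Obj C i)"
  unfolding gr_def[abs_def] by (rule bilin_right[OF k_bimodule.ract_bilin[OF bimodC] ge_closed])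

lemmas gl_closed = lin_closed[OF gl_lin] and gr_closed = lin_closed[OF gr_lin]

lemma gr_gr: "\<lbrakk>g \<in> carrier G; h \<in> carrier G; c \<in> carrier (Obj C i)\<rbrakk> \<Longrightarrow> gr i g (gr i h c) = gr i (h \<otimes>\<^bsub>G\<^esub> g) c"
  unfolding gr_def by (simp add: k_bimodule.ract_mult[OF bimodC, symmetric] ge_closed ge_mult)

lemma gr_gl: "c \<in> carrier (Obj C i) \<Longrightarrow> gr i g (gl i h c) = gl i h (gr i g c)"
  unfolding gr_def gl_def by (simp add: k_bimodule.lact_ract[OF bimodC] ge_closed)

lemma gl_one: "c \<in> carrier (Obj C i) \<Longrightarrow> gl i \<one>\<^bsub>G\<^esub> c = c"
  unfolding gl_def ge_one by (rule k_bimodule.one_lact[OF bimodC])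

lemma gr_one: "c \<in> carrier (Obj C i) \<Longrightarrow> gr i \<one>\<^bsub>G\<^esub> c = c"
  unfolding gr_def ge_one by (rule k_bimodule.ract_one[OF bimodC])

lemma dC_gr: "c \<in> carrier (Obj C (Suc i)) \<Longrightarrow> Diff C (Suc i) (gr (Suc i) g c) = gr i g (Diff C (Suc i) c)"
  unfolding gr_def by (rule bimodule_homD(4)[OF homC ge_closed])

lemma chain_map_bar:
  "chain_map B X (reduced_bar k B) f \<Longrightarrow> f n \<in> bimodule_hom B (Obj X n) (bar_bimodule k B n)"
  "chain_map B (reduced_bar k B) X p \<Longrightarrow> p n \<in> bimodule_hom B (bar_bimodule k B n) (Obj X n)"
  by (auto simp: chain_map_def reduced_bar_def)

lemmas \<iota>G_hom = chain_map_bar(1)[OF \<iota>G] and \<pi>G_hom = chain_map_bar(2)[OF \<pi>G]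
  and \<iota>S_hom = chain_map_bar(1)[OF \<iota>S] and \<pi>S_hom = chain_map_bar(2)[OF \<pi>S]

lemmas \<iota>G_lin = bimodule_hom_lin[OF bimodC kG.A.k_bimodule_bar \<iota>G_hom, unfolded kG.A.lin_bar_bimodule]
  and \<pi>G_lin = bimodule_hom_lin[OF kG.A.k_bimodule_bar bimodC \<pi>G_hom, unfolded kG.A.lin_bar_bimodule]
  and \<iota>S_lin = bimodule_hom_lin[OF bimodD S.k_bimodule_bar \<iota>S_hom, unfolded S.lin_bar_bimodule]
  and \<pi>S_lin = bimodule_hom_lin[OF S.k_bimodule_bar bimodD \<pi>S_hom, unfolded S.lin_bar_bimodule]

lemmas dC_closed = lin_closed[OF dC_lin] and dD_closed = lin_closed[OF dD_lin]
  and \<iota>G_closed = lin_closed[OF \<iota>G_lin] and \<pi>G_closed = lin_closed[OF \<pi>G_lin]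
  and \<iota>S_closed = lin_closed[OF \<iota>S_lin] and \<pi>S_closed = lin_closed[OF \<pi>S_lin]

lemma \<iota>G_gl: "c \<in> carrier (Obj C i) \<Longrightarrow> \<iota>G i (gl i g c) = kG.A.la (Suc i) (ge g) (\<iota>G i c)"
  unfolding gl_def using bimodule_homD(3)[OF \<iota>G_hom ge_closed] by (simp add: kG.A.bar_bimodule_simps)

lemma \<iota>G_gr: "c \<in> carrier (Obj C i) \<Longrightarrow> \<iota>G i (gr i g c) = kG.A.ra (Suc i) (ge g) (\<iota>G i c)"
  unfolding gr_def using bimodule_homD(4)[OF \<iota>G_hom ge_closed] by (simp add: kG.A.bar_bimodule_simps)

lemma \<iota>G_diff: "c \<in> carrier (Obj C (Suc i)) \<Longrightarrow> kG.A.gd (Suc i) (\<iota>G (Suc i) c) = \<iota>G i (Diff C (Suc i) c)"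
  using \<iota>G by (auto simp: chain_map_def reduced_bar_def kG.A.bar_diff_eq)

lemma \<pi>G_la: "u \<in> carrier (PG (Suc i)) \<Longrightarrow> \<pi>G i (kG.A.la (Suc i) (ge g) u) = gl i g (\<pi>G i u)"
  unfolding gl_def using bimodule_homD(3)[OF \<pi>G_hom ge_closed] by (simp add: kG.A.bar_bimodule_simps)

lemma \<pi>G_ra: "u \<in> carrier (PG (Suc i)) \<Longrightarrow> \<pi>G i (kG.A.ra (Suc i) (ge g) u) = gr i g (\<pi>G i u)"
  unfolding gr_def using bimodule_homD(4)[OF \<pi>G_hom ge_closed] by (simp add: kG.A.bar_bimodule_simps)

lemma \<pi>G_diff: "u \<in> carrier (PG (Suc (Suc i))) \<Longrightarrow> Diff C (Suc i) (\<pi>G (Suc i) u) = \<pi>G i (kG.A.gd (Suc i) u)"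
  using \<pi>G by (auto simp: chain_map_def reduced_bar_def kG.A.bar_diff_eq kG.A.bar_bimodule_simps)

lemma \<iota>S_lact: "s \<in> carrier S \<Longrightarrow> d \<in> carrier (Obj D j) \<Longrightarrow> \<iota>S j (s \<triangleright>\<^bsub>Obj D j\<^esub> d) = S.la (Suc j) s (\<iota>S j d)"
  using bimodule_homD(3)[OF \<iota>S_hom] by (simp add: S.bar_bimodule_simps)

lemma \<iota>S_ract: "s \<in> carrier S \<Longrightarrow> d \<in> carrier (Obj D j) \<Longrightarrow> \<iota>S j (d \<triangleleft>\<^bsub>Obj D j\<^esub> s) = S.ra (Suc j) s (\<iota>S j d)"
  using bimodule_homD(4)[OF \<iota>S_hom] by (simp add: S.bar_bimodule_simps)

lemma \<iota>S_diff: "d \<in> carrier (Obj D (Suc j)) \<Longrightarrow> S.gd (Suc j) (\<iota>S (Suc j) d) = \<iota>S j (Diff D (Suc j) d)"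
  using \<iota>S by (auto simp: chain_map_def reduced_bar_def S.bar_diff_eq)

lemma \<pi>S_la: "s \<in> carrier S \<Longrightarrow> v \<in> carrier (PS (Suc j)) \<Longrightarrow> \<pi>S j (S.la (Suc j) s v) = s \<triangleright>\<^bsub>Obj D j\<^esub> \<pi>S j v"
  using bimodule_homD(3)[OF \<pi>S_hom] by (simp add: S.bar_bimodule_simps)

lemma \<pi>S_ra: "s \<in> carrier S \<Longrightarrow> v \<in> carrier (PS (Suc j)) \<Longrightarrow> \<pi>S j (S.ra (Suc j) s v) = \<pi>S j v \<triangleleft>\<^bsub>Obj D j\<^esub> s"
  using bimodule_homD(4)[OF \<pi>S_hom] by (simp add: S.bar_bimodule_simps)

lemma \<pi>S_diff: "v \<in> carrier (PS (Suc (Suc j))) \<Longrightarrow> Diff D (Suc j) (\<pi>S (Suc j) v) = \<pi>S j (S.gd (Suc j) v)"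
  using \<pi>S by (auto simp: chain_map_def reduced_bar_def S.bar_diff_eq S.bar_bimodule_simps)

definition pc :: "nat \<Rightarrow> 'g \<Rightarrow> 'c \<Rightarrow> 'c" where
  "pc i = component (Obj C i) (carrier G) (grC i)"

lemma grC_closed: "g \<in> carrier G \<Longrightarrow> c \<in> grC i g \<Longrightarrow> c \<in> carrier (Obj C i)"
  by (rule summand_closed[OF modC dsC fin])

lemma grC_submodule: "g \<in> carrier G \<Longrightarrow> submodule (grC i g) k (Obj C i)"
  by (rule summand_submodule[OF modC dsC fin])

lemma pc_lin: "g \<in> carrier G \<Longrightarrow> pc i g \<in> lin k (Obj C i) (Obj C i)"
  unfolding pc_def by (rule component_lin[OF modC dsC fin])

lemmas pc_closed = lin_closed[OF pc_lin]

lemma pc_mem: "g \<in> carrier G \<Longrightarrow> c \<in> carrier (Obj C i) \<Longrightarrow> pc i g c \<in> grC i g"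
  unfolding pc_def by (rule component_mem[OF modC dsC fin])

lemma pc_sum: "c \<in> carrier (Obj C i) \<Longrightarrow> (\<Oplus>\<^bsub>Obj C i\<^esub>g\<in>carrier G. pc i g c) = c"
  unfolding pc_def by (rule component_sum[OF modC dsC fin])

lemma pc_homogeneous: "\<lbrakk>g \<in> carrier G; h \<in> carrier G; c \<in> grC i g\<rbrakk> \<Longrightarrow>
   pc i h c = (if h = g then c else \<zero>\<^bsub>Obj C i\<^esub>)"
  unfolding pc_def by (rule component_homogeneous[OF modC dsC fin])

lemma gl_grC:
  assumes "g \<in> carrier G" "h \<in> carrier G" "c \<in> grC i h"
  shows "gl i g c \<in> grC i (g \<otimes>\<^bsub>G\<^esub> h)"
  using shiftC[OF assms(1,2) G.one_closed assms(3)] gr_one[OF gl_closed[OF grC_closed[OF assms(2,3)]]] assms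
  by (simp add: gl_def gr_def)

lemma gr_grC:
  assumes "g \<in> carrier G" "h \<in> carrier G" "c \<in> grC i h"
  shows "gr i g c \<in> grC i (h \<otimes>\<^bsub>G\<^esub> g)"
  using shiftC[OF G.one_closed assms(2,1,3)] gl_one[OF grC_closed[OF assms(2,3)]] assms
  by (simp add: gl_def gr_def)

lemma pc_gl:
  assumes "g \<in> carrier G" "h \<in> carrier G" "c \<in> carrier (Obj C i)"
  shows "pc i h (gl i g c) = gl i g (pc i (inv\<^bsub>G\<^esub> g \<otimes>\<^bsub>G\<^esub> h) c)"
  unfolding pc_def
  by (rule component_map[OF modC dsC fin modC dsC _ gl_lin _ assms(3,2)])
    (use assms gl_grC[OF assms(1) G.m_closed[OF G.inv_closed[OF assms(1)]]]
      in \<open>auto simp: G.mult_left_bij G.m_assoc[symmetric]\<close>)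

lemma pc_gr:
  assumes "g \<in> carrier G" "h \<in> carrier G" "c \<in> carrier (Obj C i)"
  shows "pc i h (gr i g c) = gr i g (pc i (h \<otimes>\<^bsub>G\<^esub> inv\<^bsub>G\<^esub> g) c)"
  unfolding pc_def
  by (rule component_map[OF modC dsC fin modC dsC _ gr_lin _ assms(3,2)])
    (use assms gr_grC[OF assms(1) G.m_closed[OF _ G.inv_closed[OF assms(1)]]]
      in \<open>auto simp: G.mult_right_bij G.m_assoc\<close>)

lemma pc_dC:
  assumes "h \<in> carrier G" "c \<in> carrier (Obj C (Suc i))"
  shows "pc i h (Diff C (Suc i) c) = Diff C (Suc i) (pc (Suc i) h c)"
  unfolding pc_def
  by (rule component_map[OF modC dsC fin modC dsC, where q = "\<lambda>h. h"])
    (use assms in \<open>auto simp: diff_grC dC_lin bij_betw_def\<close>)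

text \<open>
  The chain maps \<open>\<iota>G\<close> and \<open>\<pi>G\<close> need not respect the grading by \<open>G\<close>.  The map \<open>Fc\<close>, which sends
  \<open>c\<close> of degree \<open>h\<close> to \<open>c h\<^sup>-\<^sup>1\<close>, makes the degree of its argument irrelevant.
\<close>

definition Fc :: "nat \<Rightarrow> 'c \<Rightarrow> 'c" where
  "Fc i c = (\<Oplus>\<^bsub>Obj C i\<^esub>h\<in>carrier G. gr i (inv\<^bsub>G\<^esub> h) (pc i h c))"

lemma Fc_lin: "Fc i \<in> lin k (Obj C i) (Obj C i)"
  unfolding Fc_def by (rule lin_finsumf[OF modC lin_comp[OF pc_lin gr_lin]])

lemmas Fc_closed = lin_closed[OF Fc_lin]

lemma Fc_degree:
  assumes "c \<in> carrier (Obj C i)"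
  shows "Fc i c \<in> grC i \<one>\<^bsub>G\<^esub>"
  unfolding Fc_def
proof (rule submodule_finsum[OF modC grC_submodule[OF G.one_closed]])
  fix h assume h: "h \<in> carrier G"
  show "gr i (inv\<^bsub>G\<^esub> h) (pc i h c) \<in> grC i \<one>\<^bsub>G\<^esub>"
    using gr_grC[OF G.inv_closed[OF h] h pc_mem[OF h assms]] h by simp
qed

text \<open>If \<open>c\<close> has degree h, then c g has degree h g, and c g times the inverse of
  h g equals c times the inverse of h. Over all degrees this is a reindexing of the sum.\<close>

lemma Fc_gr:
  assumes g: "g \<in> carrier G" and c: "c \<in> carrier (Obj C i)"
  shows "Fc i (gr i g c) = Fc i c"
proof -
  have "Fc i (gr i g c) = (\<Oplus>\<^bsub>Obj C i\<^esub>h\<in>carrier G. gr i (inv\<^bsub>G\<^esub> (h \<otimes>\<^bsub>G\<^esub> inv\<^bsub>G\<^esub> g)) (pc i (h \<otimes>\<^bsub>G\<^esub> inv\<^bsub>G\<^esub> g) c))"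
    unfolding Fc_def
    by (rule finsum_congI[OF modC])
      (use g c in \<open>auto simp: pc_gr gr_gr pc_closed G.inv_mult_group intro!: gr_closed pc_closed\<close>)
  also have "\<dots> = Fc i c"
    unfolding Fc_def
    by (rule finsum_reindexI[OF modC G.mult_right_bij[OF G.inv_closed[OF g]], symmetric])
      (use c in \<open>auto intro!: gr_closed pc_closed\<close>)
  finally show ?thesis .
qed

text \<open>If \<open>c\<close> has degree h, then g c has degree g h, and multiplying by the
  inverse of g h puts the inverse of \<open>g\<close> on the far right: left translation becomes
  conjugation.\<close>

lemma Fc_gl:
  assumes g: "g \<in> carrier G" and c: "c \<in> carrier (Obj C i)"
  shows "Fc i (gl i g c) = gl i g (gr i (inv\<^bsub>G\<^esub> g) (Fc i c))"
proof -
  have "Fc i (gl i g c) = (\<Oplus>\<^bsub>Obj C i\<^esub>h\<in>carrier G. gl i g (gr i (inv\<^bsub>G\<^esub> g)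
      (gr i (inv\<^bsub>G\<^esub> (inv\<^bsub>G\<^esub> g \<otimes>\<^bsub>G\<^esub> h)) (pc i (inv\<^bsub>G\<^esub> g \<otimes>\<^bsub>G\<^esub> h) c))))"
    unfolding Fc_def
    by (rule finsum_congI[OF modC])
      (use g c in \<open>auto simp: pc_gl gr_gr gr_gl pc_closed G.inv_mult_group G.m_assoc intro!: gr_closed gl_closed pc_closed\<close>)
  also have "\<dots> = (\<Oplus>\<^bsub>Obj C i\<^esub>h\<in>carrier G. gl i g (gr i (inv\<^bsub>G\<^esub> g) (gr i (inv\<^bsub>G\<^esub> h) (pc i h c))))"
    by (rule finsum_reindexI[OF modC G.mult_left_bij[OF G.inv_closed[OF g]], symmetric])
      (use c in \<open>auto intro!: gr_closed gl_closed pc_closed\<close>)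
  also have "\<dots> = gl i g (gr i (inv\<^bsub>G\<^esub> g) (Fc i c))"
    unfolding Fc_def
    by (rule lin_finsum[OF modC modC lin_comp[OF gr_lin gl_lin], symmetric]) (use c in \<open>auto intro!: gr_closed pc_closed\<close>)
  finally show ?thesis .
qed

lemma Fc_homogeneous:
  assumes g: "g \<in> carrier G" and c: "c \<in> grC i g"
  shows "gr i g (Fc i c) = c"
proof -
  note cc = grC_closed[OF g c]
  have "Fc i c = gr i (inv\<^bsub>G\<^esub> g) (pc i g c)"
    unfolding Fc_def
    by (rule finsum_single[OF modC fin g])
      (use g cc in \<open>auto simp: pc_homogeneous[OF g _ c] lin_zero[OF modC modC gr_lin] intro!: gr_closed\<close>)
  then show ?thesis using g cc by (simp add: pc_homogeneous[OF g _ c] gr_gr gr_one)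
qed

text \<open>The differential of \<open>C\<close> commutes with right translations and preserves
  degrees, hence commutes with each summand.\<close>

lemma Fc_dC:
  assumes c: "c \<in> carrier (Obj C (Suc i))"
  shows "Fc i (Diff C (Suc i) c) = Diff C (Suc i) (Fc (Suc i) c)"
  unfolding Fc_def
  by (subst lin_finsum[OF modC modC dC_lin])
    (use c in \<open>auto simp: pc_dC dC_gr pc_closed dC_closed intro!: finsum_congI[OF modC] gr_closed pc_closed dC_closed\<close>)

end

section \<open>The chain map from the twisted product resolution\<close>

text \<open>Linearity in the parameter is tested on pure tensors. With \<open>A\<close> as parameter
  space it makes both twisted actions bilinear.\<close>

lemma tensor_ext_param:
  assumes X: "module k X" and M: "module k M" and N: "module k N" and Q: "module k Q"
    and b: "\<And>a. a \<in> carrier X \<Longrightarrow> bilin k M N Q (\<beta> a)"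
    and l: "\<And>x y. x \<in> carrier M \<Longrightarrow> y \<in> carrier N \<Longrightarrow> (\<lambda>a. \<beta> a x y) \<in> lin k X Q"
  shows "bilin k X (tensor_module k M N) Q (\<lambda>a. linear_ext k Q (\<lambda>(x, y). \<beta> a x y))"
proof -
  interpret X: module k X by fact
  note t = tensor_ext_tensor[OF M N Q b]
  have e: "linear_ext k Q (\<lambda>(x, y). \<beta> a x y) \<in> lin k (tensor_module k M N) Q" if "a \<in> carrier X" for a
    by (rule tensor_ext_lin[OF M N Q b[OF that]])
  show ?thesis
  proof (intro bilinI linI)
    fix a a' u assume *: "a \<in> carrier X" "a' \<in> carrier X" and u: "u \<in> carrier (tensor_module k M N)"
    show "linear_ext k Q (\<lambda>(x, y). \<beta> (a \<oplus>\<^bsub>X\<^esub> a') x y) u =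
        linear_ext k Q (\<lambda>(x, y). \<beta> a x y) u \<oplus>\<^bsub>Q\<^esub> linear_ext k Q (\<lambda>(x, y). \<beta> a' x y) u"
      by (rule tensor_eqI[OF M N Q e lin_addf[OF Q e e] _ u]) (use * lin_add[OF l] in \<open>auto simp: t\<close>)
  next
    fix r a u assume *: "r \<in> carrier k" "a \<in> carrier X" and u: "u \<in> carrier (tensor_module k M N)"
    show "linear_ext k Q (\<lambda>(x, y). \<beta> (r \<odot>\<^bsub>X\<^esub> a) x y) u = r \<odot>\<^bsub>Q\<^esub> linear_ext k Q (\<lambda>(x, y). \<beta> a x y) u"
      by (rule tensor_eqI[OF M N Q e lin_smultf[OF Q e *(1)] _ u]) (use * lin_smult[OF l] in \<open>auto simp: t\<close>)
  qed (use lin_closed[OF e] lin_add[OF e] lin_smult[OF e] in auto)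
qed

context twisted_maps
begin

abbreviation "CT i j \<equiv> tensor_module k (Obj C i) (Obj D j)"
abbreviation "ct i j \<equiv> tensor k (Obj C i) (Obj D j)"
abbreviation "TT i j \<equiv> twisted_tensor k G S act (Obj C i) (grC i) (Obj D j) (actD j)"

lemmas module_CT = module_tensor[OF modC modD]
lemmas ct_bilin = tensor_bilin[OF modC modD]
lemmas ct_closed = bilin_closed[OF ct_bilin]

text \<open>Each \<open>c\<close> is the sum of its homogeneous components. Homogeneous first
  factors matter because the twisted left action and \<open>\<iota>T\<close> have closed formulas
  only for them.\<close>

lemma CT_eqI:
  assumes N: "module k N" and f: "f \<in> lin k (CT i j) N" "h \<in> lin k (CT i j) N"
    and eq: "\<And>g c d. g \<in> carrier G \<Longrightarrow> c \<in> grC i g \<Longrightarrow> d \<in> carrier (Obj D j) \<Longrightarrow> f (ct i j c d) = h (ct i j c d)"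
    and u: "u \<in> carrier (CT i j)"
  shows "f u = h u"
proof (rule tensor_eqI[OF modC modD N f _ u])
  fix c d assume c: "c \<in> carrier (Obj C i)" and d: "d \<in> carrier (Obj D j)"
  have "f (ct i j c d) = (\<Oplus>\<^bsub>N\<^esub>g\<in>carrier G. f (ct i j (pc i g c) d))"
    using lin_finsum[OF modC N lin_comp[OF bilin_left[OF ct_bilin d] f(1)], of "carrier G" "\<lambda>g. pc i g c"]
      pc_sum[OF c] pc_closed c by simp
  also have "\<dots> = (\<Oplus>\<^bsub>N\<^esub>g\<in>carrier G. h (ct i j (pc i g c) d))"
    by (rule finsum_congI[OF N]) (use c d in \<open>auto intro!: eq pc_mem lin_closed[OF f(2)] ct_closed pc_closed\<close>)
  also have "\<dots> = h (ct i j c d)"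
    using lin_finsum[OF modC N lin_comp[OF bilin_left[OF ct_bilin d] f(2)], of "carrier G" "\<lambda>g. pc i g c"]
      pc_sum[OF c] pc_closed c by simp
  finally show "f (ct i j c d) = h (ct i j c d)" .
qed

lemma TT_simps [simp]:
  "carrier (TT i j) = carrier (CT i j)" "zero (TT i j) = zero (CT i j)" "add (TT i j) = add (CT i j)"
  by (simp_all add: twisted_tensor_def Let_def)

section \<open>The twisted actions\<close>

definition lterm where
  "lterm i j a h g c d = ct i j (gl i h (pc i g c)) (act (inv\<^bsub>G\<^esub> (h \<otimes>\<^bsub>G\<^esub> g)) (a h) \<triangleright>\<^bsub>Obj D j\<^esub> d)"

definition rterm where
  "rterm i j a h c d = ct i j (gr i h c) (actD j (inv\<^bsub>G\<^esub> h) (d \<triangleleft>\<^bsub>Obj D j\<^esub> a h))"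

lemma lact_TT: "lact (TT i j) a = linear_ext k (CT i j)
   (\<lambda>(c, d). \<Oplus>\<^bsub>CT i j\<^esub>h\<in>carrier G. \<Oplus>\<^bsub>CT i j\<^esub>g\<in>carrier G. lterm i j a h g c d)"
  by (simp add: twisted_tensor_def Let_def lterm_def gl_def pc_def group_elem_eq)

lemma ract_TT: "ract (TT i j) u a = linear_ext k (CT i j)
   (\<lambda>(c, d). \<Oplus>\<^bsub>CT i j\<^esub>h\<in>carrier G. rterm i j a h c d) u"
  by (simp add: twisted_tensor_def Let_def rterm_def gr_def group_elem_eq)

lemma D_lact_bilin: "bilin k S (Obj D j) (Obj D j) (lact (Obj D j))"
  and D_ract_bilin: "bilin k S (Obj D j) (Obj D j) (\<lambda>s d. d \<triangleleft>\<^bsub>Obj D j\<^esub> s)"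
  by (rule k_bimodule.lact_bilin[OF bimodD] k_bimodule.ract_bilin[OF bimodD])+

lemmas D_lact_closed = bilin_closed[OF D_lact_bilin] and D_ract_closed = bilin_closed[OF D_ract_bilin]

lemma lterm_bilin:
  assumes "a \<in> carrier A" "h \<in> carrier G" "g \<in> carrier G"
  shows "bilin k (Obj C i) (Obj D j) (CT i j) (lterm i j a h g)"
  unfolding lterm_def[abs_def]
  by (rule bilin_two_lin[OF ct_bilin lin_comp[OF pc_lin gl_lin] bilin_right[OF D_lact_bilin act_closed[OF _ coeff_closed]]])
    (use assms in auto)

lemma lterm_lin:
  assumes "h \<in> carrier G" "g \<in> carrier G" "c \<in> carrier (Obj C i)" "d \<in> carrier (Obj D j)"
  shows "(\<lambda>s. ct i j (gl i h (pc i g c)) (act (inv\<^bsub>G\<^esub> (h \<otimes>\<^bsub>G\<^esub> g)) s \<triangleright>\<^bsub>Obj D j\<^esub> d)) \<in> lin k S (CT i j)"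
  by (rule lin_comp[OF lin_comp[OF act_lin bilin_left[OF D_lact_bilin]] bilin_right[OF ct_bilin]])
    (use assms in \<open>auto intro!: gl_closed pc_closed\<close>)

lemma rterm_bilin:
  assumes "a \<in> carrier A" "h \<in> carrier G"
  shows "bilin k (Obj C i) (Obj D j) (CT i j) (rterm i j a h)"
  unfolding rterm_def[abs_def]
  by (rule bilin_two_lin[OF ct_bilin gr_lin lin_comp[OF bilin_right[OF D_ract_bilin coeff_closed] actD_lin]])
    (use assms in auto)

lemma rterm_lin:
  assumes "h \<in> carrier G" "c \<in> carrier (Obj C i)" "d \<in> carrier (Obj D j)"
  shows "(\<lambda>s. ct i j (gr i h c) (actD j (inv\<^bsub>G\<^esub> h) (d \<triangleleft>\<^bsub>Obj D j\<^esub> s))) \<in> lin k S (CT i j)"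
  by (rule lin_comp[OF lin_comp[OF bilin_left[OF D_ract_bilin] actD_lin] bilin_right[OF ct_bilin]])
    (use assms in \<open>auto intro!: gr_closed\<close>)

lemma lact_TT_bilin: "bilin k A (CT i j) (CT i j) (lact (TT i j))"
  unfolding lact_TT
proof (rule tensor_ext_param[OF module_A modC modD module_CT])
  show "bilin k (Obj C i) (Obj D j) (CT i j) (\<lambda>c d. \<Oplus>\<^bsub>CT i j\<^esub>h\<in>carrier G. \<Oplus>\<^bsub>CT i j\<^esub>g\<in>carrier G. lterm i j a h g c d)"
    if "a \<in> carrier A" for a
    by (intro bilin_finsumf[OF module_CT] lterm_bilin that)
  show "(\<lambda>a. \<Oplus>\<^bsub>CT i j\<^esub>h\<in>carrier G. \<Oplus>\<^bsub>CT i j\<^esub>g\<in>carrier G. lterm i j a h g c d) \<in> lin k A (CT i j)"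
    if "c \<in> carrier (Obj C i)" "d \<in> carrier (Obj D j)" for c d
    unfolding lterm_def
    by (intro lin_finsumf[OF module_CT] lin_comp[OF coeff_lin lterm_lin] that)
qed

lemma ract_TT_bilin: "bilin k A (CT i j) (CT i j) (\<lambda>a u. ract (TT i j) u a)"
  unfolding ract_TT
proof (rule tensor_ext_param[OF module_A modC modD module_CT])
  show "bilin k (Obj C i) (Obj D j) (CT i j) (\<lambda>c d. \<Oplus>\<^bsub>CT i j\<^esub>h\<in>carrier G. rterm i j a h c d)"
    if "a \<in> carrier A" for a
    by (intro bilin_finsumf[OF module_CT] rterm_bilin that)
  show "(\<lambda>a. \<Oplus>\<^bsub>CT i j\<^esub>h\<in>carrier G. rterm i j a h c d) \<in> lin k A (CT i j)"
    if "c \<in> carrier (Obj C i)" "d \<in> carrier (Obj D j)" for c d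
    unfolding rterm_def
    by (intro lin_finsumf[OF module_CT] lin_comp[OF coeff_lin rterm_lin] that)
qed

text \<open>Both sums collapse: the one over the group parts because \<open>el t h\<close> is a
  monomial, the one over the degrees because \<open>c\<close> is homogeneous.\<close>

lemma lact_TT_ct:
  assumes t: "t \<in> carrier S" and h: "h \<in> carrier G" and g: "g \<in> carrier G" and c: "c \<in> grC i g" and d: "d \<in> carrier (Obj D j)"
  shows "lact (TT i j) (el t h) (ct i j c d) = ct i j (gl i h c) (act (inv\<^bsub>G\<^esub> (h \<otimes>\<^bsub>G\<^esub> g)) t \<triangleright>\<^bsub>Obj D j\<^esub> d)"
proof -
  note cc = grC_closed[OF g c]
  note l = lterm_lin[OF _ _ cc d]
  have "lact (TT i j) (el t h) (ct i j c d) = (\<Oplus>\<^bsub>CT i j\<^esub>h'\<in>carrier G. \<Oplus>\<^bsub>CT i j\<^esub>g'\<in>carrier G. lterm i j (el t h) h' g' c d)"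
    unfolding lact_TT
    by (rule tensor_ext_tensor[OF modC modD module_CT _ cc d])
      (intro bilin_finsumf[OF module_CT] lterm_bilin el_closed t)
  also have "\<dots> = (\<Oplus>\<^bsub>CT i j\<^esub>g'\<in>carrier G. lterm i j (\<lambda>_. t) h g' c d)"
    unfolding lterm_def by (rule sum_el[OF module_CT _ t h]) (intro lin_finsumf[OF module_CT] l)
  also have "\<dots> = lterm i j (\<lambda>_. t) h g c d"
    by (rule finsum_single[OF module_CT fin g])
      (use t h g cc d in \<open>auto simp: lterm_def pc_homogeneous[OF g _ c] lin_zero[OF modC modC gl_lin]
        bilin_zero_left[OF modC module_CT ct_bilin] act_closed D_lact_closed intro!: ct_closed gl_closed\<close>)
  finally show ?thesis using g by (simp add: lterm_def pc_homogeneous[OF g _ c])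
qed

lemma ract_TT_ct:
  assumes t: "t \<in> carrier S" and h: "h \<in> carrier G" and c: "c \<in> carrier (Obj C i)" and d: "d \<in> carrier (Obj D j)"
  shows "ract (TT i j) (ct i j c d) (el t h) = ct i j (gr i h c) (actD j (inv\<^bsub>G\<^esub> h) (d \<triangleleft>\<^bsub>Obj D j\<^esub> t))"
proof -
  have "ract (TT i j) (ct i j c d) (el t h) = (\<Oplus>\<^bsub>CT i j\<^esub>h'\<in>carrier G. rterm i j (el t h) h' c d)"
    unfolding ract_TT
    by (rule tensor_ext_tensor[OF modC modD module_CT _ c d])
      (intro bilin_finsumf[OF module_CT] rterm_bilin el_closed t)
  also have "\<dots> = rterm i j (\<lambda>_. t) h c d"
    unfolding rterm_def by (rule sum_el[OF module_CT rterm_lin[OF _ c d] t h])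
  finally show ?thesis by (simp add: rterm_def)
qed

text \<open>Origin of the formula: for \<open>c\<close> of degree \<open>g\<close> the twisted right
  action gives \<open>c \<otimes> d = (c g^-1 \<otimes> g d) g\<close>, where \<open>c g^-1\<close>
  has degree 1. The natural value is the shuffle of that tensor times \<open>g\<close>, and the
  factor \<open>g^-1\<close> may be omitted because \<open>Sh\<close> ignores right multiplication
  on bars over kG.\<close>

definition \<iota>T :: "nat \<Rightarrow> nat \<Rightarrow> ('c \<times> 'd \<Rightarrow> 'k) set \<Rightarrow> (('g \<Rightarrow> 's) list \<Rightarrow> 'k) set" where
  "\<iota>T i j = linear_ext k (PA (Suc (i + j))) (\<lambda>(c, d). \<Oplus>\<^bsub>PA (Suc (i + j))\<^esub>g\<in>carrier G.
     A.ra (Suc (i + j)) (el \<one>\<^bsub>S\<^esub> g) (Sh i j (\<iota>G i (pc i g c)) (\<iota>S j (actD j g d))))"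

lemma \<iota>T_bilin: "bilin k (Obj C i) (Obj D j) (PA (Suc (i + j))) (\<lambda>c d. \<Oplus>\<^bsub>PA (Suc (i + j))\<^esub>g\<in>carrier G.
     A.ra (Suc (i + j)) (el \<one>\<^bsub>S\<^esub> g) (Sh i j (\<iota>G i (pc i g c)) (\<iota>S j (actD j g d))))"
proof (rule bilin_finsumf[OF A.module_P])
  fix g assume g: "g \<in> carrier G"
  show "bilin k (Obj C i) (Obj D j) (PA (Suc (i + j))) (\<lambda>c d.
     A.ra (Suc (i + j)) (el \<one>\<^bsub>S\<^esub> g) (Sh i j (\<iota>G i (pc i g c)) (\<iota>S j (actD j g d))))"
    by (rule bilin_comp[OF Sh_bilin lin_comp[OF pc_lin \<iota>G_lin] lin_comp[OF actD_lin \<iota>S_lin] A.ra_lin[OF el_closed]])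
      (use g in auto)
qed

lemma \<iota>T_lin: "\<iota>T i j \<in> lin k (CT i j) (PA (Suc (i + j)))"
  unfolding \<iota>T_def by (rule tensor_ext_lin[OF modC modD A.module_P \<iota>T_bilin])

lemmas \<iota>T_closed = lin_closed[OF \<iota>T_lin]

lemma \<iota>T_ct_sum:
  assumes "c \<in> carrier (Obj C i)" "d \<in> carrier (Obj D j)"
  shows "\<iota>T i j (ct i j c d) = (\<Oplus>\<^bsub>PA (Suc (i + j))\<^esub>g\<in>carrier G.
     A.ra (Suc (i + j)) (el \<one>\<^bsub>S\<^esub> g) (Sh i j (\<iota>G i (pc i g c)) (\<iota>S j (actD j g d))))"
  unfolding \<iota>T_def by (rule tensor_ext_tensor[OF modC modD A.module_P \<iota>T_bilin assms])

lemma \<iota>T_ct: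
  assumes g: "g \<in> carrier G" and c: "c \<in> grC i g" and d: "d \<in> carrier (Obj D j)"
  shows "\<iota>T i j (ct i j c d) = A.ra (Suc (i + j)) (el \<one>\<^bsub>S\<^esub> g) (Sh i j (\<iota>G i c) (\<iota>S j (actD j g d)))"
proof -
  note cc = grC_closed[OF g c]
  have Z: "A.ra (Suc (i + j)) (el \<one>\<^bsub>S\<^esub> h) (Sh i j (\<iota>G i \<zero>\<^bsub>Obj C i\<^esub>) V) = \<zero>\<^bsub>PA (Suc (i + j))\<^esub>"
    if "V \<in> carrier (PS (Suc j))" for h V
    by (rule lin_zero[OF modC A.module_P lin_comp[OF lin_comp[OF \<iota>G_lin bilin_left[OF Sh_bilin that]] A.ra_lin[OF el_closed]]]) simp
  have "(\<Oplus>\<^bsub>PA (Suc (i + j))\<^esub>g\<in>carrier G. A.ra (Suc (i + j)) (el \<one>\<^bsub>S\<^esub> g) (Sh i j (\<iota>G i (pc i g c)) (\<iota>S j (actD j g d))))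
     = A.ra (Suc (i + j)) (el \<one>\<^bsub>S\<^esub> g) (Sh i j (\<iota>G i (pc i g c)) (\<iota>S j (actD j g d)))"
    by (rule finsum_single[OF A.module_P fin g])
      (use g cc d in \<open>auto simp: pc_homogeneous[OF g _ c] Z \<iota>S_closed actD_closed
         intro!: A.ra_closed el_closed Sh_closed \<iota>G_closed pc_closed\<close>)
  then show ?thesis using g by (simp add: \<iota>T_ct_sum[OF cc d] pc_homogeneous[OF g _ c])
qed

lemma A_ra_el_el:
  assumes "s \<in> carrier S" "t \<in> carrier S" "g \<in> carrier G" "h \<in> carrier G" "y \<in> carrier (PA n)"
  shows "A.ra n (el t h) (A.ra n (el s g) y) = A.ra n (el (s \<otimes>\<^bsub>S\<^esub> act g t) (g \<otimes>\<^bsub>G\<^esub> h)) y"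
  using assms by (simp add: A.ra_ra el_closed el_mult)

lemma A_la_el_el:
  assumes "s \<in> carrier S" "t \<in> carrier S" "g \<in> carrier G" "h \<in> carrier G" "y \<in> carrier (PA n)"
  shows "A.la n (el s g) (A.la n (el t h) y) = A.la n (el (s \<otimes>\<^bsub>S\<^esub> act g t) (g \<otimes>\<^bsub>G\<^esub> h)) y"
  using assms by (simp add: A.la_la el_closed el_mult)

text \<open>For \<open>c\<close> of degree \<open>g\<close> the new first factor has degree h g, so
  the twist of \<open>t\<close> by the inverse of h g is undone when h g is applied to the second
  factor. Then \<open>Sh_left_S\<close> extracts \<open>t\<close> and \<open>Sh_conj\<close>
  extracts conjugation by \<open>h\<close>, whose right factor reduces h g to
  \<open>g\<close>.\<close>

lemma \<iota>T_lact_el: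
  assumes t: "t \<in> carrier S" and h: "h \<in> carrier G" and u: "u \<in> carrier (CT i j)"
  shows "\<iota>T i j (lact (TT i j) (el t h) u) = A.la (Suc (i + j)) (el t h) (\<iota>T i j u)"
proof (rule CT_eqI[OF A.module_P _ _ _ u])
  show "(\<lambda>u. \<iota>T i j (lact (TT i j) (el t h) u)) \<in> lin k (CT i j) (PA (Suc (i + j)))"
    by (rule lin_comp[OF bilin_right[OF lact_TT_bilin el_closed[OF t]] \<iota>T_lin])
  show "(\<lambda>u. A.la (Suc (i + j)) (el t h) (\<iota>T i j u)) \<in> lin k (CT i j) (PA (Suc (i + j)))"
    by (rule lin_comp[OF \<iota>T_lin A.la_lin[OF el_closed[OF t]]])
next
  fix g c d assume g: "g \<in> carrier G" and c: "c \<in> grC i g" and d: "d \<in> carrier (Obj D j)"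
  note cc = grC_closed[OF g c] and hg = G.m_closed[OF h g]
  let ?n = "Suc (i + j)" and ?V = "\<iota>S j (actD j g d)"
  let ?X = "Sh i j (\<iota>G i c) ?V"
  have dg: "actD j g d \<in> carrier (Obj D j)" by (rule actD_closed[OF g d])
  have V: "?V \<in> carrier (PS (Suc j))" by (rule \<iota>S_closed[OF dg])
  have U: "\<iota>G i c \<in> carrier (PG (Suc i))" by (rule \<iota>G_closed[OF cc])
  have X: "?X \<in> carrier (PA ?n)" by (rule Sh_closed[OF U V])
  let ?s = "act (inv\<^bsub>G\<^esub> (h \<otimes>\<^bsub>G\<^esub> g)) t"
  have s: "?s \<in> carrier S" using act_closed h g t by simp
  have "actD j (h \<otimes>\<^bsub>G\<^esub> g) (?s \<triangleright>\<^bsub>Obj D j\<^esub> d) = t \<triangleright>\<^bsub>Obj D j\<^esub> actD j h (actD j g d)"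
    using h g t d by (simp add: actD_lact s act_act act_id actD_actD)
  then have e: "\<iota>S j (actD j (h \<otimes>\<^bsub>G\<^esub> g) (?s \<triangleright>\<^bsub>Obj D j\<^esub> d)) = S.la (Suc j) t (S.bmap (Suc j) (act h) ?V)"
    using \<iota>S_lact[OF t actD_closed[OF h dg]] \<iota>S_act[OF h dg] by simp
  have "\<iota>T i j (lact (TT i j) (el t h) (ct i j c d)) = A.ra ?n (el \<one>\<^bsub>S\<^esub> (h \<otimes>\<^bsub>G\<^esub> g))
      (Sh i j (kG.A.la (Suc i) (ge h) (\<iota>G i c)) (S.la (Suc j) t (S.bmap (Suc j) (act h) ?V)))"
    unfolding lact_TT_ct[OF t h g c d]
    using \<iota>T_ct[OF hg gl_grC[OF h g c] D_lact_closed[OF s d]] by (simp add: e \<iota>G_gl[OF cc])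
  also have "\<dots> = A.ra ?n (el \<one>\<^bsub>S\<^esub> (h \<otimes>\<^bsub>G\<^esub> g)) (A.la ?n (el t \<one>\<^bsub>G\<^esub>) (conj ?n h ?X))"
    using Sh_left_S[OF t kG.A.la_closed[OF ge_closed U] S.bmap_closed[OF act_endo[OF h] V]] Sh_conj[OF h U V] by simp
  also have "\<dots> = A.la ?n (el t h) (A.ra ?n (el \<one>\<^bsub>S\<^esub> g) ?X)"
    using t h g X unfolding conj_def
    by (simp add: A.ra_la el_closed A.la_closed A.ra_closed A_ra_el_el A_la_el_el act_unit act_closed act_id G.m_assoc[symmetric])
  finally show "\<iota>T i j (lact (TT i j) (el t h) (ct i j c d)) = A.la ?n (el t h) (\<iota>T i j (ct i j c d))"
    unfolding \<iota>T_ct[OF g c d] .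
qed

lemma \<iota>T_lact:
  assumes a: "a \<in> carrier A" and u: "u \<in> carrier (CT i j)"
  shows "\<iota>T i j (lact (TT i j) a u) = A.la (Suc (i + j)) a (\<iota>T i j u)"
  by (rule A_lin_eqI[OF A.module_P lin_comp[OF bilin_left[OF lact_TT_bilin u] \<iota>T_lin]
        bilin_left[OF A.la_bilin \<iota>T_closed[OF u]] _ a]) (rule \<iota>T_lact_el[OF _ _ u])

text \<open>Right multiplication of \<open>c\<close> by \<open>h\<close> is invisible to
  \<open>Sh\<close>, but it raises the degree to g h and so reappears as a factor of the value.
  Moving \<open>t\<close> past \<open>g\<close> accounts for \<open>act g t\<close>.\<close>

lemma \<iota>T_ract_el:
  assumes t: "t \<in> carrier S" and h: "h \<in> carrier G" and u: "u \<in> carrier (CT i j)"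
  shows "\<iota>T i j (ract (TT i j) u (el t h)) = A.ra (Suc (i + j)) (el t h) (\<iota>T i j u)"
proof (rule CT_eqI[OF A.module_P _ _ _ u])
  show "(\<lambda>u. \<iota>T i j (ract (TT i j) u (el t h))) \<in> lin k (CT i j) (PA (Suc (i + j)))"
    by (rule lin_comp[OF bilin_right[OF ract_TT_bilin el_closed[OF t]] \<iota>T_lin])
  show "(\<lambda>u. A.ra (Suc (i + j)) (el t h) (\<iota>T i j u)) \<in> lin k (CT i j) (PA (Suc (i + j)))"
    by (rule lin_comp[OF \<iota>T_lin A.ra_lin[OF el_closed[OF t]]])
next
  fix g c d assume g: "g \<in> carrier G" and c: "c \<in> grC i g" and d: "d \<in> carrier (Obj D j)"
  note cc = grC_closed[OF g c] and gh = G.m_closed[OF g h]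
  let ?n = "Suc (i + j)" and ?V = "\<iota>S j (actD j g d)"
  let ?X = "Sh i j (\<iota>G i c) ?V"
  have dg: "actD j g d \<in> carrier (Obj D j)" by (rule actD_closed[OF g d])
  have V: "?V \<in> carrier (PS (Suc j))" by (rule \<iota>S_closed[OF dg])
  have U: "\<iota>G i c \<in> carrier (PG (Suc i))" by (rule \<iota>G_closed[OF cc])
  have X: "?X \<in> carrier (PA ?n)" by (rule Sh_closed[OF U V])
  have gt: "act g t \<in> carrier S" by (rule act_closed[OF g t])
  note dt = D_ract_closed[OF t d]
  have "actD j (g \<otimes>\<^bsub>G\<^esub> h) (actD j (inv\<^bsub>G\<^esub> h) (d \<triangleleft>\<^bsub>Obj D j\<^esub> t)) = actD j g d \<triangleleft>\<^bsub>Obj D j\<^esub> act g t"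
    using actD_actD[OF gh G.inv_closed[OF h] dt] actD_ract[OF g t d] by (simp add: G.m_assoc g h)
  then have e: "\<iota>S j (actD j (g \<otimes>\<^bsub>G\<^esub> h) (actD j (inv\<^bsub>G\<^esub> h) (d \<triangleleft>\<^bsub>Obj D j\<^esub> t))) = S.ra (Suc j) (act g t) ?V"
    using \<iota>S_ract[OF gt dg] by simp
  have "\<iota>T i j (ract (TT i j) (ct i j c d) (el t h)) = A.ra ?n (el \<one>\<^bsub>S\<^esub> (g \<otimes>\<^bsub>G\<^esub> h))
      (Sh i j (kG.A.ra (Suc i) (ge h) (\<iota>G i c)) (S.ra (Suc j) (act g t) ?V))"
    unfolding ract_TT_ct[OF t h cc d]
    using \<iota>T_ct[OF gh gr_grC[OF h g c] actD_closed[OF G.inv_closed[OF h] dt]] by (simp add: e \<iota>G_gr[OF cc])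
  also have "\<dots> = A.ra ?n (el \<one>\<^bsub>S\<^esub> (g \<otimes>\<^bsub>G\<^esub> h)) (A.ra ?n (el (act g t) \<one>\<^bsub>G\<^esub>) ?X)"
    using Sh_right_G[OF h U S.ra_closed[OF gt V]] Sh_right_S[OF gt U V] by simp
  also have "\<dots> = A.ra ?n (el t h) (A.ra ?n (el \<one>\<^bsub>S\<^esub> g) ?X)"
    using t h g gt X by (simp add: A_ra_el_el act_unit act_id)
  finally show "\<iota>T i j (ract (TT i j) (ct i j c d) (el t h)) = A.ra ?n (el t h) (\<iota>T i j (ct i j c d))"
    unfolding \<iota>T_ct[OF g c d] .
qed

lemma \<iota>T_ract:
  assumes a: "a \<in> carrier A" and u: "u \<in> carrier (CT i j)"
  shows "\<iota>T i j (ract (TT i j) u a) = A.ra (Suc (i + j)) a (\<iota>T i j u)"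
  by (rule A_lin_eqI[OF A.module_P lin_comp[OF bilin_left[OF ract_TT_bilin u] \<iota>T_lin]
        bilin_left[OF A.ra_bilin \<iota>T_closed[OF u]] _ a]) (rule \<iota>T_ract_el[OF _ _ u])

section \<open>The shuffle construction and the differentials of C and D\<close>

definition dCT where
  "dCT i j = tensor_map k (Obj C i) (Obj D j) (Diff C (Suc i)) (\<lambda>d. d)"

definition dDT where
  "dDT i j = tensor_map k (Obj C i) (Obj D j) (\<lambda>c. c) (Diff D (Suc j))"

lemma dCT_lin: "dCT i j \<in> lin k (CT (Suc i) j) (CT i j)"
  unfolding dCT_def by (rule tensor_map_lin[OF modC modD modC modD dC_lin lin_ident])

lemma dDT_lin: "dDT i j \<in> lin k (CT i (Suc j)) (CT i j)"
  unfolding dDT_def by (rule tensor_map_lin[OF modC modD modC modD lin_ident dD_lin])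

lemmas dCT_closed = lin_closed[OF dCT_lin] and dDT_closed = lin_closed[OF dDT_lin]

lemma dCT_ct: "c \<in> carrier (Obj C (Suc i)) \<Longrightarrow> d \<in> carrier (Obj D j) \<Longrightarrow>
    dCT i j (ct (Suc i) j c d) = ct i j (Diff C (Suc i) c) d"
  unfolding dCT_def by (rule tensor_map_tensor[OF modC modD modC modD dC_lin lin_ident])

lemma dDT_ct: "c \<in> carrier (Obj C i) \<Longrightarrow> d \<in> carrier (Obj D (Suc j)) \<Longrightarrow>
    dDT i j (ct i (Suc j) c d) = ct i j c (Diff D (Suc j) d)"
  unfolding dDT_def by (rule tensor_map_tensor[OF modC modD modC modD lin_ident dD_lin])

lemma gd_\<iota>T_ct:
  assumes g: "g \<in> carrier G" and c: "c \<in> grC i g" and d: "d \<in> carrier (Obj D j)"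
  shows "i + j = Suc n \<Longrightarrow> A.gd (Suc n) (\<iota>T i j (ct i j c d)) =
    A.ra (Suc n) (el \<one>\<^bsub>S\<^esub> g) (E i j (\<iota>G i c) (\<iota>S j (actD j g d)))"
  using gd_Sh[OF \<iota>G_closed[OF grC_closed[OF g c]] \<iota>S_closed[OF actD_closed[OF g d]]]
    A.gd_ra[OF el_closed[OF S.one_closed] Sh_closed[OF \<iota>G_closed[OF grC_closed[OF g c]] \<iota>S_closed[OF actD_closed[OF g d]]], of g]
  by (simp add: \<iota>T_ct[OF g c d])

lemma gd_\<iota>T_left:
  assumes u: "u \<in> carrier (CT (Suc i) 0)"
  shows "A.gd (Suc i) (\<iota>T (Suc i) 0 u) = \<iota>T i 0 (dCT i 0 u)"
proof (rule CT_eqI[OF A.module_P _ _ _ u])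
  show "(\<lambda>u. A.gd (Suc i) (\<iota>T (Suc i) 0 u)) \<in> lin k (CT (Suc i) 0) (PA (Suc i))"
    using lin_comp[OF \<iota>T_lin[of "Suc i" 0]] A.gd_lin[of "Suc i"] by simp
  show "(\<lambda>u. \<iota>T i 0 (dCT i 0 u)) \<in> lin k (CT (Suc i) 0) (PA (Suc i))"
    using lin_comp[OF dCT_lin \<iota>T_lin[of i 0]] by simp
next
  fix g c d assume g: "g \<in> carrier G" and c: "c \<in> grC (Suc i) g" and d: "d \<in> carrier (Obj D 0)"
  note cc = grC_closed[OF g c]
  show "A.gd (Suc i) (\<iota>T (Suc i) 0 (ct (Suc i) 0 c d)) = \<iota>T i 0 (dCT i 0 (ct (Suc i) 0 c d))"
    using \<iota>T_ct[OF g diff_grC[OF g c] d] by (simp add: gd_\<iota>T_ct[OF g c d] dCT_ct[OF cc d] \<iota>G_diff[OF cc])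
qed

lemma gd_\<iota>T_right:
  assumes u: "u \<in> carrier (CT 0 (Suc j))"
  shows "A.gd (Suc j) (\<iota>T 0 (Suc j) u) = \<iota>T 0 j (dDT 0 j u)"
proof (rule CT_eqI[OF A.module_P _ _ _ u])
  show "(\<lambda>u. A.gd (Suc j) (\<iota>T 0 (Suc j) u)) \<in> lin k (CT 0 (Suc j)) (PA (Suc j))"
    using lin_comp[OF \<iota>T_lin[of 0 "Suc j"]] A.gd_lin[of "Suc j"] by simp
  show "(\<lambda>u. \<iota>T 0 j (dDT 0 j u)) \<in> lin k (CT 0 (Suc j)) (PA (Suc j))"
    using lin_comp[OF dDT_lin \<iota>T_lin[of 0 j]] by simp
next
  fix g c d assume g: "g \<in> carrier G" and c: "c \<in> grC 0 g" and d: "d \<in> carrier (Obj D (Suc j))"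
  note cc = grC_closed[OF g c]
  show "A.gd (Suc j) (\<iota>T 0 (Suc j) (ct 0 (Suc j) c d)) = \<iota>T 0 j (dDT 0 j (ct 0 (Suc j) c d))"
    using \<iota>T_ct[OF g c dD_closed[OF d]]
    by (simp add: gd_\<iota>T_ct[OF g c d] dDT_ct[OF cc d] \<iota>S_diff actD_closed g d diff_actD[symmetric])
qed

text \<open>The interior bidegrees; on the two axes one of the differentials is missing. The sign
  that \<open>E\<close> carries is the sign of the total complex.\<close>

lemma gd_\<iota>T_both:
  assumes u: "u \<in> carrier (CT (Suc i) (Suc j))"
  shows "A.gd (Suc (Suc (i + j))) (\<iota>T (Suc i) (Suc j) u) = \<iota>T i (Suc j) (dCT i (Suc j) u) \<oplus>\<^bsub>PA (Suc (Suc (i + j)))\<^esub>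
    signed (PA (Suc (Suc (i + j)))) (Suc i) (\<iota>T (Suc i) j (dDT (Suc i) j u))"
proof (rule CT_eqI[OF A.module_P _ _ _ u])
  let ?n = "Suc (Suc (i + j))"
  show "(\<lambda>u. A.gd ?n (\<iota>T (Suc i) (Suc j) u)) \<in> lin k (CT (Suc i) (Suc j)) (PA ?n)"
    using lin_comp[OF \<iota>T_lin[of "Suc i" "Suc j"]] A.gd_lin[of ?n] by simp
  have "(\<lambda>u. \<iota>T i (Suc j) (dCT i (Suc j) u)) \<in> lin k (CT (Suc i) (Suc j)) (PA ?n)"
    using lin_comp[OF dCT_lin \<iota>T_lin[of i "Suc j"]] by simp
  moreover have "(\<lambda>u. \<iota>T (Suc i) j (dDT (Suc i) j u)) \<in> lin k (CT (Suc i) (Suc j)) (PA ?n)"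
    using lin_comp[OF dDT_lin \<iota>T_lin[of "Suc i" j]] by simp
  ultimately show "(\<lambda>u. \<iota>T i (Suc j) (dCT i (Suc j) u) \<oplus>\<^bsub>PA ?n\<^esub> signed (PA ?n) (Suc i) (\<iota>T (Suc i) j (dDT (Suc i) j u)))
      \<in> lin k (CT (Suc i) (Suc j)) (PA ?n)"
    by (intro lin_addf[OF A.module_P] lin_signedf[OF A.module_P])
next
  let ?n = "Suc (Suc (i + j))"
  fix g c d assume g: "g \<in> carrier G" and c: "c \<in> grC (Suc i) g" and d: "d \<in> carrier (Obj D (Suc j))"
  note cc = grC_closed[OF g c]
  have dd: "Diff D (Suc j) (actD (Suc j) g d) = actD j g (Diff D (Suc j) d)" by (rule diff_actD[OF g d])
  let ?X = "Sh i (Suc j) (\<iota>G i (Diff C (Suc i) c)) (\<iota>S (Suc j) (actD (Suc j) g d))"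
  let ?Y = "Sh (Suc i) j (\<iota>G (Suc i) c) (\<iota>S j (actD j g (Diff D (Suc j) d)))"
  have X: "?X \<in> carrier (PA ?n)"
    using Sh_closed[OF \<iota>G_closed[OF dC_closed[OF cc]] \<iota>S_closed[OF actD_closed[OF g d]]] by simp
  have Y: "?Y \<in> carrier (PA ?n)"
    using Sh_closed[OF \<iota>G_closed[OF cc] \<iota>S_closed[OF actD_closed[OF g dD_closed[OF d]]]] by simp
  note r = A.ra_lin[where n = ?n, OF el_closed[OF S.one_closed, of g]]
  have "A.gd ?n (\<iota>T (Suc i) (Suc j) (ct (Suc i) (Suc j) c d)) =
      A.ra ?n (el \<one>\<^bsub>S\<^esub> g) (?X \<oplus>\<^bsub>PA ?n\<^esub> signed (PA ?n) (Suc i) ?Y)"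
    using gd_\<iota>T_ct[OF g c d, of "Suc (i + j)"] by (simp add: \<iota>G_diff[OF cc] \<iota>S_diff[OF actD_closed[OF g d]] dd)
  also have "\<dots> = A.ra ?n (el \<one>\<^bsub>S\<^esub> g) ?X \<oplus>\<^bsub>PA ?n\<^esub> signed (PA ?n) (Suc i) (A.ra ?n (el \<one>\<^bsub>S\<^esub> g) ?Y)"
    by (simp add: lin_add[OF r X signed_closed[OF A.module_P Y]] lin_signed[OF A.module_P A.module_P r Y])
  also have "A.ra ?n (el \<one>\<^bsub>S\<^esub> g) ?X = \<iota>T i (Suc j) (dCT i (Suc j) (ct (Suc i) (Suc j) c d))"
    using \<iota>T_ct[OF g diff_grC[OF g c] d] by (simp add: dCT_ct[OF cc d])
  also have "A.ra ?n (el \<one>\<^bsub>S\<^esub> g) ?Y = \<iota>T (Suc i) j (dDT (Suc i) j (ct (Suc i) (Suc j) c d))"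
    using \<iota>T_ct[OF g c dD_closed[OF d]] by (simp add: dDT_ct[OF cc d])
  finally show "A.gd ?n (\<iota>T (Suc i) (Suc j) (ct (Suc i) (Suc j) c d)) =
      \<iota>T i (Suc j) (dCT i (Suc j) (ct (Suc i) (Suc j) c d)) \<oplus>\<^bsub>PA ?n\<^esub>
      signed (PA ?n) (Suc i) (\<iota>T (Suc i) j (dDT (Suc i) j (ct (Suc i) (Suc j) c d)))" .
qed

definition gCT :: "(nat \<Rightarrow> int \<Rightarrow> 'd set) \<Rightarrow> nat \<Rightarrow> nat \<Rightarrow> int \<Rightarrow> ('c \<times> 'd \<Rightarrow> 'k) set set" where
  "gCT grD i j m = span_of k (CT i j) {ct i j c d | c d. c \<in> carrier (Obj C i) \<and> d \<in> grD j m}"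

text \<open>\<open>C\<close> is placed in degree 0, \<open>G\<close> preserves the degrees in bars
  over \<open>S\<close>, and the final multiplication is by a monomial of degree 0.\<close>

lemma \<iota>T_grading:
  assumes gr: "act_grading grS" and grD: "\<And>j m. grD j m \<subseteq> carrier (Obj D j)"
    and gm: "\<And>j m d. d \<in> grD j m \<Longrightarrow> \<iota>S j d \<in> gS grS (Suc j) m"
    and u: "u \<in> gCT grD i j m"
  shows "\<iota>T i j u \<in> gA grS (Suc (i + j)) m"
proof (rule lin_span[OF module_CT A.module_P \<iota>T_lin A.gbar_submodule _ _ u[unfolded gCT_def]])
  show "{ct i j c d | c d. c \<in> carrier (Obj C i) \<and> d \<in> grD j m} \<subseteq> carrier (CT i j)"
    using grD by (auto intro!: ct_closed)
  fix x assume "x \<in> {ct i j c d | c d. c \<in> carrier (Obj C i) \<and> d \<in> grD j m}"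
  then obtain c d where x: "x = ct i j c d" and c: "c \<in> carrier (Obj C i)" and d: "d \<in> grD j m" by blast
  have dc: "d \<in> carrier (Obj D j)" using d grD by blast
  show "\<iota>T i j x \<in> gA grS (Suc (i + j)) m"
    unfolding x \<iota>T_ct_sum[OF c dc]
  proof (rule submodule_finsum[OF A.module_P A.gbar_submodule])
    fix g assume g: "g \<in> carrier G"
    have "\<iota>S j (actD j g d) \<in> gS grS (Suc j) m"
      unfolding \<iota>S_act[OF g dc] by (rule S.bmap_gbar[OF act_endo[OF g] _ gm[OF d]]) (use gr g in \<open>auto simp: act_grading_def\<close>)
    then have "Sh i j (\<iota>G i (pc i g c)) (\<iota>S j (actD j g d)) \<in> gA grS (Suc (i + j)) m"
      using Sh_grading[OF gr, of i j] \<iota>G_closed[OF pc_closed[OF g c]] by blast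
    then show "A.ra (Suc (i + j)) (el \<one>\<^bsub>S\<^esub> g) (Sh i j (\<iota>G i (pc i g c)) (\<iota>S j (actD j g d))) \<in> gA grS (Suc (i + j)) m"
      using A.ra_gbar[OF skew_alg_grading[OF gr] el_one_grading[OF gr]] by fastforce
  qed
qed

end

section \<open>The chain map to the twisted product resolution\<close>

text \<open>In a total complex the differentials of the component \<open>i\<close> land in the
  components \<open>i - 1\<close> and \<open>i\<close>. Collecting by target shifts one of the
  families, and the two zeros are the terms that would leave the range.\<close>

lemma finsum_shift:
  assumes M: "module k M" and X: "\<And>i. i \<le> Suc n \<Longrightarrow> X i \<in> carrier M" and Y: "\<And>i. i \<le> Suc n \<Longrightarrow> Y i \<in> carrier M"
    and 0: "X 0 = \<zero>\<^bsub>M\<^esub>" "Y (Suc n) = \<zero>\<^bsub>M\<^esub>"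
  shows "(\<Oplus>\<^bsub>M\<^esub>i\<in>{..Suc n}. X i \<oplus>\<^bsub>M\<^esub> Y i) = (\<Oplus>\<^bsub>M\<^esub>i\<in>{..n}. X (Suc i) \<oplus>\<^bsub>M\<^esub> Y i)"
proof -
  interpret M: abelian_group M by (rule module_abelian[OF M])
  have c: "(\<Oplus>\<^bsub>M\<^esub>i\<in>{..n}. X (Suc i)) \<in> carrier M" "(\<Oplus>\<^bsub>M\<^esub>i\<in>{..n}. Y i) \<in> carrier M"
    by (rule module_finsum_closed[OF M]; use X Y in simp)+
  have "(\<Oplus>\<^bsub>M\<^esub>i\<in>{..Suc n}. X i \<oplus>\<^bsub>M\<^esub> Y i) = (\<Oplus>\<^bsub>M\<^esub>i\<in>{..Suc n}. X i) \<oplus>\<^bsub>M\<^esub> (\<Oplus>\<^bsub>M\<^esub>i\<in>{..Suc n}. Y i)"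
    by (rule finsum_addI[OF M]) (use X Y in auto)
  also have "(\<Oplus>\<^bsub>M\<^esub>i\<in>{..Suc n}. X i) = (\<Oplus>\<^bsub>M\<^esub>i\<in>{..n}. X (Suc i))"
    using M.finsum_Suc2[of X n] X c by (simp add: 0 Pi_def)
  also have "(\<Oplus>\<^bsub>M\<^esub>i\<in>{..Suc n}. Y i) = (\<Oplus>\<^bsub>M\<^esub>i\<in>{..n}. Y i)"
    using M.finsum_Suc[of Y n] Y c by (simp add: 0 Pi_def)
  also have "(\<Oplus>\<^bsub>M\<^esub>i\<in>{..n}. X (Suc i)) \<oplus>\<^bsub>M\<^esub> (\<Oplus>\<^bsub>M\<^esub>i\<in>{..n}. Y i) = (\<Oplus>\<^bsub>M\<^esub>i\<in>{..n}. X (Suc i) \<oplus>\<^bsub>M\<^esub> Y i)"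
    by (rule finsum_addI[OF M, symmetric]) (use X Y in auto)
  finally show ?thesis .
qed

lemma (in kalg) bar_action_eq: "bar_action k A act n g = bmap (Suc n) (act g)"
  by (simp add: bar_action_def bmap_def bar_module_eq bar_tensor_eq)

context twisted_maps
begin

text \<open>This is \<open>(Fc (\<pi>G u) \<otimes> \<pi>S v) \<gamma>\<close> for the twisted right
  action. As \<open>Fc\<close> has values of degree 1, the first factor has degree
  \<open>\<gamma>\<close>.\<close>

definition pT where
  "pT i j \<gamma> = tensor_map k (Obj C i) (Obj D j) (\<lambda>u. gr i \<gamma> (Fc i (\<pi>G i u))) (\<lambda>v. actD j (inv\<^bsub>G\<^esub> \<gamma>) (\<pi>S j v))"

lemma FG_lin: "(\<lambda>u. gr i \<gamma> (Fc i (\<pi>G i u))) \<in> lin k (PG (Suc i)) (Obj C i)"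
  by (rule lin_comp[OF lin_comp[OF \<pi>G_lin Fc_lin] gr_lin])

lemma FS_lin: "\<gamma> \<in> carrier G \<Longrightarrow> (\<lambda>v. actD j (inv\<^bsub>G\<^esub> \<gamma>) (\<pi>S j v)) \<in> lin k (PS (Suc j)) (Obj D j)"
  by (rule lin_comp[OF \<pi>S_lin actD_lin]) auto

lemma pT_lin: "\<gamma> \<in> carrier G \<Longrightarrow> pT i j \<gamma> \<in> lin k (T i j) (CT i j)"
  unfolding pT_def by (rule tensor_map_lin[OF kG.A.module_P S.module_P modC modD FG_lin FS_lin])

lemma pT_tt: "\<lbrakk>\<gamma> \<in> carrier G; u \<in> carrier (PG (Suc i)); v \<in> carrier (PS (Suc j))\<rbrakk> \<Longrightarrow>
   pT i j \<gamma> (tt i j u v) = ct i j (gr i \<gamma> (Fc i (\<pi>G i u))) (actD j (inv\<^bsub>G\<^esub> \<gamma>) (\<pi>S j v))"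
  unfolding pT_def by (rule tensor_map_tensor[OF kG.A.module_P S.module_P modC modD FG_lin FS_lin])

lemmas pT_closed = lin_closed[OF pT_lin]

text \<open>The twisted left action can be evaluated only if the degree of the first factor is
  known. Through \<open>Fc\<close> it is \<open>h^-1 \<gamma>\<close> before and
  \<open>\<gamma>\<close> after the action of \<open>h\<close>, whatever degrees occur in the value
  of \<open>\<pi>G\<close>.\<close>

lemma pT_ac:
  assumes t: "t \<in> carrier S" and h: "h \<in> carrier G" and \<gamma>: "\<gamma> \<in> carrier G" and x: "x \<in> carrier (T i j)"
  shows "pT i j \<gamma> (ac i j t h x) = lact (TT i j) (el t h) (pT i j (inv\<^bsub>G\<^esub> h \<otimes>\<^bsub>G\<^esub> \<gamma>) x)"
proof (rule T_eqI[OF module_CT lin_comp[OF ac_lin[OF t h] pT_lin[OF \<gamma>]]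
      lin_comp[OF pT_lin bilin_right[OF lact_TT_bilin el_closed[OF t]]] _ x])
  show hg: "inv\<^bsub>G\<^esub> h \<otimes>\<^bsub>G\<^esub> \<gamma> \<in> carrier G" using h \<gamma> by simp
  fix u v assume u: "u \<in> carrier (PG (Suc i))" and v: "v \<in> carrier (PS (Suc j))"
  note pu = \<pi>G_closed[OF u] and pv = \<pi>S_closed[OF v]
  note F = Fc_closed[OF pu]
  have m: "gr i (inv\<^bsub>G\<^esub> h \<otimes>\<^bsub>G\<^esub> \<gamma>) (Fc i (\<pi>G i u)) \<in> grC i (inv\<^bsub>G\<^esub> h \<otimes>\<^bsub>G\<^esub> \<gamma>)"
    using gr_grC[OF hg G.one_closed Fc_degree[OF pu]] hg by simp
  have hh: "h \<otimes>\<^bsub>G\<^esub> (inv\<^bsub>G\<^esub> h \<otimes>\<^bsub>G\<^esub> \<gamma>) = \<gamma>" using h \<gamma> by (simp add: G.m_assoc[symmetric])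
  have "pT i j \<gamma> (ac i j t h (tt i j u v)) =
      ct i j (gr i \<gamma> (Fc i (gl i h (\<pi>G i u)))) (actD j (inv\<^bsub>G\<^esub> \<gamma>) (t \<triangleright>\<^bsub>Obj D j\<^esub> actD j h (\<pi>S j v)))"
    using t h \<gamma> u v by (simp add: T_simps pT_tt \<pi>G_la \<pi>S_la \<pi>S_act)
  also have "gr i \<gamma> (Fc i (gl i h (\<pi>G i u))) = gl i h (gr i (inv\<^bsub>G\<^esub> h \<otimes>\<^bsub>G\<^esub> \<gamma>) (Fc i (\<pi>G i u)))"
    using h \<gamma> pu F by (simp add: Fc_gl gr_gl gr_gr gr_closed)
  also have "actD j (inv\<^bsub>G\<^esub> \<gamma>) (t \<triangleright>\<^bsub>Obj D j\<^esub> actD j h (\<pi>S j v)) =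
      act (inv\<^bsub>G\<^esub> \<gamma>) t \<triangleright>\<^bsub>Obj D j\<^esub> actD j (inv\<^bsub>G\<^esub> (inv\<^bsub>G\<^esub> h \<otimes>\<^bsub>G\<^esub> \<gamma>)) (\<pi>S j v)"
    using h \<gamma> t pv by (simp add: actD_lact actD_closed actD_actD G.inv_mult_group)
  finally show "pT i j \<gamma> (ac i j t h (tt i j u v)) = lact (TT i j) (el t h) (pT i j (inv\<^bsub>G\<^esub> h \<otimes>\<^bsub>G\<^esub> \<gamma>) (tt i j u v))"
    unfolding pT_tt[OF hg u v]
    using lact_TT_ct[OF t h hg m actD_closed[OF G.inv_closed[OF hg] pv]] by (simp add: hh)
qed

lemma pT_rt:
  assumes t: "t \<in> carrier S" and h: "h \<in> carrier G" and \<gamma>: "\<gamma> \<in> carrier G" and x: "x \<in> carrier (T i j)"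
  shows "pT i j \<gamma> (rt i j (act (\<gamma> \<otimes>\<^bsub>G\<^esub> inv\<^bsub>G\<^esub> h) t) x) = ract (TT i j) (pT i j (\<gamma> \<otimes>\<^bsub>G\<^esub> inv\<^bsub>G\<^esub> h) x) (el t h)"
proof -
  have gh: "\<gamma> \<otimes>\<^bsub>G\<^esub> inv\<^bsub>G\<^esub> h \<in> carrier G" using h \<gamma> by simp
  note t' = act_closed[OF gh t]
  show ?thesis
  proof (rule T_eqI[OF module_CT lin_comp[OF rt_lin[OF t'] pT_lin[OF \<gamma>]]
      lin_comp[OF pT_lin[OF gh] bilin_right[OF ract_TT_bilin el_closed[OF t]]] _ x])
    fix u v assume u: "u \<in> carrier (PG (Suc i))" and v: "v \<in> carrier (PS (Suc j))"
    note pu = \<pi>G_closed[OF u] and pv = \<pi>S_closed[OF v]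
    note F = Fc_closed[OF pu]
    have a: "act (inv\<^bsub>G\<^esub> \<gamma>) (act (\<gamma> \<otimes>\<^bsub>G\<^esub> inv\<^bsub>G\<^esub> h) t) = act (inv\<^bsub>G\<^esub> h) t"
      using h \<gamma> t by (simp add: act_act G.m_assoc[symmetric])
    have b: "inv\<^bsub>G\<^esub> h \<otimes>\<^bsub>G\<^esub> inv\<^bsub>G\<^esub> (\<gamma> \<otimes>\<^bsub>G\<^esub> inv\<^bsub>G\<^esub> h) = inv\<^bsub>G\<^esub> \<gamma>"
      using h \<gamma> by (simp add: G.inv_mult_group G.m_assoc[symmetric])
    have c: "\<gamma> \<otimes>\<^bsub>G\<^esub> inv\<^bsub>G\<^esub> h \<otimes>\<^bsub>G\<^esub> h = \<gamma>" using h \<gamma> by (simp add: G.m_assoc)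
    have "pT i j \<gamma> (rt i j (act (\<gamma> \<otimes>\<^bsub>G\<^esub> inv\<^bsub>G\<^esub> h) t) (tt i j u v)) =
        ct i j (gr i \<gamma> (Fc i (\<pi>G i u))) (actD j (inv\<^bsub>G\<^esub> \<gamma>) (\<pi>S j v) \<triangleleft>\<^bsub>Obj D j\<^esub> act (inv\<^bsub>G\<^esub> h) t)"
      using t' \<gamma> u v pv a by (simp add: T_simps pT_tt \<pi>S_ra actD_ract)
    moreover have "gr i h (gr i (\<gamma> \<otimes>\<^bsub>G\<^esub> inv\<^bsub>G\<^esub> h) (Fc i (\<pi>G i u))) = gr i \<gamma> (Fc i (\<pi>G i u))"
      using gr_gr[OF h gh F] c by simp
    moreover have "actD j (inv\<^bsub>G\<^esub> h) (actD j (inv\<^bsub>G\<^esub> (\<gamma> \<otimes>\<^bsub>G\<^esub> inv\<^bsub>G\<^esub> h)) (\<pi>S j v) \<triangleleft>\<^bsub>Obj D j\<^esub> t) =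
        actD j (inv\<^bsub>G\<^esub> \<gamma>) (\<pi>S j v) \<triangleleft>\<^bsub>Obj D j\<^esub> act (inv\<^bsub>G\<^esub> h) t"
      using actD_ract[OF G.inv_closed[OF h] t actD_closed[OF G.inv_closed[OF gh] pv]]
        actD_actD[OF G.inv_closed[OF h] G.inv_closed[OF gh] pv] b by simp
    ultimately show "pT i j \<gamma> (rt i j (act (\<gamma> \<otimes>\<^bsub>G\<^esub> inv\<^bsub>G\<^esub> h) t) (tt i j u v)) =
        ract (TT i j) (pT i j (\<gamma> \<otimes>\<^bsub>G\<^esub> inv\<^bsub>G\<^esub> h) (tt i j u v)) (el t h)"
      unfolding pT_tt[OF gh u v]
      using ract_TT_ct[OF t h gr_closed[OF F] actD_closed[OF G.inv_closed[OF gh] pv]] by simp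
  qed
qed

text \<open>\<open>Fc\<close> after \<open>\<pi>G\<close> is invariant under right multiplication,
  since \<open>\<pi>G\<close> is equivariant and \<open>Fc\<close> does not see right
  translations.\<close>

lemma Fc_\<pi>G_tau:
  assumes u: "u \<in> carrier (PG (Suc i))"
  shows "Fc i (\<pi>G i (tau (Suc i) u)) = Fc i (\<pi>G i u)"
  by (rule tau_invariant[OF modC lin_comp[OF \<pi>G_lin Fc_lin] _ u]) (simp add: \<pi>G_ra Fc_gr \<pi>G_closed)

text \<open>The correction by \<open>tau\<close> inside \<open>dG\<close> is invisible after
  \<open>Fc\<close> and \<open>\<pi>G\<close>, so the corrected differential corresponds to the
  differential of \<open>C\<close>.\<close>

lemma dCT_pT:
  assumes \<gamma>: "\<gamma> \<in> carrier G" and x: "x \<in> carrier (T (Suc i) j)"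
  shows "dCT i j (pT (Suc i) j \<gamma> x) = pT i j \<gamma> (dG i j x)"
  by (rule T_eqI[OF module_CT lin_comp[OF pT_lin[OF \<gamma>] dCT_lin] lin_comp[OF dG_lin pT_lin[OF \<gamma>]] _ x])
    (use \<gamma> in \<open>simp add: T_simps pT_tt dCT_ct gr_closed Fc_closed \<pi>G_closed \<pi>S_closed actD_closed dC_gr
      Fc_dC[symmetric] \<pi>G_diff Fc_\<pi>G_tau\<close>)

lemma dDT_pT:
  assumes \<gamma>: "\<gamma> \<in> carrier G" and x: "x \<in> carrier (T i (Suc j))"
  shows "dDT i j (pT i (Suc j) \<gamma> x) = pT i j \<gamma> (dS i j x)"
  by (rule T_eqI[OF module_CT lin_comp[OF pT_lin[OF \<gamma>] dDT_lin] lin_comp[OF dS_lin pT_lin[OF \<gamma>]] _ x])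
    (use \<gamma> in \<open>simp add: T_simps pT_tt dDT_ct gr_closed Fc_closed \<pi>G_closed \<pi>S_closed actD_closed diff_actD \<pi>S_diff\<close>)

definition \<pi>T where
  "\<pi>T i j b = (\<Oplus>\<^bsub>CT i j\<^esub>\<gamma>\<in>carrier G. pT i j \<gamma> (aw i j \<gamma> b))"

lemma \<pi>T_lin: "\<pi>T i j \<in> lin k (PA (Suc (i + j))) (CT i j)"
  unfolding \<pi>T_def[abs_def] by (rule lin_finsumf[OF module_CT lin_comp[OF aw_lin pT_lin]])

lemmas \<pi>T_closed = lin_closed[OF \<pi>T_lin]

text \<open>Each summand is carried to the one whose total degree is shifted by \<open>h\<close>,
  and the sum over all of \<open>G\<close> absorbs the shift.\<close>

lemma \<pi>T_la:
  assumes a: "a \<in> carrier A" and b: "b \<in> carrier (PA (Suc (i + j)))"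
  shows "\<pi>T i j (A.la (Suc (i + j)) a b) = lact (TT i j) a (\<pi>T i j b)"
proof (rule A_lin_eqI[OF module_CT lin_comp[OF bilin_left[OF A.la_bilin b] \<pi>T_lin]
      bilin_left[OF lact_TT_bilin \<pi>T_closed[OF b]] _ a])
  fix t h assume t: "t \<in> carrier S" and h: "h \<in> carrier G"
  note L = bilin_right[OF lact_TT_bilin el_closed[OF t]]
  have "\<pi>T i j (A.la (Suc (i + j)) (el t h) b) =
      (\<Oplus>\<^bsub>CT i j\<^esub>\<gamma>\<in>carrier G. lact (TT i j) (el t h) (pT i j (inv\<^bsub>G\<^esub> h \<otimes>\<^bsub>G\<^esub> \<gamma>) (aw i j (inv\<^bsub>G\<^esub> h \<otimes>\<^bsub>G\<^esub> \<gamma>) b)))"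
    unfolding \<pi>T_def
    by (rule finsum_congI[OF module_CT])
      (use t h b in \<open>auto simp: aw_la pT_ac aw_closed intro!: lin_closed[OF L] pT_closed aw_closed\<close>)
  also have "\<dots> = (\<Oplus>\<^bsub>CT i j\<^esub>\<gamma>\<in>carrier G. lact (TT i j) (el t h) (pT i j \<gamma> (aw i j \<gamma> b)))"
    by (rule finsum_reindexI[OF module_CT G.mult_left_bij[OF G.inv_closed[OF h]], symmetric])
      (use b in \<open>auto intro!: lin_closed[OF L] pT_closed aw_closed\<close>)
  also have "\<dots> = lact (TT i j) (el t h) (\<pi>T i j b)"
    unfolding \<pi>T_def
    by (rule lin_finsum[OF module_CT module_CT L, symmetric]) (use b in \<open>auto intro!: pT_closed aw_closed\<close>)
  finally show "\<pi>T i j (A.la (Suc (i + j)) (el t h) b) = lact (TT i j) (el t h) (\<pi>T i j b)" .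
qed

lemma \<pi>T_ra:
  assumes a: "a \<in> carrier A" and b: "b \<in> carrier (PA (Suc (i + j)))"
  shows "\<pi>T i j (A.ra (Suc (i + j)) a b) = ract (TT i j) (\<pi>T i j b) a"
proof (rule A_lin_eqI[OF module_CT lin_comp[OF bilin_left[OF A.ra_bilin b] \<pi>T_lin]
      bilin_left[OF ract_TT_bilin \<pi>T_closed[OF b]] _ a])
  fix t h assume t: "t \<in> carrier S" and h: "h \<in> carrier G"
  note L = bilin_right[OF ract_TT_bilin el_closed[OF t]]
  have "\<pi>T i j (A.ra (Suc (i + j)) (el t h) b) =
      (\<Oplus>\<^bsub>CT i j\<^esub>\<gamma>\<in>carrier G. ract (TT i j) (pT i j (\<gamma> \<otimes>\<^bsub>G\<^esub> inv\<^bsub>G\<^esub> h) (aw i j (\<gamma> \<otimes>\<^bsub>G\<^esub> inv\<^bsub>G\<^esub> h) b)) (el t h))"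
    unfolding \<pi>T_def
    by (rule finsum_congI[OF module_CT])
      (use t h b in \<open>auto simp: aw_ra pT_rt aw_closed intro!: lin_closed[OF L] pT_closed aw_closed\<close>)
  also have "\<dots> = (\<Oplus>\<^bsub>CT i j\<^esub>\<gamma>\<in>carrier G. ract (TT i j) (pT i j \<gamma> (aw i j \<gamma> b)) (el t h))"
    by (rule finsum_reindexI[OF module_CT G.mult_right_bij[OF G.inv_closed[OF h]], symmetric])
      (use b in \<open>auto intro!: lin_closed[OF L] pT_closed aw_closed\<close>)
  also have "\<dots> = ract (TT i j) (\<pi>T i j b) (el t h)"
    unfolding \<pi>T_def
    by (rule lin_finsum[OF module_CT module_CT L, symmetric]) (use b in \<open>auto intro!: pT_closed aw_closed\<close>)
  finally show "\<pi>T i j (A.ra (Suc (i + j)) (el t h) b) = ract (TT i j) (\<pi>T i j b) (el t h)" .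
qed

lemma \<pi>T_gd:
  assumes b: "b \<in> carrier (PA (Suc (Suc (i + j))))"
  shows "dCT i j (\<pi>T (Suc i) j b) \<oplus>\<^bsub>CT i j\<^esub> signed (CT i j) i (dDT i j (\<pi>T i (Suc j) b)) = \<pi>T i j (A.gd (Suc (i + j)) b)"
proof -
  have b1: "b \<in> carrier (PA (Suc (Suc i + j)))" and b2: "b \<in> carrier (PA (Suc (i + Suc j)))" using b by simp_all
  note w1 = aw_closed[OF _ b1] and w2 = aw_closed[OF _ b2]
  have 1: "dCT i j (\<pi>T (Suc i) j b) = (\<Oplus>\<^bsub>CT i j\<^esub>\<gamma>\<in>carrier G. pT i j \<gamma> (dG i j (aw (Suc i) j \<gamma> b)))"
    unfolding \<pi>T_def
    by (subst lin_finsum[OF module_CT module_CT dCT_lin])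
      (auto simp: dCT_pT w1 intro!: finsum_congI[OF module_CT] pT_closed lin_closed[OF dG_lin] w1)
  have "dDT i j (\<pi>T i (Suc j) b) = (\<Oplus>\<^bsub>CT i j\<^esub>\<gamma>\<in>carrier G. pT i j \<gamma> (dS i j (aw i (Suc j) \<gamma> b)))"
    unfolding \<pi>T_def
    by (subst lin_finsum[OF module_CT module_CT dDT_lin])
      (auto simp: dDT_pT w2 intro!: finsum_congI[OF module_CT] pT_closed lin_closed[OF dS_lin] w2)
  then have 2: "signed (CT i j) i (dDT i j (\<pi>T i (Suc j) b)) =
      (\<Oplus>\<^bsub>CT i j\<^esub>\<gamma>\<in>carrier G. signed (CT i j) i (pT i j \<gamma> (dS i j (aw i (Suc j) \<gamma> b))))"
    using lin_finsum[OF module_CT module_CT lin_signedf[OF module_CT lin_ident], of "carrier G"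
        "\<lambda>\<gamma>. pT i j \<gamma> (dS i j (aw i (Suc j) \<gamma> b))" i j i]
      pT_closed[OF _ lin_closed[OF dS_lin w2]] by simp
  show ?thesis
    unfolding 1 2 \<pi>T_def[of i j "A.gd (Suc (i + j)) b"]
  proof (subst finsum_addI[OF module_CT, symmetric])
    show "(\<Oplus>\<^bsub>CT i j\<^esub>\<gamma>\<in>carrier G. pT i j \<gamma> (dG i j (aw (Suc i) j \<gamma> b)) \<oplus>\<^bsub>CT i j\<^esub>
        signed (CT i j) i (pT i j \<gamma> (dS i j (aw i (Suc j) \<gamma> b)))) =
      (\<Oplus>\<^bsub>CT i j\<^esub>\<gamma>\<in>carrier G. pT i j \<gamma> (aw i j \<gamma> (A.gd (Suc (i + j)) b)))"
    proof (rule finsum_congI[OF module_CT])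
      fix \<gamma> assume \<gamma>: "\<gamma> \<in> carrier G"
      note x = lin_closed[OF dG_lin w1[OF \<gamma>]] and y = lin_closed[OF dS_lin w2[OF \<gamma>]]
      show "pT i j \<gamma> (dG i j (aw (Suc i) j \<gamma> b)) \<oplus>\<^bsub>CT i j\<^esub> signed (CT i j) i (pT i j \<gamma> (dS i j (aw i (Suc j) \<gamma> b))) =
          pT i j \<gamma> (aw i j \<gamma> (A.gd (Suc (i + j)) b))"
        unfolding aw_gd[OF \<gamma> b]
        by (simp add: lin_add[OF pT_lin[OF \<gamma>] x signed_closed[OF module_T y]] lin_signed[OF module_T module_CT pT_lin[OF \<gamma>] y])
    qed (use b in \<open>auto intro!: pT_closed aw_closed A.gd_closed\<close>)
  qed (auto intro!: signed_closed[OF module_CT] pT_closed lin_closed[OF dG_lin] lin_closed[OF dS_lin] w1 w2)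
qed

text \<open>The factor \<open>g\<close> at the end of \<open>\<iota>T\<close> moves the total degree
  of the shuffle from 1 to \<open>g\<close>, so only the summand \<open>\<gamma> = g\<close>
  survives. There \<open>\<pi>G\<close> cancels \<open>\<iota>G\<close> and \<open>\<pi>S\<close>
  cancels \<open>\<iota>S\<close>; \<open>Fc\<close> followed by translation by \<open>g\<close>
  restores \<open>c\<close>, which has degree \<open>g\<close>, and the actions of \<open>g\<close>
  and its inverse on \<open>d\<close> cancel.\<close>

lemma \<pi>T_\<iota>T:
  assumes n: "i' + j' = i + j" and u: "u \<in> carrier (CT i j)"
  shows "\<pi>T i' j' (\<iota>T i j u) = (if i' = i then u else \<zero>\<^bsub>CT i' j'\<^esub>)"
proof (rule CT_eqI[OF module_CT _ _ _ u])
  show "(\<lambda>u. \<pi>T i' j' (\<iota>T i j u)) \<in> lin k (CT i j) (CT i' j')"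
    using lin_comp[OF \<iota>T_lin \<pi>T_lin[of i' j', unfolded n]] .
  show "(\<lambda>u. if i' = i then u else \<zero>\<^bsub>CT i' j'\<^esub>) \<in> lin k (CT i j) (CT i' j')"
    using n lin_ident lin_zerof[OF module_CT] by (cases "i' = i") auto
next
  fix g c d assume g: "g \<in> carrier G" and c: "c \<in> grC i g" and d: "d \<in> carrier (Obj D j)"
  note cc = grC_closed[OF g c] and dg = actD_closed[OF g d]
  let ?U = "\<iota>G i c" and ?V = "\<iota>S j (actD j g d)"
  have U: "?U \<in> carrier (PG (Suc i))" and V: "?V \<in> carrier (PS (Suc j))"
    by (rule \<iota>G_closed[OF cc] \<iota>S_closed[OF dg])+
  have X: "Sh i j ?U ?V \<in> carrier (PA (Suc (i' + j')))" using Sh_closed[OF U V] n by simp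
  have tU: "tau (Suc i) ?U \<in> carrier (PG (Suc i))" by (rule tau_closed[OF U])
  have aw: "aw i' j' \<gamma> (\<iota>T i j (ct i j c d)) = (if \<gamma> = g \<and> i' = i then tt i j (tau (Suc i) ?U) ?V else \<zero>\<^bsub>T i' j'\<^esub>)"
    if \<gamma>: "\<gamma> \<in> carrier G" for \<gamma>
  proof -
    have gi: "\<gamma> \<otimes>\<^bsub>G\<^esub> inv\<^bsub>G\<^esub> g \<in> carrier G" using g \<gamma> by simp
    have eq: "\<gamma> \<otimes>\<^bsub>G\<^esub> inv\<^bsub>G\<^esub> g = \<one>\<^bsub>G\<^esub> \<longleftrightarrow> \<gamma> = g" using mult_inv_eq_iff[OF g \<gamma> G.one_closed] g by simp
    have "aw i' j' \<gamma> (\<iota>T i j (ct i j c d)) = rt i' j' \<one>\<^bsub>S\<^esub> (aw i' j' (\<gamma> \<otimes>\<^bsub>G\<^esub> inv\<^bsub>G\<^esub> g) (Sh i j ?U ?V))"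
      using aw_ra[OF \<gamma> S.one_closed g X] by (simp add: \<iota>T_ct[OF g c d] n act_unit[OF gi])
    also have "aw i' j' (\<gamma> \<otimes>\<^bsub>G\<^esub> inv\<^bsub>G\<^esub> g) (Sh i j ?U ?V) =
        (if \<gamma> = g \<and> i' = i then tt i j (tau (Suc i) ?U) ?V else \<zero>\<^bsub>T i' j'\<^esub>)"
      unfolding aw_Sh[OF n gi U V] eq ..
    finally show ?thesis
      using n rt_tt[OF S.one_closed tU V] S.ra_one[OF V]
        lin_zero[OF module_T module_T rt_lin[OF S.one_closed], of i' j'] by (auto split: if_splits)
  qed
  show "\<pi>T i' j' (\<iota>T i j (ct i j c d)) = (if i' = i then ct i j c d else \<zero>\<^bsub>CT i' j'\<^esub>)"
  proof (cases "i' = i")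
    case False
    then show ?thesis
      unfolding \<pi>T_def by (auto intro!: finsum_zeroI[OF module_CT] simp: aw lin_zero[OF module_T module_CT pT_lin])
  next
    case True
    then have j: "j' = j" using n by simp
    have "\<pi>T i j (\<iota>T i j (ct i j c d)) = pT i j g (aw i j g (\<iota>T i j (ct i j c d)))"
      unfolding \<pi>T_def
      by (rule finsum_single[OF module_CT fin g])
        (use aw g True j tU V in \<open>auto simp: lin_zero[OF module_T module_CT pT_lin] intro!: pT_closed tt_closed\<close>)
    also have "\<dots> = pT i j g (tt i j (tau (Suc i) ?U) ?V)" using aw[OF g] True j by simp
    also have "\<dots> = ct i j c d"
      unfolding pT_tt[OF g tU V]
      using g cc d by (simp add: Fc_\<pi>G_tau[OF U] \<pi>\<iota>G[OF cc] Fc_homogeneous[OF g c] \<pi>\<iota>S[OF dg] actD_actD actD_one)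
    finally show ?thesis using True j by simp
  qed
qed

lemma \<pi>T_grading:
  assumes gr: "act_grading grS" and grD: "\<And>j m. grD j m \<subseteq> carrier (Obj D j)"
    and gm: "\<And>j m v. v \<in> gS grS (Suc j) m \<Longrightarrow> \<pi>S j v \<in> grD j m"
    and b: "b \<in> gA grS (Suc (i + j)) m"
  shows "\<pi>T i j b \<in> gCT grD i j m"
proof -
  have sub: "{ct i j c d | c d. c \<in> carrier (Obj C i) \<and> d \<in> grD j m} \<subseteq> carrier (CT i j)"
    using grD by (auto intro!: ct_closed)
  have sm: "submodule (gCT grD i j m) k (CT i j)"
    unfolding gCT_def by (rule span_of_submodule[OF module_CT sub])
  show ?thesis
    unfolding \<pi>T_def
  proof (rule submodule_finsum[OF module_CT sm])
    fix \<gamma> assume \<gamma>: "\<gamma> \<in> carrier G"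
    have ig: "inv\<^bsub>G\<^esub> \<gamma> \<in> carrier G" using \<gamma> by simp
    show "pT i j \<gamma> (aw i j \<gamma> b) \<in> gCT grD i j m"
    proof (rule gT_lin[OF module_CT pT_lin[OF \<gamma>] sm _ aw_grading[OF gr \<gamma> b]])
      fix U V assume U: "U \<in> carrier (PG (Suc i))" and V: "V \<in> gS grS (Suc j) m"
      note Vc = S.gbar_closed[OF V]
      have "S.bmap (Suc j) (act (inv\<^bsub>G\<^esub> \<gamma>)) V \<in> gS grS (Suc j) m"
        by (rule S.bmap_gbar[OF act_endo[OF ig] _ V]) (use gr ig in \<open>auto simp: act_grading_def\<close>)
      from gm[OF this] have "actD j (inv\<^bsub>G\<^esub> \<gamma>) (\<pi>S j V) \<in> grD j m" using \<pi>S_act[OF ig Vc] by simp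
      then show "pT i j \<gamma> (tt i j U V) \<in> gCT grD i j m"
        unfolding pT_tt[OF \<gamma> U Vc] gCT_def
        using gr_closed[OF Fc_closed[OF \<pi>G_closed[OF U]]] by (intro span_of_gen) blast
    qed
  qed
qed

section \<open>Assembling the maps on total complexes\<close>

abbreviation "CD \<equiv> twisted_product k G S act C grC D actD"

lemma CD_carrier: "u \<in> carrier (Obj CD n) \<longleftrightarrow> u \<in> (\<Pi>\<^sub>E i\<in>{..n}. carrier (CT i (n - i)))"
  by (auto simp: twisted_product_def direct_sum_bimodule_def)

lemma CD_simps:
  "u \<oplus>\<^bsub>Obj CD n\<^esub> v = (\<lambda>i\<in>{..n}. u i \<oplus>\<^bsub>CT i (n - i)\<^esub> v i)"
  "a \<triangleright>\<^bsub>Obj CD n\<^esub> u = (\<lambda>i\<in>{..n}. a \<triangleright>\<^bsub>TT i (n - i)\<^esub> u i)"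
  "u \<triangleleft>\<^bsub>Obj CD n\<^esub> a = (\<lambda>i\<in>{..n}. u i \<triangleleft>\<^bsub>TT i (n - i)\<^esub> a)"
  by (simp_all add: twisted_product_def direct_sum_bimodule_def)

lemma CD_diff: "Diff CD (Suc n) u = (\<lambda>i\<in>{..n}. dCT i (n - i) (u (Suc i)) \<oplus>\<^bsub>CT i (n - i)\<^esub>
    signed (CT i (n - i)) i (dDT i (n - i) (u i)))"
  by (auto simp: twisted_product_def Let_def dCT_def dDT_def Suc_diff_le intro!: restrict_ext)

lemma CD_component: "u \<in> carrier (Obj CD n) \<Longrightarrow> i \<le> n \<Longrightarrow> u i \<in> carrier (CT i (n - i))"
  by (auto simp: CD_carrier)

lemma \<iota>T_lin_le: "i \<le> n \<Longrightarrow> \<iota>T i (n - i) \<in> lin k (CT i (n - i)) (PA (Suc n))"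
  using \<iota>T_lin[of i "n - i"] by simp

lemma \<pi>T_lin_le: "i \<le> n \<Longrightarrow> \<pi>T i (n - i) \<in> lin k (PA (Suc n)) (CT i (n - i))"
  using \<pi>T_lin[of i "n - i"] by simp

definition \<iota>CD where
  "\<iota>CD n u = (\<Oplus>\<^bsub>PA (Suc n)\<^esub>i\<in>{..n}. \<iota>T i (n - i) (u i))"

definition \<pi>CD where
  "\<pi>CD n b = (\<lambda>i\<in>{..n}. \<pi>T i (n - i) b)"

lemma \<iota>CD_closed:
  assumes "u \<in> carrier (Obj CD n)"
  shows "\<iota>CD n u \<in> carrier (PA (Suc n))"
  unfolding \<iota>CD_def
  by (rule module_finsum_closed[OF A.module_P]) (use CD_component[OF assms] lin_closed[OF \<iota>T_lin_le] in auto)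

lemma \<pi>CD_closed: "b \<in> carrier (PA (Suc n)) \<Longrightarrow> \<pi>CD n b \<in> carrier (Obj CD n)"
  unfolding CD_carrier \<pi>CD_def using lin_closed[OF \<pi>T_lin_le] by auto

lemma \<iota>CD_hom: "\<iota>CD n \<in> bimodule_hom A (Obj CD n) (bar_bimodule k A n)"
proof -
  have fs: "(\<Oplus>\<^bsub>PA (Suc n)\<^esub>i\<in>{..n}. \<iota>T i (n - i) (w i)) = (\<Oplus>\<^bsub>PA (Suc n)\<^esub>i\<in>{..n}. f (\<iota>T i (n - i) (u i)))"
    if "\<And>i. i \<le> n \<Longrightarrow> \<iota>T i (n - i) (w i) = f (\<iota>T i (n - i) (u i))" "f \<in> lin k (PA (Suc n)) (PA (Suc n))"
      "u \<in> carrier (Obj CD n)" for f w u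
    by (rule finsum_congI[OF A.module_P])
      (use that lin_closed[OF that(2)] lin_closed[OF \<iota>T_lin_le] CD_component[OF that(3)] in auto)
  have lf: "(\<Oplus>\<^bsub>PA (Suc n)\<^esub>i\<in>{..n}. f (\<iota>T i (n - i) (u i))) = f (\<iota>CD n u)"
    if "f \<in> lin k (PA (Suc n)) (PA (Suc n))" "u \<in> carrier (Obj CD n)" for f u
    unfolding \<iota>CD_def
    by (rule lin_finsum[OF A.module_P A.module_P that(1), symmetric])
      (use lin_closed[OF \<iota>T_lin_le] CD_component[OF that(2)] in auto)
  show ?thesis
    unfolding bimodule_hom_def A.bar_bimodule_simps
  proof (intro CollectI conjI ballI funcsetI)
    fix u assume u: "u \<in> carrier (Obj CD n)"
    note ui = CD_component[OF u]
    show "\<iota>CD n u \<in> carrier (PA (Suc n))" by (rule \<iota>CD_closed[OF u])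
    show "\<iota>CD n (u \<oplus>\<^bsub>Obj CD n\<^esub> v) = \<iota>CD n u \<oplus>\<^bsub>PA (Suc n)\<^esub> \<iota>CD n v" if v: "v \<in> carrier (Obj CD n)" for v
    proof -
      note vi = CD_component[OF v]
      have "\<iota>CD n (u \<oplus>\<^bsub>Obj CD n\<^esub> v) = (\<Oplus>\<^bsub>PA (Suc n)\<^esub>i\<in>{..n}. \<iota>T i (n - i) (u i) \<oplus>\<^bsub>PA (Suc n)\<^esub> \<iota>T i (n - i) (v i))"
        unfolding \<iota>CD_def CD_simps
        by (rule finsum_congI[OF A.module_P])
          (use ui vi lin_add[OF \<iota>T_lin_le] lin_closed[OF \<iota>T_lin_le] in \<open>auto intro!: module_add_closed[OF A.module_P]\<close>)
      also have "\<dots> = \<iota>CD n u \<oplus>\<^bsub>PA (Suc n)\<^esub> \<iota>CD n v"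
        unfolding \<iota>CD_def by (rule finsum_addI[OF A.module_P]) (use ui vi lin_closed[OF \<iota>T_lin_le] in auto)
      finally show ?thesis .
    qed
    fix a assume a: "a \<in> carrier A"
    show "\<iota>CD n (a \<triangleright>\<^bsub>Obj CD n\<^esub> u) = A.la (Suc n) a (\<iota>CD n u)"
      unfolding \<iota>CD_def[of n "a \<triangleright>\<^bsub>Obj CD n\<^esub> u"] lf[OF A.la_lin[OF a] u, symmetric]
      by (rule fs[OF _ A.la_lin[OF a] u]) (use \<iota>T_lact[OF a ui] in \<open>auto simp: CD_simps\<close>)
    show "\<iota>CD n (u \<triangleleft>\<^bsub>Obj CD n\<^esub> a) = A.ra (Suc n) a (\<iota>CD n u)"
      unfolding \<iota>CD_def[of n "u \<triangleleft>\<^bsub>Obj CD n\<^esub> a"] lf[OF A.ra_lin[OF a] u, symmetric]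
      by (rule fs[OF _ A.ra_lin[OF a] u]) (use \<iota>T_ract[OF a ui] in \<open>auto simp: CD_simps\<close>)
  qed
qed

lemma gd_\<iota>CD:
  assumes u: "u \<in> carrier (Obj CD (Suc n))"
  shows "A.gd (Suc n) (\<iota>CD (Suc n) u) = \<iota>CD n (Diff CD (Suc n) u)"
proof -
  let ?M = "PA (Suc n)"
  note ui = CD_component[OF u]
  \<comment> \<open>\<open>X i\<close> and \<open>Y i\<close> are the contributions of the component
    \<open>i\<close> through the differentials of \<open>C\<close> and of \<open>D\<close>. The
    values \<open>X 0\<close> and \<open>Y (Suc n)\<close> are set to zero, as
    \<open>finsum_shift\<close> requires.\<close>
  define X where "X i = (case i of 0 \<Rightarrow> \<zero>\<^bsub>?M\<^esub> | Suc a \<Rightarrow> \<iota>T a (n - a) (dCT a (n - a) (u (Suc a))))" for i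
  define Y where "Y i = (if i \<le> n then signed ?M i (\<iota>T i (n - i) (dDT i (n - i) (u i))) else \<zero>\<^bsub>?M\<^esub>)" for i
  have c1: "dCT a (n - a) (u (Suc a)) \<in> carrier (CT a (n - a))" if "a \<le> n" for a
    using ui[of "Suc a"] that by (intro dCT_closed) simp
  have c2: "dDT a (n - a) (u a) \<in> carrier (CT a (n - a))" if "a \<le> n" for a
    using ui[of a] that by (intro dDT_closed) (simp add: Suc_diff_le)
  have Xc: "X i \<in> carrier ?M" if "i \<le> Suc n" for i
    using that c1 lin_closed[OF \<iota>T_lin_le] module_zero_closed[OF A.module_P] by (auto simp: X_def split: nat.split)
  have Yc: "Y i \<in> carrier ?M" if "i \<le> Suc n" for i
    using that c2 lin_closed[OF \<iota>T_lin_le] module_zero_closed[OF A.module_P] by (auto simp: Y_def intro!: signed_closed[OF A.module_P])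
  have step: "A.gd (Suc n) (\<iota>T i (Suc n - i) (u i)) = X i \<oplus>\<^bsub>?M\<^esub> Y i" if i: "i \<le> Suc n" for i
  proof (cases i)
    case 0
    have "u 0 \<in> carrier (CT 0 (Suc n))" using ui[of 0] by simp
    moreover have "\<iota>T 0 n (dDT 0 n (u 0)) \<in> carrier ?M" using lin_closed[OF \<iota>T_lin_le c2, of 0] by simp
    ultimately show ?thesis
      using 0 by (simp add: X_def Y_def gd_\<iota>T_right module_l_zero[OF A.module_P] signed_def)
  next
    case (Suc a)
    show ?thesis
    proof (cases "a = n")
      case True
      have "u (Suc n) \<in> carrier (CT (Suc n) 0)" using ui[of "Suc n"] by simp
      moreover have "\<iota>T n 0 (dCT n 0 (u (Suc n))) \<in> carrier ?M" using lin_closed[OF \<iota>T_lin_le c1, of n] by simp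
      ultimately show ?thesis
        using Suc True by (simp add: X_def Y_def gd_\<iota>T_left module_r_zero[OF A.module_P])
    next
      case False
      \<comment> \<open>An interior component: both of its bidegrees are positive.\<close>
      then obtain b where b: "n = Suc (a + b)" using i Suc less_imp_Suc_add[of a n] by auto
      have "u (Suc a) \<in> carrier (CT (Suc a) (Suc b))" using ui[of "Suc a"] b by simp
      from gd_\<iota>T_both[OF this] show ?thesis using Suc b by (simp add: X_def Y_def Suc_diff_le)
    qed
  qed
  have "A.gd (Suc n) (\<iota>CD (Suc n) u) = (\<Oplus>\<^bsub>?M\<^esub>i\<in>{..Suc n}. A.gd (Suc n) (\<iota>T i (Suc n - i) (u i)))"
    unfolding \<iota>CD_def
    by (rule lin_finsum[OF A.module_P A.module_P A.gd_lin]) (use ui lin_closed[OF \<iota>T_lin_le] in auto)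
  also have "\<dots> = (\<Oplus>\<^bsub>?M\<^esub>i\<in>{..Suc n}. X i \<oplus>\<^bsub>?M\<^esub> Y i)"
    by (rule finsum_congI[OF A.module_P]) (use step Xc Yc in \<open>auto intro!: module_add_closed[OF A.module_P]\<close>)
  also have "\<dots> = (\<Oplus>\<^bsub>?M\<^esub>i\<in>{..n}. X (Suc i) \<oplus>\<^bsub>?M\<^esub> Y i)"
    by (rule finsum_shift[OF A.module_P Xc Yc]) (simp_all add: X_def Y_def)
  also have "\<dots> = \<iota>CD n (Diff CD (Suc n) u)"
    unfolding \<iota>CD_def CD_diff
  proof (rule finsum_congI[OF A.module_P])
    fix i assume "i \<in> {..n}"
    then have i: "i \<le> n" by simp
    note l = \<iota>T_lin_le[OF i]
    have s: "signed (CT i (n - i)) i (dDT i (n - i) (u i)) \<in> carrier (CT i (n - i))" by (rule signed_closed[OF module_CT c2[OF i]])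
    show "X (Suc i) \<oplus>\<^bsub>?M\<^esub> Y i = \<iota>T i (n - i) ((\<lambda>i\<in>{..n}. dCT i (n - i) (u (Suc i)) \<oplus>\<^bsub>CT i (n - i)\<^esub>
        signed (CT i (n - i)) i (dDT i (n - i) (u i))) i)"
      using i by (simp add: X_def Y_def lin_add[OF l c1[OF i] s] lin_signed[OF module_CT A.module_P l c2[OF i]])
    show "\<iota>T i (n - i) ((\<lambda>i\<in>{..n}. dCT i (n - i) (u (Suc i)) \<oplus>\<^bsub>CT i (n - i)\<^esub>
        signed (CT i (n - i)) i (dDT i (n - i) (u i))) i) \<in> carrier ?M"
      using i s c1[OF i] by (auto intro!: lin_closed[OF l] module_add_closed[OF module_CT])
  qed
  finally show ?thesis .
qed

lemma \<pi>CD_hom: "\<pi>CD n \<in> bimodule_hom A (bar_bimodule k A n) (Obj CD n)"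
  unfolding bimodule_hom_def A.bar_bimodule_simps
proof (intro CollectI conjI ballI funcsetI)
  fix b assume b: "b \<in> carrier (PA (Suc n))"
  show "\<pi>CD n b \<in> carrier (Obj CD n)" by (rule \<pi>CD_closed[OF b])
  show "\<pi>CD n (b \<oplus>\<^bsub>PA (Suc n)\<^esub> b') = \<pi>CD n b \<oplus>\<^bsub>Obj CD n\<^esub> \<pi>CD n b'" if "b' \<in> carrier (PA (Suc n))" for b'
    unfolding \<pi>CD_def CD_simps using lin_add[OF \<pi>T_lin_le b that] by (intro restrict_ext) simp
  fix a assume a: "a \<in> carrier A"
  show "\<pi>CD n (A.la (Suc n) a b) = a \<triangleright>\<^bsub>Obj CD n\<^esub> \<pi>CD n b"
    unfolding \<pi>CD_def CD_simps
  proof (rule restrict_ext)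
    fix i assume "i \<in> {..n}"
    then show "\<pi>T i (n - i) (A.la (Suc n) a b) = a \<triangleright>\<^bsub>TT i (n - i)\<^esub> (\<lambda>i\<in>{..n}. \<pi>T i (n - i) b) i"
      using \<pi>T_la[OF a, of b i "n - i"] b by simp
  qed
  show "\<pi>CD n (A.ra (Suc n) a b) = \<pi>CD n b \<triangleleft>\<^bsub>Obj CD n\<^esub> a"
    unfolding \<pi>CD_def CD_simps
  proof (rule restrict_ext)
    fix i assume "i \<in> {..n}"
    then show "\<pi>T i (n - i) (A.ra (Suc n) a b) = (\<lambda>i\<in>{..n}. \<pi>T i (n - i) b) i \<triangleleft>\<^bsub>TT i (n - i)\<^esub> a"
      using \<pi>T_ra[OF a, of b i "n - i"] b by simp
  qed
qed

lemma diff_\<pi>CD: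
  assumes b: "b \<in> carrier (PA (Suc (Suc n)))"
  shows "Diff CD (Suc n) (\<pi>CD (Suc n) b) = \<pi>CD n (A.gd (Suc n) b)"
  unfolding CD_diff \<pi>CD_def
proof (rule restrict_ext)
  fix i assume "i \<in> {..n}"
  then have i: "i \<le> n" by simp
  then show "dCT i (n - i) ((\<lambda>i\<in>{..Suc n}. \<pi>T i (Suc n - i) b) (Suc i)) \<oplus>\<^bsub>CT i (n - i)\<^esub>
      signed (CT i (n - i)) i (dDT i (n - i) ((\<lambda>i\<in>{..Suc n}. \<pi>T i (Suc n - i) b) i)) = \<pi>T i (n - i) (A.gd (Suc n) b)"
    using \<pi>T_gd[of b i "n - i"] b by (simp add: Suc_diff_le)
qed

text \<open>The matrix of the composition has identities on the diagonal and zeros elsewhere by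
  \<open>\<pi>T_\<iota>T\<close>.\<close>

lemma \<pi>CD_\<iota>CD:
  assumes u: "u \<in> carrier (Obj CD n)"
  shows "\<pi>CD n (\<iota>CD n u) = u"
proof (rule PiE_ext)
  show "u \<in> (\<Pi>\<^sub>E i\<in>{..n}. carrier (CT i (n - i)))" using u by (simp add: CD_carrier)
  show "\<pi>CD n (\<iota>CD n u) \<in> (\<Pi>\<^sub>E i\<in>{..n}. carrier (CT i (n - i)))"
    using \<pi>CD_closed[OF \<iota>CD_closed[OF u]] by (simp add: CD_carrier)
  fix i assume "i \<in> {..n}"
  then have i: "i \<le> n" by simp
  note ui = CD_component[OF u]
  have "\<pi>CD n (\<iota>CD n u) i = \<pi>T i (n - i) (\<Oplus>\<^bsub>PA (Suc n)\<^esub>i'\<in>{..n}. \<iota>T i' (n - i') (u i'))"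
    using i by (simp add: \<pi>CD_def \<iota>CD_def)
  also have "\<dots> = (\<Oplus>\<^bsub>CT i (n - i)\<^esub>i'\<in>{..n}. \<pi>T i (n - i) (\<iota>T i' (n - i') (u i')))"
    by (rule lin_finsum[OF A.module_P module_CT \<pi>T_lin_le[OF i]]) (use ui lin_closed[OF \<iota>T_lin_le] in auto)
  also have "\<dots> = \<pi>T i (n - i) (\<iota>T i (n - i) (u i))"
    by (rule finsum_single[OF module_CT]) (use i ui in \<open>auto simp: \<pi>T_\<iota>T\<close>)
  also have "\<dots> = u i" using \<pi>T_\<iota>T[OF refl ui[OF i]] by simp
  finally show "\<pi>CD n (\<iota>CD n u) i = u i" .
qed

lemma chain_map_\<iota>CD: "chain_map A CD (reduced_bar k A) \<iota>CD"
  by (auto simp: chain_map_def reduced_bar_def \<iota>CD_hom A.bar_diff_eq gd_\<iota>CD)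

lemma chain_map_\<pi>CD: "chain_map A (reduced_bar k A) CD \<pi>CD"
  by (auto simp: chain_map_def reduced_bar_def \<pi>CD_hom A.bar_diff_eq A.bar_bimodule_simps diff_\<pi>CD)

lemma graded_maps:
  assumes grS: "graded_algebra k S grS" and act: "\<forall>g\<in>carrier G. \<forall>m. act g ` grS m \<subseteq> grS m"
    and grD: "\<forall>n. graded_bimodule k grS (Obj D n) (grD n)"
    and \<iota>: "graded_map grD (bar_grading k S grS) \<iota>S" and \<pi>: "graded_map (bar_grading k S grS) grD \<pi>S"
  shows "graded_map (twisted_product_grading k C D grD) (bar_grading k A (skew_grading G grS)) \<iota>CD"
    and "graded_map (bar_grading k A (skew_grading G grS)) (twisted_product_grading k C D grD) \<pi>CD"
proof -
  have gr: "act_grading grS"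
    using grS act unfolding act_grading_def S.alg_grading_def graded_algebra_def internal_direct_sum_def by blast
  have D: "grD j m \<subseteq> carrier (Obj D j)" for j m
    using grD submodule_subset unfolding graded_bimodule_def internal_direct_sum_def by blast
  have i: "\<iota>S j d \<in> gS grS (Suc j) m" if "d \<in> grD j m" for j m d
    using \<iota> that by (auto simp: graded_map_def S.bar_grading_eq)
  have p: "\<pi>S j v \<in> grD j m" if "v \<in> gS grS (Suc j) m" for j m v
    using \<pi> that by (auto simp: graded_map_def S.bar_grading_eq)
  have tg: "twisted_product_grading k C D grD n m = (\<Pi>\<^sub>E i\<in>{..n}. gCT grD i (n - i) m)" for n m
    by (simp add: twisted_product_grading_def gCT_def)
  show "graded_map (twisted_product_grading k C D grD) (bar_grading k A (skew_grading G grS)) \<iota>CD"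
    unfolding graded_map_def tg A.bar_grading_eq
  proof (intro allI image_subsetI)
    fix n m u assume u: "u \<in> (\<Pi>\<^sub>E i\<in>{..n}. gCT grD i (n - i) m)"
    show "\<iota>CD n u \<in> gA grS (Suc n) m"
      unfolding \<iota>CD_def
    proof (rule submodule_finsum[OF A.module_P A.gbar_submodule])
      fix a assume "a \<in> {..n}"
      then show "\<iota>T a (n - a) (u a) \<in> gA grS (Suc n) m"
        using \<iota>T_grading[where grD = grD and u = "u a" and i = a and j = "n - a", OF gr D i] u by auto
    qed
  qed
  show "graded_map (bar_grading k A (skew_grading G grS)) (twisted_product_grading k C D grD) \<pi>CD"
    unfolding graded_map_def tg A.bar_grading_eq
  proof (intro allI image_subsetI)
    fix n m b assume b: "b \<in> gA grS (Suc n) m"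
    have "\<pi>T a (n - a) b \<in> gCT grD a (n - a) m" if "a \<le> n" for a
      using \<pi>T_grading[where grD = grD and b = b and i = a and j = "n - a", OF gr D p] b that by simp
    then show "\<pi>CD n b \<in> (\<Pi>\<^sub>E i\<in>{..n}. gCT grD i (n - i) m)" by (auto simp: \<pi>CD_def)
  qed
qed

end

lemma skew_if_acts:
  assumes "group G" "finite (carrier G)" "k_algebra k S" "acts_by_automorphisms k G S act"
  shows "skew k G S act"
proof -
  interpret S: k_algebra k S by fact
  interpret group_action G "carrier S" act using assms(4) by (simp add: acts_by_automorphisms_def)
  have h: "act g \<in> ring_hom S S" and s: "\<And>r s. r \<in> carrier k \<Longrightarrow> s \<in> carrier S \<Longrightarrow> act g (r \<odot>\<^bsub>S\<^esub> s) = r \<odot>\<^bsub>S\<^esub> act g s"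
    if "g \<in> carrier G" for g
    using assms(4) that by (auto simp: acts_by_automorphisms_def)
  show ?thesis
  proof (intro skew.intro kalg.intro skew_axioms.intro assms(1-3))
    show "act g \<in> lin k S S" if "g \<in> carrier G" for g
      using h[OF that] s[OF that] by (intro linI) (auto simp: ring_hom_closed ring_hom_add)
    show "act g (act h s) = act (g \<otimes>\<^bsub>G\<^esub> h) s" if "g \<in> carrier G" "h \<in> carrier G" "s \<in> carrier S" for g h s
      using composition_rule[OF that(3,1,2)] by simp
    show "act \<one>\<^bsub>G\<^esub> s = s" if "s \<in> carrier S" for s
      using fun_cong[OF id_eq_one, of s] that by simp
  qed (auto simp: ring_hom_mult[OF h] ring_hom_one[OF h])
qed

theorem theorem4p1:
  fixes k :: "'k ring" and G :: "'g monoid" and S :: "('k, 's) module"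
    and act :: "'g \<Rightarrow> 's \<Rightarrow> 's"
    and C :: "('k, 'g \<Rightarrow> 'k, 'c) bimodule_complex" and \<epsilon>C :: "'c \<Rightarrow> 'g \<Rightarrow> 'k"
    and grC :: "nat \<Rightarrow> 'g \<Rightarrow> 'c set"
    and D :: "('k, 's, 'd) bimodule_complex" and \<epsilon>D :: "'d \<Rightarrow> 's"
    and actD :: "nat \<Rightarrow> 'g \<Rightarrow> 'd \<Rightarrow> 'd"
    and \<iota>G :: "nat \<Rightarrow> 'c \<Rightarrow> (('g \<Rightarrow> 'k) list \<Rightarrow> 'k) set"
    and \<pi>G :: "nat \<Rightarrow> (('g \<Rightarrow> 'k) list \<Rightarrow> 'k) set \<Rightarrow> 'c"
    and \<iota>S :: "nat \<Rightarrow> 'd \<Rightarrow> ('s list \<Rightarrow> 'k) set"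
    and \<pi>S :: "nat \<Rightarrow> ('s list \<Rightarrow> 'k) set \<Rightarrow> 'd"
  defines "kG \<equiv> group_algebra k G"
    and "SG \<equiv> skew_group_algebra G S act"
    and "CD \<equiv> twisted_product k G S act C grC D actD"
  assumes "field k" and "group G" and "finite (carrier G)"
    and "k_algebra k S" and "acts_by_automorphisms k G S act"
    and "group_graded_resolution k G C \<epsilon>C grC"
    and "equivariant_resolution k G S act D \<epsilon>D actD"
    and "chain_map kG C (reduced_bar k kG) \<iota>G" and "chain_map kG (reduced_bar k kG) C \<pi>G"
    and "chain_map S D (reduced_bar k S) \<iota>S" and "chain_map S (reduced_bar k S) D \<pi>S"
    and "\<forall>n. \<forall>g\<in>carrier G. \<forall>x\<in>carrier (Obj D n).
           \<iota>S n (actD n g x) = bar_action k S act n g (\<iota>S n x)"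
    and "\<forall>n. \<forall>g\<in>carrier G. \<forall>x\<in>carrier (Obj (reduced_bar k S) n).
           \<pi>S n (bar_action k S act n g x) = actD n g (\<pi>S n x)"
    and "\<forall>n. \<forall>x\<in>carrier (Obj C n). \<pi>G n (\<iota>G n x) = x"
    and "\<forall>n. \<forall>x\<in>carrier (Obj D n). \<pi>S n (\<iota>S n x) = x"
  shows "(\<exists>\<iota> \<pi>. chain_map SG CD (reduced_bar k SG) \<iota> \<and> chain_map SG (reduced_bar k SG) CD \<pi> \<and>
            (\<forall>n. \<forall>x\<in>carrier (Obj CD n). \<pi> n (\<iota> n x) = x))
    \<and> (\<forall>(grS :: int \<Rightarrow> 's set) (grD :: nat \<Rightarrow> int \<Rightarrow> 'd set).
         graded_algebra k S grS \<and>
         (\<forall>g\<in>carrier G. \<forall>m. act g ` grS m \<subseteq> grS m) \<and>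
         (\<forall>n. graded_bimodule k grS (Obj D n) (grD n)) \<and>
         graded_map grD (bar_grading k S grS) \<iota>S \<and>
         graded_map (bar_grading k S grS) grD \<pi>S \<longrightarrow>
         (\<exists>\<iota> \<pi>. chain_map SG CD (reduced_bar k SG) \<iota> \<and> chain_map SG (reduced_bar k SG) CD \<pi> \<and>
            (\<forall>n. \<forall>x\<in>carrier (Obj CD n). \<pi> n (\<iota> n x) = x) \<and>
            graded_map (twisted_product_grading k C D grD)
              (bar_grading k SG (skew_grading G grS)) \<iota> \<and>
            graded_map (bar_grading k SG (skew_grading G grS))
              (twisted_product_grading k C D grD) \<pi>))"
proof -
  have kG: "kG = skew_group_algebra G (ground k) (\<lambda>g r. r)" by (simp add: kG_def group_algebra_def)
  have sk: "skew k G S act" by (rule skew_if_acts[OF assms(5-8)])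
  interpret kS: kalg k S by (rule kalg.intro) fact
  \<comment> \<open>Together with \<open>bar_action_eq\<close> this rewrites the equivariance
    hypotheses into the form that the locale asks for.\<close>
  have bc: "carrier (Obj (reduced_bar k S) n) = carrier (abar k S (Suc n))" for n
    by (simp add: reduced_bar_def kS.bar_bimodule_simps)
  interpret twisted_maps k G S act C \<epsilon>C grC D \<epsilon>D actD \<iota>G \<pi>G \<iota>S \<pi>S
    by (rule twisted_maps.intro[OF skew.twist[OF sk] twisted_maps_axioms.intro])
      (use assms(9-)[unfolded kS.bar_action_eq kG bc] in auto)
  show ?thesis
    unfolding SG_def assms(3)
  proof (intro conjI allI impI)
    show "\<exists>\<iota> \<pi>. chain_map A (twisted_product k G S act C grC D actD) (reduced_bar k A) \<iota> \<and>
        chain_map A (reduced_bar k A) (twisted_product k G S act C grC D actD) \<pi> \<and>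
        (\<forall>n. \<forall>x\<in>carrier (Obj (twisted_product k G S act C grC D actD) n). \<pi> n (\<iota> n x) = x)"
      using chain_map_\<iota>CD chain_map_\<pi>CD \<pi>CD_\<iota>CD by blast
    fix grS grD
    assume gr: "graded_algebra k S grS \<and> (\<forall>g\<in>carrier G. \<forall>m. act g ` grS m \<subseteq> grS m) \<and>
         (\<forall>n. graded_bimodule k grS (Obj D n) (grD n)) \<and>
         graded_map grD (bar_grading k S grS) \<iota>S \<and> graded_map (bar_grading k S grS) grD \<pi>S"
    show "\<exists>\<iota> \<pi>. chain_map A (twisted_product k G S act C grC D actD) (reduced_bar k A) \<iota> \<and>
        chain_map A (reduced_bar k A) (twisted_product k G S act C grC D actD) \<pi> \<and>
        (\<forall>n. \<forall>x\<in>carrier (Obj (twisted_product k G S act C grC D actD) n). \<pi> n (\<iota> n x) = x) \<and>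
        graded_map (twisted_product_grading k C D grD) (bar_grading k A (skew_grading G grS)) \<iota> \<and>
        graded_map (bar_grading k A (skew_grading G grS)) (twisted_product_grading k C D grD) \<pi>"
      \<comment> \<open>The construction does not refer to any internal grading, so the maps of the
        first part serve again.\<close>
      by (intro exI[of _ \<iota>CD] exI[of _ \<pi>CD] conjI chain_map_\<iota>CD chain_map_\<pi>CD allI ballI \<pi>CD_\<iota>CD graded_maps)
        (use gr in auto)
  qed
qed

end
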